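(* Let $\mathcal{G}\subseteq\mathbb{R}^n$ be open, $\delta,\sigma\in(0,1]$, $\varepsilon,\mu>0$, and consider the Hamiltonian $$H(I,\varphi,\xi,\eta)=h(I)+\mu\eta+\varepsilon f(I,\varphi,\xi),\qquad (I,\eta,\varphi,\xi)\in\mathcal{G}\times\mathbb{R}\times\mathbb{T}^n\times\mathbb{R},$$ where $h(I)$ and $f(I,\varphi,\xi)$ are holomorphic and bounded on $\mathcal{D}_{\delta,2\sigma}$, and $C_f:=\sup_{\mathcal{D}_{\delta,2\sigma}}|f|<+\infty$. Set $$\tilde{\mathcal{F}}:=C_f\left(\frac{1+e^{-\sigma/2}}{1-e^{-\sigma/2}}\right)^n,\qquad \lambda_{\varepsilon,\mu}:=\mu+e\,\tilde{\mathcal{F}}\,\varepsilon .$$ Let $\mathcal{M}\subseteq\mathbb{Z}^n$ be a resonance module, $r,K\in\mathbb{N}$ with $r,K\ge1$, and $\alpha>0$. Suppose that $\mathcal{V}\subseteq\mathcal{G}$ is a non-resonance domain of the type $(\mathcal{M},\alpha,\delta,N)$ with $N=rK$, and that $r,K,\varepsilon,\mu$ are such that $$\Delta:=\frac{2^8 r}{\alpha\delta\sigma}\lambda_{\varepsilon,\mu}+4e^{-K\frac{\sigma}{2}}\le\frac12,\qquad e^{-K\frac{\sigma}{2}}\ge(8+3e^2)^{-1}.$$ Then there exists a symplectic, $\varepsilon$-close to the identity, analytic change of variables $z\mapsto\mathcal{C}_r(z)$ defined on $\tilde{\mathcal{D}}_{\frac34(\delta,\sigma)}$ such that $$\tilde{\mathcal{D}}_{\frac58(\delta,\sigma)}\subset\mathcal{C}_r\tilde{\mathcal{D}}_{\frac34(\delta,\sigma)}\subset\tilde{\mathcal{D}}_{\frac78(\delta,\sigma)}$$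 (and the same inclusions hold with $\mathcal{C}_r^{-1}$ in place of $\mathcal{C}_r$), which casts the Hamiltonian in resonant normal form up to order $r$, i.e. $$H(\mathcal{C}_r(z))=h(I)+\mu\eta+Z^{(r)}+\mathcal{R}^{(r+1)},$$ where $Z^{(r)}=\sum_{k\in\mathcal{M},\,|k|\le N}z_k(I,\xi)e^{ik\cdot\varphi}$ and $$\|\mathcal{R}^{(r+1)}\|_{\frac34(\delta,\sigma)}\le 8\,\varepsilon\,\tilde{\mathcal{F}}\,\Delta^r .$$
   Context: Domains. For $\delta',\sigma'>0$ and $A\subseteq\mathbb{R}^n$ put $$A_{\delta'}:=\bigcup_{I\in A}\{\hat I\in\mathbb{C}^n:|\hat I-I|<\delta'\},\quad \mathcal{R}_{\delta'}:=\{\hat\eta\in\mathbb{C}:|\mathrm{Im}\,\hat\eta|<\delta'\},$$ $$\mathbb{T}^n_{\sigma'}:=\{\hat\varphi\in\mathbb{C}^n:|\mathrm{Im}\,\hat\varphi|<\sigma'\},\quad R_{\sigma'}:=\{\hat\xi\in\mathbb{C}:|\mathrm{Im}\,\hat\xi|<\sigma'\}.$$ Define $\mathcal{D}_{\delta',\sigma'}:=\mathcal{G}_{\delta'}\times\mathcal{R}_{\delta'}\times\mathbb{T}^n_{\sigma'}\times R_{\sigma'}\ni z=(I,\eta,\varphi,\xi)$, and let $\tilde{\mathcal{D}}_{\delta',\sigma'}:=\mathcal{V}_{\delta'}\times\mathcal{R}_{\delta'}\times\mathbb{T}^n_{\sigma'}\times R_{\sigma'}$ be the same domain with $\mathcal{G}$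 replaced by $\mathcal{V}$. For $c>0$, a subscript $c(\delta,\sigma)$ means $(c\delta,c\sigma)$. Functions are $2\pi$-periodic in each component of $\varphi$, and $h,f$ are real for real arguments. The pair $(\xi,\eta)$ is conjugate, like $(\varphi,I)$. Fourier norm. For $F(I,\varphi,\xi)=\sum_{k\in\mathbb{Z}^n}f_k(I,\xi)e^{ik\cdot\varphi}$ analytic on $\tilde{\mathcal{D}}_{\delta',\sigma'}$, $$\|F\|_{\delta',\sigma'}:=\sum_{k\in\mathbb{Z}^n}|f_k|_{\delta',\sigma'}e^{|k|\sigma'},$$ where $|f_k|_{\delta',\sigma'}$ is the supremum of $|f_k|$ over $\tilde{\mathcal{D}}_{\delta',\sigma'}$ and $|k|=|k_1|+\dots+|k_n|$. Resonance module. A subset $\mathcal{M}\subseteq\mathbb{Z}^n$ with $\mathrm{span}(\mathcal{M})\cap\mathbb{Z}^n=\mathcal{M}$, where $\mathrm{span}(\mathcal{M})\subseteq\mathbb{R}^n$ is the real linear span. Non-resonance domain. With $\omega(I):=\partial_Ih(I)$, a subset $\mathcal{V}\subseteq\mathcal{G}$ is a non-resonance domain of the type $(\mathcal{M},\alpha,\delta,N)$ if for all $k\in\mathbb{Z}^n\setminus\mathcal{M}$ with $|k|<N$ one has $|\langle\omega(I),k\rangle|>\alpha$ for all $I\in\mathcal{V}_\delta$. "$\varepsilon$-close to the identity" means that $\mathcal{C}_r(z)-z=O(\varepsilon)$ as $\varepsilon\to0$, the other parameters being fixed. *)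

theory Defs
  imports "HOL-Analysis.Analysis"
begin

text \<open>
  A phase point is \<open>z = (I, \<eta>, \<phi>, \<xi>)\<close>, in this order.  The torus is represented by its universal
  cover: functions on it are functions of \<open>\<phi> \<in> \<complex>\<^sup>n\<close> that are \<open>2\<pi>\<close>-periodic in each component.
\<close>

type_synonym 'n phase = "(complex^'n) \<times> complex \<times> (complex^'n) \<times> complex"

definition cvec :: "real^'n \<Rightarrow> complex^'n" where
  "cvec x = (\<chi> j. complex_of_real (x $ j))"

definition real_cvec :: "complex^'n \<Rightarrow> bool" where
  "real_cvec v \<longleftrightarrow> (\<forall>j. v $ j \<in> \<real>)"

definition real_phase :: "'n::finite phase \<Rightarrow> bool" where
  "real_phase = (\<lambda>(I, \<eta>, \<phi>, \<xi>). real_cvec I \<and> \<eta> \<in> \<real> \<and> real_cvec \<phi> \<and> \<xi> \<in> \<real>)"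

text \<open>
  On \<open>\<complex>\<^sup>n\<close> the modulus defining the domains is the maximum norm, written out componentwise.  For the
  strip in \<open>\<phi>\<close> this is the norm dual to the \<open>\<ell>\<^sup>1\<close> norm \<open>\<bar>k\<bar>\<close> used in the Fourier weights.
\<close>

definition cnbhd :: "(real^'n) set \<Rightarrow> real \<Rightarrow> (complex^'n) set" where
  "cnbhd A \<delta> = (\<Union>I\<in>A. {J. \<forall>j. cmod (J $ j - cvec I $ j) < \<delta>})"

definition torus_strip :: "real \<Rightarrow> (complex^'n) set" where
  "torus_strip \<sigma> = {\<phi>. \<forall>j. \<bar>Im (\<phi> $ j)\<bar> < \<sigma>}"

definition strip :: "real \<Rightarrow> complex set" where
  "strip s = {w. \<bar>Im w\<bar> < s}"

definition cdomain :: "(real^'n::finite) set \<Rightarrow> real \<Rightarrow> real \<Rightarrow> 'n phase set" where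
  "cdomain A \<delta> \<sigma> = cnbhd A \<delta> \<times> strip \<delta> \<times> torus_strip \<sigma> \<times> strip \<sigma>"

text \<open>
  Holomorphy in several variables: Frechet differentiability with complex-linear derivative.  Only
  open sets \<open>S\<close> occur below.
\<close>

definition cscale :: "complex \<Rightarrow> 'n::finite phase \<Rightarrow> 'n phase" where
  "cscale c = (\<lambda>(I, \<eta>, \<phi>, \<xi>). (c *s I, c * \<eta>, c *s \<phi>, c * \<xi>))"

definition holo_fun_on :: "'n::finite phase set \<Rightarrow> ('n phase \<Rightarrow> complex) \<Rightarrow> bool" where
  "holo_fun_on S F \<longleftrightarrow>
     (\<forall>z\<in>S. \<exists>D. (F has_derivative D) (at z) \<and> (\<forall>c v. D (cscale c v) = c * D v))"

definition holo_map_on :: "'n::finite phase set \<Rightarrow> ('n phase \<Rightarrow> 'n phase) \<Rightarrow> bool" where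
  "holo_map_on S C \<longleftrightarrow>
     (\<forall>z\<in>S. \<exists>D. (C has_derivative D) (at z) \<and> (\<forall>c v. D (cscale c v) = cscale c (D v)))"

text \<open>The two-form \<open>dI \<and> d\<phi> + d\<eta> \<and> d\<xi>\<close>.\<close>

definition symp_form :: "'n::finite phase \<Rightarrow> 'n phase \<Rightarrow> complex" where
  "symp_form = (\<lambda>(I, \<eta>, \<phi>, \<xi>) (I', \<eta>', \<phi>', \<xi>').
     (\<Sum>j\<in>UNIV. I $ j * \<phi>' $ j - \<phi> $ j * I' $ j) + (\<eta> * \<xi>' - \<xi> * \<eta>'))"

definition symplectic_on :: "'n::finite phase set \<Rightarrow> ('n phase \<Rightarrow> 'n phase) \<Rightarrow> bool" where
  "symplectic_on S C \<longleftrightarrow>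
     (\<forall>z\<in>S. \<forall>u v. symp_form (frechet_derivative C (at z) u) (frechet_derivative C (at z) v)
                    = symp_form u v)"

definition shift_angle :: "'n::finite \<Rightarrow> 'n::finite phase \<Rightarrow> 'n phase" where
  "shift_angle j = (\<lambda>(I, \<eta>, \<phi>, \<xi>). (I, \<eta>, \<phi> + axis j (complex_of_real (2 * pi)), \<xi>))"

definition angle_periodic_on :: "'n::finite phase set \<Rightarrow> ('n phase \<Rightarrow> complex) \<Rightarrow> bool" where
  "angle_periodic_on S F \<longleftrightarrow> (\<forall>z\<in>S. \<forall>j. F (shift_angle j z) = F z)"

text \<open>
  Commuting with the angle shifts says that the map descends to the torus; mapping real points to
  real points says that it is a transformation of the real phase space.
\<close>

definition symplectic_change_on :: "'n::finite phase set \<Rightarrow> ('n phase \<Rightarrow> 'n phase) \<Rightarrow> bool" where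
  "symplectic_change_on S C \<longleftrightarrow>
     holo_map_on S C \<and> inj_on C S \<and> symplectic_on S C \<and>
     (\<forall>z\<in>S. \<forall>j. C (shift_angle j z) = shift_angle j (C z)) \<and>
     (\<forall>z\<in>S. real_phase z \<longrightarrow> real_phase (C z))"

definition freq_norm :: "int^'n \<Rightarrow> int" where
  "freq_norm k = (\<Sum>j\<in>UNIV. \<bar>k $ j\<bar>)"

definition freq_pair :: "complex^'n \<Rightarrow> int^'n \<Rightarrow> complex" where
  "freq_pair v k = (\<Sum>j\<in>UNIV. v $ j * of_int (k $ j))"

definition fourier_mode :: "int^'n \<Rightarrow> complex^'n \<Rightarrow> complex" where
  "fourier_mode k \<phi> = exp (\<i> * freq_pair \<phi> k)"

definition fourier_coeff ::
  "(complex^'n \<Rightarrow> complex^'n \<Rightarrow> complex \<Rightarrow> complex) \<Rightarrow> int^'n \<Rightarrow> complex^'n \<Rightarrow> complex \<Rightarrow> complex" where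
  "fourier_coeff F k I \<xi> =
     integral (cbox 0 (\<chi> j. 2 * pi)) (\<lambda>x::real^'n. F I (cvec x) \<xi> * fourier_mode (- k) (cvec x))
       / of_real ((2 * pi) ^ CARD('n))"

text \<open>The Fourier norm on \<open>cdomain A \<delta> \<sigma>\<close>; it takes the value \<open>\<infinity>\<close> if the series diverges.\<close>

definition fourier_norm ::
  "(real^'n) set \<Rightarrow> real \<Rightarrow> real \<Rightarrow> (complex^'n \<Rightarrow> complex^'n \<Rightarrow> complex \<Rightarrow> complex) \<Rightarrow> ennreal" where
  "fourier_norm A \<delta> \<sigma> F =
     (\<Sum>\<^sub>\<infinity>k\<in>UNIV. (SUP (I, \<eta>, \<phi>, \<xi>)\<in>cdomain A \<delta> \<sigma>. ennreal (cmod (fourier_coeff F k I \<xi>)))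
                    * ennreal (exp (of_int (freq_norm k) * \<sigma>)))"

definition int_rvec :: "int^'n \<Rightarrow> real^'n" where
  "int_rvec k = (\<chi> j. real_of_int (k $ j))"

definition resonance_module :: "(int^'n) set \<Rightarrow> bool" where
  "resonance_module M \<longleftrightarrow> span (int_rvec ` M) \<inter> range int_rvec = int_rvec ` M"

definition frequency :: "(complex^'n \<Rightarrow> complex) \<Rightarrow> complex^'n \<Rightarrow> complex^'n" where
  "frequency h I = (\<chi> j. deriv (\<lambda>t. h (I + axis j t)) 0)"

definition nonresonance_domain ::
  "(complex^'n \<Rightarrow> complex) \<Rightarrow> (real^'n) set \<Rightarrow> (real^'n) set \<Rightarrow>
   (int^'n) set \<Rightarrow> real \<Rightarrow> real \<Rightarrow> nat \<Rightarrow> bool" where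
  "nonresonance_domain h G V M \<alpha> \<delta> N \<longleftrightarrow>
     V \<subseteq> G \<and>
     (\<forall>k. k \<notin> M \<longrightarrow> freq_norm k < int N \<longrightarrow>
        (\<forall>I\<in>cnbhd V \<delta>. cmod (freq_pair (frequency h I) k) > \<alpha>))"

definition hamiltonian ::
  "(complex^'n \<Rightarrow> complex) \<Rightarrow> (complex^'n \<Rightarrow> complex^'n \<Rightarrow> complex \<Rightarrow> complex) \<Rightarrow>
   real \<Rightarrow> real \<Rightarrow> 'n phase \<Rightarrow> complex" where
  "hamiltonian h f \<mu> \<epsilon> = (\<lambda>(I, \<eta>, \<phi>, \<xi>). h I + of_real \<mu> * \<eta> + of_real \<epsilon> * f I \<phi> \<xi>)"

text \<open>
  With \<open>D c\<close> the domain rescaled by \<open>c\<close>: the inverse of \<open>C\<close> restricted to \<open>D (3/4)\<close> lives on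
  \<open>C ` D (3/4)\<close>, which need not contain \<open>D (3/4)\<close>.  Hence \<open>C'\<close>, the inverse transformation as a map on \<open>D (3/4)\<close>,
  is a change of variables of its own that is inverse to \<open>C\<close> wherever the composition stays in \<open>D (3/4)\<close>.
  By the inclusions this covers \<open>D (5/8)\<close>, which meets every component of \<open>D (3/4)\<close>, so \<open>C\<close>
  determines \<open>C'\<close>.
\<close>

definition inverse_changes_on ::
  "'n::finite phase set \<Rightarrow> ('n phase \<Rightarrow> 'n phase) \<Rightarrow> ('n phase \<Rightarrow> 'n phase) \<Rightarrow> bool" where
  "inverse_changes_on S C C' \<longleftrightarrow>
     symplectic_change_on S C \<and> symplectic_change_on S C' \<and>
     (\<forall>z\<in>S. C z \<in> S \<longrightarrow> C' (C z) = z) \<and>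
     (\<forall>z\<in>S. C' z \<in> S \<longrightarrow> C (C' z) = z)"

end

theory Submission imports Defs "HOL-Complex_Analysis.Cauchy_Integral_Formula" begin

text \<open>
  The perturbation is removed by successive canonical transformations, each the time-one map of a
  Hamiltonian flow.  If \<open>P\<close> is the current perturbation, split it into its resonant modes (frequency
  in \<open>M\<close>, order below \<open>N\<close>), its nonresonant modes of order below \<open>N\<close>, and its tail of order at
  least \<open>N\<close>.  Dividing the nonresonant coefficients by \<open>\<i> \<langle>\<omega>, k\<rangle>\<close>, which is bounded
  below by \<open>\<alpha>\<close>, gives a generating function whose bracket with \<open>h\<close> cancels them
  (\<open>homological_equation\<close>).  After the transformation the resonant part is kept, the tail is made small by
  narrowing the strip of the angles, and what else remains is a series of brackets
  (\<open>normal_form_step\<close>).  The term \<open>\<mu> * \<eta>\<close> is treated as part of the perturbation: its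
  bracket with the generating function is not cancelled but is small with \<open>\<mu>\<close>.

  Norms.  All estimates use a weighted Fourier norm (\<open>fb\<close>).  A bracket costs one derivative in an
  action-like and one in an angle-like variable; Cauchy estimates and the exponential weights pay for
  them by a loss of domain.  For \<open>n\<close> successive brackets the loss can be shared so that the factor is
  \<open>fact n\<close> times a geometric one (\<open>fb_lie_iterate\<close>), and the Lie series converges.

  Flows.  No differential equation is solved.  The time-one map is the limit of Euler polygons, and
  the error of one Euler step is quadratic in the step size.  Summing these errors shows
  that functions composed with the limit are given by their Lie series, that the flow of
  the negative generating function is the inverse, and that the limit is holomorphic and symplectic.

  Bookkeeping.  Put \<open>q = exp (- K * \<sigma> / 2)\<close> and \<open>E = \<epsilon> * F\<close> with \<open>F\<close> the bound of the Fourier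
  norm of \<open>f\<close>.  One first step with losses proportional to \<open>\<delta>\<close> and \<open>\<sigma>\<close>
  brings the perturbation from \<open>E\<close> down to \<open>E / r\<close>.  The \<open>r - 1\<close> further steps lose only
  \<open>\<delta> / (16 r)\<close> and \<open>\<sigma> / (2 r)\<close>; for this angular loss the tail is reduced exactly by
  \<open>q\<close>, since \<open>N = r * K\<close>, and the brackets contribute at most \<open>\<Delta> - 4 q\<close>, so that each step
  gains a factor \<open>\<Delta>\<close>.  The resonant part of the first step has size \<open>E\<close>, which is \<open>r\<close>
  times larger than all later terms, but it lives on the whole initial domain, and a bracket
  with it costs only one of the small losses.  The result \<open>(E / r) * \<Delta> ^ (r - 1)\<close> is at most
  \<open>8 * E * \<Delta> ^ r\<close> because the lower bound on \<open>q\<close> gives \<open>1 \<le> 8 * \<Delta>\<close>.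

  The hypothesis bounds \<open>f\<close> only in the supremum norm, on a wider strip.  That it has a Fourier
  series with slowly varying holomorphic coefficients and the stated norm is \<open>fb_of_bounded\<close>; the angles
  are expanded one at a time, each by a telescoping series.
\<close>

section \<open>Holomorphic functions on phase space\<close>

text \<open>Phase points are handled through their components, so quantifiers over them must not be split
  into quantifiers over tuples.\<close>

declare split_paired_All [simp del] split_paired_Ex [simp del]

abbreviation dd :: "('n::finite phase \<Rightarrow> 'b::real_normed_vector) \<Rightarrow> 'n phase \<Rightarrow> 'n phase \<Rightarrow> 'b" where
  "dd F z \<equiv> frechet_derivative F (at z)"

lemma cscale_simps [simp]:
  "fst (cscale c z) = c *s fst z" "fst (snd (cscale c z)) = c * fst (snd z)"
  "fst (snd (snd (cscale c z))) = c *s fst (snd (snd z))"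
  "snd (snd (snd (cscale c z))) = c * snd (snd (snd z))"
  by (auto simp: cscale_def split: prod.splits)

lemma phase_eqI:
  fixes z w :: "'n::finite phase"
  assumes "\<And>j. fst z $ j = fst w $ j" "fst (snd z) = fst (snd w)"
    "\<And>j. fst (snd (snd z)) $ j = fst (snd (snd w)) $ j" "snd (snd (snd z)) = snd (snd (snd w))"
  shows "z = w"
  using assms by (auto simp: prod_eq_iff vec_eq_iff)

lemma cscale_algebra:
  "cscale c (u + v) = cscale c u + cscale c v" "cscale (c + d) u = cscale c u + cscale d u"
  "cscale c (r *\<^sub>R u) = r *\<^sub>R cscale c u" "cscale (r *\<^sub>R c) u = r *\<^sub>R cscale c u"
  "cscale c (cscale d u) = cscale (c * d) u" "cscale 1 u = u" "cscale 0 u = 0" "cscale c 0 = 0"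
  "cscale (of_real r) u = r *\<^sub>R u" "cscale c (- u) = - cscale c u" "cscale c (u - v) = cscale c u - cscale c v"
  by (auto intro!: phase_eqI simp: algebra_simps vector_scalar_mult_def scaleR_conv_of_real[where 'a=complex])

lemma norm_vec_scalar: "norm (c *s (x::complex^'n)) = cmod c * norm x"
  by (simp add: norm_vec_def norm_mult L2_set_right_distrib)

lemma norm_cscale: "norm (cscale c z) = cmod c * norm z"
proof -
  have 1: "sqrt ((c * a)\<^sup>2 + (c * b)\<^sup>2) = c * sqrt (a\<^sup>2 + b\<^sup>2)" if "c \<ge> 0" for c a b :: real
    using that by (simp add: power_mult_distrib real_sqrt_mult flip: distrib_left)
  have "norm (cscale c z) = norm (fst (cscale c z), fst (snd (cscale c z)), fst (snd (snd (cscale c z))), snd (snd (snd (cscale c z))))"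
    by (simp only: prod.collapse)
  also have "\<dots> = cmod c * norm (fst z, fst (snd z), fst (snd (snd z)), snd (snd (snd z)))"
    unfolding cscale_simps norm_Pair norm_vec_scalar norm_mult
    by (simp add: 1 del: real_sqrt_abs real_sqrt_pow2_iff)
  finally show ?thesis by (simp only: prod.collapse)
qed

lemma bounded_linear_cscale_left: "bounded_linear (\<lambda>c. cscale c u)"
  by (rule bounded_linear_intro[where K = "norm u"]) (auto simp: cscale_algebra norm_cscale)

lemma norm_vec_le_sum: "norm (x::complex^'n) \<le> (\<Sum>j\<in>UNIV. cmod (x $ j))"
  by (simp add: norm_vec_def L2_set_le_sum)

lemma norm_phase_le:
  "norm (z::'n::finite phase) \<le> (\<Sum>j\<in>UNIV. cmod (fst z $ j)) + cmod (fst (snd z))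
     + (\<Sum>j\<in>UNIV. cmod (fst (snd (snd z)) $ j)) + cmod (snd (snd (snd z)))"
proof -
  obtain I \<eta> \<phi> \<xi> where z: "z = (I, \<eta>, \<phi>, \<xi>)" by (metis prod.exhaust)
  have "norm z \<le> norm I + (norm \<eta> + (norm \<phi> + norm \<xi>))"
    unfolding z by (meson add_left_mono norm_Pair_le order_trans)
  then show ?thesis using norm_vec_le_sum[of I] norm_vec_le_sum[of \<phi>] by (simp add: z)
qed

lemma phase_comp_le_norm:
  fixes z :: "'n::finite phase"
  shows "cmod (fst z $ j) \<le> norm z" "cmod (fst (snd z)) \<le> norm z"
    "cmod (fst (snd (snd z)) $ j) \<le> norm z" "cmod (snd (snd (snd z))) \<le> norm z"
proof -
  obtain I \<eta> \<phi> \<xi> where z: "z = (I, \<eta>, \<phi>, \<xi>)" by (metis prod.exhaust)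
  have 1: "norm I \<le> norm z" "norm (\<eta>, \<phi>, \<xi>) \<le> norm z" unfolding z by (rule norm_fst_le norm_snd_le)+
  have 2: "norm \<eta> \<le> norm (\<eta>, \<phi>, \<xi>)" "norm (\<phi>, \<xi>) \<le> norm (\<eta>, \<phi>, \<xi>)" by (rule norm_fst_le norm_snd_le)+
  have 3: "norm \<phi> \<le> norm (\<phi>, \<xi>)" "norm \<xi> \<le> norm (\<phi>, \<xi>)" by (rule norm_fst_le norm_snd_le)+
  have 4: "cmod (I $ j) \<le> norm I" "cmod (\<phi> $ j) \<le> norm \<phi>" by (rule Finite_Cartesian_Product.norm_nth_le)+
  show "cmod (fst z $ j) \<le> norm z" "cmod (fst (snd z)) \<le> norm z"
    "cmod (fst (snd (snd z)) $ j) \<le> norm z" "cmod (snd (snd (snd z))) \<le> norm z"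
    using 1 2 3 4 by (simp_all add: z)
qed

lemma holo_fun_onI:
  "(\<And>z. z \<in> S \<Longrightarrow> \<exists>D. (F has_derivative D) (at z) \<and> (\<forall>c v. D (cscale c v) = c * D v)) \<Longrightarrow> holo_fun_on S F"
  by (simp add: holo_fun_on_def)

lemma holo_derivD:
  assumes "holo_fun_on S F" "z \<in> S"
  shows "(F has_derivative dd F z) (at z)" "dd F z (cscale c v) = c * dd F z v"
proof -
  obtain D where D: "(F has_derivative D) (at z)" "\<forall>c v. D (cscale c v) = c * D v"
    using assms unfolding holo_fun_on_def by blast
  then have e: "dd F z = D" by (metis frechet_derivative_at)
  show "(F has_derivative dd F z) (at z)" unfolding e by (rule D(1))
  show "dd F z (cscale c v) = c * dd F z v" unfolding e by (rule D(2)[rule_format])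
qed

lemma holo_map_derivD:
  assumes "holo_map_on S F" "z \<in> S"
  shows "(F has_derivative dd F z) (at z)" "dd F z (cscale c v) = cscale c (dd F z v)"
proof -
  obtain D where D: "(F has_derivative D) (at z)" "\<forall>c v. D (cscale c v) = cscale c (D v)"
    using assms unfolding holo_map_on_def by blast
  then have e: "dd F z = D" by (metis frechet_derivative_at)
  show "(F has_derivative dd F z) (at z)" unfolding e by (rule D(1))
  show "dd F z (cscale c v) = cscale c (dd F z v)" unfolding e by (rule D(2)[rule_format])
qed

lemma dd_eq: "(F has_derivative D) (at z) \<Longrightarrow> dd F z u = D u"
  by (metis frechet_derivative_at)

lemma holo_linear:
  assumes "holo_fun_on S F" "z \<in> S"
  shows "dd F z (u + v) = dd F z u + dd F z v" "dd F z (- u) = - dd F z u"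
    "dd F z (u - v) = dd F z u - dd F z v" "dd F z 0 = 0" "dd F z (r *\<^sub>R u) = r *\<^sub>R dd F z u"
    "dd F z (sum g X) = (\<Sum>i\<in>X. dd F z (g i))"
proof -
  have l: "linear (dd F z)" using holo_derivD(1)[OF assms] has_derivative_linear by blast
  show "dd F z (u + v) = dd F z u + dd F z v" "dd F z (- u) = - dd F z u"
    "dd F z (u - v) = dd F z u - dd F z v" "dd F z 0 = 0" "dd F z (r *\<^sub>R u) = r *\<^sub>R dd F z u"
    "dd F z (sum g X) = (\<Sum>i\<in>X. dd F z (g i))"
    using l by (simp_all add: linear_add linear_neg linear_diff linear_0 linear_cmul linear_sum)
qed

lemma holo_fun_subset: "holo_fun_on S F \<Longrightarrow> T \<subseteq> S \<Longrightarrow> holo_fun_on T F"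
  by (auto simp: holo_fun_on_def)
lemma holo_map_subset: "holo_map_on S F \<Longrightarrow> T \<subseteq> S \<Longrightarrow> holo_map_on T F"
  by (auto simp: holo_map_on_def)

lemma holo_continuous: "holo_fun_on S F \<Longrightarrow> z \<in> S \<Longrightarrow> isCont F z"
  using holo_derivD(1) has_derivative_continuous by blast
lemma dd_cong:
  assumes "open S" "z \<in> S" "\<And>w. w \<in> S \<Longrightarrow> F w = G w"
  shows "dd F z = dd G z"
proof -
  have "(F has_derivative D) (at z) \<longleftrightarrow> (G has_derivative D) (at z)" for D
    using has_derivative_transform_within_open[OF _ assms(1,2)] assms(3) by metis
  then show ?thesis by (simp add: frechet_derivative_def)
qed

lemma holo_fun_cong:
  assumes "open S" "\<And>w. w \<in> S \<Longrightarrow> F w = G w" "holo_fun_on S F"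
  shows "holo_fun_on S G"
proof (rule holo_fun_onI)
  fix z assume z: "z \<in> S"
  have "(G has_derivative dd F z) (at z)"
    using has_derivative_transform_within_open[OF holo_derivD(1)[OF assms(3) z] assms(1) z] assms(2) by blast
  then show "\<exists>D. (G has_derivative D) (at z) \<and> (\<forall>c v. D (cscale c v) = c * D v)"
    using holo_derivD(2)[OF assms(3) z] by blast
qed

lemma holo_const: "holo_fun_on S (\<lambda>z. c)"
  by (rule holo_fun_onI, rule exI[of _ "\<lambda>_. 0"]) auto

lemma holo_linear_fun:
  assumes "bounded_linear l" "\<And>c v. l (cscale c v) = c * l v"
  shows "holo_fun_on S l" "dd l z = l"
proof -
  have d: "(l has_derivative l) (at z)" for z using assms(1) by (simp add: bounded_linear_imp_has_derivative)
  show "holo_fun_on S l" by (rule holo_fun_onI) (use d assms(2) in blast)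
  show "dd l z = l" by (rule ext) (rule dd_eq[OF d])
qed

lemma holo_add:
  assumes "holo_fun_on S F" "holo_fun_on S G"
  shows "holo_fun_on S (\<lambda>z. F z + G z)"
    "z \<in> S \<Longrightarrow> dd (\<lambda>z. F z + G z) z u = dd F z u + dd G z u"
proof -
  have d: "((\<lambda>z. F z + G z) has_derivative (\<lambda>u. dd F z u + dd G z u)) (at z)" if "z \<in> S" for z
    using holo_derivD(1)[OF assms(1) that] holo_derivD(1)[OF assms(2) that] by (rule has_derivative_add)
  show "holo_fun_on S (\<lambda>z. F z + G z)"
    by (rule holo_fun_onI, rule exI, rule conjI, erule d)
       (simp add: holo_derivD(2)[OF assms(1)] holo_derivD(2)[OF assms(2)] algebra_simps)
  show "z \<in> S \<Longrightarrow> dd (\<lambda>z. F z + G z) z u = dd F z u + dd G z u" using dd_eq[OF d] by blast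
qed

lemma holo_mult:
  assumes "holo_fun_on S F" "holo_fun_on S G"
  shows "holo_fun_on S (\<lambda>z. F z * G z)"
    "z \<in> S \<Longrightarrow> dd (\<lambda>z. F z * G z) z u = F z * dd G z u + dd F z u * G z"
proof -
  have d: "((\<lambda>z. F z * G z) has_derivative (\<lambda>u. F z * dd G z u + dd F z u * G z)) (at z)" if "z \<in> S" for z
    using holo_derivD(1)[OF assms(1) that] holo_derivD(1)[OF assms(2) that] by (rule has_derivative_mult)
  show "holo_fun_on S (\<lambda>z. F z * G z)"
    by (rule holo_fun_onI, rule exI, rule conjI, erule d)
       (simp add: holo_derivD(2)[OF assms(1)] holo_derivD(2)[OF assms(2)] algebra_simps)
  show "z \<in> S \<Longrightarrow> dd (\<lambda>z. F z * G z) z u = F z * dd G z u + dd F z u * G z" using dd_eq[OF d] by blast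
qed

lemma holo_cmult:
  assumes "holo_fun_on S F"
  shows "holo_fun_on S (\<lambda>z. c * F z)" "z \<in> S \<Longrightarrow> dd (\<lambda>z. c * F z) z u = c * dd F z u"
  using holo_mult[OF holo_const[where c = c] assms] by (auto simp: dd_eq[OF has_derivative_const])

lemma holo_uminus:
  assumes "holo_fun_on S F"
  shows "holo_fun_on S (\<lambda>z. - F z)" "z \<in> S \<Longrightarrow> dd (\<lambda>z. - F z) z u = - dd F z u"
  using holo_cmult[OF assms, where c = "-1"] by auto

lemma holo_diff:
  assumes "holo_fun_on S F" "holo_fun_on S G"
  shows "holo_fun_on S (\<lambda>z. F z - G z)"
    "z \<in> S \<Longrightarrow> dd (\<lambda>z. F z - G z) z u = dd F z u - dd G z u"
  using holo_add[OF assms(1) holo_uminus(1)[OF assms(2)]] holo_uminus(2)[OF assms(2)] by auto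

lemma holo_sum:
  assumes "finite X" "\<And>i. i \<in> X \<Longrightarrow> holo_fun_on S (F i)"
  shows "holo_fun_on S (\<lambda>z. \<Sum>i\<in>X. F i z) \<and> (\<forall>z\<in>S. \<forall>u. dd (\<lambda>z. \<Sum>i\<in>X. F i z) z u = (\<Sum>i\<in>X. dd (F i) z u))"
  using assms
proof (induction X rule: finite_induct)
  case empty then show ?case by (auto simp: holo_const dd_eq[OF has_derivative_const])
next
  case (insert i X) then show ?case using holo_add[of S "F i" "\<lambda>z. \<Sum>i\<in>X. F i z"] by auto
qed

lemma holo_exp:
  assumes "holo_fun_on S F"
  shows "holo_fun_on S (\<lambda>z. exp (F z))" "z \<in> S \<Longrightarrow> dd (\<lambda>z. exp (F z)) z u = exp (F z) * dd F z u"
proof -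
  have d: "((\<lambda>z. exp (F z)) has_derivative (\<lambda>u. exp (F z) * dd F z u)) (at z)" if "z \<in> S" for z
    using has_derivative_compose[OF holo_derivD(1)[OF assms that], of exp "\<lambda>h. exp (F z) * h"]
      DERIV_exp[of "F z"] by (simp add: has_field_derivative_def)
  show "holo_fun_on S (\<lambda>z. exp (F z))"
    by (rule holo_fun_onI, rule exI, rule conjI, erule d) (simp add: holo_derivD(2)[OF assms] algebra_simps)
  show "z \<in> S \<Longrightarrow> dd (\<lambda>z. exp (F z)) z u = exp (F z) * dd F z u" using dd_eq[OF d] by blast
qed

lemma holo_divide:
  assumes "holo_fun_on S F" "holo_fun_on S G" "\<And>z. z \<in> S \<Longrightarrow> G z \<noteq> 0"
  shows "holo_fun_on S (\<lambda>z. F z / G z)"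
proof (rule holo_fun_onI)
  fix z assume z: "z \<in> S"
  note d = has_derivative_divide[OF holo_derivD(1)[OF assms(1) z] holo_derivD(1)[OF assms(2) z] assms(3)[OF z]]
  show "\<exists>D. ((\<lambda>z. F z / G z) has_derivative D) (at z) \<and> (\<forall>c v. D (cscale c v) = c * D v)"
    by (rule exI, rule conjI, rule d)
       (simp add: holo_derivD(2)[OF assms(1) z] holo_derivD(2)[OF assms(2) z] algebra_simps)
qed

lemma holo_compose:
  assumes "holo_fun_on T F" "holo_map_on S C" "C ` S \<subseteq> T"
  shows "holo_fun_on S (\<lambda>z. F (C z))" "z \<in> S \<Longrightarrow> dd (\<lambda>z. F (C z)) z u = dd F (C z) (dd C z u)"
proof -
  have d: "((\<lambda>z. F (C z)) has_derivative (\<lambda>u. dd F (C z) (dd C z u))) (at z)" if "z \<in> S" for z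
    by (rule has_derivative_compose[OF holo_map_derivD(1)[OF assms(2) that]])
       (use assms(3) that in \<open>auto intro: holo_derivD(1)[OF assms(1)]\<close>)
  show "holo_fun_on S (\<lambda>z. F (C z))"
    by (rule holo_fun_onI, rule exI, rule conjI, erule d)
       (use assms(3) in \<open>simp add: holo_derivD(2)[OF assms(1)] holo_map_derivD(2)[OF assms(2)] image_subset_iff\<close>)
  show "z \<in> S \<Longrightarrow> dd (\<lambda>z. F (C z)) z u = dd F (C z) (dd C z u)" using dd_eq[OF d] by blast
qed

lemma holo_map_compose:
  assumes "holo_map_on T F" "holo_map_on S C" "C ` S \<subseteq> T"
  shows "holo_map_on S (\<lambda>z. F (C z))" "z \<in> S \<Longrightarrow> dd (\<lambda>z. F (C z)) z u = dd F (C z) (dd C z u)"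
proof -
  have d: "((\<lambda>z. F (C z)) has_derivative (\<lambda>u. dd F (C z) (dd C z u))) (at z)" if "z \<in> S" for z
    by (rule has_derivative_compose[OF holo_map_derivD(1)[OF assms(2) that]])
       (use assms(3) that in \<open>auto intro: holo_map_derivD(1)[OF assms(1)]\<close>)
  show "holo_map_on S (\<lambda>z. F (C z))"
    unfolding holo_map_on_def
    by (rule ballI, rule exI, rule conjI, erule d)
       (use assms(3) in \<open>simp add: holo_map_derivD(2)[OF assms(1)] holo_map_derivD(2)[OF assms(2)] image_subset_iff\<close>)
  show "z \<in> S \<Longrightarrow> dd (\<lambda>z. F (C z)) z u = dd F (C z) (dd C z u)" using dd_eq[OF d] by blast
qed

lemma holo_map_affine:
  assumes "bounded_linear l" "\<And>c v. l (cscale c v) = cscale c (l v)"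
  shows "holo_map_on S (\<lambda>z. l z + w)"
proof -
  have "((\<lambda>z. l z + w) has_derivative l) (at z)" for z
    using has_derivative_add[OF bounded_linear_imp_has_derivative[OF assms(1)] has_derivative_const] by simp
  then show ?thesis unfolding holo_map_on_def using assms(2) by blast
qed

lemma holo_map_id: "holo_map_on S (\<lambda>z. z)"
  using holo_map_affine[of "\<lambda>z. z" S 0] by auto

lemma has_derivative_vecI:
  fixes f :: "'a::real_normed_vector \<Rightarrow> complex^'n"
  assumes "\<And>j. ((\<lambda>z. f z $ j) has_derivative (\<lambda>u. f' u $ j)) (at z)"
  shows "(f has_derivative f') (at z)"
proof -
  have "((\<lambda>z. f z \<bullet> b) has_derivative (\<lambda>u. f' u \<bullet> b)) (at z)" if "b \<in> Basis" for b
  proof -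
    obtain j c where b: "b = axis j c" using \<open>b \<in> Basis\<close> by (auto simp: Basis_vec_def)
    show ?thesis unfolding b inner_axis
      using bounded_linear.has_derivative[OF bounded_linear_inner_left[of c] assms[of j]] by simp
  qed
  then show ?thesis by (subst has_derivative_componentwise_within) auto
qed

lemma holo_map_components:
  fixes C :: "'n::finite phase \<Rightarrow> 'n phase"
  assumes "\<And>j. holo_fun_on S (\<lambda>z. fst (C z) $ j)" "holo_fun_on S (\<lambda>z. fst (snd (C z)))"
    "\<And>j. holo_fun_on S (\<lambda>z. fst (snd (snd (C z))) $ j)" "holo_fun_on S (\<lambda>z. snd (snd (snd (C z))))"
  shows "holo_map_on S C"
    "z \<in> S \<Longrightarrow> dd C z u = ((\<chi> j. dd (\<lambda>z. fst (C z) $ j) z u), dd (\<lambda>z. fst (snd (C z))) z u,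
        (\<chi> j. dd (\<lambda>z. fst (snd (snd (C z))) $ j) z u), dd (\<lambda>z. snd (snd (snd (C z)))) z u)"
proof -
  define D where "D = (\<lambda>z u. ((\<chi> j. dd (\<lambda>z. fst (C z) $ j) z u), dd (\<lambda>z. fst (snd (C z))) z u,
        (\<chi> j. dd (\<lambda>z. fst (snd (snd (C z))) $ j) z u), dd (\<lambda>z. snd (snd (snd (C z)))) z u))"
  have "(C has_derivative D z) (at z)" if z: "z \<in> S" for z
  proof -
    have "((\<lambda>z. (fst (C z), fst (snd (C z)), fst (snd (snd (C z))), snd (snd (snd (C z))))) has_derivative D z) (at z)"
      unfolding D_def
      by (intro has_derivative_Pair has_derivative_vecI holo_derivD(1)[OF assms(2) z] holo_derivD(1)[OF assms(4) z])
         (simp_all add: holo_derivD(1)[OF assms(1) z] holo_derivD(1)[OF assms(3) z])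
    then show ?thesis by simp
  qed note d = this
  have "D z (cscale c v) = cscale c (D z v)" if z: "z \<in> S" for z c v
    by (rule phase_eqI) (simp_all add: D_def holo_derivD(2)[OF assms(1) z] holo_derivD(2)[OF assms(2) z]
        holo_derivD(2)[OF assms(3) z] holo_derivD(2)[OF assms(4) z])
  with d show "holo_map_on S C" unfolding holo_map_on_def by blast
  show "z \<in> S \<Longrightarrow> dd C z u = ((\<chi> j. dd (\<lambda>z. fst (C z) $ j) z u), dd (\<lambda>z. fst (snd (C z))) z u,
        (\<chi> j. dd (\<lambda>z. fst (snd (snd (C z))) $ j) z u), dd (\<lambda>z. snd (snd (snd (C z)))) z u)"
    using dd_eq[OF d] by (auto simp: D_def)
qed

lemma bl_comps:
  "bounded_linear (\<lambda>z::'n::finite phase. fst z $ j)" "bounded_linear (\<lambda>z::'n phase. fst (snd z))"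
  "bounded_linear (\<lambda>z::'n phase. fst (snd (snd z)) $ j)" "bounded_linear (\<lambda>z::'n phase. snd (snd (snd z)))"
  by (rule bounded_linear_intro[where K=1];
      simp add: phase_comp_le_norm scaleR_conv_of_real[where 'a=complex])+

lemma holo_coords:
  "holo_fun_on S (\<lambda>z::'n::finite phase. fst z $ j)" "holo_fun_on S (\<lambda>z::'n phase. fst (snd z))"
  "holo_fun_on S (\<lambda>z::'n phase. fst (snd (snd z)) $ j)" "holo_fun_on S (\<lambda>z::'n phase. snd (snd (snd z)))"
  by (rule holo_linear_fun, rule bl_comps, simp)+

subsection \<open>Cauchy estimates along complex lines\<close>

lemma holo_line:
  assumes "holo_fun_on S F" "z + cscale \<zeta> u \<in> S"
  shows "((\<lambda>\<zeta>. F (z + cscale \<zeta> u)) has_field_derivative dd F (z + cscale \<zeta> u) u) (at \<zeta>)"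
proof -
  have 1: "((\<lambda>\<zeta>. z + cscale \<zeta> u) has_derivative (\<lambda>h. cscale h u)) (at \<zeta>)"
    using has_derivative_add[OF has_derivative_const bounded_linear_imp_has_derivative[OF bounded_linear_cscale_left]]
    by simp
  have "((\<lambda>\<zeta>. F (z + cscale \<zeta> u)) has_derivative (\<lambda>h. dd F (z + cscale \<zeta> u) (cscale h u))) (at \<zeta>)"
    by (rule has_derivative_compose[OF 1 holo_derivD(1)[OF assms]])
  then show ?thesis
    by (simp add: has_field_derivative_def holo_derivD(2)[OF assms] mult.commute[of _ "dd F _ _"])
qed

lemma cauchy_deriv_bound:
  fixes g :: "complex \<Rightarrow> complex"
  assumes "g holomorphic_on ball a \<rho>" "\<And>\<zeta>. \<zeta> \<in> ball a \<rho> \<Longrightarrow> cmod (g \<zeta>) \<le> B" "0 < \<rho>"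
  shows "cmod ((deriv ^^ n) g a) \<le> fact n * B / \<rho> ^ n"
proof -
  have *: "cmod ((deriv ^^ n) g a) \<le> fact n * B / t ^ n" if t: "0 < t" "t < \<rho>" for t
  proof (rule Cauchy_inequality)
    show "g holomorphic_on ball a t" by (rule holomorphic_on_subset[OF assms(1)]) (use t in auto)
    show "continuous_on (cball a t) g"
      by (rule holomorphic_on_imp_continuous_on[OF holomorphic_on_subset[OF assms(1)]]) (use t in auto)
  qed (use t assms(2) in \<open>auto simp: dist_norm norm_minus_commute\<close>)
  have 1: "((\<lambda>t. fact n * B / t ^ n) \<longlongrightarrow> fact n * B / \<rho> ^ n) (at_left \<rho>)"
    by (intro tendsto_intros) (use assms(3) in auto)
  have 2: "\<forall>\<^sub>F t in at_left \<rho>. cmod ((deriv ^^ n) g a) \<le> fact n * B / t ^ n"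
    using eventually_at_left_real[OF \<open>0 < \<rho>\<close>] by eventually_elim (use * in auto)
  show ?thesis by (rule tendsto_lowerbound[OF 1 2]) simp
qed

lemma holo_line_holomorphic:
  assumes "holo_fun_on S F" "\<And>\<zeta>. cmod \<zeta> < \<rho> \<Longrightarrow> z + cscale \<zeta> u \<in> S"
  shows "(\<lambda>\<zeta>. F (z + cscale \<zeta> u)) holomorphic_on ball 0 \<rho>"
  by (auto simp: holomorphic_on_open intro!: exI holo_line[OF assms(1)] assms(2))

lemma cauchy_estimate:
  assumes "holo_fun_on S F" "0 < \<rho>" "\<And>\<zeta>. cmod \<zeta> < \<rho> \<Longrightarrow> z + cscale \<zeta> u \<in> S"
    "\<And>\<zeta>. cmod \<zeta> < \<rho> \<Longrightarrow> cmod (F (z + cscale \<zeta> u)) \<le> B"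
  shows "cmod (dd F z u) \<le> B / \<rho>"
proof -
  have "cmod ((deriv ^^ 1) (\<lambda>\<zeta>. F (z + cscale \<zeta> u)) 0) \<le> fact 1 * B / \<rho> ^ 1"
    by (rule cauchy_deriv_bound[OF holo_line_holomorphic[OF assms(1,3)]]) (use assms(2,4) in auto)
  moreover have "deriv (\<lambda>\<zeta>. F (z + cscale \<zeta> u)) 0 = dd F z u"
    using DERIV_imp_deriv[OF holo_line[OF assms(1) assms(3)[of 0]]] assms(2) by (simp add: cscale_algebra)
  ultimately show ?thesis by simp
qed

text \<open>Taylor's formula, with the second derivative bounded by Cauchy's estimate on discs of half the radius.\<close>

lemma quadratic_remainder:
  fixes g :: "complex \<Rightarrow> complex"
  assumes "g holomorphic_on ball 0 \<rho>" "\<And>\<zeta>. \<zeta> \<in> ball 0 \<rho> \<Longrightarrow> cmod (g \<zeta>) \<le> B" "0 < \<rho>" "cmod h < \<rho> / 2"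
  shows "cmod (g h - g 0 - h * deriv g 0) \<le> 8 * B / \<rho>\<^sup>2 * (cmod h)\<^sup>2"
proof -
  define T where "T = ball (0::complex) (\<rho>/2)"
  have sub: "ball x (\<rho>/2) \<subseteq> ball 0 \<rho>" if "x \<in> T" for x
  proof
    fix y assume "y \<in> ball x (\<rho>/2)"
    then have "dist 0 x < \<rho>/2" "dist x y < \<rho>/2" using that by (auto simp: T_def)
    then show "y \<in> ball 0 \<rho>" using dist_triangle[of 0 y x] by auto
  qed
  have b2: "cmod ((deriv ^^ 2) g x) \<le> 8 * B / \<rho>\<^sup>2" if "x \<in> T" for x
  proof -
    have "cmod ((deriv ^^ 2) g x) \<le> fact 2 * B / (\<rho>/2) ^ 2"
      by (rule cauchy_deriv_bound) (use sub[OF that] assms holomorphic_on_subset in \<open>auto\<close>)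
    then show ?thesis by (simp add: power_divide)
  qed
  have "cmod (g h - (\<Sum>i\<le>1. (deriv ^^ i) g 0 * (h - 0) ^ i / fact i)) \<le> 8 * B / \<rho>\<^sup>2 * cmod (h - 0) ^ Suc 1 / fact 1"
  proof (rule complex_Taylor[of T 1 "\<lambda>i. (deriv ^^ i) g", simplified funpow_0])
    show "convex T" by (simp add: T_def)
    show "((deriv ^^ i) g has_field_derivative (deriv ^^ Suc i) g x) (at x within T)" if "x \<in> T" "i \<le> 1" for i x
    proof -
      have hol: "(deriv ^^ i) g holomorphic_on ball 0 \<rho>" by (intro holomorphic_higher_deriv assms) auto
      have "x \<in> ball 0 \<rho>" by (rule subsetD[OF sub[OF that(1)]]) (use assms(3) in simp)
      then show ?thesis using holomorphic_derivI[OF hol] by simp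
    qed
    show "cmod ((deriv ^^ Suc 1) g x) \<le> 8 * B / \<rho>\<^sup>2" if "x \<in> T" for x using b2[OF that] by (simp add: numeral_2_eq_2)
    show "0 \<in> T" "h \<in> T" using assms(3,4) by (auto simp: T_def)
  qed
  then show ?thesis by (simp add: power2_eq_square algebra_simps)
qed

text \<open>The error of a single Euler step is quadratic in the step size, with a constant that only depends on
  the supremum and on the distance to the boundary.\<close>

lemma holo_quadratic:
  assumes "holo_fun_on S F" "0 < \<rho>" "\<And>\<zeta>. cmod \<zeta> < \<rho> \<Longrightarrow> z + cscale \<zeta> u \<in> S"
    "\<And>\<zeta>. cmod \<zeta> < \<rho> \<Longrightarrow> cmod (F (z + cscale \<zeta> u)) \<le> B" "\<bar>h\<bar> < \<rho> / 2"
  shows "cmod (F (z + h *\<^sub>R u) - F z - of_real h * dd F z u) \<le> 8 * B / \<rho>\<^sup>2 * h\<^sup>2"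
proof -
  have "deriv (\<lambda>\<zeta>. F (z + cscale \<zeta> u)) 0 = dd F z u"
    using DERIV_imp_deriv[OF holo_line[OF assms(1) assms(3)[of 0]]] assms(2) by (simp add: cscale_algebra)
  then show ?thesis
    using quadratic_remainder[OF holo_line_holomorphic[OF assms(1,3)], of \<rho> B "of_real h"] assms
    by (auto simp: cscale_algebra)
qed

subsection \<open>Locally uniform limits\<close>

lemma dist_add_le: "dist z (x + w) \<le> dist z x + norm (w::'a::real_normed_vector)"
  using norm_triangle_ineq4[of "z - x" w] by (simp add: dist_norm diff_diff_eq)

lemma holo_sup_deriv:
  assumes "holo_fun_on (ball z \<rho>) F" "\<And>w. w \<in> ball z \<rho> \<Longrightarrow> cmod (F w) \<le> B" "x \<in> ball z (\<rho>/2)" "0 < \<rho>"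
  shows "cmod (dd F x u) \<le> 2 * B / \<rho> * norm u"
proof (cases "u = 0")
  case True
  have "x \<in> ball z \<rho>" using assms(3,4) by auto
  then show ?thesis using holo_linear(4)[OF assms(1)] True by simp
next
  case False
  have in_ball: "x + cscale \<zeta> u \<in> ball z \<rho>" if "cmod \<zeta> < \<rho> / 2 / norm u" for \<zeta>
  proof -
    have "norm (cscale \<zeta> u) < \<rho>/2" using that False by (simp add: norm_cscale field_simps)
    moreover have "dist z (x + cscale \<zeta> u) \<le> dist z x + norm (cscale \<zeta> u)"
      by (rule dist_add_le)
    ultimately show ?thesis using assms(3) by auto
  qed
  have "cmod (dd F x u) \<le> B / (\<rho> / 2 / norm u)"
    by (rule cauchy_estimate[OF assms(1)]) (use in_ball assms False in auto)
  then show ?thesis using False by (simp add: field_simps)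
qed

text \<open>By Cauchy's estimate the derivatives inherit uniform convergence on the smaller ball.\<close>

lemma holo_limit_ball:
  fixes F :: "nat \<Rightarrow> 'n::finite phase \<Rightarrow> complex"
  assumes hol: "\<And>m. holo_fun_on (ball z \<rho>) (F m)" and lim: "uniform_limit (ball z \<rho>) F G sequentially" and "0 < \<rho>"
  shows "holo_fun_on (ball z (\<rho>/2)) G \<and> (\<forall>x\<in>ball z (\<rho>/2). \<forall>u. (\<lambda>m. dd (F m) x u) \<longlonglongrightarrow> dd G x u)"
proof -
  define S where "S = ball z (\<rho>/2)"
  have sub: "S \<subseteq> ball z \<rho>" using \<open>0 < \<rho>\<close> by (auto simp: S_def)
  have cau: "\<exists>M. \<forall>m\<ge>M. \<forall>l\<ge>M. \<forall>x\<in>S. \<forall>h. cmod (dd (F m) x h - dd (F l) x h) \<le> e * norm h" if "e > 0" for e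
  proof -
    have "uniformly_Cauchy_on (ball z \<rho>) F"
      using lim uniformly_convergent_eq_Cauchy uniformly_convergent_on_def by blast
    then obtain M where M: "\<And>x m l. x \<in> ball z \<rho> \<Longrightarrow> m \<ge> M \<Longrightarrow> l \<ge> M \<Longrightarrow> dist (F m x) (F l x) < e * \<rho> / 2"
      unfolding uniformly_Cauchy_on_def using \<open>e > 0\<close> \<open>0 < \<rho>\<close> by (meson half_gt_zero mult_pos_pos)
    have "cmod (dd (F m) x h - dd (F l) x h) \<le> e * norm h" if "m \<ge> M" "l \<ge> M" "x \<in> S" for m l x h
    proof -
      have "cmod (dd (\<lambda>z. F m z - F l z) x h) \<le> 2 * (e * \<rho> / 2) / \<rho> * norm h"
        by (rule holo_sup_deriv[OF holo_diff(1)[OF hol hol]])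
           (use M[OF _ that(1,2)] that(3) \<open>0 < \<rho>\<close> in \<open>simp_all add: S_def dist_norm less_imp_le\<close>)
      then show ?thesis using holo_diff(2)[OF hol hol subsetD[OF sub that(3)]] \<open>0 < \<rho>\<close> by simp
    qed
    then show ?thesis by blast
  qed
  define g' where "g' = (\<lambda>x h. lim (\<lambda>m. dd (F m) x h))"
  have conv: "(\<lambda>m. dd (F m) x h) \<longlonglongrightarrow> g' x h" if xS: "x \<in> S" for x h
  proof -
    have "Cauchy (\<lambda>m. dd (F m) x h)"
    proof (rule metric_CauchyI)
      fix e :: real assume "e > 0"
      then have "e / (norm h + 1) > 0" by (simp add: add_nonneg_pos)
      from cau[OF this] obtain M where M: "\<And>m l. m \<ge> M \<Longrightarrow> l \<ge> M \<Longrightarrow> cmod (dd (F m) x h - dd (F l) x h) \<le> e / (norm h + 1) * norm h"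
        using xS by blast
      have "e / (norm h + 1) * norm h < e" using \<open>e > 0\<close> add_nonneg_pos[OF norm_ge_zero[of h] zero_less_one]
        by (simp add: pos_divide_less_eq)
      then show "\<exists>M. \<forall>m\<ge>M. \<forall>n\<ge>M. dist (dd (F m) x h) (dd (F n) x h) < e"
        using M unfolding dist_norm by (meson le_less_trans)
    qed
    then show ?thesis unfolding g'_def by (simp add: Cauchy_convergent_iff convergent_LIMSEQ_iff)
  qed
  have ex: "\<exists>g. \<forall>x\<in>S. (\<lambda>n. F n x) \<longlonglongrightarrow> g x \<and> (g has_derivative g' x) (at x within S)"
  proof (rule has_derivative_sequence)
    show "convex S" by (simp add: S_def)
    show "(F n has_derivative dd (F n) x) (at x within S)" if "x \<in> S" for n x
      using holo_derivD(1)[OF hol] sub that has_derivative_at_withinI by blast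
    show "\<forall>\<^sub>F n in sequentially. \<forall>x\<in>S. \<forall>h. cmod (dd (F n) x h - g' x h) \<le> e * norm h" if e0: "e > 0" for e
    proof -
      obtain M where M: "\<And>m l x h. m \<ge> M \<Longrightarrow> l \<ge> M \<Longrightarrow> x \<in> S \<Longrightarrow> cmod (dd (F m) x h - dd (F l) x h) \<le> e * norm h"
        using cau[OF e0] by blast
      have "cmod (dd (F n) x h - g' x h) \<le> e * norm h" if "n \<ge> M" "x \<in> S" for n x h
      proof (rule LIMSEQ_le_const2)
        show "(\<lambda>l. cmod (dd (F n) x h - dd (F l) x h)) \<longlonglongrightarrow> cmod (dd (F n) x h - g' x h)"
          by (intro tendsto_intros conv that)
        show "\<exists>N. \<forall>l\<ge>N. cmod (dd (F n) x h - dd (F l) x h) \<le> e * norm h" using M that by blast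
      qed
      then show ?thesis unfolding eventually_sequentially by blast
    qed
    show "z \<in> S" using \<open>0 < \<rho>\<close> by (simp add: S_def)
    show "(\<lambda>n. F n z) \<longlonglongrightarrow> G z" by (rule tendsto_uniform_limitI[OF lim]) (use \<open>0 < \<rho>\<close> in simp)
  qed
  then obtain g where g: "\<And>x. x \<in> S \<Longrightarrow> (\<lambda>n. F n x) \<longlonglongrightarrow> g x" "\<And>x. x \<in> S \<Longrightarrow> (g has_derivative g' x) (at x within S)"
    by blast
  have gG: "g x = G x" if "x \<in> S" for x
    by (rule LIMSEQ_unique[OF g(1)[OF that] tendsto_uniform_limitI[OF lim subsetD[OF sub that]]])
  have dG: "(G has_derivative g' x) (at x)" if "x \<in> S" for x
  proof -
    have "(g has_derivative g' x) (at x)" using g(2)[OF that] at_within_open[OF that] by (simp add: S_def)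
    moreover have "open S" by (simp add: S_def)
    ultimately show ?thesis
      by (rule has_derivative_transform_within_open[OF _ _ that]) (rule gG)
  qed
  have "g' x (cscale c v) = c * g' x v" if "x \<in> S" for x c v
  proof (rule LIMSEQ_unique[OF conv[OF that]])
    have "(\<lambda>m. c * dd (F m) x v) \<longlonglongrightarrow> c * g' x v" by (intro tendsto_intros conv that)
    moreover have "dd (F m) x (cscale c v) = c * dd (F m) x v" for m
      by (rule holo_derivD(2)[OF hol]) (use that sub in blast)
    ultimately show "(\<lambda>m. dd (F m) x (cscale c v)) \<longlonglongrightarrow> c * g' x v" by simp
  qed
  with dG have "holo_fun_on S G" unfolding holo_fun_on_def by blast
  moreover have "(\<lambda>m. dd (F m) x u) \<longlonglongrightarrow> dd G x u" if "x \<in> S" for x u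
    using conv[OF that] dd_eq[OF dG[OF that]] by simp
  ultimately show ?thesis by (auto simp: S_def)
qed

lemma holo_limit:
  fixes F :: "nat \<Rightarrow> 'n::finite phase \<Rightarrow> complex"
  assumes "open S" and hol: "\<And>m. holo_fun_on S (F m)"
    and lim: "\<And>z. z \<in> S \<Longrightarrow> \<exists>\<rho>>0. uniform_limit (ball z \<rho> \<inter> S) F G sequentially"
  shows "holo_fun_on S G" "\<And>z u. z \<in> S \<Longrightarrow> (\<lambda>m. dd (F m) z u) \<longlonglongrightarrow> dd G z u"
proof -
  have *: "\<exists>\<rho>>0. holo_fun_on (ball z \<rho>) G \<and> (\<forall>x\<in>ball z \<rho>. \<forall>u. (\<lambda>m. dd (F m) x u) \<longlonglongrightarrow> dd G x u)" if zS: "z \<in> S" for z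
  proof -
    obtain r1 where 1: "r1 > 0" "uniform_limit (ball z r1 \<inter> S) F G sequentially" using lim[OF zS] by metis
    obtain r2 where 2: "r2 > 0" "ball z r2 \<subseteq> S" using \<open>open S\<close> zS open_contains_ball by blast
    define \<rho> where "\<rho> = min r1 r2"
    have sub: "ball z \<rho> \<subseteq> ball z r1 \<inter> S" "0 < \<rho>" using 1 2 by (auto simp: \<rho>_def)
    from holo_limit_ball[OF holo_fun_subset[OF hol] uniform_limit_on_subset[OF 1(2)], of z \<rho>] sub
    show ?thesis by (intro exI[of _ "\<rho>/2"]) auto
  qed
  show "holo_fun_on S G"
    unfolding holo_fun_on_def
  proof
    fix z assume "z \<in> S"
    from *[OF this] obtain \<rho> where "\<rho> > 0" "holo_fun_on (ball z \<rho>) G" by blast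
    then show "\<exists>D. (G has_derivative D) (at z) \<and> (\<forall>c v. D (cscale c v) = c * D v)"
      unfolding holo_fun_on_def by (meson centre_in_ball)
  qed
  show "(\<lambda>m. dd (F m) z u) \<longlonglongrightarrow> dd G z u" if "z \<in> S" for z u using *[OF that] by (meson centre_in_ball)
qed

subsection \<open>Directional derivatives are holomorphic and commute\<close>

text \<open>The difference quotients in a direction converge locally uniformly by \<open>holo_quadratic\<close>, so a directional
  derivative is itself a locally uniform limit of holomorphic functions.\<close>

lemma dir_deriv_quotients:
  fixes F :: "'n::finite phase \<Rightarrow> complex"
  assumes "open S" "holo_fun_on S F" "z \<in> S"
  obtains \<rho> and t :: "nat \<Rightarrow> real" where "\<rho> > 0" "ball z \<rho> \<subseteq> S" "t \<longlonglongrightarrow> 0" "\<And>m. t m \<noteq> 0"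
    "\<And>m. holo_fun_on (ball z \<rho>) (\<lambda>x. inverse (of_real (t m)) * (F (x + t m *\<^sub>R u) - F x))"
    "\<And>m x w. x \<in> ball z \<rho> \<Longrightarrow> dd (\<lambda>x. inverse (of_real (t m)) * (F (x + t m *\<^sub>R u) - F x)) x w
        = inverse (of_real (t m)) * (dd F (x + t m *\<^sub>R u) w - dd F x w)"
    "uniform_limit (ball z \<rho>) (\<lambda>m x. inverse (of_real (t m)) * (F (x + t m *\<^sub>R u) - F x)) (\<lambda>x. dd F x u) sequentially"
proof -
    obtain r1 where r1: "r1 > 0" "ball z r1 \<subseteq> S" using \<open>open S\<close> assms(3) open_contains_ball by blast
    have "isCont F z" using holo_continuous[OF assms(2,3)] .
    then obtain r2 where r2: "r2 > 0" "\<And>x. dist x z < r2 \<Longrightarrow> dist (F x) (F z) < 1"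
      unfolding continuous_at_eps_delta by (metis zero_less_one)
    define r where "r = min r1 r2"
    define B where "B = cmod (F z) + 1"
    have r: "r > 0" "ball z r \<subseteq> S" using r1 r2 by (auto simp: r_def)
    have B: "cmod (F x) \<le> B" if "x \<in> ball z r" for x
    proof -
      have "dist (F x) (F z) < 1" using that r2(2)[of x] by (auto simp: r_def dist_commute)
      then show ?thesis unfolding B_def dist_norm using norm_triangle_sub[of "F x" "F z"] by linarith
    qed
    define \<tau> where "\<tau> = r / (2 * (norm u + 1))"
    have nu: "norm u + 1 > 0" by (simp add: add_nonneg_pos)
    have \<tau>: "\<tau> > 0" using r nu by (simp add: \<tau>_def)
    have inb: "x + cscale \<zeta> u \<in> ball z r" if "x \<in> ball z (r/2)" "cmod \<zeta> < \<tau>" for x \<zeta>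
    proof -
      have "norm (cscale \<zeta> u) \<le> cmod \<zeta> * (norm u + 1)" by (simp add: norm_cscale mult_left_mono)
      also have "\<dots> \<le> \<tau> * (norm u + 1)" using that nu by (intro mult_right_mono) auto
      also have "\<dots> = r/2" using nu by (simp add: \<tau>_def field_simps)
      finally have "norm (cscale \<zeta> u) \<le> r/2" .
      moreover have "dist z (x + cscale \<zeta> u) \<le> dist z x + norm (cscale \<zeta> u)"
        by (rule dist_add_le)
      ultimately show ?thesis using that(1) by auto
    qed
    define t where "t = (\<lambda>m. \<tau> / 4 * inverse (real (Suc m)))"
    have tpos: "0 < t m" for m using \<tau> by (simp add: t_def)
    have tsm: "t m < \<tau> / 2" for m
    proof -
      have "t m \<le> \<tau> / 4 * 1" unfolding t_def using \<tau> by (intro mult_left_mono) (auto simp: inverse_le_1_iff)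
      then show ?thesis using \<tau> by simp
    qed
    have tlim: "t \<longlonglongrightarrow> 0" unfolding t_def by (rule tendsto_mult_right_zero[OF LIMSEQ_inverse_real_of_nat])
    have inS: "x + t m *\<^sub>R u \<in> S" if "x \<in> ball z (r/2)" for x m
      using inb[OF that, of "of_real (t m)"] tsm[of m] tpos[of m] r
      unfolding cscale_algebra norm_of_real by (intro subsetD[OF r(2)]) simp
    have ballS: "ball z (r/2) \<subseteq> S" using r by (auto simp: subset_iff)
    define Q where "Q = (\<lambda>m x. inverse (of_real (t m)) * (F (x + t m *\<^sub>R u) - F x))"
    have hQ: "holo_fun_on (ball z (r/2)) (Q m)" and
      dQ: "\<And>x w. x \<in> ball z (r/2) \<Longrightarrow> dd (Q m) x w = inverse (of_real (t m)) * (dd F (x + t m *\<^sub>R u) w - dd F x w)" for m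
    proof -
      define C where "C = (\<lambda>x. x + t m *\<^sub>R u)"
      have C: "holo_map_on (ball z (r/2)) C" unfolding C_def by (rule holo_map_affine[where l = "\<lambda>z. z"]) auto
      have im: "C ` ball z (r/2) \<subseteq> S" using inS by (auto simp: C_def)
      have dC: "dd C x w = w" for x w
        unfolding C_def by (rule dd_eq) (auto intro!: derivative_eq_intros)
      have h1: "holo_fun_on (ball z (r/2)) (\<lambda>x. F (C x))" by (rule holo_compose(1)[OF assms(2) C im])
      have h2: "holo_fun_on (ball z (r/2)) F" by (rule holo_fun_subset[OF assms(2) ballS])
      have Q: "Q m = (\<lambda>x. inverse (of_real (t m)) * (F (C x) - F x))" by (simp add: Q_def C_def)
      show "holo_fun_on (ball z (r/2)) (Q m)" unfolding Q by (rule holo_cmult(1)[OF holo_diff(1)[OF h1 h2]])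
      show "dd (Q m) x w = inverse (of_real (t m)) * (dd F (x + t m *\<^sub>R u) w - dd F x w)" if "x \<in> ball z (r/2)" for x w
        unfolding Q holo_cmult(2)[OF holo_diff(1)[OF h1 h2] that] holo_diff(2)[OF h1 h2 that]
          holo_compose(2)[OF assms(2) C im that] dC by (simp add: C_def)
    qed
    have ul: "uniform_limit (ball z (r/2)) Q (\<lambda>x. dd F x u) sequentially"
    proof (rule uniform_limitI)
      fix e :: real assume "e > 0"
      have est: "dist (Q m x) (dd F x u) \<le> 8 * B / \<tau>\<^sup>2 * t m" if "x \<in> ball z (r/2)" for x m
      proof -
        have "cmod (F (x + t m *\<^sub>R u) - F x - of_real (t m) * dd F x u) \<le> 8 * B / \<tau>\<^sup>2 * (t m)\<^sup>2"
          by (rule holo_quadratic[OF holo_fun_subset[OF assms(2) r(2)] \<tau>])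
             (use inb[OF that] B tsm[of m] tpos[of m] in auto)
        moreover have "F (x + t m *\<^sub>R u) - F x - of_real (t m) * dd F x u = of_real (t m) * (Q m x - dd F x u)"
          using tpos[of m] by (simp add: Q_def right_diff_distrib mult.assoc[symmetric])
        ultimately have "t m * dist (Q m x) (dd F x u) \<le> t m * (8 * B / \<tau>\<^sup>2 * t m)"
          using tpos[of m] by (simp add: norm_mult dist_norm power2_eq_square mult_ac)
        then show ?thesis using tpos[of m] by (simp only: mult_le_cancel_left_pos)
      qed
      have "(\<lambda>m. 8 * B / \<tau>\<^sup>2 * t m) \<longlonglongrightarrow> 0" by (rule tendsto_mult_right_zero[OF tlim])
      then have "\<forall>\<^sub>F m in sequentially. 8 * B / \<tau>\<^sup>2 * t m < e"
        using \<open>e > 0\<close> by (intro order_tendstoD(2)) auto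
      then show "\<forall>\<^sub>F m in sequentially. \<forall>x\<in>ball z (r/2). dist (Q m x) (dd F x u) < e"
        by eventually_elim (use est le_less_trans in blast)
    qed
    show ?thesis
    proof (rule that[of "r/2" t])
      show "t m \<noteq> 0" for m using tpos[of m] by simp
    qed (use r ballS tlim hQ dQ ul in \<open>simp_all add: Q_def\<close>)
qed

lemma holo_dir_deriv:
  fixes F :: "'n::finite phase \<Rightarrow> complex"
  assumes "open S" "holo_fun_on S F"
  shows "holo_fun_on S (\<lambda>z. dd F z u)"
  unfolding holo_fun_on_def
proof
  fix z assume "z \<in> S"
  obtain \<rho> and t :: "nat \<Rightarrow> real" where *: "\<rho> > 0" "ball z \<rho> \<subseteq> S" "t \<longlonglongrightarrow> 0" "\<And>m. t m \<noteq> 0"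
    "\<And>m. holo_fun_on (ball z \<rho>) (\<lambda>x. inverse (of_real (t m)) * (F (x + t m *\<^sub>R u) - F x))"
    "\<And>m x w. x \<in> ball z \<rho> \<Longrightarrow> dd (\<lambda>x. inverse (of_real (t m)) * (F (x + t m *\<^sub>R u) - F x)) x w
        = inverse (of_real (t m)) * (dd F (x + t m *\<^sub>R u) w - dd F x w)"
    "uniform_limit (ball z \<rho>) (\<lambda>m x. inverse (of_real (t m)) * (F (x + t m *\<^sub>R u) - F x)) (\<lambda>x. dd F x u) sequentially"
    by (rule dir_deriv_quotients[OF assms \<open>z \<in> S\<close>, where u = u]) blast
  have "holo_fun_on (ball z (\<rho>/2)) (\<lambda>z. dd F z u)" using holo_limit_ball[OF *(5,7,1)] by blast
  then show "\<exists>D. ((\<lambda>z. dd F z u) has_derivative D) (at z) \<and> (\<forall>c v. D (cscale c v) = c * D v)"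
    unfolding holo_fun_on_def using *(1) by (meson centre_in_ball half_gt_zero)
qed

text \<open>The derivative along \<open>w\<close> of the difference quotients in direction \<open>u\<close> is a difference
  quotient of the derivative along \<open>w\<close>; both sides are its limit.\<close>

lemma dir_deriv_commute:
  fixes F :: "'n::finite phase \<Rightarrow> complex"
  assumes "open S" "holo_fun_on S F" "z \<in> S"
  shows "dd (\<lambda>z. dd F z u) z w = dd (\<lambda>z. dd F z w) z u"
proof -
  obtain \<rho> and t :: "nat \<Rightarrow> real" where *: "\<rho> > 0" "ball z \<rho> \<subseteq> S" "t \<longlonglongrightarrow> 0" "\<And>m. t m \<noteq> 0"
    "\<And>m. holo_fun_on (ball z \<rho>) (\<lambda>x. inverse (of_real (t m)) * (F (x + t m *\<^sub>R u) - F x))"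
    "\<And>m x w. x \<in> ball z \<rho> \<Longrightarrow> dd (\<lambda>x. inverse (of_real (t m)) * (F (x + t m *\<^sub>R u) - F x)) x w
        = inverse (of_real (t m)) * (dd F (x + t m *\<^sub>R u) w - dd F x w)"
    "uniform_limit (ball z \<rho>) (\<lambda>m x. inverse (of_real (t m)) * (F (x + t m *\<^sub>R u) - F x)) (\<lambda>x. dd F x u) sequentially"
    by (rule dir_deriv_quotients[OF assms, where u = u]) blast
  have "(\<lambda>m. dd (\<lambda>x. inverse (of_real (t m)) * (F (x + t m *\<^sub>R u) - F x)) z w) \<longlonglongrightarrow> dd (\<lambda>z. dd F z u) z w"
    using conjunct2[OF holo_limit_ball[OF *(5,7,1)]] *(1) by (meson centre_in_ball half_gt_zero)
  then have l1: "(\<lambda>m. inverse (of_real (t m)) * (dd F (z + t m *\<^sub>R u) w - dd F z w)) \<longlonglongrightarrow> dd (\<lambda>z. dd F z u) z w"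
    using *(1) by (simp only: *(6) centre_in_ball)
  have hw: "holo_fun_on S (\<lambda>z. dd F z w)" by (rule holo_dir_deriv[OF assms(1,2)])
  have d: "((\<lambda>\<zeta>. dd F (z + cscale \<zeta> u) w) has_field_derivative dd (\<lambda>z. dd F z w) z u) (at 0)"
    using holo_line[OF hw, of z 0 u] assms(3) by (simp add: cscale_algebra)
  have fl: "filterlim (\<lambda>m. complex_of_real (t m)) (at 0) sequentially"
    unfolding filterlim_at
    using tendsto_of_real[OF *(3), where 'a=complex] *(4) by (auto intro!: always_eventually)
  have "((\<lambda>h. (dd F (z + cscale h u) w - dd F (z + cscale 0 u) w) / h) \<longlongrightarrow> dd (\<lambda>z. dd F z w) z u) (at 0)"
    using d by (simp add: DERIV_def cscale_algebra)
  from filterlim_compose[OF this fl]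
  have "(\<lambda>m. inverse (of_real (t m)) * (dd F (z + t m *\<^sub>R u) w - dd F z w)) \<longlonglongrightarrow> dd (\<lambda>z. dd F z w) z u"
    by (simp only: cscale_algebra add_0_right divide_inverse mult.commute)
  with l1 show ?thesis using LIMSEQ_unique by blast
qed

section \<open>Complex neighbourhoods and Fourier modes\<close>

lemma open_strip: "open (strip s)"
  unfolding strip_def by (intro open_Collect_less continuous_intros)

lemma open_torus_strip: "open (torus_strip s :: (complex^'n) set)"
proof -
  have "torus_strip s = (\<Inter>j\<in>UNIV. {\<phi>::complex^'n. \<bar>Im (\<phi> $ j)\<bar> < s})" by (auto simp: torus_strip_def)
  also have "open \<dots>" by (intro open_INT ballI open_Collect_less continuous_intros) auto
  finally show ?thesis .
qed

lemma open_cnbhd: "open (cnbhd V a :: (complex^'n) set)"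
proof -
  have "{J::complex^'n. \<forall>j. cmod (J $ j - cvec I $ j) < a} = (\<Inter>j\<in>UNIV. {J. cmod (J $ j - cvec I $ j) < a})" for I
    by auto
  moreover have "open (\<Inter>j\<in>UNIV. {J::complex^'n. cmod (J $ j - cvec I $ j) < a})" for I
    by (intro open_INT ballI open_Collect_less continuous_intros) auto
  ultimately show ?thesis unfolding cnbhd_def by (intro open_UN ballI) simp
qed

lemma open_cdomain [simp]: "open (cdomain V a s)"
  unfolding cdomain_def by (intro open_Times open_cnbhd open_strip open_torus_strip)

lemma mem_cdomain:
  "z \<in> cdomain V a s \<longleftrightarrow> fst z \<in> cnbhd V a \<and> \<bar>Im (fst (snd z))\<bar> < a \<and>
     (\<forall>j. \<bar>Im (fst (snd (snd z)) $ j)\<bar> < s) \<and> \<bar>Im (snd (snd (snd z)))\<bar> < s"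
  by (cases z) (auto simp: cdomain_def strip_def torus_strip_def)

lemma mem_cnbhd: "J \<in> cnbhd V a \<longleftrightarrow> (\<exists>I\<in>V. \<forall>j. cmod (J $ j - cvec I $ j) < a)"
  by (auto simp: cnbhd_def)

lemma cnbhd_mono: "a \<le> a' \<Longrightarrow> cnbhd V a \<subseteq> cnbhd V a'"
  by (auto simp: mem_cnbhd) (meson less_le_trans)

lemma cdomain_mono: "a \<le> a' \<Longrightarrow> s \<le> s' \<Longrightarrow> cdomain V a s \<subseteq> cdomain V a' s'"
  unfolding subset_iff mem_cdomain using cnbhd_mono[of a a' V] by (meson less_le_trans subsetD)

lemma cdomain_monoD: "z \<in> cdomain V a s \<Longrightarrow> a \<le> a' \<Longrightarrow> s \<le> s' \<Longrightarrow> z \<in> cdomain V a' s'"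
  using cdomain_mono by blast

lemma cdomain_pos: assumes "z \<in> cdomain V a s" shows "0 < a" "0 < s"
  using assms by (auto simp: mem_cdomain)

text \<open>Displacements are measured separately in the directions of \<open>I, \<eta>\<close> and of \<open>\<phi>, \<xi>\<close>, since the two
  widths of a domain are consumed at different rates.\<close>

definition disp :: "real \<Rightarrow> real \<Rightarrow> 'n::finite phase \<Rightarrow> bool" where
  "disp p q u \<longleftrightarrow> (\<forall>j. cmod (fst u $ j) \<le> p) \<and> cmod (fst (snd u)) \<le> p \<and>
     (\<forall>j. cmod (fst (snd (snd u)) $ j) \<le> q) \<and> cmod (snd (snd (snd u))) \<le> q"

lemma cdomain_add:
  assumes "z \<in> cdomain V a s" "disp p q u"
  shows "z + u \<in> cdomain V (a + p) (s + q)"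
proof -
  obtain I where I: "I \<in> V" "\<And>j. cmod (fst z $ j - cvec I $ j) < a"
    using assms(1) by (auto simp: mem_cdomain mem_cnbhd)
  have "cmod (fst (z + u) $ j - cvec I $ j) < a + p" for j
    using I(2)[of j] assms(2) norm_triangle_ineq[of "fst z $ j - cvec I $ j" "fst u $ j"]
    by (simp add: disp_def add_diff_eq diff_add_eq) (meson add_less_le_mono le_less_trans)
  then have 1: "fst (z + u) \<in> cnbhd V (a + p)" using I(1) by (auto simp: mem_cnbhd)
  have im: "\<bar>Im (x + y)\<bar> < c + d" if "\<bar>Im x\<bar> < c" "cmod y \<le> d" for x y c d
    using that abs_Im_le_cmod[of y] by simp
  show ?thesis
    using assms 1 im unfolding mem_cdomain disp_def by (simp only: fst_add snd_add vector_add_component) blast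
qed

lemma disp_cscale: "disp p q u \<Longrightarrow> cmod \<zeta> \<le> t \<Longrightarrow> disp (t * p) (t * q) (cscale \<zeta> u)"
  unfolding disp_def by (auto simp: norm_mult intro!: mult_mono intro: order_trans[OF norm_ge_zero])

lemma disp_mono: "disp p q u \<Longrightarrow> p \<le> p' \<Longrightarrow> q \<le> q' \<Longrightarrow> disp p' q' u"
  unfolding disp_def by (meson order_trans)

lemma disp_norm: "norm u \<le> p \<Longrightarrow> disp p p u"
  unfolding disp_def using phase_comp_le_norm[of u] by (meson order_trans)

lemma disp_add: "disp p q u \<Longrightarrow> disp p' q' v \<Longrightarrow> disp (p + p') (q + q') (u + v)"
  unfolding disp_def by (auto intro!: norm_triangle_mono)

lemma disp_nonneg: "disp p q u \<Longrightarrow> 0 \<le> p \<and> 0 \<le> q"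
  unfolding disp_def by (meson norm_ge_zero order_trans)

lemma norm_disp:
  fixes u :: "'n::finite phase"
  assumes "disp p q u" shows "norm u \<le> (real CARD('n) + 1) * (p + q)"
proof -
  have "norm u \<le> (\<Sum>j\<in>(UNIV::'n set). p) + p + (\<Sum>j\<in>(UNIV::'n set). q) + q"
    using assms by (intro order_trans[OF norm_phase_le] add_mono sum_mono) (auto simp: disp_def)
  then show ?thesis by (simp add: algebra_simps)
qed

definition slow_part :: "'n::finite phase \<Rightarrow> 'n phase" where
  "slow_part z = (fst z, 0, 0, snd (snd (snd z)))"

text \<open>Coefficients of Fourier series are functions of \<open>I\<close> and \<open>\<xi>\<close> alone; keeping them as functions of
  the full phase point lets them be differentiated like every other function.\<close>

definition slow :: "'n::finite phase set \<Rightarrow> ('n phase \<Rightarrow> complex) \<Rightarrow> bool" where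
  "slow S c \<longleftrightarrow> (\<forall>z\<in>S. c z = c (slow_part z))"

lemma slow_part_simps [simp]:
  "fst (slow_part z) = fst z" "fst (snd (slow_part z)) = 0" "fst (snd (snd (slow_part z))) = 0"
  "snd (snd (snd (slow_part z))) = snd (snd (snd z))" "slow_part (slow_part z) = slow_part z"
  by (simp_all add: slow_part_def)

lemma slow_part_cdomain: "z \<in> cdomain V a s \<Longrightarrow> slow_part z \<in> cdomain V a s"
  using cdomain_pos[of z V a s] by (simp add: mem_cdomain)

lemma slow_part_linear:
  fixes v :: "'n::finite phase"
  shows "bounded_linear (slow_part :: 'n phase \<Rightarrow> 'n phase)" "slow_part (cscale c v) = cscale c (slow_part v)"
proof -
  have "(slow_part :: 'n phase \<Rightarrow> 'n phase) = (\<lambda>z. (fst z, 0, 0, snd (snd (snd z))))" by (simp add: slow_part_def fun_eq_iff)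
  moreover have "bounded_linear (\<lambda>z::'n phase. (fst z, 0::complex, 0::complex^'n, snd (snd (snd z))))"
    by (intro bounded_linear_Pair bounded_linear_fst bounded_linear_zero bounded_linear_compose[OF bounded_linear_snd]
        bounded_linear_snd)
  ultimately show "bounded_linear (slow_part :: 'n phase \<Rightarrow> 'n phase)" by simp
  show "slow_part (cscale c v) = cscale c (slow_part v)" by (rule phase_eqI) auto
qed

lemma slow_deriv:
  assumes hol: "holo_fun_on (cdomain V a s) c" and sl: "slow (cdomain V a s) c"
  shows "slow (cdomain V a s) (\<lambda>z. dd c z u)" "z \<in> cdomain V a s \<Longrightarrow> dd c z u = dd c z (slow_part u)"
proof -
  have m: "holo_map_on (cdomain V a s) slow_part"
    using holo_map_affine[OF slow_part_linear(1), of "cdomain V a s" 0] slow_part_linear(2) by auto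
  have dm: "dd slow_part z u = slow_part u" for z u :: "'a phase"
    by (rule dd_eq[OF bounded_linear_imp_has_derivative[OF slow_part_linear(1)]])
  have im: "slow_part ` cdomain V a s \<subseteq> cdomain V a s" using slow_part_cdomain by blast
  have key: "dd c z u = dd c (slow_part z) (slow_part u)" if z: "z \<in> cdomain V a s" for z u
  proof -
    have "dd c z u = dd (\<lambda>z. c (slow_part z)) z u"
      using dd_cong[OF open_cdomain z, of c "\<lambda>z. c (slow_part z)"] sl by (simp add: slow_def)
    also have "\<dots> = dd c (slow_part z) (slow_part u)" using holo_compose(2)[OF hol m im z] by (simp add: dm)
    finally show ?thesis .
  qed
  show "slow (cdomain V a s) (\<lambda>z. dd c z u)"
    unfolding slow_def using key slow_part_cdomain by (metis slow_part_simps(5))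
  show "z \<in> cdomain V a s \<Longrightarrow> dd c z u = dd c z (slow_part u)"
    using key by (metis slow_part_simps(5))
qed

definition kvec :: "int^'n \<Rightarrow> 'n::finite phase" where
  "kvec k = ((\<chi> j. of_int (k $ j)), 0, 0, 0)"

lemma freq_norm_nonneg: "0 \<le> freq_norm k" by (simp add: freq_norm_def sum_nonneg)
lemma freq_norm_comp: "\<bar>k $ j\<bar> \<le> freq_norm k"
  unfolding freq_norm_def by (rule member_le_sum) auto
lemma freq_norm_triangle: "freq_norm (k + l) \<le> freq_norm k + freq_norm l"
  unfolding freq_norm_def sum.distrib[symmetric] by (intro sum_mono) (simp add: abs_triangle_ineq)
lemma freq_norm_zero [simp]: "freq_norm 0 = 0" by (simp add: freq_norm_def)
lemma freq_norm_minus [simp]: "freq_norm (- k) = freq_norm k" by (simp add: freq_norm_def)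

lemma finite_freq_norm_le: "finite {k :: int^'n. freq_norm k \<le> m}"
proof -
  have "k $ j \<in> {-m..m}" if "freq_norm k \<le> m" for k :: "int^'n" and j
    using freq_norm_comp[of k j] that by auto
  then have "(\<lambda>k::int^'n. \<lambda>j. k $ j) ` {k. freq_norm k \<le> m} \<subseteq> (UNIV::'n set) \<rightarrow>\<^sub>E {-m..m}"
    by (auto simp: PiE_def)
  then have "finite ((\<lambda>k::int^'n. \<lambda>j. k $ j) ` {k. freq_norm k \<le> m})"
    by (rule finite_subset) (intro finite_PiE, auto)
  then show ?thesis by (rule finite_imageD) (auto simp: inj_on_def vec_eq_iff fun_eq_iff)
qed

definition wt :: "real \<Rightarrow> int^'n \<Rightarrow> real" where
  "wt s k = exp (s * real_of_int (freq_norm k))"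

lemma wt_pos [simp]: "0 < wt s k" "0 \<le> wt s k" by (simp_all add: wt_def)
lemma wt_ge_1: "0 \<le> s \<Longrightarrow> 1 \<le> wt s k" using freq_norm_nonneg[of k] by (simp add: wt_def)
lemma wt_mono: "s \<le> s' \<Longrightarrow> wt s k \<le> wt s' k"
  using freq_norm_nonneg[of k] by (simp add: wt_def mult_right_mono)
lemma wt_add: "0 \<le> s \<Longrightarrow> wt s (k + l) \<le> wt s k * wt s l"
  using freq_norm_triangle[of k l] by (simp add: wt_def flip: exp_add distrib_left of_int_add)
     (simp add: mult_left_mono)

text \<open>This is \<open>x * exp (- d * x) \<le> 1 / (exp 1 * d)\<close>: the weight on a wider strip absorbs a power of the frequency.\<close>

lemma wt_gain:
  assumes "s0 < s" shows "real_of_int (freq_norm k) * wt s0 k \<le> wt s k / (exp 1 * (s - s0))"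
proof -
  let ?x = "real_of_int (freq_norm k)"
  have "1 + (?x * (s - s0) - 1) \<le> exp (?x * (s - s0) - 1)" by (rule exp_ge_add_one_self)
  then have "?x * (s - s0) \<le> exp (?x * (s - s0)) / exp 1" by (simp add: exp_diff)
  then have "?x * (s - s0) * wt s0 k \<le> exp (?x * (s - s0)) / exp 1 * wt s0 k" by (intro mult_right_mono) auto
  also have "\<dots> = wt s k / exp 1" by (simp add: wt_def algebra_simps flip: exp_add)
  finally show ?thesis using assms by (simp add: field_simps)
qed

definition fmode :: "int^'n \<Rightarrow> 'n::finite phase \<Rightarrow> complex" where
  "fmode k z = fourier_mode k (fst (snd (snd z)))"

lemma fmode_alt: "fmode k z = exp (\<i> * (\<Sum>j\<in>UNIV. fst (snd (snd z)) $ j * of_int (k $ j)))"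
  by (simp add: fmode_def fourier_mode_def freq_pair_def)

lemma fmode_add: "fmode (k + l) z = fmode k z * fmode l z"
  by (simp add: fmode_alt distrib_left sum.distrib exp_add)

lemma fmode_bound:
  assumes "z \<in> cdomain V a s" shows "cmod (fmode k z) \<le> wt s k"
proof -
  have "cmod (fmode k z) = exp (\<Sum>j\<in>UNIV. - (Im (fst (snd (snd z)) $ j) * of_int (k $ j)))"
    by (simp add: fmode_alt sum_negf)
  also have "\<dots> \<le> exp (\<Sum>j\<in>UNIV. s * of_int \<bar>k $ j\<bar>)"
  proof (subst exp_le_cancel_iff, rule sum_mono)
    fix j
    have "- (Im (fst (snd (snd z)) $ j) * of_int (k $ j)) \<le> \<bar>Im (fst (snd (snd z)) $ j)\<bar> * \<bar>of_int (k $ j)\<bar>"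
      by (metis abs_ge_minus_self abs_mult)
    also have "\<dots> \<le> s * \<bar>of_int (k $ j)\<bar>" using assms by (intro mult_right_mono) (auto simp: mem_cdomain less_imp_le)
    finally show "- (Im (fst (snd (snd z)) $ j) * of_int (k $ j)) \<le> s * of_int \<bar>k $ j\<bar>" by simp
  qed
  also have "\<dots> = wt s k" by (simp add: wt_def freq_norm_def sum_distrib_left)
  finally show ?thesis .
qed

lemma fmode_holo:
  "holo_fun_on S (fmode k)"
  "z \<in> S \<Longrightarrow> dd (fmode k) z u = fmode k z * (\<i> * (\<Sum>j\<in>UNIV. fst (snd (snd u)) $ j * of_int (k $ j)))"
proof -
  let ?l = "\<lambda>z::'a phase. \<i> * (\<Sum>j\<in>UNIV. fst (snd (snd z)) $ j * of_int (k $ j))"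
  have bl: "bounded_linear ?l"
    by (intro bounded_linear_mult_right[THEN bounded_linear_compose] bounded_linear_sum
        bounded_linear_mult_left[THEN bounded_linear_compose] bl_comps)
  have sc: "?l (cscale c v) = c * ?l v" for c v by (simp add: sum_distrib_left mult_ac)
  note h = holo_linear_fun[OF bl sc]
  have e: "fmode k = (\<lambda>z. exp (?l z))" by (simp add: fun_eq_iff fmode_alt)
  show "holo_fun_on S (fmode k)" unfolding e by (rule holo_exp(1)[OF h(1)])
  show "z \<in> S \<Longrightarrow> dd (fmode k) z u = fmode k z * ?l u"
    unfolding e by (subst holo_exp(2)[OF h(1)]) (auto simp: h(2))
qed

section \<open>Uniformly summable families of holomorphic functions\<close>

lemma has_sum_tail_bound:
  fixes g :: "'i \<Rightarrow> complex"
  assumes "(g has_sum G) UNIV" "\<And>i. cmod (g i) \<le> \<beta> i" "\<beta> summable_on UNIV" "finite X"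
  shows "cmod (G - sum g X) \<le> infsum \<beta> UNIV - sum \<beta> X"
proof -
  have s: "(g has_sum (G - sum g X)) (UNIV - X)"
    by (rule has_sum_Diff[OF assms(1)]) (use assms(4) in auto)
  have "(\<beta> has_sum (infsum \<beta> UNIV - sum \<beta> X)) (UNIV - X)"
    by (rule has_sum_Diff[OF has_sum_infsum[OF assms(3)]]) (use assms(4) in auto)
  then show ?thesis using norm_has_sum_bound[of "\<lambda>i. cmod (g i)" "UNIV - X"]
    by (metis assms(2) has_sum_iff norm_infsum_le s)
qed

lemma infsum_sum_tendsto:
  fixes \<beta> :: "'i \<Rightarrow> real"
  assumes "\<beta> summable_on UNIV"
  shows "((\<lambda>X. infsum \<beta> UNIV - sum \<beta> X) \<longlongrightarrow> 0) (finite_subsets_at_top UNIV)"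
  using tendsto_diff[OF tendsto_const infsum_tendsto[OF assms], of "infsum \<beta> UNIV"] by simp

text \<open>A finite set of indices with small tail of the majorant gives uniform approximation by holomorphic finite sums.\<close>

lemma holo_has_sum:
  fixes g :: "'i \<Rightarrow> 'n::finite phase \<Rightarrow> complex"
  assumes "open S" and hol: "\<And>i. holo_fun_on S (g i)" and bd: "\<And>i z. z \<in> S \<Longrightarrow> cmod (g i z) \<le> \<beta> i"
    and sm: "\<beta> summable_on UNIV" and hs: "\<And>z. z \<in> S \<Longrightarrow> ((\<lambda>i. g i z) has_sum F z) UNIV"
  shows "holo_fun_on S F" "z \<in> S \<Longrightarrow> ((\<lambda>i. dd (g i) z u) has_sum dd F z u) UNIV"
proof -
  have "\<exists>X. finite X \<and> infsum \<beta> UNIV - sum \<beta> X < inverse (real (Suc m))" for m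
  proof -
    have "\<forall>\<^sub>F X in finite_subsets_at_top UNIV. infsum \<beta> UNIV - sum \<beta> X < inverse (real (Suc m))"
      by (rule order_tendstoD(2)[OF infsum_sum_tendsto[OF sm]]) simp
    then show ?thesis unfolding eventually_finite_subsets_at_top by blast
  qed
  then obtain X where X: "\<And>m. finite (X m)" "\<And>m. infsum \<beta> UNIV - sum \<beta> (X m) < inverse (real (Suc m))"
    by metis
  define P where "P = (\<lambda>Y z. \<Sum>i\<in>Y. g i z)"
  have hP: "holo_fun_on S (P Y)" and dP: "\<And>z u. z \<in> S \<Longrightarrow> dd (P Y) z u = (\<Sum>i\<in>Y. dd (g i) z u)" if "finite Y" for Y
    using holo_sum[OF that, of S g] hol unfolding P_def by auto
  have ul: "uniform_limit S (\<lambda>m. P (X m)) F sequentially"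
  proof (rule uniform_limitI)
    fix e :: real assume "e > 0"
    have "\<forall>\<^sub>F m in sequentially. inverse (real (Suc m)) < e"
      by (rule order_tendstoD(2)[OF LIMSEQ_inverse_real_of_nat \<open>e > 0\<close>])
    then show "\<forall>\<^sub>F m in sequentially. \<forall>z\<in>S. dist (P (X m) z) (F z) < e"
    proof eventually_elim
      case (elim m)
      show ?case
      proof
        fix z assume z: "z \<in> S"
        have "cmod (F z - P (X m) z) \<le> infsum \<beta> UNIV - sum \<beta> (X m)"
          unfolding P_def by (rule has_sum_tail_bound[OF hs[OF z] bd[OF z] sm X(1)])
        with elim X(2)[of m] show "dist (P (X m) z) (F z) < e" by (simp add: dist_norm norm_minus_commute)
      qed
    qed
  qed
  show hF: "holo_fun_on S F"
    by (rule holo_limit(1)[OF assms(1), of "\<lambda>m. P (X m)"])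
       (use hP X(1) ul uniform_limit_on_subset[OF ul] in \<open>auto intro!: exI[of _ 1]\<close>)
  show "((\<lambda>i. dd (g i) z u) has_sum dd F z u) UNIV" if z: "z \<in> S"
  proof -
    obtain \<rho> where \<rho>: "\<rho> > 0" "ball z \<rho> \<subseteq> S" using assms(1) z open_contains_ball by blast
    have "norm ((\<Sum>i\<in>Y. dd (g i) z u) - dd F z u) \<le> (infsum \<beta> UNIV - sum \<beta> Y) * (2 / \<rho> * norm u)" if Y: "finite Y" for Y
    proof -
      have "cmod (dd (\<lambda>z. F z - P Y z) z u) \<le> 2 * (infsum \<beta> UNIV - sum \<beta> Y) / \<rho> * norm u"
      proof (rule holo_sup_deriv[where z = z])
        show "holo_fun_on (ball z \<rho>) (\<lambda>z. F z - P Y z)"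
          by (rule holo_fun_subset[OF holo_diff(1)[OF hF hP[OF Y]] \<rho>(2)])
        show "cmod (F w - P Y w) \<le> infsum \<beta> UNIV - sum \<beta> Y" if "w \<in> ball z \<rho>" for w
        proof -
          have w: "w \<in> S" using that \<rho>(2) by blast
          show ?thesis unfolding P_def by (rule has_sum_tail_bound[OF hs[OF w] bd[OF w] sm Y])
        qed
      qed (use \<rho> in auto)
      moreover have "dd (\<lambda>z. F z - P Y z) z u = dd F z u - (\<Sum>i\<in>Y. dd (g i) z u)"
        using holo_diff(2)[OF hF hP[OF Y] z] dP[OF Y z] by simp
      ultimately show ?thesis by (simp add: norm_minus_commute mult_ac)
    qed note est = this
    have "((\<lambda>Y. (\<Sum>i\<in>Y. dd (g i) z u) - dd F z u) \<longlongrightarrow> 0) (finite_subsets_at_top UNIV)"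
    proof (rule Lim_null_comparison)
      show "\<forall>\<^sub>F Y in finite_subsets_at_top UNIV. norm ((\<Sum>i\<in>Y. dd (g i) z u) - dd F z u)
          \<le> (infsum \<beta> UNIV - sum \<beta> Y) * (2 / \<rho> * norm u)"
        by (rule eventually_finite_subsets_at_top_weakI) (rule est)
      show "((\<lambda>Y. (infsum \<beta> UNIV - sum \<beta> Y) * (2 / \<rho> * norm u)) \<longlongrightarrow> 0) (finite_subsets_at_top UNIV)"
        by (rule tendsto_mult_left_zero[OF infsum_sum_tendsto[OF sm]])
    qed
    then show ?thesis unfolding has_sum_def by (simp only: LIM_zero_iff)
  qed
qed

lemma has_sum_finite_sum:
  fixes f :: "'i \<Rightarrow> 'j \<Rightarrow> complex"
  assumes "finite X" "\<And>i. i \<in> X \<Longrightarrow> (f i has_sum g i) A"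
  shows "((\<lambda>j. \<Sum>i\<in>X. f i j) has_sum (\<Sum>i\<in>X. g i)) A"
  using assms by (induction X rule: finite_induct) (auto intro: has_sum_add)

section \<open>Functions of bounded Fourier norm\<close>

text \<open>The coefficients are bounded by constants \<open>b k\<close> instead of their suprema: such majorants can be
  added and multiplied without computing any supremum.\<close>

definition fser :: "(real^'n::finite) set \<Rightarrow> real \<Rightarrow> real \<Rightarrow> ('n phase \<Rightarrow> complex)
    \<Rightarrow> (int^'n \<Rightarrow> 'n phase \<Rightarrow> complex) \<Rightarrow> (int^'n \<Rightarrow> real) \<Rightarrow> real \<Rightarrow> bool" where
  "fser V a s F c b B \<longleftrightarrow>
     (\<forall>k. holo_fun_on (cdomain V a s) (c k)) \<and> (\<forall>k. slow (cdomain V a s) (c k)) \<and>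
     (\<forall>k. 0 \<le> b k) \<and> (\<forall>k. \<forall>z\<in>cdomain V a s. cmod (c k z) \<le> b k) \<and>
     (\<lambda>k. b k * wt s k) summable_on UNIV \<and> infsum (\<lambda>k. b k * wt s k) UNIV \<le> B \<and>
     (\<forall>z\<in>cdomain V a s. ((\<lambda>k. c k z * fmode k z) has_sum F z) UNIV)"

definition fb :: "(real^'n::finite) set \<Rightarrow> real \<Rightarrow> real \<Rightarrow> ('n phase \<Rightarrow> complex) \<Rightarrow> real \<Rightarrow> bool" where
  "fb V a s F B \<longleftrightarrow> (\<exists>c b. fser V a s F c b B)"

lemma fserD:
  assumes "fser V a s F c b B"
  shows "holo_fun_on (cdomain V a s) (c k)" "slow (cdomain V a s) (c k)" "0 \<le> b k"
    "z \<in> cdomain V a s \<Longrightarrow> cmod (c k z) \<le> b k" "(\<lambda>k. b k * wt s k) summable_on UNIV"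
    "infsum (\<lambda>k. b k * wt s k) UNIV \<le> B" "z \<in> cdomain V a s \<Longrightarrow> ((\<lambda>k. c k z * fmode k z) has_sum F z) UNIV"
  using assms unfolding fser_def by blast+

lemma fserI:
  assumes "\<And>k. holo_fun_on (cdomain V a s) (c k)" "\<And>k. slow (cdomain V a s) (c k)" "\<And>k. 0 \<le> b k"
    "\<And>k z. z \<in> cdomain V a s \<Longrightarrow> cmod (c k z) \<le> b k" "(\<lambda>k. b k * wt s k) summable_on UNIV"
    "infsum (\<lambda>k. b k * wt s k) UNIV \<le> B" "\<And>z. z \<in> cdomain V a s \<Longrightarrow> ((\<lambda>k. c k z * fmode k z) has_sum F z) UNIV"
  shows "fser V a s F c b B"
  using assms unfolding fser_def by blast

lemma fser_fb: "fser V a s F c b B \<Longrightarrow> fb V a s F B" unfolding fb_def by blast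

lemma fser_nonneg: "fser V a s F c b B \<Longrightarrow> 0 \<le> B"
  by (rule order_trans[OF infsum_nonneg fserD(6)]) (simp_all add: fserD(3))

lemma fb_nonneg: "fb V a s F B \<Longrightarrow> 0 \<le> B" unfolding fb_def using fser_nonneg by blast

lemma fser_term_bound:
  assumes "fser V a s F c b B" "z \<in> cdomain V a s"
  shows "cmod (c k z * fmode k z) \<le> b k * wt s k"
  unfolding norm_mult by (intro mult_mono fserD(4)[OF assms] fmode_bound[OF assms(2)] fserD(3)[OF assms(1)]) auto

lemma fser_term_holo:
  assumes "fser V a s F c b B"
  shows "holo_fun_on (cdomain V a s) (\<lambda>z. c k z * fmode k z)"
  by (rule holo_mult(1)[OF fserD(1)[OF assms] fmode_holo(1)])

lemma fser_holo:
  assumes "fser V a s F c b B"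
  shows "holo_fun_on (cdomain V a s) F"
    "z \<in> cdomain V a s \<Longrightarrow> ((\<lambda>k. (dd (c k) z u + \<i> * (\<Sum>j\<in>UNIV. fst (snd (snd u)) $ j * of_int (k $ j)) * c k z)
        * fmode k z) has_sum dd F z u) UNIV"
proof -
  let ?g = "\<lambda>k z. c k z * fmode k z"
  show "holo_fun_on (cdomain V a s) F"
    by (rule holo_has_sum(1)[of _ ?g "\<lambda>k. b k * wt s k"])
       (use fser_term_holo[OF assms] fser_term_bound[OF assms] fserD(5,7)[OF assms] in auto)
  assume z: "z \<in> cdomain V a s"
  have "((\<lambda>k. dd (?g k) z u) has_sum dd F z u) UNIV"
    by (rule holo_has_sum(2)[of "cdomain V a s" ?g "\<lambda>k. b k * wt s k"])
       (use fser_term_holo[OF assms] fser_term_bound[OF assms] fserD(5,7)[OF assms] z in auto)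
  then show "((\<lambda>k. (dd (c k) z u + \<i> * (\<Sum>j\<in>UNIV. fst (snd (snd u)) $ j * of_int (k $ j)) * c k z)
        * fmode k z) has_sum dd F z u) UNIV"
    unfolding holo_mult(2)[OF fserD(1)[OF assms] fmode_holo(1) z] fmode_holo(2)[OF z]
    by (simp add: algebra_simps)
qed

lemma fb_holo: "fb V a s F B \<Longrightarrow> holo_fun_on (cdomain V a s) F"
  unfolding fb_def using fser_holo(1) by blast

lemma fser_bound:
  assumes "fser V a s F c b B" "z \<in> cdomain V a s" shows "cmod (F z) \<le> B"
  using has_sum_tail_bound[OF fserD(7)[OF assms] fser_term_bound[OF assms] fserD(5)[OF assms(1)], of "{}"]
    fserD(6)[OF assms(1)] by simp

lemma fb_bound: "fb V a s F B \<Longrightarrow> z \<in> cdomain V a s \<Longrightarrow> cmod (F z) \<le> B"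
  unfolding fb_def using fser_bound by blast

lemma fser_mono:
  assumes "fser V a s F c b B" "a' \<le> a" "s' \<le> s" "B \<le> B'"
  shows "fser V a' s' F c b B'"
proof (rule fserI)
  have sub: "cdomain V a' s' \<subseteq> cdomain V a s" by (rule cdomain_mono[OF assms(2,3)])
  have le: "b k * wt s' k \<le> b k * wt s k" for k by (intro mult_left_mono wt_mono assms fserD(3)[OF assms(1)])
  show sm: "(\<lambda>k. b k * wt s' k) summable_on UNIV"
    by (rule summable_on_comparison_test[OF fserD(5)[OF assms(1)]]) (use le fserD(3)[OF assms(1)] in auto)
  have "infsum (\<lambda>k. b k * wt s' k) UNIV \<le> infsum (\<lambda>k. b k * wt s k) UNIV"
    by (rule infsum_mono[OF sm fserD(5)[OF assms(1)] le])
  then show "infsum (\<lambda>k. b k * wt s' k) UNIV \<le> B'" using fserD(6)[OF assms(1)] assms(4) by linarith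
  show "holo_fun_on (cdomain V a' s') (c k)" for k by (rule holo_fun_subset[OF fserD(1)[OF assms(1)] sub])
  show "slow (cdomain V a' s') (c k)" for k using fserD(2)[OF assms(1), of k] sub by (auto simp: slow_def)
qed (use fserD[OF assms(1)] cdomain_mono[OF assms(2,3), of V] in blast)+

lemma fb_mono: "fb V a s F B \<Longrightarrow> a' \<le> a \<Longrightarrow> s' \<le> s \<Longrightarrow> B \<le> B' \<Longrightarrow> fb V a' s' F B'"
  unfolding fb_def using fser_mono by blast

lemma fser_cong:
  assumes "fser V a s F c b B" "\<And>z. z \<in> cdomain V a s \<Longrightarrow> F z = G z" shows "fser V a s G c b B"
  using assms unfolding fser_def by simp

lemma fb_cong: "fb V a s F B \<Longrightarrow> (\<And>z. z \<in> cdomain V a s \<Longrightarrow> F z = G z) \<Longrightarrow> fb V a s G B"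
  unfolding fb_def using fser_cong by blast

lemma fb_zero: "0 \<le> B \<Longrightarrow> fb V a s (\<lambda>z. 0) B"
  unfolding fb_def by (rule exI[of _ "\<lambda>_ _. 0"], rule exI[of _ "\<lambda>_. 0"]) (simp add: fser_def holo_const slow_def)

lemma fb_add:
  assumes "fb V a s F B" "fb V a s G B'" shows "fb V a s (\<lambda>z. F z + G z) (B + B')"
proof -
  obtain c b c' b' where 1: "fser V a s F c b B" and 2: "fser V a s G c' b' B'" using assms by (auto simp: fb_def)
  note s = fserD(5)[OF 1] fserD(5)[OF 2]
  have "fser V a s (\<lambda>z. F z + G z) (\<lambda>k z. c k z + c' k z) (\<lambda>k. b k + b' k) (B + B')"
  proof (rule fserI)
    show "holo_fun_on (cdomain V a s) (\<lambda>z. c k z + c' k z)" for k by (rule holo_add(1)[OF fserD(1)[OF 1] fserD(1)[OF 2]])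
    show "slow (cdomain V a s) (\<lambda>z. c k z + c' k z)" for k
      unfolding slow_def
    proof
      fix z assume "z \<in> cdomain V a s"
      then have "c k z = c k (slow_part z)" "c' k z = c' k (slow_part z)"
        using fserD(2)[OF 1, of k] fserD(2)[OF 2, of k] by (simp_all only: slow_def)
      then show "c k z + c' k z = c k (slow_part z) + c' k (slow_part z)" by simp
    qed
    show "0 \<le> b k + b' k" for k using fserD(3)[OF 1] fserD(3)[OF 2] by (simp add: add_nonneg_nonneg)
    show "cmod (c k z + c' k z) \<le> b k + b' k" if "z \<in> cdomain V a s" for k z
      by (rule norm_triangle_mono[OF fserD(4)[OF 1 that] fserD(4)[OF 2 that]])
    show "(\<lambda>k. (b k + b' k) * wt s k) summable_on UNIV"
      unfolding distrib_right by (rule summable_on_add[OF s])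
    show "infsum (\<lambda>k. (b k + b' k) * wt s k) UNIV \<le> B + B'"
      unfolding distrib_right infsum_add[OF s] by (intro add_mono fserD(6)[OF 1] fserD(6)[OF 2])
    show "((\<lambda>k. (c k z + c' k z) * fmode k z) has_sum F z + G z) UNIV" if "z \<in> cdomain V a s" for z
      unfolding distrib_right by (rule has_sum_add[OF fserD(7)[OF 1 that] fserD(7)[OF 2 that]])
  qed
  then show ?thesis by (rule fser_fb)
qed

lemma fser_cmult:
  assumes 1: "fser V a s F c b B"
  shows "fser V a s (\<lambda>z. w * F z) (\<lambda>k z. w * c k z) (\<lambda>k. cmod w * b k) (cmod w * B)"
proof (rule fserI)
    show "holo_fun_on (cdomain V a s) (\<lambda>z. w * c k z)" for k by (rule holo_cmult(1)[OF fserD(1)[OF 1]])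
    show "slow (cdomain V a s) (\<lambda>z. w * c k z)" for k
      unfolding slow_def
    proof
      fix z assume "z \<in> cdomain V a s"
      then have "c k z = c k (slow_part z)" using fserD(2)[OF 1, of k] by (simp only: slow_def)
      then show "w * c k z = w * c k (slow_part z)" by simp
    qed
    show "0 \<le> cmod w * b k" for k using fserD(3)[OF 1] by simp
    show "cmod (w * c k z) \<le> cmod w * b k" if "z \<in> cdomain V a s" for k z
      unfolding norm_mult by (rule mult_left_mono[OF fserD(4)[OF 1 that]]) simp
    show "(\<lambda>k. cmod w * b k * wt s k) summable_on UNIV"
      unfolding mult.assoc by (rule summable_on_cmult_right[OF fserD(5)[OF 1]])
    show "infsum (\<lambda>k. cmod w * b k * wt s k) UNIV \<le> cmod w * B"
      unfolding mult.assoc by (simp add: infsum_cmult_right' mult_left_mono[OF fserD(6)[OF 1]])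
    show "((\<lambda>k. w * c k z * fmode k z) has_sum w * F z) UNIV" if "z \<in> cdomain V a s" for z
      unfolding mult.assoc by (rule has_sum_cmult_right[OF fserD(7)[OF 1 that]])
qed

lemma fb_cmult: "fb V a s F B \<Longrightarrow> fb V a s (\<lambda>z. w * F z) (cmod w * B)"
  unfolding fb_def using fser_cmult by blast

lemma fb_uminus: "fb V a s F B \<Longrightarrow> fb V a s (\<lambda>z. - F z) B"
  using fb_cmult[of V a s F B "-1"] by simp

lemma fb_sum:
  assumes "finite X" "\<And>i. i \<in> X \<Longrightarrow> fb V a s (F i) (B i)"
  shows "fb V a s (\<lambda>z. \<Sum>i\<in>X. F i z) (\<Sum>i\<in>X. B i)"
  using assms by (induction X rule: finite_induct) (auto intro: fb_add fb_zero)

text \<open>With values 0 and 1 the multiplier selects parts of a Fourier series, such as its resonant modes or its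
  tail.\<close>

lemma fser_multiplier:
  assumes 1: "fser V a s F c b B" and w: "\<And>k. \<bar>w k\<bar> \<le> 1"
  shows "fser V a s (\<lambda>z. infsum (\<lambda>k. of_real (w k) * c k z * fmode k z) UNIV)
    (\<lambda>k z. of_real (w k) * c k z) (\<lambda>k. \<bar>w k\<bar> * b k) B"
proof (rule fserI)
    show "holo_fun_on (cdomain V a s) (\<lambda>z. of_real (w k) * c k z)" for k by (rule holo_cmult(1)[OF fserD(1)[OF 1]])
    show "slow (cdomain V a s) (\<lambda>z. of_real (w k) * c k z)" for k
      unfolding slow_def
    proof
      fix z assume "z \<in> cdomain V a s"
      then have "c k z = c k (slow_part z)" using fserD(2)[OF 1, of k] by (simp only: slow_def)
      then show "of_real (w k) * c k z = of_real (w k) * c k (slow_part z)" by simp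
    qed
    show "0 \<le> \<bar>w k\<bar> * b k" for k using fserD(3)[OF 1] by simp
    show "cmod (of_real (w k) * c k z) \<le> \<bar>w k\<bar> * b k" if "z \<in> cdomain V a s" for k z
      unfolding norm_mult norm_of_real by (rule mult_left_mono[OF fserD(4)[OF 1 that]]) simp
    have le: "\<bar>w k\<bar> * b k * wt s k \<le> b k * wt s k" for k
      using w[of k] fserD(3)[OF 1, of k] by (intro mult_right_mono) (auto simp: mult_left_le_one_le)
    show sm: "(\<lambda>k. \<bar>w k\<bar> * b k * wt s k) summable_on UNIV"
      by (rule summable_on_comparison_test[OF fserD(5)[OF 1]]) (use le fserD(3)[OF 1] in auto)
    show "infsum (\<lambda>k. \<bar>w k\<bar> * b k * wt s k) UNIV \<le> B"
      by (rule order_trans[OF infsum_mono[OF sm fserD(5)[OF 1] le] fserD(6)[OF 1]])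
    show "((\<lambda>k. of_real (w k) * c k z * fmode k z) has_sum infsum (\<lambda>k. of_real (w k) * c k z * fmode k z) UNIV) UNIV"
      if z: "z \<in> cdomain V a s" for z
    proof (rule has_sum_infsum, rule abs_summable_summable, rule summable_on_comparison_test[OF sm])
      show "norm (of_real (w k) * c k z * fmode k z) \<le> \<bar>w k\<bar> * b k * wt s k" for k
        unfolding mult.assoc norm_mult[of "of_real (w k)"] norm_of_real
        by (rule mult_left_mono[OF fser_term_bound[OF 1 z]]) simp
    qed auto
qed

text \<open>Every remaining mode has order at least \<open>N\<close>, so narrowing the strip lowers its weight at least by this factor.\<close>

lemma fser_tail_gain:
  assumes 1: "fser V a s F c b B" and "\<And>k. real_of_int (freq_norm k) < N \<Longrightarrow> b k = 0" and "0 \<le> d"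
  shows "fser V a (s - d) F c b (exp (- N * d) * B)"
proof -
  note m = fser_mono[OF 1 order_refl, of "s - d" B]
  have le: "b k * wt (s - d) k \<le> exp (- N * d) * (b k * wt s k)" for k
  proof (cases "real_of_int (freq_norm k) < N")
    case False
    then have "wt (s - d) k \<le> exp (- N * d) * wt s k"
      using mult_right_mono[of N "real_of_int (freq_norm k)" d] assms(3) by (simp add: wt_def algebra_simps flip: exp_add)
    then have "b k * wt (s - d) k \<le> b k * (exp (- N * d) * wt s k)" by (rule mult_left_mono) (rule fserD(3)[OF 1])
    then show ?thesis by (simp add: mult_ac)
  qed (use assms(2) in simp)
  have "infsum (\<lambda>k. b k * wt (s - d) k) UNIV \<le> infsum (\<lambda>k. exp (- N * d) * (b k * wt s k)) UNIV"
    by (intro infsum_mono fserD(5)[OF m] summable_on_cmult_right fserD(5)[OF 1] le) (use assms(3) in auto)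
  also have "\<dots> \<le> exp (- N * d) * B" by (simp add: infsum_cmult_right' mult_left_mono[OF fserD(6)[OF 1]])
  finally show ?thesis using m assms(3) unfolding fser_def by auto
qed

lemma fb_suminf:
  fixes F :: "nat \<Rightarrow> 'n::finite phase \<Rightarrow> complex"
  assumes F: "\<And>n. fb V a s (F n) (B n)" and sB: "summable B" and s0: "0 \<le> s"
    and G: "\<And>z. z \<in> cdomain V a s \<Longrightarrow> (\<lambda>n. F n z) sums G z"
  shows "fb V a s G (suminf B)"
proof -
  obtain c b where f: "\<And>n. fser V a s (F n) (c n) (b n) (B n)" using F unfolding fb_def by metis
  define w where "w = (\<lambda>n k. b n k * wt s k)"
  have B0: "0 \<le> B n" for n by (rule fser_nonneg[OF f])
  have w0: "0 \<le> w n k" for n k using fserD(3)[OF f] by (simp add: w_def)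
  have wn: "w n summable_on UNIV" "infsum (w n) UNIV \<le> B n" for n
    using fserD(5,6)[OF f[of n]] by (simp_all add: w_def)
  have sB': "B summable_on UNIV" using sB B0 summable_on_UNIV_nonneg_real_iff by blast
  have swn: "(\<lambda>n. infsum (w n) UNIV) summable_on UNIV"
    by (rule summable_on_comparison_test[OF sB']) (use wn w0 in \<open>auto intro: infsum_nonneg\<close>)
  have j1: "(\<lambda>(n, k). w n k) summable_on UNIV \<times> UNIV"
    by (rule summable_on_SigmaI[where g = "\<lambda>n. infsum (w n) UNIV"]) (use wn swn w0 in auto)
  have j2: "(\<lambda>(k, n). w n k) summable_on UNIV \<times> UNIV" using j1 by (subst summable_on_swap) (simp add: case_prod_unfold)
  have wk: "(\<lambda>n. w n k) summable_on UNIV" for k using summable_on_SigmaD1[OF j2, of k] by simp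
  have bk: "(\<lambda>n. b n k) summable_on UNIV" for k
  proof (rule summable_on_comparison_test[OF wk[of k]])
    show "b n k \<le> w n k" for n using mult_left_mono[OF wt_ge_1[OF s0, of k] fserD(3)[OF f, of n k]] by (simp add: w_def)
  qed (use fserD(3)[OF f] in auto)
  define b' where "b' = (\<lambda>k. infsum (\<lambda>n. b n k) UNIV)"
  define c' where "c' = (\<lambda>k z. infsum (\<lambda>n. c n k z) UNIV)"
  have b'w: "b' k * wt s k = infsum (\<lambda>n. w n k) UNIV" for k
    by (simp add: b'_def w_def infsum_cmult_left')
  have ck: "((\<lambda>n. c n k z) has_sum c' k z) UNIV" if z: "z \<in> cdomain V a s" for k z
    unfolding c'_def
    by (rule has_sum_infsum, rule abs_summable_summable, rule summable_on_comparison_test[OF bk[of k]])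
       (use fserD(4)[OF f z] in auto)
  have "fser V a s G c' b' (suminf B)"
  proof (rule fserI)
    show "holo_fun_on (cdomain V a s) (c' k)" for k
      by (rule holo_has_sum(1)[OF open_cdomain, where \<beta> = "\<lambda>n. b n k" and g = "\<lambda>n. c n k"])
         (use fserD(1)[OF f] fserD(4)[OF f] bk ck in auto)
    show "slow (cdomain V a s) (c' k)" for k
      unfolding slow_def
    proof
      fix z assume "z \<in> cdomain V a s"
      then have "c n k z = c n k (slow_part z)" for n using fserD(2)[OF f, of n k] by (simp only: slow_def)
      then show "c' k z = c' k (slow_part z)" by (simp add: c'_def)
    qed
    show "0 \<le> b' k" for k unfolding b'_def by (rule infsum_nonneg) (rule fserD(3)[OF f])
    show "cmod (c' k z) \<le> b' k" if z: "z \<in> cdomain V a s" for k z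
      using has_sum_tail_bound[OF ck[OF z] fserD(4)[OF f z] bk, of "{}" k] by (simp add: b'_def)
    show sb': "(\<lambda>k. b' k * wt s k) summable_on UNIV"
      unfolding b'w by (rule summable_on_SigmaD[OF j2, simplified]) (rule wk)
    have "infsum (\<lambda>k. b' k * wt s k) UNIV = infsum (\<lambda>n. infsum (w n) UNIV) UNIV"
      unfolding b'w by (rule infsum_swap_banach[OF j2])
    also have "\<dots> \<le> infsum B UNIV" by (rule infsum_mono[OF swn sB' wn(2)])
    also have "\<dots> = suminf B" using has_sum_imp_sums[OF has_sum_infsum[OF sB']] by (simp add: sums_iff)
    finally show "infsum (\<lambda>k. b' k * wt s k) UNIV \<le> suminf B" .
    show "((\<lambda>k. c' k z * fmode k z) has_sum G z) UNIV" if z: "z \<in> cdomain V a s" for z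
    proof -
      define t where "t = (\<lambda>n k. c n k z * fmode k z)"
      have tw: "cmod (t n k) \<le> w n k" for n k
        unfolding t_def w_def by (rule fser_term_bound[OF f z])
      have J2: "(\<lambda>(k, n). t n k) summable_on UNIV \<times> UNIV"
        by (rule abs_summable_summable, rule summable_on_comparison_test[OF j2]) (use tw in auto)
      have F1: "(\<lambda>n. F n z) summable_on UNIV"
        by (rule abs_summable_summable, rule summable_on_comparison_test[OF sB']) (use fser_bound[OF f z] in auto)
      have Gz: "G z = infsum (\<lambda>n. F n z) UNIV"
        using has_sum_imp_sums[OF has_sum_infsum[OF F1]] G[OF z] sums_unique2 by blast
      have tk: "((\<lambda>n. t n k) has_sum c' k z * fmode k z) UNIV" for k
        unfolding t_def by (rule has_sum_cmult_left[OF ck[OF z]])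
      have Fn: "F n z = infsum (t n) UNIV" for n
        using fserD(7)[OF f z, of n] by (simp add: t_def infsumI)
      have "((\<lambda>k. c' k z * fmode k z) has_sum infsum (\<lambda>(k, n). t n k) (UNIV \<times> UNIV)) UNIV"
        by (rule has_sum_SigmaD[OF has_sum_infsum[OF J2]]) (use tk in auto)
      moreover have "infsum (\<lambda>(k, n). t n k) (UNIV \<times> UNIV) = infsum (\<lambda>k. infsum (\<lambda>n. t n k) UNIV) UNIV"
        using infsum_Sigma'_banach[of "\<lambda>k n. t n k" UNIV "\<lambda>_. UNIV"] J2 by simp
      moreover have "\<dots> = infsum (\<lambda>n. infsum (t n) UNIV) UNIV"
        by (rule infsum_swap_banach[OF J2])
      ultimately show ?thesis by (simp add: Gz Fn)
    qed
  qed
  then show ?thesis by (rule fser_fb)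
qed

section \<open>Derivatives and Poisson brackets in the Fourier norm\<close>

abbreviation "dirI j \<equiv> (axis j 1, 0, 0, 0)"
abbreviation "dirEta \<equiv> (0, 1, 0, 0)"
abbreviation "dirPhi j \<equiv> (0, 0, axis j 1, 0)"
abbreviation "dirXi \<equiv> (0, 0, 0, 1)"

lemma cauchy_on_cdomain:
  assumes hol: "holo_fun_on (cdomain V a s) F" and bd: "\<And>z. z \<in> cdomain V a s \<Longrightarrow> cmod (F z) \<le> B"
    and z: "z \<in> cdomain V a0 s0" and u: "disp p q u" and "0 < \<rho>" "a0 + \<rho> * p \<le> a" "s0 + \<rho> * q \<le> s"
  shows "cmod (dd F z u) \<le> B / \<rho>"
proof -
  have "z + cscale \<zeta> u \<in> cdomain V a s" if "cmod \<zeta> < \<rho>" for \<zeta>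
    by (rule cdomain_monoD[OF cdomain_add[OF z disp_cscale[OF u, of \<zeta> \<rho>]]]) (use that assms in auto)
  then show ?thesis by (intro cauchy_estimate[OF hol \<open>0 < \<rho>\<close>] bd) auto
qed

lemma disp_dirs:
  "disp 1 0 (dirI j)" "disp 0 1 dirXi" "disp 0 1 (dirPhi j)" "disp 1 0 dirEta"
  by (auto simp: disp_def axis_def)

lemma disp_kvec: "disp (real_of_int (freq_norm k)) 0 (kvec k)"
proof -
  have "cmod (of_int (k $ j)) \<le> real_of_int (freq_norm k)" for j
    using freq_norm_comp[of k j] by simp
  then show ?thesis by (simp add: disp_def kvec_def freq_norm_nonneg)
qed

text \<open>Differentiating termwise, it suffices to bound the new coefficients by the old ones with the gain in the weights.\<close>

lemma fb_dirderiv: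
  assumes f: "fser V a s F c b B" and "a0 \<le> a" "s0 \<le> s" and \<beta>0: "\<And>k. 0 \<le> \<beta> k"
    and \<beta>: "\<And>k z. z \<in> cdomain V a0 s0 \<Longrightarrow>
       cmod (dd (c k) z u + \<i> * (\<Sum>j\<in>UNIV. fst (snd (snd u)) $ j * of_int (k $ j)) * c k z) \<le> \<beta> k"
    and le: "\<And>k. \<beta> k * wt s0 k \<le> C * (b k * wt s k)" and "0 \<le> C"
  shows "fb V a0 s0 (\<lambda>z. dd F z u) (C * B)"
proof -
  have sub: "cdomain V a0 s0 \<subseteq> cdomain V a s" by (rule cdomain_mono) fact+
  note c = fserD(1)[OF f] and cs = fserD(2)[OF f]
  have hol: "holo_fun_on (cdomain V a s) (\<lambda>z. dd (c k) z u + \<i> * (\<Sum>j\<in>UNIV. fst (snd (snd u)) $ j * of_int (k $ j)) * c k z)" for k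
    by (rule holo_add(1)[OF holo_dir_deriv[OF open_cdomain c] holo_cmult(1)[OF c]])
  have sl: "slow (cdomain V a s) (\<lambda>z. dd (c k) z u + \<i> * (\<Sum>j\<in>UNIV. fst (snd (snd u)) $ j * of_int (k $ j)) * c k z)" for k
    unfolding slow_def
  proof
    fix z assume z: "z \<in> cdomain V a s"
    have "c k z = c k (slow_part z)" "dd (c k) z u = dd (c k) (slow_part z) u"
      using cs[of k] slow_deriv(1)[OF c cs, of k u] z by (simp_all only: slow_def)
    then show "dd (c k) z u + \<i> * (\<Sum>j\<in>UNIV. fst (snd (snd u)) $ j * of_int (k $ j)) * c k z =
      dd (c k) (slow_part z) u + \<i> * (\<Sum>j\<in>UNIV. fst (snd (snd u)) $ j * of_int (k $ j)) * c k (slow_part z)"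
      by simp
  qed
  have sC: "(\<lambda>k. C * (b k * wt s k)) summable_on UNIV" by (rule summable_on_cmult_right[OF fserD(5)[OF f]])
  have "fser V a0 s0 (\<lambda>z. dd F z u)
    (\<lambda>k z. dd (c k) z u + \<i> * (\<Sum>j\<in>UNIV. fst (snd (snd u)) $ j * of_int (k $ j)) * c k z) \<beta> (C * B)"
  proof (rule fserI)
    show sm: "(\<lambda>k. \<beta> k * wt s0 k) summable_on UNIV"
      by (rule summable_on_comparison_test[OF sC]) (use le \<beta>0 in auto)
    have "infsum (\<lambda>k. \<beta> k * wt s0 k) UNIV \<le> infsum (\<lambda>k. C * (b k * wt s k)) UNIV" by (rule infsum_mono[OF sm sC le])
    also have "\<dots> \<le> C * B" using mult_left_mono[OF fserD(6)[OF f] \<open>0 \<le> C\<close>] by (simp add: infsum_cmult_right')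
    finally show "infsum (\<lambda>k. \<beta> k * wt s0 k) UNIV \<le> C * B" .
    fix k
    let ?c = "\<lambda>z. dd (c k) z u + \<i> * (\<Sum>j\<in>UNIV. fst (snd (snd u)) $ j * of_int (k $ j)) * c k z"
    show "holo_fun_on (cdomain V a0 s0) ?c" by (rule holo_fun_subset[OF hol sub])
    show "slow (cdomain V a0 s0) ?c" using sl[of k] sub unfolding slow_def by blast
    show "0 \<le> \<beta> k" by (rule \<beta>0)
  next
    fix k z assume z: "z \<in> cdomain V a0 s0"
    show "cmod (dd (c k) z u + \<i> * (\<Sum>j\<in>UNIV. fst (snd (snd u)) $ j * of_int (k $ j)) * c k z) \<le> \<beta> k"
      by (rule \<beta>[OF z])
    show "((\<lambda>k. (dd (c k) z u + \<i> * (\<Sum>j\<in>UNIV. fst (snd (snd u)) $ j * of_int (k $ j)) * c k z) * fmode k z)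
        has_sum dd F z u) UNIV" by (rule fser_holo(2)[OF f subsetD[OF sub z]])
  qed
  then show ?thesis by (rule fser_fb)
qed

lemma fb_deriv_phi:
  assumes "fb V a s F B" "s0 < s"
  shows "fb V a s0 (\<lambda>z. dd F z (dirPhi j)) (1 / (exp 1 * (s - s0)) * B)"
proof -
  obtain c b where f: "fser V a s F c b B" using assms by (auto simp: fb_def)
  show ?thesis
  proof (rule fb_dirderiv[OF f order_refl less_imp_le[OF assms(2)], where \<beta> = "\<lambda>k. real_of_int (freq_norm k) * b k"])
    show "0 \<le> real_of_int (freq_norm k) * b k" for k using freq_norm_nonneg[of k] fserD(3)[OF f] by simp
    show "cmod (dd (c k) z (dirPhi j) + \<i> * (\<Sum>i\<in>UNIV. fst (snd (snd (dirPhi j))) $ i * of_int (k $ i)) * c k z)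
        \<le> real_of_int (freq_norm k) * b k" if "z \<in> cdomain V a s0" for k z
    proof -
      have z: "z \<in> cdomain V a s" using cdomain_monoD[OF that] assms(2) by simp
      have "dd (c k) z (dirPhi j) = dd (c k) z (slow_part (dirPhi j))" by (rule slow_deriv(2)[OF fserD(1,2)[OF f] z])
      also have "slow_part (dirPhi j) = (0::'a phase)" by (simp add: slow_part_def zero_prod_def)
      finally have 1: "dd (c k) z (dirPhi j) = 0" using holo_linear(4)[OF fserD(1)[OF f] z] by simp
      have 2: "(\<Sum>i\<in>UNIV. fst (snd (snd (dirPhi j))) $ i * of_int (k $ i)) = (of_int (k $ j) :: complex)"
        by (simp add: axis_def if_distrib[of "\<lambda>x. x * _"] cong: if_cong)
      have "cmod (of_int (k $ j)) \<le> real_of_int (freq_norm k)"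
        using freq_norm_comp[of k j] by simp
      then show ?thesis unfolding 1 2 using mult_mono[OF _ fserD(4)[OF f z]] freq_norm_nonneg[of k]
        by (simp add: norm_mult)
    qed
    show "real_of_int (freq_norm k) * b k * wt s0 k \<le> 1 / (exp 1 * (s - s0)) * (b k * wt s k)" for k
      using mult_left_mono[OF wt_gain[OF assms(2), of k] fserD(3)[OF f, of k]] by (simp add: mult_ac)
  qed (use assms in auto)
qed

lemma fb_deriv_slow_dir:
  assumes "fb V a s F B" and u: "disp p q u" "fst (snd (snd u)) = 0" and "0 < \<rho>" "a0 + \<rho> * p \<le> a" "s0 + \<rho> * q \<le> s"
  shows "fb V a0 s0 (\<lambda>z. dd F z u) (1 / \<rho> * B)"
proof -
  obtain c b where f: "fser V a s F c b B" using assms by (auto simp: fb_def)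
  have "0 \<le> \<rho> * p" "0 \<le> \<rho> * q" using disp_nonneg[OF u(1)] \<open>0 < \<rho>\<close> by auto
  then have le: "a0 \<le> a" "s0 \<le> s" using assms by linarith+
  show ?thesis
  proof (rule fb_dirderiv[OF f le, where \<beta> = "\<lambda>k. b k / \<rho>"])
    show "cmod (dd (c k) z u + \<i> * (\<Sum>j\<in>UNIV. fst (snd (snd u)) $ j * of_int (k $ j)) * c k z) \<le> b k / \<rho>"
      if "z \<in> cdomain V a0 s0" for k z
      using cauchy_on_cdomain[OF fserD(1)[OF f] fserD(4)[OF f] that u(1) assms(4-6)] by (simp add: u(2))
    show "b k / \<rho> * wt s0 k \<le> 1 / \<rho> * (b k * wt s k)" for k
      using mult_left_mono[OF wt_mono[OF le(2), of k] fserD(3)[OF f, of k]] \<open>0 < \<rho>\<close> by (simp add: field_simps)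
  qed (use fserD(3)[OF f] \<open>0 < \<rho>\<close> in auto)
qed

lemma fb_deriv_eta:
  fixes V :: "(real^'n::finite) set"
  assumes "fb V a s F B" "z \<in> cdomain V a s" shows "dd F z dirEta = 0"
proof -
  obtain c b where f: "fser V a s F c b B" using assms by (auto simp: fb_def)
  have "dd (c k) z dirEta = dd (c k) z (slow_part dirEta)" for k by (rule slow_deriv(2)[OF fserD(1,2)[OF f] assms(2)])
  moreover have "slow_part dirEta = (0::'n phase)" by (simp add: slow_part_def zero_prod_def)
  ultimately have "dd (c k) z dirEta = 0" for k using holo_linear(4)[OF fserD(1)[OF f] assms(2)] by simp
  then have "((\<lambda>k::int^'n. 0) has_sum dd F z dirEta) UNIV" using fser_holo(2)[OF f assms(2), of dirEta] by simp
  then show ?thesis by (metis has_sum_0_simp has_sum_unique)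
qed

text \<open>The vector field of Hamilton's equations with \<open>I\<close> conjugate to \<open>\<phi>\<close> and \<open>\<eta>\<close> conjugate to \<open>\<xi>\<close>;
  \<open>lie \<psi> F\<close> is the rate of change of \<open>F\<close> along it, that is, a Poisson bracket.\<close>

definition ham :: "('n::finite phase \<Rightarrow> complex) \<Rightarrow> 'n phase \<Rightarrow> 'n phase" where
  "ham \<psi> z = ((\<chi> j. - dd \<psi> z (dirPhi j)), - dd \<psi> z dirXi, (\<chi> j. dd \<psi> z (dirI j)), dd \<psi> z dirEta)"

definition lie :: "('n::finite phase \<Rightarrow> complex) \<Rightarrow> ('n phase \<Rightarrow> complex) \<Rightarrow> 'n phase \<Rightarrow> complex" where
  "lie \<psi> F z = dd F z (ham \<psi> z)"

lemma fst_sum': "fst (sum f A) = (\<Sum>x\<in>A. fst (f x))" by (induction A rule: infinite_finite_induct) auto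
lemma snd_sum': "snd (sum f A) = (\<Sum>x\<in>A. snd (f x))" by (induction A rule: infinite_finite_induct) auto

lemma kvec_sum: "kvec k = (\<Sum>j\<in>UNIV. cscale (of_int (k $ j)) (dirI j))"
  by (rule phase_eqI)
     (simp_all add: kvec_def fst_sum' snd_sum' axis_def if_distrib[of "\<lambda>x. _ * x"] cong: if_cong)

text \<open>A trigonometric polynomial in the angles, as a Fourier series with finite support.\<close>

definition trig :: "(real^'n::finite) set \<Rightarrow> real \<Rightarrow> real \<Rightarrow> ('n phase \<Rightarrow> complex)
    \<Rightarrow> (int^'n \<Rightarrow> 'n phase \<Rightarrow> complex) \<Rightarrow> (int^'n \<Rightarrow> real) \<Rightarrow> (int^'n) set \<Rightarrow> real \<Rightarrow> bool" where
  "trig V a s \<psi> x y S X \<longleftrightarrow> fser V a s \<psi> x y X \<and> finite S \<and> (\<forall>k. k \<notin> S \<longrightarrow> y k = 0)"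

lemma trig_mono: "trig V a s \<psi> x y S X \<Longrightarrow> a' \<le> a \<Longrightarrow> s' \<le> s \<Longrightarrow> X \<le> X' \<Longrightarrow> trig V a' s' \<psi> x y S X'"
  unfolding trig_def using fser_mono by blast

lemma trig_fser: "trig V a s \<psi> x y S X \<Longrightarrow> fser V a s \<psi> x y X" by (simp add: trig_def)

lemma trig_deriv:
  assumes t: "trig V a s \<psi> x y S X" and z: "z \<in> cdomain V a s"
  shows "dd \<psi> z u = (\<Sum>k\<in>S. (dd (x k) z u + \<i> * (\<Sum>j\<in>UNIV. fst (snd (snd u)) $ j * of_int (k $ j)) * x k z) * fmode k z)"
proof -
  note f = trig_fser[OF t]
  have x0: "x k w = 0" if "k \<notin> S" "w \<in> cdomain V a s" for k w
    using fserD(4)[OF f that(2), of k] t that(1) by (simp add: trig_def)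
  have d0: "dd (x k) z u = 0" if "k \<notin> S" for k
    using dd_cong[OF open_cdomain z, of "x k" "\<lambda>_. 0"] x0[OF that] by (simp add: dd_eq[OF has_derivative_const])
  show ?thesis
    by (rule has_sum_unique[OF fser_holo(2)[OF f z, of u]], rule has_sum_finite_neutralI)
       (use t x0 d0 z in \<open>auto simp: trig_def\<close>)
qed

text \<open>In a product of two modes every angular derivative becomes a factor \<open>k\<close> or \<open>l\<close>, so that a
  bracket only involves derivatives of coefficients in the directions \<open>kvec\<close>.\<close>

lemma bracket_expand:
  fixes V :: "(real^'n::finite) set"
  assumes t: "trig V a' s' \<psi> x y S X" and f: "fser V a s F c b B"
    and z: "z \<in> cdomain V a' s'" "z \<in> cdomain V a s"
  shows "((\<lambda>l. \<Sum>k\<in>S. \<i> * (dd (x k) z (kvec l) * c l z - x k z * dd (c l) z (kvec k)) * fmode (k + l) z)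
      has_sum lie \<psi> F z) UNIV"
proof -
  let ?v = "ham \<psi> z"
  note c = fserD(1)[OF f]
  have hx: "holo_fun_on (cdomain V a' s') \<psi>" by (rule fser_holo(1)[OF trig_fser[OF t]])
  have phi: "dd (x k) z (dirPhi j) = 0" for k j
  proof -
    have "dd (x k) z (dirPhi j) = dd (x k) z (slow_part (dirPhi j))"
      by (rule slow_deriv(2)[OF fserD(1,2)[OF trig_fser[OF t]] z(1)])
    moreover have "slow_part (dirPhi j) = (0::'n phase)" by (simp add: slow_part_def zero_prod_def)
    ultimately show ?thesis using holo_linear(4)[OF fserD(1)[OF trig_fser[OF t]] z(1)] by simp
  qed
  have sp: "slow_part ?v = (\<Sum>k\<in>S. cscale (- \<i> * x k z * fmode k z) (kvec k))"
  proof (rule phase_eqI)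
    fix j
    have "(\<Sum>i\<in>UNIV. fst (snd (snd (dirPhi j))) $ i * of_int (k $ i)) = (of_int (k $ j) :: complex)" for k :: "int^'n"
      by (simp add: axis_def if_distrib[of "\<lambda>x. x * _"] cong: if_cong)
    then have "fst ?v $ j = - (\<Sum>k\<in>S. \<i> * of_int (k $ j) * x k z * fmode k z)"
      unfolding ham_def by (simp add: trig_deriv[OF t z(1)] phi)
    then show "fst (slow_part ?v) $ j = fst (\<Sum>k\<in>S. cscale (- \<i> * x k z * fmode k z) (kvec k)) $ j"
      by (simp add: fst_sum' kvec_def sum_negf[symmetric] mult_ac)
  next
    have "dd \<psi> z dirEta = 0" by (rule fb_deriv_eta[OF fser_fb[OF trig_fser[OF t]] z(1)])
    then show "snd (snd (snd (slow_part ?v))) = snd (snd (snd (\<Sum>k\<in>S. cscale (- \<i> * x k z * fmode k z) (kvec k))))"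
      by (simp add: snd_sum' kvec_def ham_def)
  qed (simp_all add: fst_sum' snd_sum' kvec_def)
  have 1: "dd (c l) z ?v = (\<Sum>k\<in>S. - \<i> * x k z * fmode k z * dd (c l) z (kvec k))" for l
    unfolding slow_deriv(2)[OF fserD(1,2)[OF f] z(2), of l ?v] sp holo_linear(6)[OF c z(2)]
    by (rule sum.cong[OF refl]) (rule holo_derivD(2)[OF c z(2)])
  have 2: "(\<Sum>j\<in>UNIV. fst (snd (snd ?v)) $ j * of_int (l $ j)) = (\<Sum>k\<in>S. dd (x k) z (kvec l) * fmode k z)" for l
  proof -
    have "(\<Sum>j\<in>UNIV. fst (snd (snd ?v)) $ j * of_int (l $ j)) = (\<Sum>j\<in>UNIV. of_int (l $ j) * dd \<psi> z (dirI j))"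
      by (simp add: ham_def mult.commute)
    also have "\<dots> = dd \<psi> z (kvec l)"
      unfolding kvec_sum holo_linear(6)[OF hx z(1)]
      by (rule sum.cong[OF refl]) (rule holo_derivD(2)[OF hx z(1), symmetric])
    also have "\<dots> = (\<Sum>k\<in>S. dd (x k) z (kvec l) * fmode k z)"
      unfolding trig_deriv[OF t z(1)] by (simp add: kvec_def)
    finally show ?thesis .
  qed
  have "(dd (c l) z ?v + \<i> * (\<Sum>j\<in>UNIV. fst (snd (snd ?v)) $ j * of_int (l $ j)) * c l z) * fmode l z
      = (\<Sum>k\<in>S. \<i> * (dd (x k) z (kvec l) * c l z - x k z * dd (c l) z (kvec k)) * fmode (k + l) z)" for l
    unfolding 1 2 fmode_add sum_distrib_left sum_distrib_right sum.distrib[symmetric]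
    by (rule sum.cong[OF refl]) (simp add: algebra_simps)
  then show ?thesis using fser_holo(2)[OF f z(2), of ?v] by (simp add: lie_def)
qed

text \<open>The factor \<open>l\<close> from differentiating \<open>F\<close> in the angles is absorbed by the weights of \<open>F\<close>, while
  the factor \<open>k\<close> remains, to be absorbed by the weights of \<open>\<psi>\<close> when the modes of \<open>\<psi>\<close> are summed.\<close>

lemma fb_single_mode:
  fixes V :: "(real^'n::finite) set" and k :: "int^'n"
  assumes xk: "holo_fun_on (cdomain V a' s') xk" "slow (cdomain V a' s') xk" "\<And>z. z \<in> cdomain V a' s' \<Longrightarrow> cmod (xk z) \<le> yk"
    "0 \<le> yk" and f: "fser V a s F c b B"
    and a: "a0 < a" "a0 < a'" and s: "s0 < s" "s0 \<le> s'" "0 \<le> s0"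
  defines "g \<equiv> \<lambda>l z. \<i> * (dd xk z (kvec l) * c l z - xk z * dd (c l) z (kvec k)) * fmode (k + l) z"
  shows "fb V a0 s0 (\<lambda>z. infsum (\<lambda>l. g l z) UNIV)
      ((yk * wt s0 k / ((a' - a0) * (exp 1 * (s - s0))) + yk * real_of_int (freq_norm k) * wt s0 k / (a - a0)) * B)"
    and "z \<in> cdomain V a0 s0 \<Longrightarrow> (\<lambda>l. g l z) summable_on UNIV"
proof -
  let ?N = "\<lambda>k. real_of_int (freq_norm k)"
  define A where "A = yk * wt s0 k / ((a' - a0) * (exp 1 * (s - s0))) + yk * ?N k * wt s0 k / (a - a0)"
  have N0: "0 \<le> ?N l" for l :: "int^'n" using freq_norm_nonneg by simp
  note c = fserD(1)[OF f] and b0 = fserD(3)[OF f]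
  have sub: "cdomain V a0 s0 \<subseteq> cdomain V a s" "cdomain V a0 s0 \<subseteq> cdomain V a' s'"
    by (rule cdomain_mono; use a s in simp)+
  define c' where "c' = (\<lambda>m z. \<i> * (dd xk z (kvec (m - k)) * c (m - k) z - xk z * dd (c (m - k)) z (kvec k)))"
  define b1 where "b1 = (\<lambda>l. yk * ?N l / (a' - a0) * b l + yk * (?N k / (a - a0) * b l))"
  have dx: "cmod (dd xk z (kvec l)) \<le> yk * ?N l / (a' - a0)" if z: "z \<in> cdomain V a0 s0" for z l
  proof (cases "l = 0")
    case True
    have "kvec (0 :: int^'n) = (0 :: 'n phase)" by (simp add: kvec_def zero_prod_def zero_vec_def)
    then show ?thesis using True holo_linear(4)[OF xk(1) subsetD[OF sub(2) z]] by simp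
  next
    case False
    then have "?N l > 0"
    proof -
      obtain j where "l $ j \<noteq> 0" using False by (auto simp: vec_eq_iff)
      then show ?thesis using freq_norm_comp[of l j] by simp
    qed
    then have "cmod (dd xk z (kvec l)) \<le> yk / ((a' - a0) / ?N l)"
      by (intro cauchy_on_cdomain[OF xk(1) xk(3) z disp_kvec]) (use a s in auto)
    then show ?thesis by (simp add: field_simps)
  qed
  have dc: "cmod (dd (c l) z (kvec k)) \<le> ?N k / (a - a0) * b l" if z: "z \<in> cdomain V a0 s0" for z l
  proof (cases "k = 0")
    case True
    have "kvec (0 :: int^'n) = (0 :: 'n phase)" by (simp add: kvec_def zero_prod_def zero_vec_def)
    then show ?thesis using True holo_linear(4)[OF c subsetD[OF sub(1) z]] by simp
  next
    case False
    then have "?N k > 0"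
    proof -
      obtain j where "k $ j \<noteq> 0" using False by (auto simp: vec_eq_iff)
      then show ?thesis using freq_norm_comp[of k j] by simp
    qed
    then have "cmod (dd (c l) z (kvec k)) \<le> b l / ((a - a0) / ?N k)"
      by (intro cauchy_on_cdomain[OF c fserD(4)[OF f] z disp_kvec]) (use a s in auto)
    then show ?thesis by (simp add: field_simps)
  qed
  have c'b: "cmod (\<i> * (dd xk z (kvec l) * c l z - xk z * dd (c l) z (kvec k))) \<le> b1 l" if z: "z \<in> cdomain V a0 s0" for z l
  proof -
    have "z \<in> cdomain V a s" "z \<in> cdomain V a' s'" using z sub by auto
    note z' = this
    have "cmod (dd xk z (kvec l) * c l z) \<le> yk * ?N l / (a' - a0) * b l"
      unfolding norm_mult
      by (rule mult_mono[OF dx[OF z] fserD(4)[OF f z'(1)]]) (use xk(4) a N0 in \<open>auto intro!: divide_nonneg_nonneg\<close>)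
    moreover have "cmod (xk z * dd (c l) z (kvec k)) \<le> yk * (?N k / (a - a0) * b l)"
      unfolding norm_mult by (rule mult_mono[OF xk(3)[OF z'(2)] dc[OF z] xk(4)]) simp
    ultimately show ?thesis unfolding b1_def norm_mult[of \<i>] norm_ii mult_1
      by (intro order_trans[OF norm_triangle_ineq4] add_mono)
  qed
  have b1w: "b1 l * wt s0 (k + l) \<le> A * (b l * wt s l)" for l
  proof -
    have b10: "0 \<le> b1 l" unfolding b1_def using xk(4) a N0 b0 by (intro add_nonneg_nonneg mult_nonneg_nonneg divide_nonneg_nonneg) auto
    have "b1 l * wt s0 (k + l) \<le> b1 l * (wt s0 k * wt s0 l)" by (rule mult_left_mono[OF wt_add[OF s(3)] b10])
    also have "\<dots> = yk / (a' - a0) * b l * wt s0 k * (?N l * wt s0 l) + yk * ?N k / (a - a0) * b l * wt s0 k * wt s0 l"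
      by (simp add: b1_def algebra_simps)
    also have "\<dots> \<le> yk / (a' - a0) * b l * wt s0 k * (wt s l / (exp 1 * (s - s0))) + yk * ?N k / (a - a0) * b l * wt s0 k * wt s l"
      using xk(4) a s N0[of k] b0[of l]
      by (intro add_mono mult_left_mono wt_gain wt_mono mult_nonneg_nonneg divide_nonneg_nonneg) auto
    also have "\<dots> = A * (b l * wt s l)" by (simp add: A_def algebra_simps)
    finally show ?thesis .
  qed
  have bij: "bij_betw (\<lambda>m. m - k) UNIV UNIV" by (rule bij_betwI[where g = "\<lambda>m. m + k"]) auto
  have bij': "bij_betw (\<lambda>m. k + m) UNIV UNIV" by (rule bij_betwI[where g = "\<lambda>m. m - k"]) auto
  have sA: "(\<lambda>l. A * (b l * wt s l)) summable_on UNIV" by (rule summable_on_cmult_right[OF fserD(5)[OF f]])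
  have s1: "(\<lambda>l. b1 l * wt s0 (k + l)) summable_on UNIV"
    by (rule summable_on_comparison_test[OF sA b1w]) (use xk(4) a N0 b0 in \<open>auto simp: b1_def\<close>)
  show gs: "(\<lambda>l. g l z) summable_on UNIV" if z: "z \<in> cdomain V a0 s0" for z
  proof (rule abs_summable_summable, rule summable_on_comparison_test[OF s1])
    show "norm (g l z) \<le> b1 l * wt s0 (k + l)" for l
      unfolding g_def norm_mult[of _ "fmode (k + l) z"]
      by (intro mult_mono c'b[OF z] fmode_bound[OF z] order_trans[OF norm_ge_zero c'b[OF z]]) auto
  qed auto
  have "fser V a0 s0 (\<lambda>z. infsum (\<lambda>l. g l z) UNIV) c' (\<lambda>m. b1 (m - k)) (A * B)"
  proof (rule fserI)
    show "holo_fun_on (cdomain V a0 s0) (c' m)" for m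
      unfolding c'_def
      by (intro holo_cmult(1) holo_diff(1) holo_mult(1) holo_fun_subset[OF holo_dir_deriv[OF open_cdomain xk(1)] sub(2)]
          holo_fun_subset[OF holo_dir_deriv[OF open_cdomain c] sub(1)] holo_fun_subset[OF c sub(1)] holo_fun_subset[OF xk(1) sub(2)])
    show "slow (cdomain V a0 s0) (c' m)" for m
      unfolding slow_def
    proof
      fix z assume "z \<in> cdomain V a0 s0"
      then have z: "z \<in> cdomain V a s" "z \<in> cdomain V a' s'" using sub by auto
      have "c (m - k) z = c (m - k) (slow_part z)" "xk z = xk (slow_part z)"
        "dd (c (m - k)) z (kvec k) = dd (c (m - k)) (slow_part z) (kvec k)"
        "dd xk z (kvec (m - k)) = dd xk (slow_part z) (kvec (m - k))"
        using fserD(2)[OF f, of "m - k"] xk(2) slow_deriv(1)[OF c fserD(2)[OF f], of "m - k" "kvec k"]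
          slow_deriv(1)[OF xk(1,2), of "kvec (m - k)"] z by (simp_all only: slow_def)
      then show "c' m z = c' m (slow_part z)" unfolding c'_def by simp
    qed
    show "0 \<le> b1 (m - k)" for m
      unfolding b1_def using xk(4) a N0 b0 by (intro add_nonneg_nonneg mult_nonneg_nonneg divide_nonneg_nonneg) auto
    show "cmod (c' m z) \<le> b1 (m - k)" if "z \<in> cdomain V a0 s0" for m z unfolding c'_def by (rule c'b[OF that])
    have e: "(\<lambda>m. b1 (m - k) * wt s0 m) = (\<lambda>m. (\<lambda>l. b1 l * wt s0 (k + l)) (m - k))" by simp
    show "(\<lambda>m. b1 (m - k) * wt s0 m) summable_on UNIV"
      unfolding e by (subst summable_on_reindex_bij_betw[OF bij]) (rule s1)
    have "infsum (\<lambda>m. b1 (m - k) * wt s0 m) UNIV = infsum (\<lambda>l. b1 l * wt s0 (k + l)) UNIV"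
      unfolding e by (rule infsum_reindex_bij_betw[OF bij])
    also have "\<dots> \<le> infsum (\<lambda>l. A * (b l * wt s l)) UNIV" by (rule infsum_mono[OF s1 sA b1w])
    also have "\<dots> = A * infsum (\<lambda>l. b l * wt s l) UNIV" by (rule infsum_cmult_right')
    also have "\<dots> \<le> A * B"
      by (rule mult_left_mono[OF fserD(6)[OF f]]) (use xk(4) a s N0[of k] in \<open>auto simp: A_def intro!: add_nonneg_nonneg divide_nonneg_nonneg mult_nonneg_nonneg\<close>)
    finally show "infsum (\<lambda>m. b1 (m - k) * wt s0 m) UNIV \<le> A * B" .
    show "((\<lambda>m. c' m z * fmode m z) has_sum infsum (\<lambda>l. g l z) UNIV) UNIV" if z: "z \<in> cdomain V a0 s0" for z
    proof -
      have "((\<lambda>l. (\<lambda>m. c' m z * fmode m z) (k + l)) has_sum infsum (\<lambda>l. g l z) UNIV) UNIV"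
        using has_sum_infsum[OF gs[OF z]] by (simp add: g_def c'_def)
      then show ?thesis by (subst (asm) has_sum_reindex_bij_betw[OF bij'])
    qed
  qed
  then show "fb V a0 s0 (\<lambda>z. infsum (\<lambda>l. g l z) UNIV)
      ((yk * wt s0 k / ((a' - a0) * (exp 1 * (s - s0))) + yk * real_of_int (freq_norm k) * wt s0 k / (a - a0)) * B)"
    unfolding A_def by (rule fser_fb)
qed

lemma fb_lie:
  assumes t: "trig V a' s' \<psi> x y S X" and F: "fb V a s F B"
    and a: "a0 < a" "a0 < a'" and s: "s0 < s" "s0 < s'" "0 \<le> s0"
  shows "fb V a0 s0 (lie \<psi> F) (X * B * (1 / (exp 1 * (a' - a0) * (s - s0)) + 1 / (exp 1 * (a - a0) * (s' - s0))))"
proof -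
  obtain c b where f: "fser V a s F c b B" using F by (auto simp: fb_def)
  let ?N = "\<lambda>k. real_of_int (freq_norm k)"
  note tx = trig_fser[OF t]
  have fin: "finite S" using t by (simp add: trig_def)
  define g where "g = (\<lambda>k l z. \<i> * (dd (x k) z (kvec l) * c l z - x k z * dd (c l) z (kvec k)) * fmode (k + l) z)"
  define A where "A = (\<lambda>k. y k * wt s0 k / ((a' - a0) * (exp 1 * (s - s0))) + y k * ?N k * wt s0 k / (a - a0))"
  have sm: "fb V a0 s0 (\<lambda>z. infsum (\<lambda>l. g k l z) UNIV) (A k * B)"
    "z \<in> cdomain V a0 s0 \<Longrightarrow> (\<lambda>l. g k l z) summable_on UNIV" for k z
    unfolding g_def A_def
    by (rule fb_single_mode[OF fserD(1,2)[OF tx] fserD(4)[OF tx] fserD(3)[OF tx] f a s(1) less_imp_le[OF s(2)] s(3)]; assumption)+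
  have B0: "0 \<le> B" by (rule fb_nonneg[OF F])
  have 1: "fb V a0 s0 (\<lambda>z. \<Sum>k\<in>S. infsum (\<lambda>l. g k l z) UNIV) (\<Sum>k\<in>S. A k * B)"
    by (intro fb_sum[OF fin]) (rule sm(1))
  have 2: "(\<Sum>k\<in>S. infsum (\<lambda>l. g k l z) UNIV) = lie \<psi> F z" if z: "z \<in> cdomain V a0 s0" for z
  proof (rule has_sum_unique)
    have z': "z \<in> cdomain V a' s'" "z \<in> cdomain V a s" using cdomain_monoD[OF z] a s by auto
    show "((\<lambda>l. \<Sum>k\<in>S. g k l z) has_sum lie \<psi> F z) UNIV"
      unfolding g_def by (rule bracket_expand[OF t f z'])
    show "((\<lambda>l. \<Sum>k\<in>S. g k l z) has_sum (\<Sum>k\<in>S. infsum (\<lambda>l. g k l z) UNIV)) UNIV"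
      by (rule has_sum_finite_sum[OF fin]) (rule has_sum_infsum[OF sm(2)[OF z]])
  qed
  have yS: "(\<Sum>k\<in>S. y k * wt s' k) \<le> X"
    by (rule order_trans[OF finite_sum_le_infsum fserD(6)[OF tx]]) (use fserD(3,5)[OF tx] fin in auto)
  have X0: "0 \<le> X" by (rule fser_nonneg[OF tx])
  have "A k \<le> y k * wt s' k * (1 / (exp 1 * (a' - a0) * (s - s0)) + 1 / (exp 1 * (a - a0) * (s' - s0)))" for k
  proof -
    have y0: "0 \<le> y k" by (rule fserD(3)[OF tx])
    have "y k * wt s0 k / ((a' - a0) * (exp 1 * (s - s0))) \<le> y k * wt s' k / ((a' - a0) * (exp 1 * (s - s0)))"
      by (intro divide_right_mono mult_left_mono wt_mono y0) (use a s in auto)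
    moreover have "y k * ?N k * wt s0 k / (a - a0) \<le> y k * (wt s' k / (exp 1 * (s' - s0))) / (a - a0)"
      unfolding mult.assoc by (intro divide_right_mono mult_left_mono wt_gain y0) (use a s in auto)
    ultimately show ?thesis by (simp add: A_def algebra_simps)
  qed
  then have "(\<Sum>k\<in>S. A k) \<le> (\<Sum>k\<in>S. y k * wt s' k) * (1 / (exp 1 * (a' - a0) * (s - s0)) + 1 / (exp 1 * (a - a0) * (s' - s0)))"
    unfolding sum_distrib_right by (rule sum_mono)
  also have "\<dots> \<le> X * (1 / (exp 1 * (a' - a0) * (s - s0)) + 1 / (exp 1 * (a - a0) * (s' - s0)))"
    by (rule mult_right_mono[OF yS]) (use a s in \<open>auto intro!: add_nonneg_nonneg\<close>)
  finally have "(\<Sum>k\<in>S. A k * B) \<le> X * (1 / (exp 1 * (a' - a0) * (s - s0)) + 1 / (exp 1 * (a - a0) * (s' - s0))) * B"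
    unfolding sum_distrib_right[symmetric] by (rule mult_right_mono[OF _ B0])
  then have "(\<Sum>k\<in>S. A k * B) \<le> X * B * (1 / (exp 1 * (a' - a0) * (s - s0)) + 1 / (exp 1 * (a - a0) * (s' - s0)))"
    by (simp only: mult_ac)
  from fb_cong[OF fb_mono[OF 1 order_refl order_refl this] 2] show ?thesis .
qed

lemma power_self_le_fact_exp: "real n ^ n \<le> fact n * exp (real n)"
proof -
  have "(\<Sum>k\<in>{n}. inverse (fact k) * real n ^ k) \<le> (\<Sum>k. inverse (fact k) * real n ^ k)"
    by (rule sum_le_suminf[OF summable_exp]) auto
  also have "\<dots> = exp (real n)" by (simp add: exp_def)
  finally have "inverse (fact n) * real n ^ n \<le> exp (real n)" by simp
  then have "fact n * (inverse (fact n) * real n ^ n) \<le> fact n * exp (real n)" by (rule mult_left_mono) simp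
  then show ?thesis by (simp flip: mult.assoc)
qed

lemma two_gaps:
  fixes p q n x y :: real
  assumes "p > 0" "q > 0" "n > 0" "x > 0" "y > 0"
  shows "1 / (p * (q * x / n) * (y / n)) + 1 / (p * (x / n) * (q * y / n)) = 2 * n\<^sup>2 / (p * x * y) / q"
proof -
  have "1 / (p * (q * x / n) * (y / n)) = n\<^sup>2 / (p * x * y) / q" "1 / (p * (x / n) * (q * y / n)) = n\<^sup>2 / (p * x * y) / q"
    using assms by (simp_all add: power2_eq_square)
  then show ?thesis by simp
qed

text \<open>Spending the \<open>n\<close>-th part of the loss on each of \<open>n\<close> brackets gives a factor \<open>n ^ (2 * n) / fact n\<close>,
  because the \<open>i\<close>-th bracket profits from the full gap between its domain and that of \<open>\<psi>\<close>; up to a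
  geometric factor this is \<open>fact n\<close>.\<close>

lemma fb_lie_iterate:
  assumes t: "trig V a s \<psi> x y S X" and F: "fb V a s F B"
    and d: "0 < da" "0 < ds" "ds \<le> s"
  shows "fb V (a - da) (s - ds) ((lie \<psi> ^^ n) F) (fact n * (2 * exp 1 * X / (da * ds)) ^ n * B)"
proof (cases "n = 0")
  case True then show ?thesis using fb_mono[OF F] d by simp
next
  case False
  then have n: "real n > 0" by simp
  define q where "q = 2 * (real n)\<^sup>2 * X / (exp 1 * da * ds)"
  define t where "t = 2 * (real n)\<^sup>2 / (exp 1 * da * ds)"
  have qt: "q = X * t" by (simp add: q_def t_def)
  have X0: "0 \<le> X" by (rule fser_nonneg[OF trig_fser[OF assms(1)]])
  have B0: "0 \<le> B" by (rule fb_nonneg[OF F])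
  have *: "fb V (a - real i / real n * da) (s - real i / real n * ds) ((lie \<psi> ^^ i) F) (q ^ i / fact i * B)" if "i \<le> n" for i
    using that
  proof (induction i)
    case 0 show ?case using F by simp
  next
    case (Suc i)
    let ?a = "a - real i / real n * da" and ?s = "s - real i / real n * ds"
    let ?an = "a - real (Suc i) / real n * da" and ?sn = "s - real (Suc i) / real n * ds"
    have gap: "?a - ?an = da / real n" "?s - ?sn = ds / real n" "a - ?an = real (Suc i) * da / real n" "s - ?sn = real (Suc i) * ds / real n"
      by (simp_all add: add_divide_distrib algebra_simps)
    have pos: "0 < da / real n" "0 < ds / real n" "0 < real (Suc i) * da / real n" "0 < real (Suc i) * ds / real n"
      using n d by simp_all
    have "real (Suc i) / real n * ds \<le> 1 * ds" by (rule mult_right_mono) (use Suc.prems n d in auto)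
    then have s0: "0 \<le> ?sn" using d by simp
    have "fb V ?an ?sn (lie \<psi> ((lie \<psi> ^^ i) F)) (X * (q ^ i / fact i * B) *
        (1 / (exp 1 * (a - ?an) * (?s - ?sn)) + 1 / (exp 1 * (?a - ?an) * (s - ?sn))))"
      by (rule fb_lie[OF assms(1) Suc.IH]) (use Suc.prems gap pos s0 in linarith)+
    moreover have "X * (q ^ i / fact i * B) *
        (1 / (exp 1 * (a - ?an) * (?s - ?sn)) + 1 / (exp 1 * (?a - ?an) * (s - ?sn))) = q ^ Suc i / fact (Suc i) * B"
    proof -
      have "1 / (exp 1 * (real (Suc i) * da / real n) * (ds / real n)) + 1 / (exp 1 * (da / real n) * (real (Suc i) * ds / real n))
          = t / real (Suc i)"
        unfolding t_def by (rule two_gaps) (use n d in auto)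
      moreover have "X * (q ^ i / fact i * B) * (t / real (Suc i)) = q ^ Suc i / fact (Suc i) * B"
        by (simp add: qt mult_ac)
      ultimately show ?thesis unfolding gap by simp
    qed
    ultimately show ?case by simp
  qed
  have "q ^ n / fact n * B \<le> fact n * (2 * exp 1 * X / (da * ds)) ^ n * B"
  proof (rule mult_right_mono[OF _ B0])
    have "(real n ^ n)\<^sup>2 \<le> (fact n * exp (real n))\<^sup>2" by (rule power_mono[OF power_self_le_fact_exp]) simp
    then have "(real n ^ n)\<^sup>2 * (2 * X / (exp 1 * da * ds)) ^ n \<le> (fact n * exp (real n))\<^sup>2 * (2 * X / (exp 1 * da * ds)) ^ n"
      by (rule mult_right_mono) (use X0 d in auto)
    moreover have "q ^ n = (real n ^ n)\<^sup>2 * (2 * X / (exp 1 * da * ds)) ^ n"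
      by (simp add: q_def power_mult_distrib power_divide power2_eq_square flip: power_add)
    moreover have "(2 * exp 1 * X / (da * ds)) ^ n = (exp (real n))\<^sup>2 * (2 * X / (exp 1 * da * ds)) ^ n"
    proof -
      have "2 * exp 1 * X / (da * ds) = (exp 1)\<^sup>2 * (2 * X / (exp 1 * da * ds))" by (simp add: power2_eq_square)
      moreover have "exp (real n) = exp (1::real) ^ n" by (simp flip: exp_of_nat_mult)
      ultimately show ?thesis by (simp only: power_mult_distrib power_mult[symmetric] mult.commute[of n 2])
    qed
    ultimately show "q ^ n / fact n \<le> fact n * (2 * exp 1 * X / (da * ds)) ^ n"
      by (simp add: power2_eq_square power_mult_distrib divide_le_eq mult_ac)
  qed
  moreover have "fb V (a - da) (s - ds) ((lie \<psi> ^^ n) F) (q ^ n / fact n * B)" using *[of n] n by simp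
  ultimately show ?thesis by (rule fb_mono[OF _ order_refl order_refl, rotated])
qed

section \<open>Hamiltonian flows as limits of Euler polygons\<close>

text \<open>Euler's polygon after \<open>j\<close> of \<open>m\<close> steps of length \<open>1 / m\<close>.\<close>

definition euler :: "('n::finite phase \<Rightarrow> complex) \<Rightarrow> nat \<Rightarrow> nat \<Rightarrow> 'n phase \<Rightarrow> 'n phase" where
  "euler \<psi> m j = (\<lambda>z. z + (1 / real m) *\<^sub>R ham \<psi> z) ^^ j"

definition flow :: "('n::finite phase \<Rightarrow> complex) \<Rightarrow> 'n phase \<Rightarrow> 'n phase" where
  "flow \<psi> z = lim (\<lambda>m. euler \<psi> m m z)"

text \<open>The change of a function along the flow up to time \<open>t\<close>, where \<open>W\<close> is the derivative of that function
  along the vector field.  Starting from \<open>W\<close> covers functions that have no bounded Fourier norm themselves,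
  such as the coordinates.\<close>

definition lie_series :: "('n::finite phase \<Rightarrow> complex) \<Rightarrow> ('n phase \<Rightarrow> complex) \<Rightarrow> real \<Rightarrow> 'n phase \<Rightarrow> complex" where
  "lie_series \<psi> W t z = (\<Sum>n. of_real (t ^ Suc n / fact (Suc n)) * (lie \<psi> ^^ n) W z)"

lemma euler_0 [simp]: "euler \<psi> m 0 z = z" by (simp add: euler_def)
lemma euler_Suc: "euler \<psi> m (Suc j) z = euler \<psi> m j z + (1 / real m) *\<^sub>R ham \<psi> (euler \<psi> m j z)"
  by (simp add: euler_def)

subsection \<open>Coordinates\<close>

text \<open>A point of phase space is determined by these linear functions, and each of them is transported along a flow by
  its own Lie series.\<close>

definition coord :: "('n::finite phase \<Rightarrow> complex) \<Rightarrow> bool" where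
  "coord l \<longleftrightarrow> (\<exists>j. l = (\<lambda>z. fst z $ j)) \<or> l = (\<lambda>z. fst (snd z)) \<or> (\<exists>j. l = (\<lambda>z. fst (snd (snd z)) $ j))
     \<or> l = (\<lambda>z. snd (snd (snd z)))"

lemma coord_simps:
  "coord (\<lambda>z. fst z $ j)" "coord (\<lambda>z. fst (snd z))" "coord (\<lambda>z. fst (snd (snd z)) $ j)" "coord (\<lambda>z. snd (snd (snd z)))"
  by (auto simp: coord_def)

lemma coord_linear:
  assumes "coord l"
  shows "bounded_linear l" "l (cscale c u) = c * l u" "l (u + w) = l u + l w" "l (r *\<^sub>R u) = of_real r * l u"
    "cmod (l u) \<le> norm u" "holo_fun_on T l" "dd l z = l" "l (u - w) = l u - l w"
proof -
  show bl: "bounded_linear l" using assms bl_comps by (auto simp: coord_def)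
  show sc: "l (cscale c u) = c * l u" for c u using assms by (auto simp: coord_def)
  show "l (u + w) = l u + l w" "l (u - w) = l u - l w"
    using assms by (auto simp: coord_def)
  show "l (r *\<^sub>R u) = of_real r * l u" using sc[of "of_real r"] by (simp add: cscale_algebra)
  show "cmod (l u) \<le> norm u" using assms phase_comp_le_norm[of u] by (auto simp: coord_def)
  show "holo_fun_on T l" "dd l z = l" by (rule holo_linear_fun[OF bl sc])+
qed

lemma phase_eq_coordI: "(\<And>l. coord l \<Longrightarrow> l z = l w) \<Longrightarrow> z = w"
  using coord_simps by (intro phase_eqI) blast+

lemma tendsto_phaseI:
  fixes f :: "nat \<Rightarrow> 'n::finite phase"
  assumes "\<And>l. coord l \<Longrightarrow> (\<lambda>m. l (f m)) \<longlonglongrightarrow> l w"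
  shows "f \<longlonglongrightarrow> w"
proof -
  have "(\<lambda>m. (fst (f m), fst (snd (f m)), fst (snd (snd (f m))), snd (snd (snd (f m))))) \<longlonglongrightarrow>
      (fst w, fst (snd w), fst (snd (snd w)), snd (snd (snd w)))"
    by (intro tendsto_Pair vec_tendstoI assms[OF coord_simps(1)] assms[OF coord_simps(2)]
        assms[OF coord_simps(3)] assms[OF coord_simps(4)])
  then show ?thesis by (simp only: prod.collapse)
qed

lemma holo_map_coords:
  fixes C :: "'n::finite phase \<Rightarrow> 'n phase"
  assumes "\<And>l. coord l \<Longrightarrow> holo_fun_on T (\<lambda>z. l (C z))"
  shows "holo_map_on T C" "z \<in> T \<Longrightarrow> coord l \<Longrightarrow> l (dd C z u) = dd (\<lambda>z. l (C z)) z u"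
proof -
  show hm: "holo_map_on T C"
    by (rule holo_map_components(1)[OF assms[OF coord_simps(1)] assms[OF coord_simps(2)]
          assms[OF coord_simps(3)] assms[OF coord_simps(4)]])
  show "l (dd C z u) = dd (\<lambda>z. l (C z)) z u" if "z \<in> T" "coord l"
    using holo_compose(2)[OF coord_linear(6)[OF that(2)] hm, of UNIV z u] that by (simp add: coord_linear(7))
qed

lemma closed_disp: assumes "\<And>m. disp p q (f m)" "f \<longlonglongrightarrow> u" shows "disp p q u"
proof -
  have c: "(\<lambda>m. l (f m)) \<longlonglongrightarrow> l u" if "coord l" for l
    by (rule bounded_linear.tendsto[OF coord_linear(1)[OF that] assms(2)])
  have "cmod (l u) \<le> b" if "coord l" "\<And>m. cmod (l (f m)) \<le> b" for l b
    by (rule LIMSEQ_le_const2[OF tendsto_norm[OF c[OF that(1)]]]) (use that(2) in auto)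
  from this[OF coord_simps(1)] this[OF coord_simps(2)] this[OF coord_simps(3)] this[OF coord_simps(4)]
  show ?thesis using assms(1) unfolding disp_def by blast
qed

subsection \<open>The Hamiltonian vector field\<close>

lemma ham_coord:
  "fst (ham \<psi> z) $ j = - dd \<psi> z (dirPhi j)" "fst (snd (ham \<psi> z)) = - dd \<psi> z dirXi"
  "fst (snd (snd (ham \<psi> z))) $ j = dd \<psi> z (dirI j)" "snd (snd (snd (ham \<psi> z))) = dd \<psi> z dirEta"
  by (simp_all add: ham_def)

lemma ham_holo:
  assumes "open T" "holo_fun_on T \<psi>" "coord l" shows "holo_fun_on T (\<lambda>z. l (ham \<psi> z))"
  using assms(3) holo_dir_deriv[OF assms(1,2)] holo_uminus(1)[OF holo_dir_deriv[OF assms(1,2)]]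
  by (auto simp: coord_def ham_coord)

lemma phase_expand:
  "(u :: 'n::finite phase) = (\<Sum>j\<in>UNIV. cscale (fst u $ j) (dirI j)) + cscale (fst (snd u)) dirEta
     + (\<Sum>j\<in>UNIV. cscale (fst (snd (snd u)) $ j) (dirPhi j)) + cscale (snd (snd (snd u))) dirXi"
  by (rule phase_eqI)
     (simp_all add: fst_sum' snd_sum' axis_def if_distrib[of "\<lambda>x. _ * x"] cong: if_cong)

lemma symp_form_alt: "symp_form u w = (\<Sum>j\<in>UNIV. fst u $ j * fst (snd (snd w)) $ j - fst (snd (snd u)) $ j * fst w $ j)
    + (fst (snd u) * snd (snd (snd w)) - snd (snd (snd u)) * fst (snd w))"
  by (cases u; cases w) (simp add: symp_form_def)

lemma symp_form_ham:
  assumes "holo_fun_on T \<psi>" "z \<in> T" shows "symp_form (ham \<psi> z) u = - dd \<psi> z u"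
proof -
  have "dd \<psi> z u = (\<Sum>j\<in>UNIV. fst u $ j * dd \<psi> z (dirI j)) + fst (snd u) * dd \<psi> z dirEta
     + (\<Sum>j\<in>UNIV. fst (snd (snd u)) $ j * dd \<psi> z (dirPhi j)) + snd (snd (snd u)) * dd \<psi> z dirXi"
    by (subst phase_expand[of u])
       (simp only: holo_linear(1)[OF assms] holo_linear(6)[OF assms] holo_derivD(2)[OF assms])
  then show ?thesis
    by (simp add: symp_form_alt ham_coord sum_subtractf sum_negf mult.commute algebra_simps)
qed

lemma symp_form_add:
  "symp_form (u + u') w = symp_form u w + symp_form u' w" "symp_form u (w + w') = symp_form u w + symp_form u w'"
  "symp_form (r *\<^sub>R u) w = of_real r * symp_form u w" "symp_form u (r *\<^sub>R w) = of_real r * symp_form u w"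
  "symp_form u w = - symp_form w u" "symp_form (cscale c u) w = c * symp_form u w"
  by (simp_all add: symp_form_alt algebra_simps sum.distrib sum_subtractf sum_distrib_left scaleR_conv_of_real[where 'a=complex])

lemma symp_form_bound: "cmod (symp_form u (w :: 'n::finite phase)) \<le> 2 * (real CARD('n) + 1) * (norm u * norm w)"
proof -
  have m: "cmod (x * y) \<le> norm u * norm w" if "cmod x \<le> norm u" "cmod y \<le> norm w" for x y
    unfolding norm_mult by (rule mult_mono[OF that]) auto
  have m2: "cmod (x * y - x' * y') \<le> 2 * (norm u * norm w)"
    if "cmod x \<le> norm u" "cmod y \<le> norm w" "cmod x' \<le> norm u" "cmod y' \<le> norm w" for x y x' y'
    using norm_triangle_ineq4[of "x * y" "x' * y'"] m[OF that(1,2)] m[OF that(3,4)] by linarith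
  have "cmod (symp_form u w) \<le> (\<Sum>j\<in>(UNIV::'n set). 2 * (norm u * norm w)) + 2 * (norm u * norm w)"
    unfolding symp_form_alt
  proof (rule norm_triangle_le, rule add_mono)
    show "cmod (\<Sum>j\<in>UNIV. fst u $ j * fst (snd (snd w)) $ j - fst (snd (snd u)) $ j * fst w $ j)
        \<le> (\<Sum>j\<in>(UNIV::'n set). 2 * (norm u * norm w))"
      by (rule order_trans[OF norm_sum]) (rule sum_mono, rule m2; rule phase_comp_le_norm)
    show "cmod (fst (snd u) * snd (snd (snd w)) - snd (snd (snd u)) * fst (snd w)) \<le> 2 * (norm u * norm w)"
      by (rule m2; rule phase_comp_le_norm)
  qed
  then show ?thesis by (simp add: algebra_simps)
qed

lemma symp_form_blin: "bounded_linear (\<lambda>u. symp_form u (w :: 'n::finite phase))"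
  by (rule bounded_linear_intro[where K = "2 * (real CARD('n) + 1) * norm w"])
     (use symp_form_bound[of _ w] in \<open>auto simp: symp_form_add(1,3) scaleR_conv_of_real[where 'a=complex] mult_ac\<close>)

text \<open>The derivative of a Hamiltonian vector field is infinitesimally symplectic because second
  derivatives of the Hamiltonian commute.\<close>

lemma ham_infinitesimally_symplectic:
  assumes "open T" "holo_fun_on T \<psi>" "z \<in> T"
  shows "symp_form (dd (ham \<psi>) z u) w + symp_form u (dd (ham \<psi>) z w) = 0"
proof -
  have hm: "holo_map_on T (ham \<psi>)" by (rule holo_map_coords(1)[OF ham_holo[OF assms(1,2)]])
  have key: "symp_form (dd (ham \<psi>) z u) w = - dd (\<lambda>z. dd \<psi> z w) z u" for u w
  proof -
    have l: "holo_fun_on UNIV (\<lambda>u. symp_form u w)" "dd (\<lambda>u. symp_form u w) z' = (\<lambda>u. symp_form u w)" for z'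
      by (rule holo_linear_fun[OF symp_form_blin symp_form_add(6)])+
    have "symp_form (dd (ham \<psi>) z u) w = dd (\<lambda>z. symp_form (ham \<psi> z) w) z u"
      using holo_compose(2)[OF l(1) hm _ assms(3), of u] by (simp add: l(2))
    also have "\<dots> = dd (\<lambda>z. - dd \<psi> z w) z u"
      by (simp add: dd_cong[OF assms(1,3) symp_form_ham[OF assms(2)]])
    also have "\<dots> = - dd (\<lambda>z. dd \<psi> z w) z u" by (rule holo_uminus(2)[OF holo_dir_deriv[OF assms(1,2)] assms(3)])
    finally show ?thesis .
  qed
  show ?thesis
    using key[of u w] key[of w u] dir_deriv_commute[OF assms, of u w] symp_form_add(5)[of u "dd (ham \<psi>) z w"] by simp
qed

lemma real_deriv:
  assumes hol: "holo_fun_on T F" and "open T" and re: "\<And>w. w \<in> T \<Longrightarrow> real_phase w \<Longrightarrow> F w \<in> \<real>"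
    and z: "z \<in> T" "real_phase z" and u: "real_phase u"
  shows "dd F z u \<in> \<real>"
proof -
  have rp: "real_phase (z + t *\<^sub>R u)" for t
    using z(2) u by (cases z; cases u) (auto simp: real_phase_def real_cvec_def scaleR_conv_of_real[where 'a=complex])
  have "((\<lambda>t. z + t *\<^sub>R u) has_derivative (\<lambda>t. t *\<^sub>R u)) (at 0)" by (auto intro!: derivative_eq_intros)
  then have "((\<lambda>t. F (z + t *\<^sub>R u)) has_derivative (\<lambda>t. dd F z (t *\<^sub>R u))) (at (0::real))"
    by (rule has_derivative_compose) (use holo_derivD(1)[OF hol z(1)] in simp)
  then have d: "((\<lambda>t. Im (F (z + t *\<^sub>R u))) has_derivative (\<lambda>t. Im (dd F z (t *\<^sub>R u)))) (at (0::real))"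
    by (rule bounded_linear.has_derivative[OF bounded_linear_Im])
  have "\<forall>\<^sub>F t in at (0::real). Im (F (z + t *\<^sub>R u)) = 0"
  proof -
    have "((\<lambda>t. z + t *\<^sub>R u) \<longlongrightarrow> z + 0 *\<^sub>R u) (at (0::real))" by (intro tendsto_intros)
    then have "\<forall>\<^sub>F t in at (0::real). z + t *\<^sub>R u \<in> T" using topological_tendstoD[OF _ \<open>open T\<close>] z(1) by fastforce
    then show ?thesis by eventually_elim (use re rp in \<open>auto simp: complex_is_Real_iff\<close>)
  qed
  then have "((\<lambda>t::real. 0::real) has_derivative (\<lambda>t. Im (dd F z (t *\<^sub>R u)))) (at 0)"
    using has_derivative_transform_eventually[OF d] re[OF z] by (simp add: complex_is_Real_iff)
  then have "(\<lambda>t. Im (dd F z (t *\<^sub>R u))) = (\<lambda>t. 0)"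
    using has_derivative_unique has_derivative_const by blast
  then have "Im (dd F z (1 *\<^sub>R u)) = 0" by metis
  then show ?thesis by (simp add: complex_is_Real_iff)
qed

lemma real_phase_dirs: "real_phase (dirI j)" "real_phase (dirPhi j)" "real_phase dirXi" "real_phase dirEta"
  by (auto simp: real_phase_def real_cvec_def axis_def)

lemma real_phase_alt: "real_phase z \<longleftrightarrow> (\<forall>j. fst z $ j \<in> \<real>) \<and> fst (snd z) \<in> \<real> \<and>
    (\<forall>j. fst (snd (snd z)) $ j \<in> \<real>) \<and> snd (snd (snd z)) \<in> \<real>"
  by (cases z) (simp add: real_phase_def real_cvec_def)

lemma ham_real:
  assumes "holo_fun_on T \<psi>" "open T" "\<And>w. w \<in> T \<Longrightarrow> real_phase w \<Longrightarrow> \<psi> w \<in> \<real>" "z \<in> T" "real_phase z"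
  shows "real_phase (ham \<psi> z)"
  unfolding real_phase_alt ham_coord
  by (intro conjI allI Reals_minus real_deriv[OF assms] real_phase_dirs)

lemma shift_angle_alt: "shift_angle j z = z + (0, 0, axis j (complex_of_real (2 * pi)), 0)"
  by (cases z) (simp add: shift_angle_def)

lemma shift_cdomain [simp]: "shift_angle j z \<in> cdomain V a s \<longleftrightarrow> z \<in> cdomain V a s"
proof -
  have "Im (axis j (complex_of_real (2 * pi)) $ i) = 0" for i by (simp add: axis_def)
  then show ?thesis by (simp add: shift_angle_alt mem_cdomain)
qed

lemma fmode_shift: "fmode k (shift_angle j z) = fmode k z"
proof -
  have "fmode k (shift_angle j z) = fmode k z * exp (\<i> * (of_real (2 * pi) * of_int (k $ j)))"
    by (simp add: fmode_alt shift_angle_alt axis_def if_distrib[of "\<lambda>x. x * _"] distrib_right sum.distrib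
        distrib_left exp_add cong: if_cong)
  also have "exp (\<i> * (of_real (2 * pi) * of_int (k $ j))) = 1"
    using exp_integer_2pi[of "of_int (k $ j)"] by (simp add: mult_ac)
  finally show ?thesis by simp
qed

lemma fb_shift: assumes "fb V a s F B" "z \<in> cdomain V a s" shows "F (shift_angle j z) = F z"
proof -
  obtain c b where f: "fser V a s F c b B" using assms by (auto simp: fb_def)
  have "c k (shift_angle j z) = c k z" for k
  proof -
    have "slow_part (shift_angle j z) = slow_part z" by (simp add: slow_part_def shift_angle_alt)
    then show ?thesis using fserD(2)[OF f, of k] assms(2) shift_cdomain[of j z V a s] unfolding slow_def by metis
  qed
  then show ?thesis
    using fserD(7)[OF f assms(2)] fserD(7)[OF f, of "shift_angle j z"] assms(2) has_sum_unique
    by (simp add: fmode_shift) blast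
qed

lemma ham_shift:
  assumes F: "fb V a s \<psi> B" and z: "z \<in> cdomain V a s" shows "ham \<psi> (shift_angle j z) = ham \<psi> z"
proof -
  have "dd \<psi> (shift_angle j z) u = dd \<psi> z u" for u
  proof -
    have m: "holo_map_on (cdomain V a s) (shift_angle j)"
      using holo_map_affine[where l = "\<lambda>z. z" and w = "(0, 0, axis j (complex_of_real (2 * pi)), 0)" and S = "cdomain V a s"]
      by (auto simp: shift_angle_alt[abs_def])
    have d: "dd (shift_angle j) z u = u"
      unfolding shift_angle_alt[abs_def] by (rule dd_eq) (auto intro!: derivative_eq_intros)
    have "dd \<psi> z u = dd (\<lambda>z. \<psi> (shift_angle j z)) z u"
      by (simp add: dd_cong[OF open_cdomain z fb_shift[OF F]])
    also have "\<dots> = dd \<psi> (shift_angle j z) u"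
    proof -
      have "shift_angle j ` cdomain V a s \<subseteq> cdomain V a s" by (simp add: image_subset_iff)
      from holo_compose(2)[OF fb_holo[OF F] m this z, of u] show ?thesis by (simp only: d)
    qed
    finally show ?thesis by simp
  qed
  then show ?thesis by (simp add: ham_def)
qed

lemma taylor_power_bound:
  fixes t h :: real
  assumes "\<bar>t\<bar> \<le> 1" "\<bar>t + h\<bar> \<le> 1"
  shows "\<bar>(t + h) ^ Suc n - t ^ Suc n - real (Suc n) * h * t ^ n\<bar> \<le> (real (Suc n))\<^sup>2 * h\<^sup>2"
proof (induction n)
  case (Suc n)
  let ?P = "(t + h) ^ Suc n - t ^ Suc n - real (Suc n) * h * t ^ n"
  have "(t + h) ^ Suc (Suc n) - t ^ Suc (Suc n) - real (Suc (Suc n)) * h * t ^ Suc n = (t + h) * ?P + real (Suc n) * t ^ n * h\<^sup>2"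
    by (simp add: algebra_simps power2_eq_square)
  also have "\<bar>\<dots>\<bar> \<le> \<bar>t + h\<bar> * \<bar>?P\<bar> + real (Suc n) * \<bar>t ^ n\<bar> * h\<^sup>2"
    by (rule order_trans[OF abs_triangle_ineq]) (simp add: abs_mult)
  also have "\<dots> \<le> 1 * ((real (Suc n))\<^sup>2 * h\<^sup>2) + real (Suc n) * 1 * h\<^sup>2"
    using Suc assms by (intro add_mono mult_mono) (auto simp: power_abs power_le_one)
  also have "\<dots> \<le> (real (Suc (Suc n)))\<^sup>2 * h\<^sup>2"
  proof -
    have "(real (Suc n))\<^sup>2 + real (Suc n) \<le> (real (Suc (Suc n)))\<^sup>2" by (simp add: power2_eq_square algebra_simps)
    from mult_right_mono[OF this zero_le_power2[of h]] show ?thesis by (simp add: distrib_right)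
  qed
  finally show ?case .
qed simp

lemma holo_map_add_scaleR:
  assumes "holo_map_on T A" "holo_map_on T B"
  shows "holo_map_on T (\<lambda>z. A z + r *\<^sub>R B z)"
    "z \<in> T \<Longrightarrow> dd (\<lambda>z. A z + r *\<^sub>R B z) z u = dd A z u + r *\<^sub>R dd B z u"
proof -
  have d: "((\<lambda>z. A z + r *\<^sub>R B z) has_derivative (\<lambda>u. dd A z u + r *\<^sub>R dd B z u)) (at z)" if "z \<in> T" for z
    by (intro has_derivative_add has_derivative_scaleR_right holo_map_derivD(1)[OF assms(1) that] holo_map_derivD(1)[OF assms(2) that])
  show "holo_map_on T (\<lambda>z. A z + r *\<^sub>R B z)"
    unfolding holo_map_on_def
    by (rule ballI, rule exI, rule conjI, erule d)
       (simp add: holo_map_derivD(2)[OF assms(1)] holo_map_derivD(2)[OF assms(2)] cscale_algebra)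
  show "z \<in> T \<Longrightarrow> dd (\<lambda>z. A z + r *\<^sub>R B z) z u = dd A z u + r *\<^sub>R dd B z u" using dd_eq[OF d] by blast
qed

text \<open>The generating function lives on a domain from which the fraction \<open>c\<close> of a prescribed loss
  \<open>(da, ds)\<close> is taken off in \<open>dom c\<close>.  The smallness of \<open>X\<close> makes the vector field move points
  by at most a sixteenth of the loss, and makes the Lie series converge on \<open>dom (13/16)\<close>.  Polygons start in
  \<open>dom (15/16)\<close> and stay in \<open>dom (14/16)\<close>; the last sixteenth is needed to apply the inverse.\<close>

locale ham_flow =
  fixes V :: "(real^'n::finite) set" and a s da ds :: real and \<psi> :: "'n phase \<Rightarrow> complex"
    and x :: "int^'n \<Rightarrow> 'n phase \<Rightarrow> complex" and y :: "int^'n \<Rightarrow> real" and S :: "(int^'n) set" and X :: real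
  assumes trig: "trig V a s \<psi> x y S X" and da: "0 < da" and ds: "0 < ds" and dss: "ds \<le> s"
    and small: "32 * X \<le> da * ds"
begin

definition dom :: "real \<Rightarrow> 'n phase set" where
  "dom c = cdomain V (a - c * da) (s - c * ds)"

lemma open_dom [simp]: "open (dom c)" by (simp add: dom_def)

lemma dom_mono: "c' \<le> c \<Longrightarrow> dom c \<subseteq> dom c'"
  unfolding dom_def using da ds by (intro cdomain_mono) (simp_all add: mult_right_mono)

lemma dom_add: "z \<in> dom c \<Longrightarrow> disp (t * da) (t * ds) u \<Longrightarrow> c' \<le> c - t \<Longrightarrow> z + u \<in> dom c'"
  using cdomain_add[of z V "a - c * da" "s - c * ds" "t * da" "t * ds" u] subsetD[OF dom_mono[of c' "c - t"]]
  by (simp add: dom_def algebra_simps)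

lemma psi_fb: "fb V a s \<psi> X" by (rule fser_fb[OF trig_fser[OF trig]])
lemma X0: "0 \<le> X" by (rule fb_nonneg[OF psi_fb])
lemma psi_holo: "holo_fun_on (cdomain V a s) \<psi>" by (rule fb_holo[OF psi_fb])
lemma dom_sub: "0 \<le> c \<Longrightarrow> dom c \<subseteq> cdomain V a s"
  unfolding dom_def using da ds by (intro cdomain_mono) simp_all

lemma displacement_small: "2 * X / ds \<le> 1/16 * da" "2 * X / da \<le> 1/16 * ds" "0 \<le> 2 * X / ds" "0 \<le> 2 * X / da"
  using small da ds X0 by (simp_all add: pos_divide_le_eq mult.commute)

lemma coord_ham_fb:
  assumes "coord l" "0 < c" "c \<le> 1"
  shows "fb V (a - c * da) (s - c * ds) (\<lambda>z. l (ham \<psi> z)) (X / (c * ds) + X / (c * da))"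
proof -
  have p: "0 < c * da" "0 < c * ds" using assms da ds by auto
  have n: "0 \<le> X / (c * ds)" "0 \<le> X / (c * da)" using p X0 by auto
  have e: "1 / (exp 1 * (c * ds)) * X \<le> X / (c * ds)"
  proof -
    have "X / (c * ds) * (1 / exp 1) \<le> X / (c * ds) * 1" by (intro mult_left_mono n) auto
    then show ?thesis by (simp add: mult_ac)
  qed
  have 1: "fb V (a - c * da) (s - c * ds) (\<lambda>z. - dd \<psi> z (dirPhi j)) (X / (c * ds) + X / (c * da))" for j
    by (rule fb_mono[OF fb_uminus[OF fb_deriv_phi[OF psi_fb, of "s - c * ds"]]]) (use p e n in \<open>auto\<close>)
  have 2: "fb V (a - c * da) (s - c * ds) (\<lambda>z. - dd \<psi> z dirXi) (X / (c * ds) + X / (c * da))"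
    by (rule fb_mono[OF fb_uminus[OF fb_deriv_slow_dir[OF psi_fb disp_dirs(2), where \<rho> = "c * ds" and ?a0.0 = "a - c * da" and ?s0.0 = "s - c * ds"]]]) (use p n in auto)
  have 3: "fb V (a - c * da) (s - c * ds) (\<lambda>z. dd \<psi> z (dirI j)) (X / (c * ds) + X / (c * da))" for j
    by (rule fb_mono[OF fb_deriv_slow_dir[OF psi_fb disp_dirs(1), where \<rho> = "c * da" and ?a0.0 = "a - c * da" and ?s0.0 = "s - c * ds"]]) (use p n in auto)
  have "fb V (a - c * da) (s - c * ds) (\<lambda>z. 0) (X / (c * ds) + X / (c * da))" by (rule fb_zero) (use n in simp)
  then have 4: "fb V (a - c * da) (s - c * ds) (\<lambda>z. dd \<psi> z dirEta) (X / (c * ds) + X / (c * da))"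
  proof (rule fb_cong)
    fix z assume "z \<in> cdomain V (a - c * da) (s - c * ds)"
    then have "z \<in> cdomain V a s" using dom_sub[of c] assms by (auto simp: dom_def)
    then show "0 = dd \<psi> z dirEta" using fb_deriv_eta[OF psi_fb] by simp
  qed
  show ?thesis using assms(1) 1 2 3 4 by (auto simp: coord_def ham_coord)
qed

lemma disp_ham: assumes "z \<in> dom (13/16)" shows "disp (2 * X / ds) (2 * X / da) (ham \<psi> z)"
proof -
  let ?c = "13/16 :: real"
  have p: "0 < ?c * da" "0 < ?c * ds" using da ds by auto
  have z: "z \<in> cdomain V (a - ?c * da) (s - ?c * ds)" using assms by (simp add: dom_def)
  have e1: "1 / (exp 1 * (?c * ds)) * X \<le> 2 * X / ds"
  proof -
    have "16 / (13 * exp (1::real)) \<le> 2" using exp_ge_add_one_self[of "1::real"] by (simp add: field_simps)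
    from mult_right_mono[OF this, of "X / ds"] show ?thesis using X0 ds by (simp add: mult_ac)
  qed
  have e2: "1 / (?c * d) * X \<le> 2 * X / d" if "0 < d" for d
    using X0 that by (simp add: field_simps)
  have z1: "z \<in> cdomain V a (s - ?c * ds)" by (rule cdomain_monoD[OF z]) (use p in auto)
  have 1: "cmod (dd \<psi> z (dirPhi j)) \<le> 2 * X / ds" for j
    by (rule order_trans[OF fb_bound[OF fb_deriv_phi[OF psi_fb, of "s - ?c * ds"] z1]]) (use p e1 in auto)
  have 2: "cmod (dd \<psi> z dirXi) \<le> 2 * X / ds"
    by (rule order_trans[OF fb_bound[OF fb_deriv_slow_dir[OF psi_fb disp_dirs(2), where \<rho> = "?c * ds" and ?a0.0 = "a - ?c * da" and ?s0.0 = "s - ?c * ds"] z] e2[OF ds]]) (use p in auto)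
  have 3: "cmod (dd \<psi> z (dirI j)) \<le> 2 * X / da" for j
    by (rule order_trans[OF fb_bound[OF fb_deriv_slow_dir[OF psi_fb disp_dirs(1), where \<rho> = "?c * da" and ?a0.0 = "a - ?c * da" and ?s0.0 = "s - ?c * ds"] z] e2[OF da]]) (use p in auto)
  have 4: "dd \<psi> z dirEta = 0" by (rule fb_deriv_eta[OF psi_fb subsetD[OF dom_sub assms]]) simp
  show ?thesis unfolding disp_def ham_coord using 1 2 3 4 displacement_small by simp
qed

lemma disp_ham': assumes "z \<in> dom (13/16)" shows "disp (1/16 * da) (1/16 * ds) (ham \<psi> z)"
  by (rule disp_mono[OF disp_ham[OF assms]]) (rule displacement_small)+

subsection \<open>Lie series\<close>

lemma lie_iterate_quarter:
  assumes W: "fb V (a - da / 4) (s - ds / 4) W B"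
  shows "fb V (a - 13/16 * da) (s - 13/16 * ds) ((lie \<psi> ^^ n) W) (fact n * (3/5) ^ n * B)"
    "fb V (a - da) (s - ds) ((lie \<psi> ^^ n) W) (fact n * (1/3) ^ n * B)"
proof -
  have t: "trig V (a - da / 4) (s - ds / 4) \<psi> x y S X" by (rule trig_mono[OF trig]) (use da ds in auto)
  have B0: "0 \<le> B" by (rule fb_nonneg[OF W])
  have q: "2 * exp 1 * X / (c * da * (c * ds)) \<le> r" if "0 < c" "3 / 16 \<le> r * c\<^sup>2" for c r
  proof -
    have "2 * exp 1 * X \<le> 6 * X" using X0 exp_le by (intro mult_right_mono) auto
    also have "\<dots> \<le> (3/16) * (da * ds)" using small by simp
    also have "\<dots> \<le> r * c\<^sup>2 * (da * ds)" by (rule mult_right_mono[OF that(2)]) (use da ds in auto)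
    finally show ?thesis using that(1) da ds by (simp add: pos_divide_le_eq power2_eq_square mult_ac)
  qed
  have gen: "fb V (a - da / 4 - c * da) (s - ds / 4 - c * ds) ((lie \<psi> ^^ n) W) (fact n * r ^ n * B)"
    if "0 < c" "c \<le> 3/4" "3 / 16 \<le> r * c\<^sup>2" for c r
  proof (rule fb_mono[OF fb_lie_iterate[OF t W]])
    show "0 < c * da" "0 < c * ds" using that da ds by auto
    have "c * ds \<le> 3/4 * ds" by (rule mult_right_mono) (use that ds in auto)
    then show "c * ds \<le> s - ds / 4" using dss by simp
    show "fact n * (2 * exp 1 * X / (c * da * (c * ds))) ^ n * B \<le> fact n * r ^ n * B"
      by (intro mult_right_mono mult_left_mono power_mono q that B0) (use that X0 da ds in auto)
  qed auto
  have e: "a - da / 4 - 9/16 * da = a - 13/16 * da" "s - ds / 4 - 9/16 * ds = s - 13/16 * ds"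
    "a - da / 4 - 3/4 * da = a - da" "s - ds / 4 - 3/4 * ds = s - ds" by simp_all
  show "fb V (a - 13/16 * da) (s - 13/16 * ds) ((lie \<psi> ^^ n) W) (fact n * (3/5) ^ n * B)"
    using gen[of "9/16" "3/5"] unfolding e by (simp add: power2_eq_square)
  show "fb V (a - da) (s - ds) ((lie \<psi> ^^ n) W) (fact n * (1/3) ^ n * B)"
    using gen[of "3/4" "1/3"] unfolding e by (simp add: power2_eq_square)
qed

context
  fixes W B assumes W: "fb V (a - da / 4) (s - ds / 4) W B"
begin

lemma W_iter_fb: "fb V (a - 13/16 * da) (s - 13/16 * ds) ((lie \<psi> ^^ n) W) (fact n * (3/5) ^ n * B)"
  by (rule lie_iterate_quarter(1)[OF W])

lemma W_iter: "z \<in> dom (13/16) \<Longrightarrow> cmod ((lie \<psi> ^^ n) W z) \<le> fact n * (3/5) ^ n * B"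
  "holo_fun_on (dom (13/16)) ((lie \<psi> ^^ n) W)"
  using fb_bound[OF W_iter_fb] fb_holo[OF W_iter_fb] by (auto simp: dom_def)

lemma B0: "0 \<le> B" by (rule fb_nonneg[OF W])

lemma series_term_bound:
  assumes "\<bar>t\<bar> \<le> 1" "z \<in> dom (13/16)"
  shows "cmod (of_real (t ^ Suc n / fact (Suc n)) * (lie \<psi> ^^ n) W z) \<le> (3/5) ^ n * B"
proof -
  have f: "(fact n :: real) \<le> fact (Suc n)" by (simp add: fact_mono)
  have "cmod (of_real (t ^ Suc n / fact (Suc n)) * (lie \<psi> ^^ n) W z) \<le> 1 / fact (Suc n) * (fact n * (3/5) ^ n * B)"
    unfolding norm_mult norm_of_real abs_divide
    by (intro mult_mono divide_mono W_iter(1)[OF assms(2)]) (use assms in \<open>auto simp: power_abs power_le_one simp del: power_Suc\<close>)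
  also have "\<dots> = fact n / fact (Suc n) * ((3/5) ^ n * B)" by simp
  also have "\<dots> \<le> 1 * ((3/5) ^ n * B)" by (rule mult_right_mono) (use f B0 in \<open>simp_all del: fact_Suc\<close>)
  finally show ?thesis by simp
qed

lemma geo_summable: "summable (\<lambda>n. (3/5) ^ n * B)" "(\<lambda>n. (3/5) ^ n * B) summable_on UNIV"
proof -
  show "summable (\<lambda>n. (3/5) ^ n * B)" by (intro summable_mult2 summable_geometric) simp
  then show "(\<lambda>n. (3/5) ^ n * B) summable_on UNIV" using B0 by (subst summable_on_UNIV_nonneg_real_iff) auto
qed

lemma series_has_sum:
  assumes "\<bar>t\<bar> \<le> 1" "z \<in> dom (13/16)"
  shows "((\<lambda>n. of_real (t ^ Suc n / fact (Suc n)) * (lie \<psi> ^^ n) W z) has_sum lie_series \<psi> W t z) UNIV"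
    "(\<lambda>n. of_real (t ^ Suc n / fact (Suc n)) * (lie \<psi> ^^ n) W z) sums lie_series \<psi> W t z"
proof -
  have "((\<lambda>n. of_real (t ^ Suc n / fact (Suc n)) * (lie \<psi> ^^ n) W z) has_sum
      infsum (\<lambda>n. of_real (t ^ Suc n / fact (Suc n)) * (lie \<psi> ^^ n) W z) UNIV) UNIV"
    by (rule has_sum_infsum, rule abs_summable_summable, rule summable_on_comparison_test[OF geo_summable(2)])
       (use series_term_bound[OF assms] in auto)
  moreover from has_sum_imp_sums[OF this]
  have "lie_series \<psi> W t z = infsum (\<lambda>n. of_real (t ^ Suc n / fact (Suc n)) * (lie \<psi> ^^ n) W z) UNIV"
    unfolding lie_series_def by (simp add: sums_iff)
  ultimately show "((\<lambda>n. of_real (t ^ Suc n / fact (Suc n)) * (lie \<psi> ^^ n) W z) has_sum lie_series \<psi> W t z) UNIV" by simp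
  then show "(\<lambda>n. of_real (t ^ Suc n / fact (Suc n)) * (lie \<psi> ^^ n) W z) sums lie_series \<psi> W t z"
    by (rule has_sum_imp_sums)
qed

lemma series_bound:
  assumes "\<bar>t\<bar> \<le> 1" "z \<in> dom (13/16)" shows "cmod (lie_series \<psi> W t z) \<le> 5/2 * B"
proof -
  have "cmod (lie_series \<psi> W t z) \<le> infsum (\<lambda>n. (3/5) ^ n * B) UNIV"
    using has_sum_tail_bound[OF series_has_sum(1)[OF assms] series_term_bound[OF assms] geo_summable(2), of "{}"] by simp
  also have "\<dots> = (\<Sum>n. (3/5) ^ n * B)"
    using has_sum_imp_sums[OF has_sum_infsum[OF geo_summable(2)]] by (simp add: sums_iff)
  also have "\<dots> = 5/2 * B" using suminf_mult2[OF summable_geometric[of "3/5::real"], of B] by (simp add: suminf_geometric)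
  finally show ?thesis .
qed

lemma series_holo:
  assumes "\<bar>t\<bar> \<le> 1"
  shows "holo_fun_on (dom (13/16)) (lie_series \<psi> W t)"
    "z \<in> dom (13/16) \<Longrightarrow> ((\<lambda>n. of_real (t ^ Suc n / fact (Suc n)) * (lie \<psi> ^^ Suc n) W z) has_sum lie \<psi> (lie_series \<psi> W t) z) UNIV"
proof -
  note h = W_iter(2)
  show "holo_fun_on (dom (13/16)) (lie_series \<psi> W t)"
    by (rule holo_has_sum(1)[OF open_dom holo_cmult(1)[OF h] series_term_bound[OF assms] geo_summable(2) series_has_sum(1)[OF assms]])
  assume z: "z \<in> dom (13/16)"
  have "((\<lambda>n. dd (\<lambda>z. of_real (t ^ Suc n / fact (Suc n)) * (lie \<psi> ^^ n) W z) z (ham \<psi> z)) has_sum lie \<psi> (lie_series \<psi> W t) z) UNIV"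
    unfolding lie_def[of \<psi> "lie_series \<psi> W t"]
    by (rule holo_has_sum(2)[OF open_dom holo_cmult(1)[OF h] series_term_bound[OF assms] geo_summable(2) series_has_sum(1)[OF assms] z])
  then show "((\<lambda>n. of_real (t ^ Suc n / fact (Suc n)) * (lie \<psi> ^^ Suc n) W z) has_sum lie \<psi> (lie_series \<psi> W t) z) UNIV"
    unfolding holo_cmult(2)[OF h z] by (simp add: lie_def)
qed

definition quad_const :: real where "quad_const = (\<Sum>n. real (Suc n) * ((3/5) ^ n * B))"

text \<open>Termwise this is the Taylor formula for powers of \<open>t\<close>, which says that the Lie series \<open>S\<close> satisfies
  \<open>S' = W + lie \<psi> S\<close>.\<close>

lemma series_taylor:
  assumes t: "\<bar>t\<bar> \<le> 1" "\<bar>t + h\<bar> \<le> 1" and z: "z \<in> dom (13/16)"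
  shows "cmod (lie_series \<psi> W (t + h) z - lie_series \<psi> W t z - of_real h * (W z + lie \<psi> (lie_series \<psi> W t) z)) \<le> quad_const * h\<^sup>2"
proof -
  let ?w = "\<lambda>n. (lie \<psi> ^^ n) W z"
  have "(\<lambda>n. of_real (t ^ Suc n / fact (Suc n)) * ?w (Suc n)) sums lie \<psi> (lie_series \<psi> W t) z"
    by (rule has_sum_imp_sums[OF series_holo(2)[OF t(1) z]])
  then have "(\<lambda>n. of_real (t ^ n / fact n) * ?w n) sums (lie \<psi> (lie_series \<psi> W t) z + W z)"
    using sums_Suc_iff[of "\<lambda>n. of_real (t ^ n / fact n) * ?w n"] by simp
  then have "(\<lambda>n. of_real h * (of_real (t ^ n / fact n) * ?w n)) sums (of_real h * (W z + lie \<psi> (lie_series \<psi> W t) z))"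
    unfolding add.commute[of "W z"] by (rule sums_mult)
  from sums_diff[OF sums_diff[OF series_has_sum(2)[OF t(2) z] series_has_sum(2)[OF t(1) z]] this]
  have sm: "(\<lambda>n. of_real ((t + h) ^ Suc n / fact (Suc n)) * ?w n - of_real (t ^ Suc n / fact (Suc n)) * ?w n
      - of_real h * (of_real (t ^ n / fact n) * ?w n)) sums
      (lie_series \<psi> W (t + h) z - lie_series \<psi> W t z - of_real h * (W z + lie \<psi> (lie_series \<psi> W t) z))"
    (is "?f sums _") .
  have bd: "cmod (?f n) \<le> real (Suc n) * ((3/5) ^ n * B) * h\<^sup>2" for n
  proof -
    have e: "t ^ n / fact n = real (Suc n) * t ^ n / fact (Suc n)" by (simp add: fact_Suc del: of_nat_Suc)
    have "?f n = of_real (((t + h) ^ Suc n - t ^ Suc n - real (Suc n) * h * t ^ n) / fact (Suc n)) * ?w n"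
    proof -
      have "((t + h) ^ Suc n - t ^ Suc n - real (Suc n) * h * t ^ n) / fact (Suc n)
          = (t + h) ^ Suc n / fact (Suc n) - t ^ Suc n / fact (Suc n) - h * (t ^ n / fact n)"
        unfolding e by (simp only: diff_divide_distrib times_divide_eq_right mult_ac)
      then show ?thesis by (simp only: of_real_diff of_real_mult left_diff_distrib mult.assoc)
    qed
    also have "cmod \<dots> \<le> (real (Suc n))\<^sup>2 * h\<^sup>2 / fact (Suc n) * (fact n * (3/5) ^ n * B)"
      unfolding norm_mult norm_of_real abs_divide
      by (intro mult_mono divide_mono taylor_power_bound t W_iter(1)[OF z]) auto
    also have "\<dots> = real (Suc n) * ((3/5) ^ n * B) * h\<^sup>2" by (simp add: power2_eq_square)
    finally show ?thesis .
  qed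
  have "summable (\<lambda>n. real (Suc n) * (3/5::real) ^ n)"
  proof -
    have "(\<lambda>n. of_nat (Suc n) * (3/5::real) ^ n) sums (1 / (1 - 3/5)\<^sup>2)" by (rule geometric_deriv_sums) simp
    then show ?thesis by (simp add: sums_iff)
  qed
  from summable_mult2[OF this, of B] have s1: "summable (\<lambda>n. real (Suc n) * ((3/5) ^ n * B))" by (simp only: mult.assoc)
  have "cmod (suminf ?f) \<le> (\<Sum>n. real (Suc n) * ((3/5) ^ n * B) * h\<^sup>2)"
    by (rule norm_suminf_le[OF bd summable_mult2[OF s1]])
  also have "\<dots> = quad_const * h\<^sup>2" unfolding quad_const_def by (rule suminf_mult2[OF s1, symmetric])
  finally show ?thesis using sm by (simp add: sums_iff)
qed

text \<open>Moving the point by an Euler step has the same effect as advancing the time of the Lie series, up to an error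
  of second order.\<close>

lemma lie_series_step:
  assumes g: "cmod (g (z + h *\<^sub>R ham \<psi> z) - g z - of_real h * W z) \<le> Cg * h\<^sup>2"
    and z: "z \<in> dom (14/16)" and h: "0 < h" "h < 1/2" and t: "\<bar>t\<bar> \<le> 1" "\<bar>t + h\<bar> \<le> 1"
  shows "cmod ((g (z + h *\<^sub>R ham \<psi> z) + lie_series \<psi> W t (z + h *\<^sub>R ham \<psi> z)) - (g z + lie_series \<psi> W (t + h) z))
    \<le> (Cg + 20 * B + quad_const) * h\<^sup>2"
proof -
  have z13: "z \<in> dom (13/16)" using z dom_mono[of "13/16" "14/16"] by auto
  have "z + cscale \<zeta> (ham \<psi> z) \<in> dom (13/16)" if "cmod \<zeta> < 1" for \<zeta>
    by (rule dom_add[OF z, of "1/16"]) (use disp_cscale[OF disp_ham'[OF z13], of \<zeta> 1] that in auto)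
  then have c: "cmod (lie_series \<psi> W t (z + h *\<^sub>R ham \<psi> z) - lie_series \<psi> W t z - of_real h * dd (lie_series \<psi> W t) z (ham \<psi> z))
      \<le> 8 * (5/2 * B) / 1\<^sup>2 * h\<^sup>2"
    by (intro holo_quadratic[OF series_holo(1)[OF t(1)]] series_bound[OF t(1)]) (use h in auto)
  define p q r where "p = g (z + h *\<^sub>R ham \<psi> z) - g z - of_real h * W z"
    and "q = lie_series \<psi> W t (z + h *\<^sub>R ham \<psi> z) - lie_series \<psi> W t z - of_real h * lie \<psi> (lie_series \<psi> W t) z"
    and "r = lie_series \<psi> W (t + h) z - lie_series \<psi> W t z - of_real h * (W z + lie \<psi> (lie_series \<psi> W t) z)"
  have "(g (z + h *\<^sub>R ham \<psi> z) + lie_series \<psi> W t (z + h *\<^sub>R ham \<psi> z)) - (g z + lie_series \<psi> W (t + h) z) = p + q - r"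
    by (simp add: p_def q_def r_def algebra_simps)
  also have "cmod \<dots> \<le> cmod p + cmod q + cmod r"
    using norm_triangle_ineq4[of "p + q" r] norm_triangle_ineq[of p q] by linarith
  also have "\<dots> \<le> Cg * h\<^sup>2 + 20 * B * h\<^sup>2 + quad_const * h\<^sup>2"
    using g c series_taylor[OF t z13] by (intro add_mono) (simp_all add: p_def q_def r_def lie_def)
  finally show ?thesis by (simp add: algebra_simps)
qed

end

subsection \<open>Euler polygons\<close>

lemma euler_disp:
  assumes z: "z \<in> dom (15/16)"
  shows "j \<le> m \<Longrightarrow> disp (real j / real m * (2 * X / ds)) (real j / real m * (2 * X / da)) (euler \<psi> m j z - z) \<and> euler \<psi> m j z \<in> dom (14/16)"
proof (induction j)
  case 0
  show ?case using z dom_mono[of "14/16" "15/16"] by (auto simp: disp_def)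
next
  case (Suc j)
  then have IH: "disp (real j / real m * (2 * X / ds)) (real j / real m * (2 * X / da)) (euler \<psi> m j z - z)"
    "euler \<psi> m j z \<in> dom (14/16)" by auto
  have m: "real m > 0" using Suc.prems by simp
  have "euler \<psi> m j z \<in> dom (13/16)" using IH(2) dom_mono[of "13/16" "14/16"] by auto
  moreover have "cmod (of_real (1 / real m)) \<le> 1 / real m" using m by (simp only: norm_of_real) simp
  ultimately have "disp (1 / real m * (2 * X / ds)) (1 / real m * (2 * X / da)) ((1 / real m) *\<^sub>R ham \<psi> (euler \<psi> m j z))"
    using disp_cscale[OF disp_ham, of "euler \<psi> m j z" "of_real (1 / real m)" "1 / real m"] by (simp only: cscale_algebra)
  from disp_add[OF IH(1) this]
  have d: "disp (real (Suc j) / real m * (2 * X / ds)) (real (Suc j) / real m * (2 * X / da)) (euler \<psi> m (Suc j) z - z)"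
    by (simp add: euler_Suc add_divide_distrib distrib_right algebra_simps)
  have "real (Suc j) / real m \<le> 1" using Suc.prems m by simp
  then have le: "real (Suc j) / real m * (2 * X / ds) \<le> 1/16 * da" "real (Suc j) / real m * (2 * X / da) \<le> 1/16 * ds"
    using displacement_small mult_right_mono[of "real (Suc j) / real m" 1 "2 * X / ds"]
      mult_right_mono[of "real (Suc j) / real m" 1 "2 * X / da"] by linarith+
  have "z + (euler \<psi> m (Suc j) z - z) \<in> dom (14/16)"
    by (rule dom_add[OF z disp_mono[OF d le]]) simp
  with d show ?case by simp
qed

lemma euler_dom: "z \<in> dom (15/16) \<Longrightarrow> j \<le> m \<Longrightarrow> euler \<psi> m j z \<in> dom (14/16)"
  using euler_disp by blast

text \<open>The quadratic errors of the \<open>m\<close> steps of length \<open>1 / m\<close> add up to order \<open>1 / m\<close>.  With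
  \<open>\<tau> = 0\<close> this computes functions at the end of the polygon; with \<open>\<tau> = - 1\<close> it recovers them at its start.\<close>

lemma transport:
  assumes step: "\<And>t h z. z \<in> dom (14/16) \<Longrightarrow> -1 \<le> t \<Longrightarrow> 0 < h \<Longrightarrow> h < 1/2 \<Longrightarrow> t + h \<le> 1 \<Longrightarrow>
      cmod (G t (z + h *\<^sub>R ham \<psi> z) - G (t + h) z) \<le> C * h\<^sup>2"
    and z: "z \<in> dom (15/16)" and \<tau>: "-1 \<le> \<tau>" "\<tau> \<le> 0" and m: "2 < m"
  shows "cmod (G \<tau> (euler \<psi> m m z) - G (\<tau> + 1) z) \<le> C / real m"
proof -
  define h where "h = 1 / real m"
  have h: "0 < h" "h < 1/2" using m by (auto simp: h_def field_simps)
  have *: "j \<le> m \<Longrightarrow> cmod (G (\<tau> + 1 - real j * h) (euler \<psi> m j z) - G (\<tau> + 1) z) \<le> real j * (C * h\<^sup>2)" for j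
  proof (induction j)
    case (Suc j)
    have jh: "real (Suc j) * h \<le> 1" using Suc.prems m by (simp add: h_def)
    have jh0: "0 \<le> real j * h" "real (Suc j) * h = real j * h + h" using h by (simp_all add: algebra_simps)
    have b: "-1 \<le> \<tau> + 1 - real (Suc j) * h" "\<tau> + 1 - real (Suc j) * h + h \<le> 1"
      using jh jh0 \<tau> by linarith+
    have "cmod (G (\<tau> + 1 - real (Suc j) * h) (euler \<psi> m j z + h *\<^sub>R ham \<psi> (euler \<psi> m j z)) - G (\<tau> + 1 - real (Suc j) * h + h) (euler \<psi> m j z)) \<le> C * h\<^sup>2"
      by (rule step[OF euler_dom[OF z]]) (use Suc.prems b h in auto)
    moreover have "\<tau> + 1 - real (Suc j) * h + h = \<tau> + 1 - real j * h" by (simp add: algebra_simps)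
    ultimately have "cmod (G (\<tau> + 1 - real (Suc j) * h) (euler \<psi> m (Suc j) z) - G (\<tau> + 1 - real j * h) (euler \<psi> m j z)) \<le> C * h\<^sup>2"
      by (simp only: euler_Suc h_def[symmetric])
    with Suc have "cmod (G (\<tau> + 1 - real (Suc j) * h) (euler \<psi> m (Suc j) z) - G (\<tau> + 1) z) \<le> C * h\<^sup>2 + real j * (C * h\<^sup>2)"
      by (intro norm_diff_triangle_le[where y = "G (\<tau> + 1 - real j * h) (euler \<psi> m j z)"]) auto
    then show ?case by (simp add: algebra_simps)
  qed simp
  have "real m * h = 1" using m by (simp add: h_def)
  then have "real m * (C * h\<^sup>2) = C * h" by (simp add: power2_eq_square)
  then show ?thesis using *[of m] \<open>real m * h = 1\<close> by (simp add: h_def)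
qed

end

lemma lie_series_0 [simp]: "lie_series \<psi> W 0 z = 0" by (simp add: lie_series_def)

lemma ham_neg:
  assumes "holo_fun_on T \<psi>" "z \<in> T" shows "ham (\<lambda>z. - \<psi> z) z = - ham \<psi> z"
  by (rule phase_eqI) (simp_all add: ham_coord holo_uminus(2)[OF assms])

lemma trig_neg: "trig V a s \<psi> x y S X \<Longrightarrow> trig V a s (\<lambda>z. - \<psi> z) (\<lambda>k z. - x k z) y S X"
  using fser_cmult[of V a s \<psi> x y X "-1"] by (simp add: trig_def)

lemma symp_form_step:
  "symp_form (p + h *\<^sub>R p') (q + h *\<^sub>R q') = symp_form p q
     + of_real h * (symp_form p' q + symp_form p q') + of_real (h\<^sup>2) * symp_form p' q'"
  by (simp add: symp_form_add(1-4) algebra_simps power2_eq_square)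

context ham_flow
begin

subsection \<open>The time-one map\<close>

definition rate :: real where
  "rate = 20 * (4 * X / ds + 4 * X / da) + quad_const (4 * X / ds + 4 * X / da)"

lemma coord_W: "coord l \<Longrightarrow> fb V (a - da / 4) (s - ds / 4) (\<lambda>z. l (ham \<psi> z)) (4 * X / ds + 4 * X / da)"
  using coord_ham_fb[of l "1/4"] by (simp add: mult.commute)

lemma coord_transport:
  assumes l: "coord l" and z: "z \<in> dom (15/16)" and \<tau>: "-1 \<le> \<tau>" "\<tau> \<le> 0" and m: "2 < m"
  shows "cmod ((l (euler \<psi> m m z) + lie_series \<psi> (\<lambda>z. l (ham \<psi> z)) \<tau> (euler \<psi> m m z))
      - (l z + lie_series \<psi> (\<lambda>z. l (ham \<psi> z)) (\<tau> + 1) z)) \<le> rate / real m"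
proof (rule transport[where G = "\<lambda>t z. l z + lie_series \<psi> (\<lambda>z. l (ham \<psi> z)) t z", OF _ z \<tau> m])
  fix t h :: real and z assume *: "z \<in> dom (14/16)" "-1 \<le> t" "0 < h" "h < 1/2" "t + h \<le> 1"
  have "cmod (l (z + h *\<^sub>R ham \<psi> z) - l z - of_real h * l (ham \<psi> z)) \<le> 0 * h\<^sup>2"
    by (simp add: coord_linear(3,4)[OF l])
  from lie_series_step[OF coord_W[OF l] this *(1,3,4), of t]
  show "cmod ((l (z + h *\<^sub>R ham \<psi> z) + lie_series \<psi> (\<lambda>z. l (ham \<psi> z)) t (z + h *\<^sub>R ham \<psi> z))
      - (l z + lie_series \<psi> (\<lambda>z. l (ham \<psi> z)) (t + h) z)) \<le> rate * h\<^sup>2"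
    using * by (simp add: rate_def)
qed

lemma tendsto_rate: "(\<lambda>m. C / real m) \<longlonglongrightarrow> 0"
  using tendsto_mult_right_zero[OF lim_1_over_n[where 'a=real], of C] by simp

lemma flow_limit:
  assumes z: "z \<in> dom (15/16)"
  shows "(\<lambda>m. euler \<psi> m m z) \<longlonglongrightarrow> flow \<psi> z"
    "coord l \<Longrightarrow> l (flow \<psi> z) = l z + lie_series \<psi> (\<lambda>z. l (ham \<psi> z)) 1 z"
proof -
  define L where "L = (\<lambda>l. l z + lie_series \<psi> (\<lambda>z. l (ham \<psi> z)) 1 z)"
  define w :: "'n phase" where "w = ((\<chi> j. L (\<lambda>z. fst z $ j)), L (\<lambda>z. fst (snd z)), (\<chi> j. L (\<lambda>z. fst (snd (snd z)) $ j)), L (\<lambda>z. snd (snd (snd z))))"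
  have lw: "l w = L l" if "coord l" for l using that by (auto simp: coord_def w_def)
  have lim: "(\<lambda>m. l (euler \<psi> m m z)) \<longlonglongrightarrow> l w" if l: "coord l" for l
  proof -
    have "(\<lambda>m. l (euler \<psi> m m z) - L l) \<longlonglongrightarrow> 0"
    proof (rule Lim_null_comparison[OF _ tendsto_rate[of rate]])
      show "\<forall>\<^sub>F m in sequentially. norm (l (euler \<psi> m m z) - L l) \<le> rate / real m"
        unfolding eventually_sequentially
        by (rule exI[of _ 3]) (use coord_transport[OF l z, of 0] in \<open>auto simp: L_def\<close>)
    qed
    then show ?thesis using lw[OF l] by (simp add: LIM_zero_iff)
  qed
  have 1: "(\<lambda>m. euler \<psi> m m z) \<longlonglongrightarrow> w" by (rule tendsto_phaseI[OF lim])
  then have 2: "flow \<psi> z = w" unfolding flow_def by (rule limI)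
  show "(\<lambda>m. euler \<psi> m m z) \<longlonglongrightarrow> flow \<psi> z" using 1 2 by simp
  show "coord l \<Longrightarrow> l (flow \<psi> z) = l z + lie_series \<psi> (\<lambda>z. l (ham \<psi> z)) 1 z" using lw by (simp add: 2 L_def)
qed

lemma flow_rate:
  assumes "coord l" "z \<in> dom (15/16)" "2 < m"
  shows "cmod (l (euler \<psi> m m z) - l (flow \<psi> z)) \<le> rate / real m"
  using coord_transport[OF assms(1,2) _ _ assms(3), of 0] flow_limit(2)[OF assms(2,1)] by simp

lemma flow_disp: assumes z: "z \<in> dom (15/16)" shows "disp (2 * X / ds) (2 * X / da) (flow \<psi> z - z)"
proof (rule closed_disp)
  show "(\<lambda>m. euler \<psi> m m z - z) \<longlonglongrightarrow> flow \<psi> z - z" by (intro tendsto_intros flow_limit(1) z)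
  show "disp (2 * X / ds) (2 * X / da) (euler \<psi> m m z - z)" for m
  proof (cases "m = 0")
    case True then show ?thesis using displacement_small by (simp add: disp_def)
  next
    case False
    then show ?thesis using euler_disp[OF z, of m m] by simp
  qed
qed

lemma flow_dom:
  assumes "z \<in> dom c" "15/16 \<le> c" shows "flow \<psi> z \<in> dom (c - 1/16)"
proof -
  have z: "z \<in> dom (15/16)" using assms dom_mono by blast
  have "z + (flow \<psi> z - z) \<in> dom (c - 1/16)"
    by (rule dom_add[OF assms(1) disp_mono[OF flow_disp[OF z]], where t = "1/16"]) (use displacement_small in auto)
  then show ?thesis by simp
qed

lemma ham_holo_map: "holo_map_on (cdomain V a s) (ham \<psi>)"
  by (rule holo_map_coords(1)[OF ham_holo[OF open_cdomain psi_holo]])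

lemma euler_holo:
  "j \<le> m \<Longrightarrow> holo_map_on (dom (15/16)) (euler \<psi> m j)"
  "Suc j \<le> m \<Longrightarrow> z \<in> dom (15/16) \<Longrightarrow>
     dd (euler \<psi> m (Suc j)) z u = dd (euler \<psi> m j) z u + (1 / real m) *\<^sub>R dd (ham \<psi>) (euler \<psi> m j z) (dd (euler \<psi> m j) z u)"
proof -
  have im: "euler \<psi> m j ` dom (15/16) \<subseteq> cdomain V a s" if "j \<le> m" for j
    using euler_dom that dom_sub[of "14/16"] by auto
  have S: "euler \<psi> m (Suc j) = (\<lambda>z. euler \<psi> m j z + (1 / real m) *\<^sub>R ham \<psi> (euler \<psi> m j z))" for j
    by (simp add: euler_Suc fun_eq_iff)
  show *: "holo_map_on (dom (15/16)) (euler \<psi> m j)" if "j \<le> m" for j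
    using that
  proof (induction j)
    case 0 then show ?case using holo_map_id by (simp add: euler_def id_def)
  next
    case (Suc j)
    then have h: "holo_map_on (dom (15/16)) (euler \<psi> m j)" "j \<le> m" by auto
    show ?case unfolding S
      by (rule holo_map_add_scaleR(1)[OF h(1) holo_map_compose(1)[OF ham_holo_map h(1) im[OF h(2)]]])
  qed
  show "dd (euler \<psi> m (Suc j)) z u = dd (euler \<psi> m j) z u + (1 / real m) *\<^sub>R dd (ham \<psi>) (euler \<psi> m j z) (dd (euler \<psi> m j) z u)"
    if "Suc j \<le> m" "z \<in> dom (15/16)"
  proof -
    have h: "holo_map_on (dom (15/16)) (euler \<psi> m j)" "j \<le> m" using * that by auto
    show ?thesis unfolding S
      using holo_map_add_scaleR(2)[OF h(1) holo_map_compose(1)[OF ham_holo_map h(1) im[OF h(2)]] that(2)]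
        holo_map_compose(2)[OF ham_holo_map h(1) im[OF h(2)] that(2)] by simp
  qed
qed

lemma flow_coord_holo:
  assumes l: "coord l"
  shows "holo_fun_on (dom (15/16)) (\<lambda>z. l (flow \<psi> z))"
    "z \<in> dom (15/16) \<Longrightarrow> (\<lambda>m. dd (\<lambda>z. l (euler \<psi> m m z)) z u) \<longlonglongrightarrow> dd (\<lambda>z. l (flow \<psi> z)) z u"
proof -
  have h: "holo_fun_on (dom (15/16)) (\<lambda>z. l (euler \<psi> m m z))" for m
    by (rule holo_compose(1)[OF coord_linear(6)[OF l, of UNIV] euler_holo(1)]) auto
  have ul: "uniform_limit (dom (15/16)) (\<lambda>m z. l (euler \<psi> m m z)) (\<lambda>z. l (flow \<psi> z)) sequentially"
  proof (rule uniform_limitI)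
    fix e :: real assume "e > 0"
    have "\<forall>\<^sub>F m in sequentially. rate / real m < e" by (rule order_tendstoD(2)[OF tendsto_rate \<open>e > 0\<close>])
    moreover have "\<forall>\<^sub>F m in sequentially. 2 < m" by (rule eventually_gt_at_top)
    ultimately show "\<forall>\<^sub>F m in sequentially. \<forall>z\<in>dom (15/16). dist (l (euler \<psi> m m z)) (l (flow \<psi> z)) < e"
    proof eventually_elim
      case (elim m)
      then show ?case using flow_rate[OF l _ elim(2)] unfolding dist_norm by (meson le_less_trans)
    qed
  qed
  have ul': "\<exists>\<rho>>0. uniform_limit (ball z \<rho> \<inter> dom (15/16)) (\<lambda>m z. l (euler \<psi> m m z)) (\<lambda>z. l (flow \<psi> z)) sequentially" for z
    by (rule exI[of _ 1]) (use uniform_limit_on_subset[OF ul] in auto)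
  show "holo_fun_on (dom (15/16)) (\<lambda>z. l (flow \<psi> z))"
    by (rule holo_limit(1)[OF open_dom h ul'])
  show "z \<in> dom (15/16) \<Longrightarrow> (\<lambda>m. dd (\<lambda>z. l (euler \<psi> m m z)) z u) \<longlonglongrightarrow> dd (\<lambda>z. l (flow \<psi> z)) z u"
    by (rule holo_limit(2)[OF open_dom h ul'])
qed

lemma flow_holo: "holo_map_on (dom (15/16)) (flow \<psi>)"
  by (rule holo_map_coords(1)[OF flow_coord_holo(1)])

lemma euler_deriv_tendsto:
  assumes "z \<in> dom (15/16)" shows "(\<lambda>m. dd (euler \<psi> m m) z u) \<longlonglongrightarrow> dd (flow \<psi>) z u"
proof (rule tendsto_phaseI)
  fix l :: "'n phase \<Rightarrow> complex" assume l: "coord l"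
  have e: "l (dd (euler \<psi> m m) z u) = dd (\<lambda>z. l (euler \<psi> m m z)) z u" for m
    using holo_compose(2)[OF coord_linear(6)[OF l, of UNIV] euler_holo(1)[OF order_refl] _ assms, of m u]
    by (simp add: coord_linear(7)[OF l])
  have f: "l (dd (flow \<psi>) z u) = dd (\<lambda>z. l (flow \<psi> z)) z u"
    by (rule holo_map_coords(2)[OF flow_coord_holo(1) assms l])
  show "(\<lambda>m. l (dd (euler \<psi> m m) z u)) \<longlonglongrightarrow> l (dd (flow \<psi>) z u)"
    unfolding e f by (rule flow_coord_holo(2)[OF l assms])
qed

lemma ham_deriv_bound: "\<exists>L\<ge>0. \<forall>z\<in>dom (14/16). \<forall>u. norm (dd (ham \<psi>) z u) \<le> L * norm u"
proof -
  define M where "M = X / (13/16 * ds) + X / (13/16 * da)"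
  define \<rho> where "\<rho> = 1/16 * min da ds"
  have M0: "0 \<le> M" using X0 da ds by (simp add: M_def)
  have \<rho>: "0 < \<rho>" using da ds by (simp add: \<rho>_def)
  have c: "cmod (dd (\<lambda>z. l (ham \<psi> z)) z u) \<le> 2 * M / \<rho> * norm u" if l: "coord l" and z: "z \<in> dom (14/16)" for l z u
  proof (rule holo_sup_deriv[where z = z and \<rho> = \<rho>])
    have sub: "ball z \<rho> \<subseteq> dom (13/16)"
    proof
      fix w assume "w \<in> ball z \<rho>"
      then have "norm (w - z) \<le> \<rho>" by (simp add: dist_norm norm_minus_commute)
      then have "disp \<rho> \<rho> (w - z)" by (rule disp_norm)
      then have "disp (1/16 * da) (1/16 * ds) (w - z)" by (rule disp_mono) (auto simp: \<rho>_def)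
      from dom_add[OF z this, of "13/16"] show "w \<in> dom (13/16)" by simp
    qed
    note f = coord_ham_fb[OF l, of "13/16", folded M_def dom_def]
    show "holo_fun_on (ball z \<rho>) (\<lambda>z. l (ham \<psi> z))"
      by (rule holo_fun_subset[OF fb_holo[OF f] sub[unfolded dom_def]]) auto
    show "cmod (l (ham \<psi> w)) \<le> M" if "w \<in> ball z \<rho>" for w
      by (rule fb_bound[OF f]) (use sub that in \<open>auto simp: dom_def\<close>)
  qed (use \<rho> in auto)
  define L where "L = (2 * real CARD('n) + 2) * (2 * M / \<rho>)"
  have "norm (dd (ham \<psi>) z u) \<le> L * norm u" if z: "z \<in> dom (14/16)" for z u
  proof -
    have zs: "z \<in> cdomain V a s" using z dom_sub[of "14/16"] by auto
    have c': "cmod (l (dd (ham \<psi>) z u)) \<le> 2 * M / \<rho> * norm u" if l: "coord l" for l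
      using c[OF l z] holo_map_coords(2)[where C = "ham \<psi>", OF ham_holo[OF open_cdomain psi_holo] zs l] by simp
    have "norm (dd (ham \<psi>) z u) \<le> (\<Sum>j\<in>(UNIV::'n set). 2 * M / \<rho> * norm u) + 2 * M / \<rho> * norm u
        + (\<Sum>j\<in>(UNIV::'n set). 2 * M / \<rho> * norm u) + 2 * M / \<rho> * norm u"
      by (intro order_trans[OF norm_phase_le] add_mono sum_mono c'[OF coord_simps(1)] c'[OF coord_simps(2)]
          c'[OF coord_simps(3)] c'[OF coord_simps(4)])
    then show ?thesis by (simp add: L_def algebra_simps)
  qed
  moreover have "0 \<le> L" using M0 \<rho> by (simp add: L_def)
  ultimately show ?thesis by blast
qed

text \<open>Each Euler step is symplectic up to the square of the step size, so the error of the whole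
  polygon vanishes in the limit.\<close>

lemma flow_symplectic:
  assumes z: "z \<in> dom (15/16)"
  shows "symp_form (dd (flow \<psi>) z u) (dd (flow \<psi>) z w) = symp_form u w"
proof -
  obtain L where L: "0 \<le> L" "\<And>z u. z \<in> dom (14/16) \<Longrightarrow> norm (dd (ham \<psi>) z u) \<le> L * norm u"
    using ham_deriv_bound by blast
  define c where "c = 2 * (real CARD('n) + 1)"
  define C where "C = c * (L * exp L * norm u) * (L * exp L * norm w)"
  have C0: "0 \<le> C" using L(1) by (simp add: C_def c_def)
  have main: "cmod (symp_form (dd (euler \<psi> m m) z u) (dd (euler \<psi> m m) z w) - symp_form u w) \<le> C / real m"
    if m: "0 < m" for m
  proof -
    let ?h = "1 / real m"
    let ?P = "\<lambda>j. dd (euler \<psi> m j) z"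
    have id: "?P 0 v = v" for v
    proof -
      have "((\<lambda>z. z) has_derivative (\<lambda>v. v)) (at z)" by (rule has_derivative_ident)
      then show ?thesis using dd_eq[of "\<lambda>z. z" "\<lambda>v. v"] by (simp add: euler_def id_def)
    qed
    have growth: "norm (?P j v) \<le> (1 + ?h * L) ^ j * norm v" if "j \<le> m" for j v
      using that
    proof (induction j)
      case 0 then show ?case by (simp add: id)
    next
      case (Suc j)
      have "norm (?P (Suc j) v) \<le> norm (?P j v) + ?h * norm (dd (ham \<psi>) (euler \<psi> m j z) (?P j v))"
        unfolding euler_holo(2)[OF Suc.prems z] by (rule order_trans[OF norm_triangle_ineq]) simp
      also have "\<dots> \<le> norm (?P j v) + ?h * (L * norm (?P j v))"
        by (intro add_left_mono mult_left_mono L(2) euler_dom[OF z]) (use Suc.prems in auto)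
      also have "\<dots> = (1 + ?h * L) * norm (?P j v)" by (simp add: algebra_simps)
      also have "\<dots> \<le> (1 + ?h * L) * ((1 + ?h * L) ^ j * norm v)"
        by (rule mult_left_mono[OF Suc.IH]) (use Suc.prems L(1) in auto)
      finally show ?case by simp
    qed
    have pw: "(1 + ?h * L) ^ j \<le> exp L" if "j \<le> m" for j
    proof -
      have "(1 + ?h * L) ^ j \<le> (1 + ?h * L) ^ m" by (rule power_increasing) (use that L(1) in auto)
      also have "\<dots> \<le> exp (?h * L) ^ m" by (rule power_mono[OF exp_ge_add_one_self]) (use L(1) in simp)
      also have "\<dots> = exp L" using m by (simp flip: exp_of_nat_mult)
      finally show ?thesis .
    qed
    have bd: "norm (dd (ham \<psi>) (euler \<psi> m j z) (?P j v)) \<le> L * exp L * norm v" if "j \<le> m" for j v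
    proof -
      have "norm (dd (ham \<psi>) (euler \<psi> m j z) (?P j v)) \<le> L * norm (?P j v)" by (rule L(2)[OF euler_dom[OF z that]])
      also have "\<dots> \<le> L * (exp L * norm v)"
        by (rule mult_left_mono[OF order_trans[OF growth[OF that] mult_right_mono[OF pw[OF that]]] L(1)]) simp
      finally show ?thesis by simp
    qed
    have "j \<le> m \<Longrightarrow> cmod (symp_form (?P j u) (?P j w) - symp_form u w) \<le> real j * (C * ?h\<^sup>2)" for j
    proof (induction j)
      case 0 then show ?case by (simp add: id)
    next
      case (Suc j)
      let ?A = "dd (ham \<psi>) (euler \<psi> m j z)"
      have zs: "euler \<psi> m j z \<in> cdomain V a s" using euler_dom[OF z] Suc.prems dom_sub[of "14/16"] by auto
      have "symp_form (?P (Suc j) u) (?P (Suc j) w) = symp_form (?P j u) (?P j w)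
          + of_real ?h * (symp_form (?A (?P j u)) (?P j w) + symp_form (?P j u) (?A (?P j w)))
          + of_real (?h\<^sup>2) * symp_form (?A (?P j u)) (?A (?P j w))"
        unfolding euler_holo(2)[OF Suc.prems z] by (rule symp_form_step)
      also have "symp_form (?A (?P j u)) (?P j w) + symp_form (?P j u) (?A (?P j w)) = 0"
        by (rule ham_infinitesimally_symplectic[OF open_cdomain psi_holo zs])
      finally have e: "symp_form (?P (Suc j) u) (?P (Suc j) w) - symp_form u w =
          (symp_form (?P j u) (?P j w) - symp_form u w) + of_real (?h\<^sup>2) * symp_form (?A (?P j u)) (?A (?P j w))" by simp
      have "cmod (symp_form (?A (?P j u)) (?A (?P j w))) \<le> c * (norm (?A (?P j u)) * norm (?A (?P j w)))"
        unfolding c_def by (rule symp_form_bound)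
      also have "\<dots> \<le> c * ((L * exp L * norm u) * (L * exp L * norm w))"
        by (intro mult_left_mono mult_mono bd) (use Suc.prems L(1) in \<open>auto simp: c_def\<close>)
      finally have "cmod (of_real (?h\<^sup>2) * symp_form (?A (?P j u)) (?A (?P j w))) \<le> ?h\<^sup>2 * C"
        unfolding norm_mult norm_of_real by (intro mult_mono) (auto simp: C_def)
      then show ?case unfolding e using Suc by (intro order_trans[OF norm_triangle_ineq]) (auto simp: algebra_simps)
    qed
    from this[of m] show ?thesis using m by (simp add: power2_eq_square)
  qed
  let ?O = "\<lambda>m. symp_form (dd (euler \<psi> m m) z u) (dd (euler \<psi> m m) z w)"
  have 1: "?O \<longlonglongrightarrow> symp_form u w"
  proof -
    have "(\<lambda>m. ?O m - symp_form u w) \<longlonglongrightarrow> 0"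
      by (rule Lim_null_comparison[OF _ tendsto_rate[of C]])
         (use main in \<open>auto simp: eventually_sequentially intro!: exI[of _ 1]\<close>)
    then show ?thesis by (simp only: LIM_zero_iff)
  qed
  have co: "(\<lambda>m. l (dd (euler \<psi> m m) z v)) \<longlonglongrightarrow> l (dd (flow \<psi>) z v)" if "coord l" for l v
    by (rule bounded_linear.tendsto[OF coord_linear(1)[OF that] euler_deriv_tendsto[OF z]])
  have 2: "?O \<longlonglongrightarrow> symp_form (dd (flow \<psi>) z u) (dd (flow \<psi>) z w)"
    unfolding symp_form_alt
    by (intro tendsto_intros co[OF coord_simps(1)] co[OF coord_simps(2)] co[OF coord_simps(3)] co[OF coord_simps(4)])
  show ?thesis by (rule LIMSEQ_unique[OF 2 1])
qed

lemma flow_real: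
  assumes re: "\<And>w. w \<in> cdomain V a s \<Longrightarrow> real_phase w \<Longrightarrow> \<psi> w \<in> \<real>" and z: "z \<in> dom (15/16)" "real_phase z"
  shows "real_phase (flow \<psi> z)"
proof -
  have e: "j \<le> m \<Longrightarrow> real_phase (euler \<psi> m j z)" for j m
  proof (induction j)
    case (Suc j)
    then have "real_phase (ham \<psi> (euler \<psi> m j z))"
      by (intro ham_real[OF psi_holo open_cdomain re]) (use euler_dom[OF z(1)] dom_sub[of "14/16"] in auto)
    with Suc show ?case unfolding euler_Suc real_phase_alt by (simp add: scaleR_conv_of_real[where 'a=complex])
  qed (use z in simp)
  have "l (flow \<psi> z) \<in> \<real>" if l: "coord l" for l
  proof (rule closed_sequentially[OF closed_complex_Reals])
    show "(\<lambda>m. l (euler \<psi> m m z)) \<longlonglongrightarrow> l (flow \<psi> z)"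
      by (rule bounded_linear.tendsto[OF coord_linear(1)[OF l] flow_limit(1)[OF z(1)]])
    show "l (euler \<psi> m m z) \<in> \<real>" for m using e[of m m] l by (auto simp: real_phase_alt coord_def)
  qed
  then show ?thesis using coord_simps unfolding real_phase_alt by blast
qed

lemma flow_shift:
  assumes z: "z \<in> dom (15/16)"
  shows "flow \<psi> (shift_angle j z) = shift_angle j (flow \<psi> z)"
proof -
  have z': "shift_angle j z \<in> dom (15/16)" using z by (simp add: dom_def)
  have e: "i \<le> m \<Longrightarrow> euler \<psi> m i (shift_angle j z) = shift_angle j (euler \<psi> m i z)" for i m
  proof (induction i)
    case (Suc i)
    then have "euler \<psi> m i z \<in> cdomain V a s" using euler_dom[OF z] dom_sub[of "14/16"] by auto
    from ham_shift[OF psi_fb this, of j] Suc show ?case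
      by (simp add: euler_Suc shift_angle_alt algebra_simps)
  qed simp
  have "(\<lambda>m. shift_angle j (euler \<psi> m m z)) \<longlonglongrightarrow> shift_angle j (flow \<psi> z)"
    unfolding shift_angle_alt by (intro tendsto_intros flow_limit(1) z)
  then have "(\<lambda>m. euler \<psi> m m (shift_angle j z)) \<longlonglongrightarrow> shift_angle j (flow \<psi> z)" by (simp add: e)
  then show ?thesis using flow_limit(1)[OF z'] LIMSEQ_unique by blast
qed

text \<open>Only the error of a single Euler step and continuity of \<open>g\<close> are used, so that coordinates and functions of
  bounded norm are covered alike.\<close>

theorem flow_lie_series:
  assumes W: "fb V (a - da / 4) (s - ds / 4) W B"
    and g: "\<And>z h. z \<in> dom (14/16) \<Longrightarrow> 0 < h \<Longrightarrow> h < 1/2 \<Longrightarrow> cmod (g (z + h *\<^sub>R ham \<psi> z) - g z - of_real h * W z) \<le> Cg * h\<^sup>2"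
    and cont: "\<And>z. z \<in> dom (14/16) \<Longrightarrow> isCont g z" and z: "z \<in> dom (15/16)"
  shows "g (flow \<psi> z) = g z + lie_series \<psi> W 1 z"
proof (rule LIMSEQ_unique)
  have "flow \<psi> z \<in> dom (14/16)" using flow_dom[OF z] by simp
  then show "(\<lambda>m. g (euler \<psi> m m z)) \<longlonglongrightarrow> g (flow \<psi> z)"
    by (intro isCont_tendsto_compose[OF cont] flow_limit(1) z)
  let ?C = "Cg + 20 * B + quad_const B"
  have "cmod (g (euler \<psi> m m z) - (g z + lie_series \<psi> W 1 z)) \<le> ?C / real m" if m: "2 < m" for m
  proof -
    have "cmod ((g (euler \<psi> m m z) + lie_series \<psi> W 0 (euler \<psi> m m z)) - (g z + lie_series \<psi> W (0 + 1) z)) \<le> ?C / real m"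
      by (rule transport[where G = "\<lambda>t z. g z + lie_series \<psi> W t z", OF _ z _ _ m])
         (auto intro!: lie_series_step[OF W] g)
    then show ?thesis by simp
  qed
  then have "(\<lambda>m. g (euler \<psi> m m z) - (g z + lie_series \<psi> W 1 z)) \<longlonglongrightarrow> 0"
    by (intro Lim_null_comparison[OF _ tendsto_rate[of ?C]]) (auto simp: eventually_sequentially intro!: exI[of _ 3])
  then show "(\<lambda>m. g (euler \<psi> m m z)) \<longlonglongrightarrow> g z + lie_series \<psi> W 1 z" by (simp only: LIM_zero_iff)
qed

lemma neg_flow: "ham_flow V a s da ds (\<lambda>z. - \<psi> z) (\<lambda>k z. - x k z) y S X"
  by (rule ham_flow.intro[OF trig_neg[OF trig] da ds dss small])

lemma lie_neg_iterate:
  assumes l: "coord l"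
  shows "z \<in> dom (13/16) \<Longrightarrow> (lie (\<lambda>z. - \<psi> z) ^^ n) (\<lambda>z. l (ham (\<lambda>z. - \<psi> z) z)) z
    = (-1) ^ Suc n * (lie \<psi> ^^ n) (\<lambda>z. l (ham \<psi> z)) z"
proof (induction n arbitrary: z)
  case 0
  then have "ham (\<lambda>z. - \<psi> z) z = - ham \<psi> z" by (intro ham_neg[OF psi_holo] subsetD[OF dom_sub]) auto
  then show ?case using coord_linear(4)[OF l, of "-1" "ham \<psi> z"] by simp
next
  case (Suc n)
  let ?F = "(lie \<psi> ^^ n) (\<lambda>z. l (ham \<psi> z))"
  have hF: "holo_fun_on (dom (13/16)) ?F" by (rule W_iter(2)[OF coord_W[OF l]])
  have "ham (\<lambda>z. - \<psi> z) z = - ham \<psi> z" by (intro ham_neg[OF psi_holo] subsetD[OF dom_sub Suc.prems]) auto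
  then have "lie (\<lambda>z. - \<psi> z) ((lie (\<lambda>z. - \<psi> z) ^^ n) (\<lambda>z. l (ham (\<lambda>z. - \<psi> z) z))) z
      = dd (\<lambda>z. (-1) ^ Suc n * ?F z) z (- ham \<psi> z)"
    by (simp only: lie_def[of _ "(lie (\<lambda>z. - \<psi> z) ^^ n) (\<lambda>z. l (ham (\<lambda>z. - \<psi> z) z))"] dd_cong[OF open_dom Suc.prems Suc.IH])
  also have "\<dots> = (-1) ^ Suc (Suc n) * dd ?F z (ham \<psi> z)"
    unfolding holo_cmult(2)[OF hF Suc.prems] holo_linear(2)[OF hF Suc.prems] by simp
  finally show ?case unfolding funpow.simps comp_apply lie_def[of \<psi> ?F] .
qed

text \<open>Up to a vanishing error, the Lie series for time \<open>-1\<close> takes the end of a polygon back to its start, and this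
  series is the one for time \<open>1\<close> of the negative generating function.\<close>

lemma flow_inverse:
  assumes z: "z \<in> dom 1" shows "flow (\<lambda>z. - \<psi> z) (flow \<psi> z) = z"
proof (rule phase_eq_coordI)
  fix l :: "'n phase \<Rightarrow> complex" assume l: "coord l"
  interpret neg: ham_flow V a s da ds "\<lambda>z. - \<psi> z" "\<lambda>k z. - x k z" y S X by (rule neg_flow)
  have dm: "ham_flow.dom V a s da ds = dom" by (simp add: fun_eq_iff dom_def neg.dom_def)
  let ?W = "\<lambda>z. l (ham \<psi> z)" and ?y = "flow \<psi> z"
  have z15: "z \<in> dom (15/16)" using z dom_mono[of "15/16" 1] by auto
  have y15: "?y \<in> dom (15/16)" using flow_dom[OF z] by simp
  then have y13: "?y \<in> dom (13/16)" using dom_mono[of "13/16" "15/16"] by auto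
  have "lie_series (\<lambda>z. - \<psi> z) (\<lambda>z. l (ham (\<lambda>z. - \<psi> z) z)) 1 ?y = lie_series \<psi> ?W (-1) ?y"
    unfolding lie_series_def
  proof (rule suminf_cong)
    fix n
    have "complex_of_real ((-1) ^ Suc n / fact (Suc n)) = of_real (1 ^ Suc n / fact (Suc n)) * (-1) ^ Suc n"
      by (simp only: of_real_divide of_real_power of_real_minus of_real_1 power_one times_divide_eq_left mult_1)
    then show "complex_of_real (1 ^ Suc n / fact (Suc n)) * (lie (\<lambda>z. - \<psi> z) ^^ n) (\<lambda>z. l (ham (\<lambda>z. - \<psi> z) z)) ?y
        = of_real ((-1) ^ Suc n / fact (Suc n)) * (lie \<psi> ^^ n) ?W ?y"
      by (simp only: lie_neg_iterate[OF l y13] mult.assoc)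
  qed
  then have 1: "l (flow (\<lambda>z. - \<psi> z) ?y) = l ?y + lie_series \<psi> ?W (-1) ?y"
    using neg.flow_limit(2)[OF _ l, of ?y] y15 by (simp add: neg.dom_def dom_def)
  let ?G = "\<lambda>w. l w + lie_series \<psi> ?W (-1) w"
  have "holo_fun_on (dom (13/16)) ?G"
    by (rule holo_add(1)[OF coord_linear(6)[OF l] series_holo(1)[OF coord_W[OF l]]]) simp
  then have "isCont ?G ?y" by (rule holo_continuous[OF _ y13])
  then have 2: "(\<lambda>m. ?G (euler \<psi> m m z)) \<longlonglongrightarrow> ?G ?y" by (rule isCont_tendsto_compose[OF _ flow_limit(1)[OF z15]])
  have "(\<lambda>m. ?G (euler \<psi> m m z) - l z) \<longlonglongrightarrow> 0"
    by (rule Lim_null_comparison[OF _ tendsto_rate[of rate]])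
       (use coord_transport[OF l z15, of "-1"] in \<open>auto simp: eventually_sequentially intro!: exI[of _ 3]\<close>)
  then have "(\<lambda>m. ?G (euler \<psi> m m z)) \<longlonglongrightarrow> l z" by (simp only: LIM_zero_iff)
  from LIMSEQ_unique[OF this 2] 1 show "l (flow (\<lambda>z. - \<psi> z) ?y) = l z" by simp
qed

end

section \<open>Uniqueness of Fourier coefficients\<close>

lemma fourier_mode_add: "fourier_mode (k + l) \<phi> = fourier_mode k \<phi> * fourier_mode l \<phi>"
  by (simp add: fourier_mode_def freq_pair_def distrib_left sum.distrib exp_add)

lemma fourier_mode_0 [simp]: "fourier_mode 0 \<phi> = 1" by (simp add: fourier_mode_def freq_pair_def)

lemma fourier_mode_real_norm: "cmod (fourier_mode k (cvec x)) = 1"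
proof -
  have "freq_pair (cvec x) k = of_real (\<Sum>j\<in>UNIV. x $ j * of_int (k $ j))" by (simp add: freq_pair_def cvec_def)
  then show ?thesis by (simp add: fourier_mode_def mult.commute[of \<i>] flip: cis_conv_exp) 
qed

lemma continuous_fourier_mode: "continuous_on T (\<lambda>x. fourier_mode k (cvec x))"
  unfolding fourier_mode_def freq_pair_def cvec_def by (intro continuous_intros)

text \<open>Translating the period box by half a period of the mode in one coordinate changes the sign of the
  mode, but not the integral, by periodicity.\<close>

lemma integral_fourier_mode:
  fixes k :: "int^'n::finite"
  assumes "k \<noteq> 0"
  shows "integral (cbox 0 (\<chi> j. 2 * pi)) (\<lambda>x::real^'n. fourier_mode k (cvec x)) = 0"
proof -
  obtain j where j: "k $ j \<noteq> 0" using assms by (auto simp: vec_eq_iff)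
  define g where "g = (\<lambda>x::real^'n. fourier_mode k (cvec x))"
  define lo hi where "lo = (\<lambda>t::real. (\<chi> i. if i = j then t else 0) :: real^'n)"
    and "hi = (\<lambda>t::real. (\<chi> i. if i = j then t else 2 * pi) :: real^'n)"
  define c where "c = pi / \<bar>of_int (k $ j)\<bar>"
  have "1 \<le> \<bar>real_of_int (k $ j)\<bar>" using j by linarith
  then have c: "0 \<le> c" "c \<le> 2 * pi" using mult_left_mono[of 1 "\<bar>real_of_int (k $ j)\<bar>" pi] pi_gt_zero
    by (auto simp: c_def pos_divide_le_eq)
  have int: "g integrable_on cbox p q" for p q
    unfolding g_def by (intro integrable_continuous continuous_fourier_mode)
  let ?I = "\<lambda>p q. integral (cbox (lo p) (hi q)) g"
  have split: "?I 0 (2 * pi) = ?I 0 t + ?I t (2 * pi)" if "0 \<le> t" "t \<le> 2 * pi" for t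
  proof -
    have s: "cbox (lo 0) (hi (2 * pi)) \<inter> {x. x \<bullet> axis j 1 \<le> t} = cbox (lo 0) (hi t)"
      "cbox (lo 0) (hi (2 * pi)) \<inter> {x. x \<bullet> axis j 1 \<ge> t} = cbox (lo t) (hi (2 * pi))"
      using that by (auto simp: mem_box_cart lo_def hi_def inner_axis split: if_splits; metis order_trans)+
    show ?thesis using integral_split[OF int, of "axis j 1" "lo 0" "hi (2 * pi)" t] unfolding s by simp
  qed
  have shift: "?I t (2 * pi) = exp (\<i> * of_real (t * of_int (k $ j))) * ?I 0 (2 * pi - t)" for t
  proof -
    have e: "lo t - axis j t = lo 0" "hi (2 * pi) - axis j t = hi (2 * pi - t)"
      by (auto simp: vec_eq_iff lo_def hi_def axis_def)
    have "g (x + axis j t) = exp (\<i> * of_real (t * of_int (k $ j))) * g x" for x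
      by (simp add: g_def fourier_mode_def freq_pair_def cvec_def axis_def distrib_left distrib_right sum.distrib exp_add
          if_distrib[of "\<lambda>x. x * _"] if_distrib[of "\<lambda>x. _ * x"] if_distrib[of of_real] mult.commute cong: if_cong)
    then show ?thesis using integral_shift_cbox[of "lo t" "axis j t" "hi (2 * pi)" g] unfolding e by simp
  qed
  have ck: "c * of_int (k $ j) = pi \<or> c * of_int (k $ j) = - pi"
    using j by (cases "k $ j > 0") (auto simp: c_def)
  have e1: "exp (\<i> * of_real (c * of_int (k $ j))) = -1"
    using ck by (elim disjE; simp only:) (simp_all add: exp_minus)
  have e2: "exp (\<i> * of_real ((2 * pi - c) * of_int (k $ j))) = -1"
  proof -
    have "exp (\<i> * of_real ((2 * pi - c) * of_int (k $ j))) = exp (2 * of_real pi * of_int (k $ j) * \<i>) / exp (\<i> * of_real (c * of_int (k $ j)))"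
      by (simp add: algebra_simps flip: exp_diff)
    also have "exp (2 * of_real pi * of_int (k $ j) * \<i>) = (1::complex)"
      using exp_integer_2pi[of "of_int (k $ j)"] by (simp add: mult_ac)
    finally show ?thesis unfolding e1 by simp
  qed
  have "?I 0 (2 * pi) = ?I 0 c - ?I 0 (2 * pi - c)" using split[of c] shift[of c] c e1 by simp
  moreover have "?I 0 (2 * pi) = ?I 0 (2 * pi - c) - ?I 0 c"
    using split[of "2 * pi - c"] shift[of "2 * pi - c"] c e2 by simp
  ultimately have "?I 0 (2 * pi) = - ?I 0 (2 * pi)" by simp
  then have "?I 0 (2 * pi) = 0" by (simp only: equation_minus_iff[of "?I 0 (2 * pi)"] eq_neg_iff_add_eq_0) simp
  moreover have "lo 0 = 0" "hi (2 * pi) = (\<chi> j. 2 * pi)" by (auto simp: lo_def hi_def vec_eq_iff)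
  ultimately show ?thesis by (simp add: g_def)
qed

text \<open>The series converges absolutely and uniformly on the real torus, where different modes are orthogonal.\<close>

lemma fourier_coeff_unique:
  fixes V :: "(real^'n::finite) set"
  assumes f: "fser V a s F c b B" and z: "(I, 0, 0, \<xi>) \<in> cdomain V a s"
  shows "fourier_coeff (\<lambda>I \<phi> \<xi>. F (I, 0, \<phi>, \<xi>)) k I \<xi> = c k (I, 0, 0, \<xi>)"
proof -
  let ?B = "cbox 0 (\<chi> j. 2 * pi) :: (real^'n) set"
  let ?c = "\<lambda>l. c l (I, 0, 0, \<xi>)"
  define G where "G = (\<lambda>x. F (I, 0, cvec x, \<xi>) * fourier_mode (- k) (cvec x))"
  define P where "P = (\<lambda>X x. \<Sum>l\<in>X. ?c l * fourier_mode (l - k) (cvec x))"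
  have zx: "(I, 0, cvec x, \<xi>) \<in> cdomain V a s" for x using z by (simp add: mem_cdomain cvec_def)
  have cx: "c l (I, 0, cvec x, \<xi>) = ?c l" for l x
    using bspec[OF fserD(2)[OF f, of l, unfolded slow_def] zx[of x]] by (simp add: slow_part_def)
  have mode: "fourier_mode (l - k) \<phi> = fourier_mode l \<phi> * fourier_mode (- k) \<phi>" for l \<phi>
    using fourier_mode_add[of l "- k" \<phi>] by simp
  have tail: "cmod (G x - P X x) \<le> infsum (\<lambda>l. b l * wt s l) UNIV - (\<Sum>l\<in>X. b l * wt s l)" if "finite X" for X x
  proof -
    have "G x - P X x = (F (I, 0, cvec x, \<xi>) - (\<Sum>l\<in>X. c l (I, 0, cvec x, \<xi>) * fmode l (I, 0, cvec x, \<xi>))) * fourier_mode (- k) (cvec x)"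
      unfolding G_def P_def left_diff_distrib sum_distrib_right mode cx fmode_def snd_conv fst_conv mult.assoc ..
    then show ?thesis
      using has_sum_tail_bound[OF fserD(7)[OF f zx] fser_term_bound[OF f zx] fserD(5)[OF f] that, of x]
      by (simp add: norm_mult fourier_mode_real_norm)
  qed
  have ul: "uniform_limit ?B P G (finite_subsets_at_top UNIV)"
  proof (rule uniform_limitI)
    fix e :: real assume "e > 0"
    have "\<forall>\<^sub>F X in finite_subsets_at_top UNIV. infsum (\<lambda>l. b l * wt s l) UNIV - (\<Sum>l\<in>X. b l * wt s l) < e"
      by (rule order_tendstoD(2)[OF infsum_sum_tendsto[OF fserD(5)[OF f]] \<open>e > 0\<close>])
    moreover have "\<forall>\<^sub>F X in finite_subsets_at_top (UNIV :: (int^'n) set). finite X"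
      by (rule eventually_finite_subsets_at_top_weakI)
    ultimately show "\<forall>\<^sub>F X in finite_subsets_at_top UNIV. \<forall>x\<in>?B. dist (P X x) (G x) < e"
    proof eventually_elim
      case (elim X)
      then show ?case using tail[OF elim(2)] unfolding dist_norm norm_minus_commute[of "P X _"] by (meson le_less_trans)
    qed
  qed
  have cont: "continuous_on ?B (P X)" for X unfolding P_def by (intro continuous_intros continuous_fourier_mode)
  obtain i J where iJ: "\<And>X. (P X has_integral i X) ?B" "(G has_integral J) ?B" "(i \<longlongrightarrow> J) (finite_subsets_at_top UNIV)"
    by (rule uniform_limit_integral_cbox[OF ul cont]) auto
  have ct: "integral ?B (\<lambda>x. 1 :: complex) = of_real ((2 * pi) ^ CARD('n))"
  proof -
    have "measure lborel ?B = (\<Prod>i\<in>(UNIV::'n set). 2 * pi)"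
    proof -
      have "(0 :: real^'n) \<in> ?B" by (simp add: mem_box_cart)
      then have "?B \<noteq> {}" by blast
      from content_cbox_cart[OF this] show ?thesis by simp
    qed
    then show ?thesis by (simp add: scaleR_conv_of_real)
  qed
  have iX: "i X = ?c k * of_real ((2 * pi) ^ CARD('n))" if "finite X" "k \<in> X" for X
  proof -
    have "i X = integral ?B (P X)" using iJ(1) integral_unique by metis
    also have "\<dots> = (\<Sum>l\<in>X. ?c l * integral ?B (\<lambda>x. fourier_mode (l - k) (cvec x)))"
      unfolding P_def
      by (subst integral_sum[OF that(1)])
         (auto intro!: integrable_continuous continuous_intros continuous_fourier_mode)
    also have "\<dots> = (\<Sum>l\<in>X. if l = k then ?c k * of_real ((2 * pi) ^ CARD('n)) else 0)"
    proof (rule sum.cong[OF refl])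
      fix l
      show "?c l * integral ?B (\<lambda>x. fourier_mode (l - k) (cvec x)) = (if l = k then ?c k * of_real ((2 * pi) ^ CARD('n)) else 0)"
      proof (cases "l = k")
        case True
        then have "(\<lambda>x::real^'n. fourier_mode (l - k) (cvec x)) = (\<lambda>x. 1)" by simp
        then show ?thesis using True by (simp only: ct if_True refl)
      next
        case False
        then show ?thesis using integral_fourier_mode[of "l - k"] by simp
      qed
    qed
    also have "\<dots> = ?c k * of_real ((2 * pi) ^ CARD('n))" using that by simp
    finally show ?thesis .
  qed
  have "\<forall>\<^sub>F X in finite_subsets_at_top UNIV. i X = ?c k * of_real ((2 * pi) ^ CARD('n))"
    unfolding eventually_finite_subsets_at_top by (rule exI[of _ "{k}"]) (use iX in auto)
  then have "(i \<longlongrightarrow> ?c k * of_real ((2 * pi) ^ CARD('n))) (finite_subsets_at_top UNIV)" by (rule tendsto_eventually)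
  then have "J = ?c k * of_real ((2 * pi) ^ CARD('n))" using tendsto_unique[OF _ iJ(3)] by simp
  moreover have "integral ?B G = J" using iJ(2) by (rule integral_unique)
  ultimately show ?thesis unfolding fourier_coeff_def G_def[symmetric] by simp
qed

lemma fourier_norm_le:
  fixes V :: "(real^'n::finite) set"
  assumes f: "fb V a s F B"
  shows "fourier_norm V a s (\<lambda>I \<phi> \<xi>. F (I, 0, \<phi>, \<xi>)) \<le> ennreal B"
proof -
  obtain c b where f: "fser V a s F c b B" using f by (auto simp: fb_def)
  let ?F = "\<lambda>I \<phi> \<xi>. F (I, 0, \<phi>, \<xi>)"
  have le: "(SUP (I, \<eta>, \<phi>, \<xi>)\<in>cdomain V a s. ennreal (cmod (fourier_coeff ?F k I \<xi>))) * ennreal (exp (of_int (freq_norm k) * s))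
      \<le> ennreal (b k * wt s k)" for k
  proof -
    have "(SUP (I, \<eta>, \<phi>, \<xi>)\<in>cdomain V a s. ennreal (cmod (fourier_coeff ?F k I \<xi>))) \<le> ennreal (b k)"
    proof (rule SUP_least, clarify)
      fix I \<eta> \<phi> \<xi> assume "(I, \<eta>, \<phi>, \<xi>) \<in> cdomain V a s"
      then have z: "(I, 0, 0, \<xi>) \<in> cdomain V a s" using slow_part_cdomain by (fastforce simp: slow_part_def)
      show "ennreal (cmod (fourier_coeff ?F k I \<xi>)) \<le> ennreal (b k)"
        unfolding fourier_coeff_unique[OF f z] by (rule ennreal_leI[OF fserD(4)[OF f z]])
    qed
    moreover have "ennreal (b k * wt s k) = ennreal (b k) * ennreal (exp (of_int (freq_norm k) * s))"
      using fserD(3)[OF f] by (simp add: ennreal_mult wt_def mult.commute)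
    ultimately show ?thesis by (simp only: mult_right_mono zero_le)
  qed
  have "fourier_norm V a s ?F \<le> infsum (\<lambda>k. ennreal (b k * wt s k)) UNIV"
    unfolding fourier_norm_def by (rule infsum_mono[OF nonneg_summable_on_complete nonneg_summable_on_complete le]) auto
  also have "\<dots> = (SUP X\<in>{X. finite X \<and> X \<subseteq> UNIV}. \<Sum>k\<in>X. ennreal (b k * wt s k))"
    by (rule nonneg_infsum_complete) auto
  also have "\<dots> \<le> ennreal B"
  proof (rule SUP_least)
    fix X :: "(int^'n) set" assume "X \<in> {X. finite X \<and> X \<subseteq> UNIV}"
    then have X: "finite X" by simp
    have "(\<Sum>k\<in>X. b k * wt s k) \<le> infsum (\<lambda>k. b k * wt s k) UNIV"
      by (rule finite_sum_le_infsum[OF fserD(5)[OF f] X]) (use fserD(3)[OF f] in auto)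
    then show "(\<Sum>k\<in>X. ennreal (b k * wt s k)) \<le> ennreal B"
      using fserD(3)[OF f] fserD(6)[OF f] by (subst sum_ennreal) (auto intro!: ennreal_leI)
  qed
  finally show ?thesis .
qed

text \<open>At real points the coefficients are Fourier integrals of a real function, and those of opposite modes are conjugate.\<close>

lemma fser_real_coeff:
  assumes f: "fser V a s F c b B" and re: "\<And>z. z \<in> cdomain V a s \<Longrightarrow> real_phase z \<Longrightarrow> F z \<in> \<real>"
    and z: "z \<in> cdomain V a s" "real_phase z"
  shows "c (- k) z = cnj (c k z)"
proof -
  let ?F = "\<lambda>I \<phi> \<xi>. F (I, 0, \<phi>, \<xi>)"
  let ?I = "fst z" and ?\<xi> = "snd (snd (snd z))"
  have s: "(?I, 0, 0, ?\<xi>) \<in> cdomain V a s" using slow_part_cdomain[OF z(1)] by (simp add: slow_part_def)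
  have c: "c l z = c l (?I, 0, 0, ?\<xi>)" for l using bspec[OF fserD(2)[OF f, of l, unfolded slow_def] z(1)] by (simp add: slow_part_def)
  have r: "F (?I, 0, cvec x, ?\<xi>) \<in> \<real>" for x
    by (rule re) (use s z(2) in \<open>auto simp: mem_cdomain real_phase_alt cvec_def\<close>)
  have "fourier_coeff ?F (- k) ?I ?\<xi> = cnj (fourier_coeff ?F k ?I ?\<xi>)"
  proof -
    have "fourier_mode k (cvec x) = cnj (fourier_mode (- k) (cvec x))" for x
      by (simp add: fourier_mode_def freq_pair_def cvec_def exp_cnj sum_negf)
    then have "F (?I, 0, cvec x, ?\<xi>) * fourier_mode (- (- k)) (cvec x) = cnj (F (?I, 0, cvec x, ?\<xi>) * fourier_mode (- k) (cvec x))" for x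
      using r[of x] by (simp add: Reals_cnj_iff)
    then show ?thesis unfolding fourier_coeff_def by (simp only: integral_cnj[symmetric]) simp
  qed
  then show ?thesis unfolding fourier_coeff_unique[OF f s] c[symmetric] .
qed

lemma fmode_cnj: "real_phase z \<Longrightarrow> fmode (- k) z = cnj (fmode k z)"
  by (simp add: fmode_alt real_phase_alt exp_cnj sum_negf Reals_cnj_iff)

lemma bij_uminus_freq: "bij_betw (uminus :: int^'n \<Rightarrow> int^'n) UNIV UNIV"
  by (rule bij_betwI[where g = uminus]) auto

text \<open>Modes \<open>k\<close> and \<open>- k\<close> are conjugate at real points, and a symmetric multiplier respects this pairing.\<close>

lemma multiplier_real:
  assumes f: "fser V a s F c b B" and re: "\<And>z. z \<in> cdomain V a s \<Longrightarrow> real_phase z \<Longrightarrow> F z \<in> \<real>"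
    and w: "\<And>k. w (- k) = w k" and z: "z \<in> cdomain V a s" "real_phase z"
  shows "infsum (\<lambda>k. of_real (w k) * c k z * fmode k z) UNIV \<in> \<real>"
proof -
  let ?g = "\<lambda>k. of_real (w k) * c k z * fmode k z"
  have "cnj (infsum ?g UNIV) = infsum (\<lambda>k. cnj (?g k)) UNIV" by (rule infsum_cnj[symmetric])
  also have "\<dots> = infsum (\<lambda>k. ?g (- k)) UNIV"
    by (simp add: fser_real_coeff[OF f re z] fmode_cnj[OF z(2)] w)
  also have "\<dots> = infsum ?g UNIV" by (rule infsum_reindex_bij_betw[OF bij_uminus_freq])
  finally show ?thesis by (simp add: Reals_cnj_iff)
qed

section \<open>Pairs of inverse symplectic changes\<close>

text \<open>The maps invert each other at every point of the domain, also where the image leaves it: the maps constructed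
  below keep their properties on a larger domain.\<close>

definition change_pair :: "(real^'n::finite) set \<Rightarrow> real \<Rightarrow> real \<Rightarrow> real \<Rightarrow> real
    \<Rightarrow> ('n phase \<Rightarrow> 'n phase) \<Rightarrow> ('n phase \<Rightarrow> 'n phase) \<Rightarrow> bool" where
  "change_pair V a s p q C C' \<longleftrightarrow>
     symplectic_change_on (cdomain V a s) C \<and> symplectic_change_on (cdomain V a s) C' \<and>
     (\<forall>z\<in>cdomain V a s. disp p q (C z - z) \<and> disp p q (C' z - z) \<and> C' (C z) = z \<and> C (C' z) = z)"

lemma symplectic_changeI:
  assumes "holo_map_on T C" "inj_on C T"
    "\<And>z u w. z \<in> T \<Longrightarrow> symp_form (dd C z u) (dd C z w) = symp_form u w"
    "\<And>z j. z \<in> T \<Longrightarrow> C (shift_angle j z) = shift_angle j (C z)"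
    "\<And>z. z \<in> T \<Longrightarrow> real_phase z \<Longrightarrow> real_phase (C z)"
  shows "symplectic_change_on T C"
  using assms unfolding symplectic_change_on_def symplectic_on_def by blast

lemma symplectic_changeD:
  assumes "symplectic_change_on T C"
  shows "holo_map_on T C" "inj_on C T"
    "z \<in> T \<Longrightarrow> symp_form (dd C z u) (dd C z w) = symp_form u w"
    "z \<in> T \<Longrightarrow> C (shift_angle j z) = shift_angle j (C z)"
    "z \<in> T \<Longrightarrow> real_phase z \<Longrightarrow> real_phase (C z)"
  using assms unfolding symplectic_change_on_def symplectic_on_def by blast+

lemma symplectic_change_subset:
  assumes C: "symplectic_change_on T C" and sub: "T' \<subseteq> T"
  shows "symplectic_change_on T' C"
proof (rule symplectic_changeI)
  show "holo_map_on T' C" by (rule holo_map_subset[OF symplectic_changeD(1)[OF C] sub])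
  show "inj_on C T'" by (rule inj_on_subset[OF symplectic_changeD(2)[OF C] sub])
  fix z assume "z \<in> T'"
  then have z: "z \<in> T" using sub by blast
  show "symp_form (dd C z u) (dd C z w) = symp_form u w" for u w by (rule symplectic_changeD(3)[OF C z])
  show "C (shift_angle j z) = shift_angle j (C z)" for j by (rule symplectic_changeD(4)[OF C z])
  show "real_phase (C z)" if "real_phase z" by (rule symplectic_changeD(5)[OF C z that])
qed

lemma symplectic_change_compose:
  assumes F: "symplectic_change_on T F" and C: "symplectic_change_on S C" and im: "C ` S \<subseteq> T"
    and inj: "inj_on (\<lambda>z. F (C z)) S"
  shows "symplectic_change_on S (\<lambda>z. F (C z))"
proof (rule symplectic_changeI[OF _ inj])
  note h = symplectic_changeD(1)[OF F] symplectic_changeD(1)[OF C] im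
  show "holo_map_on S (\<lambda>z. F (C z))" by (rule holo_map_compose(1)[OF h])
  fix z assume z: "z \<in> S"
  then have Cz: "C z \<in> T" using im by auto
  show "symp_form (dd (\<lambda>z. F (C z)) z u) (dd (\<lambda>z. F (C z)) z w) = symp_form u w" for u w
    unfolding holo_map_compose(2)[OF h z] symplectic_changeD(3)[OF F Cz] by (rule symplectic_changeD(3)[OF C z])
  show "F (C (shift_angle j z)) = shift_angle j (F (C z))" for j
    by (simp only: symplectic_changeD(4)[OF C z] symplectic_changeD(4)[OF F Cz])
  show "real_phase (F (C z))" if "real_phase z"
    by (rule symplectic_changeD(5)[OF F Cz symplectic_changeD(5)[OF C z that]])
qed

lemma change_pairD:
  assumes "change_pair V a s p q C C'" "z \<in> cdomain V a s"
  shows "disp p q (C z - z)" "disp p q (C' z - z)" "C' (C z) = z" "C (C' z) = z"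
  using assms unfolding change_pair_def by blast+

lemma change_pair_mono:
  assumes 1: "change_pair V a s p q C C'" and le: "a' \<le> a" "s' \<le> s" "p \<le> p'" "q \<le> q'"
  shows "change_pair V a' s' p' q' C C'"
  unfolding change_pair_def
proof (intro conjI ballI)
  have sub: "cdomain V a' s' \<subseteq> cdomain V a s" by (rule cdomain_mono[OF le(1,2)])
  have sy: "symplectic_change_on (cdomain V a s) C" "symplectic_change_on (cdomain V a s) C'"
    using 1 by (auto simp: change_pair_def)
  show "symplectic_change_on (cdomain V a' s') C" "symplectic_change_on (cdomain V a' s') C'"
    by (rule symplectic_change_subset[OF sy(1) sub], rule symplectic_change_subset[OF sy(2) sub])
  fix z assume "z \<in> cdomain V a' s'"
  then have z: "z \<in> cdomain V a s" using sub by blast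
  show "disp p' q' (C z - z)" "disp p' q' (C' z - z)"
    by (rule disp_mono[OF change_pairD(1)[OF 1 z] le(3,4)], rule disp_mono[OF change_pairD(2)[OF 1 z] le(3,4)])
  show "C' (C z) = z" "C (C' z) = z" by (rule change_pairD[OF 1 z])+
qed

lemma change_pair_image:
  assumes 1: "change_pair V a s p q C C'" and z: "z \<in> cdomain V a' s'" and le: "a' \<le> a" "s' \<le> s"
  shows "C z \<in> cdomain V (a' + p) (s' + q)" "C' z \<in> cdomain V (a' + p) (s' + q)"
proof -
  note z' = cdomain_monoD[OF z le]
  have "z + (C z - z) \<in> cdomain V (a' + p) (s' + q)" "z + (C' z - z) \<in> cdomain V (a' + p) (s' + q)"
    by (rule cdomain_add[OF z change_pairD(1)[OF 1 z']], rule cdomain_add[OF z change_pairD(2)[OF 1 z']])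
  then show "C z \<in> cdomain V (a' + p) (s' + q)" "C' z \<in> cdomain V (a' + p) (s' + q)" by simp_all
qed

text \<open>The domain shrinks by the displacements of the two maps only, not by the losses needed to construct them.\<close>

lemma change_pair_compose:
  assumes 1: "change_pair V a1 s1 p1 q1 C1 C1'" and 2: "change_pair V a2 s2 p2 q2 C2 C2'"
    and a: "a + p2 \<le> a1" "a + p1 \<le> a2" and s: "s + q2 \<le> s1" "s + q1 \<le> s2"
    and n: "0 \<le> p1" "0 \<le> p2" "0 \<le> q1" "0 \<le> q2"
  shows "change_pair V a s (p1 + p2) (q1 + q2) (\<lambda>z. C1 (C2 z)) (\<lambda>z. C2' (C1' z))"
proof -
  let ?T = "cdomain V a s"
  have le: "a \<le> a1" "a \<le> a2" "s \<le> s1" "s \<le> s2" using a s n by auto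
  have T1: "z \<in> cdomain V a1 s1" and T2: "z \<in> cdomain V a2 s2" if "z \<in> ?T" for z
    using that by (auto intro: cdomain_monoD[OF _ le(1,3)] cdomain_monoD[OF _ le(2,4)])
  have C2: "C2 z \<in> cdomain V a1 s1" if "z \<in> ?T" for z
    by (rule cdomain_monoD[OF change_pair_image(1)[OF 2 that le(2,4)] a(1) s(1)])
  have C1': "C1' z \<in> cdomain V a2 s2" if "z \<in> ?T" for z
    by (rule cdomain_monoD[OF change_pair_image(2)[OF 1 that le(1,3)] a(2) s(2)])
  have inv: "C2' (C1' (C1 (C2 z))) = z" "C1 (C2 (C2' (C1' z))) = z" if "z \<in> ?T" for z
    using change_pairD(3)[OF 1 C2[OF that]] change_pairD(3)[OF 2 T2[OF that]]
      change_pairD(4)[OF 2 C1'[OF that]] change_pairD(4)[OF 1 T1[OF that]] by simp_all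
  have sy: "symplectic_change_on (cdomain V a1 s1) C1" "symplectic_change_on (cdomain V a1 s1) C1'"
    "symplectic_change_on (cdomain V a2 s2) C2" "symplectic_change_on (cdomain V a2 s2) C2'"
    using 1 2 by (auto simp: change_pair_def)
  have "symplectic_change_on ?T (\<lambda>z. C1 (C2 z))"
    by (rule symplectic_change_compose[OF sy(1) symplectic_change_subset[OF sy(3)]])
       (use C2 T2 in \<open>auto intro!: inj_on_inverseI[of _ "\<lambda>z. C2' (C1' z)"] simp: inv\<close>)
  moreover have "symplectic_change_on ?T (\<lambda>z. C2' (C1' z))"
    by (rule symplectic_change_compose[OF sy(4) symplectic_change_subset[OF sy(2)]])
       (use C1' T1 in \<open>auto intro!: inj_on_inverseI[of _ "\<lambda>z. C1 (C2 z)"] simp: inv\<close>)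
  moreover have "disp (p1 + p2) (q1 + q2) (C1 (C2 z) - z)" if "z \<in> ?T" for z
    using disp_add[OF change_pairD(1)[OF 1 C2[OF that]] change_pairD(1)[OF 2 T2[OF that]]] by simp
  moreover have "disp (p1 + p2) (q1 + q2) (C2' (C1' z) - z)" if "z \<in> ?T" for z
    using disp_add[OF change_pairD(2)[OF 1 T1[OF that]] change_pairD(2)[OF 2 C1'[OF that]]] by simp
  ultimately show ?thesis unfolding change_pair_def using inv by blast
qed

context ham_flow
begin

lemma flow_symplectic_change:
  assumes re: "\<And>w. w \<in> cdomain V a s \<Longrightarrow> real_phase w \<Longrightarrow> \<psi> w \<in> \<real>"
  shows "symplectic_change_on (dom 1) (flow \<psi>)"
proof (rule symplectic_changeI)
  have sub: "dom 1 \<subseteq> dom (15/16)" by (rule dom_mono) simp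
  show "holo_map_on (dom 1) (flow \<psi>)" by (rule holo_map_subset[OF flow_holo sub])
  show "inj_on (flow \<psi>) (dom 1)" by (rule inj_on_inverseI[where g = "flow (\<lambda>z. - \<psi> z)"]) (rule flow_inverse)
  fix z assume "z \<in> dom 1"
  then have z: "z \<in> dom (15/16)" using sub by blast
  show "symp_form (dd (flow \<psi>) z u) (dd (flow \<psi>) z w) = symp_form u w" for u w by (rule flow_symplectic[OF z])
  show "flow \<psi> (shift_angle j z) = shift_angle j (flow \<psi> z)" for j by (rule flow_shift[OF z])
  show "real_phase (flow \<psi> z)" if "real_phase z" by (rule flow_real[OF re z that])
qed

text \<open>All properties of the flow are available for \<open>- \<psi>\<close> as well, which satisfies the same bounds.\<close>

lemma flow_change_pair:
  assumes re: "\<And>w. w \<in> cdomain V a s \<Longrightarrow> real_phase w \<Longrightarrow> \<psi> w \<in> \<real>"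
  shows "change_pair V (a - da) (s - ds) (2 * X / ds) (2 * X / da) (flow \<psi>) (flow (\<lambda>z. - \<psi> z))"
proof -
  interpret neg: ham_flow V a s da ds "\<lambda>z. - \<psi> z" "\<lambda>k z. - x k z" y S X by (rule neg_flow)
  have d1: "cdomain V (a - da) (s - ds) = dom 1" by (simp add: dom_def)
  have sub: "dom 1 \<subseteq> dom (15/16)" by (rule dom_mono) simp
  show ?thesis
    unfolding change_pair_def d1
  proof (intro conjI ballI)
    show "symplectic_change_on (dom 1) (flow \<psi>)" by (rule flow_symplectic_change[OF re])
    show "symplectic_change_on (dom 1) (flow (\<lambda>z. - \<psi> z))"
      by (rule neg.flow_symplectic_change) (simp add: re)
    fix z assume z: "z \<in> dom 1"
    then have z15: "z \<in> dom (15/16)" using sub by blast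
    show "disp (2 * X / ds) (2 * X / da) (flow \<psi> z - z)" by (rule flow_disp[OF z15])
    show "disp (2 * X / ds) (2 * X / da) (flow (\<lambda>z. - \<psi> z) z - z)" by (rule neg.flow_disp[OF z15])
    show "flow (\<lambda>z. - \<psi> z) (flow \<psi> z) = z" by (rule flow_inverse[OF z])
    show "flow \<psi> (flow (\<lambda>z. - \<psi> z) z) = z" using neg.flow_inverse[OF z] by simp
  qed
qed

lemma quadratic_fb:
  assumes g: "fb V a s g B" and z: "z \<in> dom (14/16)" and h: "0 < h" "h < 1/2"
  shows "cmod (g (z + h *\<^sub>R ham \<psi> z) - g z - of_real h * lie \<psi> g z) \<le> 8 * B * h\<^sup>2"
proof -
  have z13: "z \<in> dom (13/16)" using z dom_mono[of "13/16" "14/16"] by auto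
  have in13: "z + cscale \<zeta> (ham \<psi> z) \<in> dom (13/16)" if "cmod \<zeta> < 1" for \<zeta>
    by (rule dom_add[OF z, of "1/16"]) (use disp_cscale[OF disp_ham'[OF z13], of \<zeta> 1] that in auto)
  have ins: "z + cscale \<zeta> (ham \<psi> z) \<in> cdomain V a s" if "cmod \<zeta> < 1" for \<zeta>
    by (rule subsetD[OF dom_sub in13[OF that]]) simp
  have "cmod (g (z + h *\<^sub>R ham \<psi> z) - g z - of_real h * dd g z (ham \<psi> z)) \<le> 8 * B / 1\<^sup>2 * h\<^sup>2"
    by (rule holo_quadratic[OF fb_holo[OF g] zero_less_one ins fb_bound[OF g ins]]) (use h in auto)
  then show ?thesis by (simp add: lie_def)
qed

lemma flow_lie_series_fb:
  assumes g: "fb V a s g B" and W: "fb V (a - da / 4) (s - ds / 4) W B'"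
    and eq: "\<And>z. z \<in> dom (13/16) \<Longrightarrow> lie \<psi> g z = W z" and z: "z \<in> dom 1"
  shows "g (flow \<psi> z) = g z + lie_series \<psi> W 1 z"
proof (rule flow_lie_series[OF W])
  have sub: "dom (14/16) \<subseteq> dom (13/16)" "dom (14/16) \<subseteq> cdomain V a s"
    by (rule dom_mono, simp) (rule dom_sub, simp)
  show "cmod (g (z + h *\<^sub>R ham \<psi> z) - g z - of_real h * W z) \<le> 8 * B * h\<^sup>2"
    if "z \<in> dom (14/16)" "0 < h" "h < 1/2" for z h
    using quadratic_fb[OF g that] eq[of z] sub that by auto
  show "isCont g z" if "z \<in> dom (14/16)" for z
    by (rule holo_continuous[OF fb_holo[OF g]]) (use that sub in blast)
  show "z \<in> dom (15/16)" using z dom_mono[of "15/16" 1] by auto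
qed

lemma lie_series_fb:
  assumes W: "fb V (a - da / 4) (s - ds / 4) W B"
  shows "fb V (a - da) (s - ds) (lie_series \<psi> W 1) (3/2 * B)"
proof -
  have B0: "0 \<le> B" by (rule fb_nonneg[OF W])
  have g: "(\<lambda>n. (1/3) ^ n * B) sums (3/2 * B)"
    using sums_mult2[OF geometric_sums[of "1/3::real"], of B] by simp
  have "fb V (a - da) (s - ds) (\<lambda>z. of_real (1 ^ Suc n / fact (Suc n)) * (lie \<psi> ^^ n) W z) ((1/3) ^ n * B)" for n
  proof (rule fb_mono[OF fb_cmult[OF lie_iterate_quarter(2)[OF W]] order_refl order_refl])
    have "cmod (of_real (1 ^ Suc n / fact (Suc n))) * (fact n * (1/3) ^ n * B) = fact n / fact (Suc n) * ((1/3) ^ n * B)"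
      by (simp only: norm_of_real) (simp del: fact_Suc)
    also have "\<dots> \<le> 1 * ((1/3) ^ n * B)"
      by (rule mult_right_mono) (use B0 fact_mono[of n "Suc n", where 'a=real] in \<open>auto simp del: fact_Suc\<close>)
    finally show "cmod (of_real (1 ^ Suc n / fact (Suc n))) * (fact n * (1/3) ^ n * B) \<le> (1/3) ^ n * B" by simp
  qed
  note F = this
  have "fb V (a - da) (s - ds) (lie_series \<psi> W 1) (\<Sum>n. (1/3) ^ n * B)"
  proof (rule fb_suminf[OF F])
    show "summable (\<lambda>n. (1/3) ^ n * B)" using g by (rule sums_summable)
    show "0 \<le> s - ds" using dss by simp
    show "(\<lambda>n. of_real (1 ^ Suc n / fact (Suc n)) * (lie \<psi> ^^ n) W z) sums lie_series \<psi> W 1 z"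
      if "z \<in> cdomain V (a - da) (s - ds)" for z
      by (rule series_has_sum(2)[OF W]) (use that dom_mono[of "13/16" 1] in \<open>auto simp: dom_def\<close>)
  qed
  then show ?thesis unfolding sums_unique[OF g, symmetric] .
qed

lemma lie_iterate_linear:
  assumes F: "fb V a s F B" and G: "fb V a s G B'"
  shows "z \<in> cdomain V (a - da) (s - ds) \<Longrightarrow>
    (lie \<psi> ^^ n) (\<lambda>z. F z + w * G z) z = (lie \<psi> ^^ n) F z + w * (lie \<psi> ^^ n) G z"
proof (induction n arbitrary: z)
  case (Suc n)
  let ?T = "cdomain V (a - da) (s - ds)"
  have h: "holo_fun_on ?T ((lie \<psi> ^^ n) F)" "holo_fun_on ?T ((lie \<psi> ^^ n) G)"
    by (rule fb_holo[OF fb_lie_iterate[OF trig _ da ds dss]], fact F G)+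
  have "dd ((lie \<psi> ^^ n) (\<lambda>z. F z + w * G z)) z (ham \<psi> z) = dd (\<lambda>z. (lie \<psi> ^^ n) F z + w * (lie \<psi> ^^ n) G z) z (ham \<psi> z)"
    by (simp only: dd_cong[OF open_cdomain Suc.prems Suc.IH])
  also have "\<dots> = dd ((lie \<psi> ^^ n) F) z (ham \<psi> z) + w * dd ((lie \<psi> ^^ n) G) z (ham \<psi> z)"
    by (simp only: holo_add(2)[OF h(1) holo_cmult(1)[OF h(2)] Suc.prems] holo_cmult(2)[OF h(2) Suc.prems])
  finally show ?case
    unfolding funpow.simps comp_apply lie_def[of \<psi> "(lie \<psi> ^^ n) (\<lambda>z. F z + w * G z)"]
      lie_def[of \<psi> "(lie \<psi> ^^ n) F"] lie_def[of \<psi> "(lie \<psi> ^^ n) G"] .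
qed simp

text \<open>If the unperturbed part has derivative \<open>- R\<close> along the flow, its Lie series consists of the iterated
  brackets of \<open>- R\<close>, one order behind those of \<open>Q\<close>.  Terms with the same number of brackets combine to
  brackets of \<open>Q - t * R\<close> with \<open>t\<close> in the unit interval.  When \<open>R\<close> consists of modes of \<open>Q\<close>, this
  difference is no larger than \<open>Q\<close>, so nothing is lost by treating the two series together.\<close>

lemma lie_series_combine:
  assumes Q: "fb V a s Q B" and R: "fb V a s R B'"
    and QR: "\<And>t. 0 \<le> t \<Longrightarrow> t \<le> 1 \<Longrightarrow> fb V a s (\<lambda>z. Q z - of_real t * R z) B"
  shows "fb V (a - da) (s - ds) (\<lambda>z. lie_series \<psi> (lie \<psi> Q) 1 z + (lie_series \<psi> (\<lambda>z. - R z) 1 z + R z))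
    (5/4 * (2 * exp 1 * X / (da * ds)) * B)"
proof -
  let ?T = "cdomain V (a - da) (s - ds)"
  define \<kappa> where "\<kappa> = 2 * exp 1 * X / (da * ds)"
  have B0: "0 \<le> B" by (rule fb_nonneg[OF Q])
  have \<kappa>: "0 \<le> \<kappa>" "\<kappa> \<le> 1/5"
  proof -
    show "0 \<le> \<kappa>" using X0 da ds by (simp add: \<kappa>_def)
    have "2 * exp 1 * X \<le> 6 * X" using X0 exp_le by (intro mult_right_mono) auto
    also have "\<dots> \<le> 1/5 * (da * ds)" using small X0 by simp
    finally show "\<kappa> \<le> 1/5" unfolding \<kappa>_def using da ds by (simp add: pos_divide_le_eq)
  qed
  define E where "E = (\<lambda>n z. of_real (1 / fact (Suc n)) * (lie \<psi> ^^ Suc n) (\<lambda>z. Q z - of_real (1 / real (Suc (Suc n))) * R z) z)"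
  have E: "fb V (a - da) (s - ds) (E n) (\<kappa> ^ Suc n * B)" for n
    unfolding E_def
  proof (rule fb_mono[OF fb_cmult[OF fb_lie_iterate[OF trig QR da ds dss]] order_refl order_refl])
    show "cmod (of_real (1 / fact (Suc n))) * (fact (Suc n) * (2 * exp 1 * X / (da * ds)) ^ Suc n * B) \<le> \<kappa> ^ Suc n * B"
      unfolding \<kappa>_def[symmetric] norm_of_real by (simp del: fact_Suc)
  qed auto
  have gs: "(\<lambda>n. \<kappa> ^ Suc n * B) sums (\<kappa> / (1 - \<kappa>) * B)"
    using sums_mult2[OF sums_mult[OF geometric_sums[of \<kappa>], of \<kappa>], of B] \<kappa> by (simp add: mult_ac)
  have "fb V (a - da) (s - ds) (\<lambda>z. lie_series \<psi> (lie \<psi> Q) 1 z + (lie_series \<psi> (\<lambda>z. - R z) 1 z + R z)) (\<Sum>n. \<kappa> ^ Suc n * B)"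
  proof (rule fb_suminf[OF E sums_summable[OF gs]])
    show "0 \<le> s - ds" using dss by simp
    fix z assume z: "z \<in> ?T"
    have z13: "z \<in> dom (13/16)" using z dom_mono[of "13/16" 1] by (auto simp: dom_def)
    have p4: "a - da / 4 < a" "s - ds / 4 < s" "0 \<le> s - ds / 4" using da ds dss by auto
    note lQ = fb_lie[OF trig Q p4(1,1,2,2,3)]
    have mR: "fb V (a - da / 4) (s - ds / 4) (\<lambda>z. - R z) B'" by (rule fb_mono[OF fb_uminus[OF R]]) (use da ds in auto)
    let ?q = "\<lambda>n. (lie \<psi> ^^ n) Q z" and ?r = "\<lambda>n. (lie \<psi> ^^ n) R z"
    have 1: "(\<lambda>n. of_real (1 / fact (Suc n)) * ?q (Suc n)) sums lie_series \<psi> (lie \<psi> Q) 1 z"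
      using series_has_sum(2)[OF lQ _ z13, of 1] by (simp add: funpow_Suc_right del: funpow.simps)
    have neg: "(lie \<psi> ^^ n) (\<lambda>z. - R z) z = - ?r n" for n
      using lie_iterate_linear[OF R R z, of n "-2"] by simp
    have "(\<lambda>n. of_real (1 / fact (Suc n)) * (- ?r n)) sums lie_series \<psi> (\<lambda>z. - R z) 1 z"
      using series_has_sum(2)[OF mR _ z13, of 1] by (simp add: neg)
    then have 2: "(\<lambda>n. of_real (1 / fact (Suc (Suc n))) * (- ?r (Suc n))) sums (lie_series \<psi> (\<lambda>z. - R z) 1 z + R z)"
      by (subst sums_Suc_iff) simp
    have "E n z = of_real (1 / fact (Suc n)) * ?q (Suc n) + of_real (1 / fact (Suc (Suc n))) * (- ?r (Suc n))" for n
    proof -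
      have "(lie \<psi> ^^ Suc n) (\<lambda>z. Q z - of_real (1 / real (Suc (Suc n))) * R z) z
          = ?q (Suc n) + (- of_real (1 / real (Suc (Suc n)))) * ?r (Suc n)"
        using lie_iterate_linear[OF Q R z, of "Suc n" "- of_real (1 / real (Suc (Suc n)))"] by simp
      then have "E n z = of_real (1 / fact (Suc n)) * ?q (Suc n)
          + of_real (1 / fact (Suc n) * (1 / real (Suc (Suc n)))) * (- ?r (Suc n))"
        unfolding E_def by (simp only: distrib_left of_real_mult mult_minus_left mult_minus_right mult.assoc)
      moreover have "1 / fact (Suc n) * (1 / real (Suc (Suc n))) = (1 / fact (Suc (Suc n)) :: real)"
        by (simp add: fact_Suc[of "Suc n"] mult.commute del: of_nat_Suc)
      ultimately show ?thesis by simp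
    qed
    then show "(\<lambda>n. E n z) sums (lie_series \<psi> (lie \<psi> Q) 1 z + (lie_series \<psi> (\<lambda>z. - R z) 1 z + R z))"
      using sums_add[OF 1 2] by simp
  qed
  moreover have "(\<Sum>n. \<kappa> ^ Suc n * B) \<le> 5/4 * \<kappa> * B"
  proof -
    have "\<kappa> / (1 - \<kappa>) \<le> \<kappa> / (4/5)" using \<kappa> by (intro divide_left_mono) auto
    then have "\<kappa> / (1 - \<kappa>) * B \<le> 5/4 * \<kappa> * B" using B0 by (intro mult_right_mono) auto
    then show ?thesis using gs by (simp add: sums_iff)
  qed
  ultimately show ?thesis unfolding \<kappa>_def[symmetric] by (rule fb_mono[OF _ order_refl order_refl])
qed

end

section \<open>One normalization step\<close>

lemma fser_slow:
  fixes V :: "(real^'n::finite) set"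
  assumes "holo_fun_on (cdomain V a s) g" "slow (cdomain V a s) g" "\<And>z. z \<in> cdomain V a s \<Longrightarrow> cmod (g z) \<le> B" "0 \<le> B"
  shows "fser V a s g (\<lambda>k z. if k = 0 then g z else 0) (\<lambda>k. if k = 0 then B else 0) B"
proof (rule fserI)
  fix k :: "int^'n"
  show "0 \<le> (if k = 0 then B else 0)" using assms(4) by simp
  show "slow (cdomain V a s) (\<lambda>z. if k = 0 then g z else 0)" using assms(2) by (cases "k = 0") (auto simp: slow_def)
  show "holo_fun_on (cdomain V a s) (\<lambda>z. if k = 0 then g z else 0)" using assms(1) by (cases "k = 0") (auto simp: holo_const)
  show "cmod (if k = 0 then g z else 0) \<le> (if k = 0 then B else 0)" if "z \<in> cdomain V a s" for z
    using assms(3)[OF that] by simp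
next
  have hs: "((\<lambda>k::int^'n. (if k = 0 then B else 0) * wt s k) has_sum B) UNIV"
    by (rule has_sum_finite_neutralI[of "{0}"]) (auto simp: wt_def)
  show "(\<lambda>k::int^'n. (if k = 0 then B else 0) * wt s k) summable_on UNIV" using hs by (rule has_sum_imp_summable)
  show "infsum (\<lambda>k::int^'n. (if k = 0 then B else 0) * wt s k) UNIV \<le> B" unfolding infsumI[OF hs] ..
  show "((\<lambda>k. (if k = 0 then g z else 0) * fmode k z) has_sum g z) UNIV" for z
    by (rule has_sum_finite_neutralI[of "{0}"]) (auto simp: fmode_alt)
qed

text \<open>The bracket with a function of \<open>I\<close> alone multiplies the mode \<open>k\<close> by \<open>- \<i> \<langle>\<omega>, k\<rangle>\<close>, so the equation
  is solved by division in each mode, at the cost of a factor \<open>1 / \<alpha>\<close> in the norm.\<close>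

lemma homological_equation:
  fixes V :: "(real^'n::finite) set" and x :: "int^'n \<Rightarrow> 'n phase \<Rightarrow> complex" and y :: "int^'n \<Rightarrow> real"
    and \<psi> :: "'n phase \<Rightarrow> complex"
  assumes hh: "holo_fun_on (cdomain V a s) hh" "slow (cdomain V a s) hh" "\<And>z. z \<in> cdomain V a s \<Longrightarrow> cmod (hh z) \<le> Bh"
    and nr: "\<And>k z. k \<in> S \<Longrightarrow> z \<in> cdomain V a s \<Longrightarrow> \<alpha> < cmod (dd hh z (kvec k))" and \<alpha>: "0 < \<alpha>"
    and P: "fser V a s P c b p" and S: "finite S"
  defines "x \<equiv> \<lambda>k z. if k \<in> S then c k z / (\<i> * dd hh z (kvec k)) else 0"
    and "y \<equiv> \<lambda>k. if k \<in> S then b k / \<alpha> else 0"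
    and "\<psi> \<equiv> \<lambda>z. \<Sum>k\<in>S. x k z * fmode k z"
  shows "trig V a s \<psi> x y S (p / \<alpha>)" "z \<in> cdomain V a s \<Longrightarrow> lie \<psi> hh z = - (\<Sum>k\<in>S. c k z * fmode k z)"
proof -
  let ?T = "cdomain V a s"
  have ne: "dd hh z (kvec k) \<noteq> 0" if "k \<in> S" "z \<in> ?T" for k z using nr[OF that] \<alpha> by auto
  show t: "trig V a s \<psi> x y S (p / \<alpha>)"
    unfolding trig_def
  proof (intro conjI fserI allI impI)
    show "holo_fun_on ?T (x k)" for k
    proof (cases "k \<in> S")
      case True
      have "holo_fun_on ?T (\<lambda>z. c k z / (\<i> * dd hh z (kvec k)))"
        by (rule holo_divide[OF fserD(1)[OF P] holo_cmult(1)[OF holo_dir_deriv[OF open_cdomain hh(1)]]]) (use ne True in auto)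
      then show ?thesis using True by (simp add: x_def)
    qed (simp add: x_def holo_const)
    show "slow ?T (x k)" for k
      unfolding slow_def
    proof
      fix z assume z: "z \<in> ?T"
      have "c k z = c k (slow_part z)" "dd hh z (kvec k) = dd hh (slow_part z) (kvec k)"
        using bspec[OF fserD(2)[OF P, of k, unfolded slow_def] z] bspec[OF slow_deriv(1)[OF hh(1,2), of "kvec k", unfolded slow_def] z] by auto
      then show "x k z = x k (slow_part z)" by (simp only: x_def)
    qed
    show "0 \<le> y k" for k using fserD(3)[OF P, of k] \<alpha> by (simp add: y_def)
    show "cmod (x k z) \<le> y k" if "z \<in> ?T" for k z
      using fserD(4)[OF P that, of k] nr[OF _ that, of k] \<alpha> fserD(3)[OF P, of k]
      by (auto simp: x_def y_def norm_divide norm_mult intro!: frac_le)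
    have le: "y k * wt s k \<le> 1 / \<alpha> * (b k * wt s k)" for k using fserD(3)[OF P, of k] \<alpha> by (simp add: y_def)
    have sP: "(\<lambda>k. 1 / \<alpha> * (b k * wt s k)) summable_on UNIV" by (rule summable_on_cmult_right[OF fserD(5)[OF P]])
    show sm: "(\<lambda>k. y k * wt s k) summable_on UNIV"
      by (rule summable_on_comparison_test[OF sP le]) (use fserD(3)[OF P] \<alpha> in \<open>auto simp: y_def\<close>)
    have "infsum (\<lambda>k. y k * wt s k) UNIV \<le> infsum (\<lambda>k. 1 / \<alpha> * (b k * wt s k)) UNIV" by (rule infsum_mono[OF sm sP le])
    also have "\<dots> \<le> p / \<alpha>" unfolding infsum_cmult_right' using fserD(6)[OF P] \<alpha> by (simp add: divide_right_mono)
    finally show "infsum (\<lambda>k. y k * wt s k) UNIV \<le> p / \<alpha>" .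
    show "((\<lambda>k. x k z * fmode k z) has_sum \<psi> z) UNIV" for z
      unfolding \<psi>_def by (rule has_sum_finite_neutralI[OF S]) (auto simp: x_def)
    show "finite S" by (rule S)
    show "y k = 0" if "k \<notin> S" for k using that by (simp add: y_def)
  qed
  assume z: "z \<in> ?T"
  \<comment> \<open>\<open>hh\<close> is a Fourier series consisting of the zero mode\<close>
  define hc where "hc = (\<lambda>(k::int^'n) z. if k = 0 then hh z else 0)"
  have "fser V a s hh hc (\<lambda>k. if k = 0 then Bh else 0) Bh"
    unfolding hc_def by (rule fser_slow[OF hh(1-3)]) (use order_trans[OF norm_ge_zero hh(3)[OF z]] in auto)
  from bracket_expand[OF t this z z]
  have hs: "((\<lambda>l. \<Sum>k\<in>S. \<i> * (dd (x k) z (kvec l) * hc l z - x k z * dd (hc l) z (kvec k)) * fmode (k + l) z) has_sum lie \<psi> hh z) UNIV" .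
  have "dd (hc l) z u = 0" if "l \<noteq> 0" for l u using that by (simp add: hc_def dd_eq[OF has_derivative_const])
  then have "((\<lambda>l. \<Sum>k\<in>S. \<i> * (dd (x k) z (kvec l) * hc l z - x k z * dd (hc l) z (kvec k)) * fmode (k + l) z)
      has_sum (\<Sum>k\<in>S. \<i> * (dd (x k) z (kvec 0) * hc 0 z - x k z * dd (hc 0) z (kvec k)) * fmode (k + 0) z)) UNIV"
    by (intro has_sum_finite_neutralI[of "{0}"]) (auto simp: hc_def)
  with hs have "lie \<psi> hh z = (\<Sum>k\<in>S. \<i> * (dd (x k) z (kvec 0) * hc 0 z - x k z * dd (hc 0) z (kvec k)) * fmode (k + 0) z)"
    by (rule has_sum_unique)
  also have "\<dots> = (\<Sum>k\<in>S. - (c k z * fmode k z))"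
  proof (rule sum.cong[OF refl])
    fix k assume k: "k \<in> S"
    have "dd (x k) z (kvec 0) = 0"
    proof -
      have "kvec (0 :: int^'n) = (0 :: 'n phase)" by (simp add: kvec_def zero_prod_def zero_vec_def)
      then show ?thesis using holo_linear(4)[OF fserD(1)[OF trig_fser[OF t]] z] by simp
    qed
    moreover have "dd (hc 0) z = dd hh z" by (simp add: hc_def)
    moreover have "\<i> * (x k z * dd hh z (kvec k)) = c k z" using k ne[OF k z] by (simp add: x_def)
    ultimately show "\<i> * (dd (x k) z (kvec 0) * hc 0 z - x k z * dd (hc 0) z (kvec k)) * fmode (k + 0) z = - (c k z * fmode k z)"
      by (simp add: right_diff_distrib)
  qed
  finally show "lie \<psi> hh z = - (\<Sum>k\<in>S. c k z * fmode k z)" by (simp add: sum_negf)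
qed

text \<open>The resonant terms present before the step come in two parts: \<open>Z1\<close>, which is bounded on a domain larger by
  \<open>(ga, gs)\<close>, so that its bracket with the generating function contains only one of the small losses \<open>da\<close>,
  \<open>ds\<close> in each denominator, and \<open>Z2\<close>, which is treated like \<open>P\<close> and therefore has to be of comparable size.\<close>

theorem normal_form_step:
  fixes V :: "(real^'n::finite) set"
  assumes hh: "holo_fun_on (cdomain V a s) hh" "slow (cdomain V a s) hh" "\<And>z. z \<in> cdomain V a s \<Longrightarrow> cmod (hh z) \<le> Bh"
    "\<And>z. z \<in> cdomain V a s \<Longrightarrow> real_phase z \<Longrightarrow> hh z \<in> \<real>"
    and nr: "\<And>k z. k \<notin> M \<Longrightarrow> freq_norm k < int N \<Longrightarrow> z \<in> cdomain V a s \<Longrightarrow> \<alpha> < cmod (dd hh z (kvec k))" and \<alpha>: "0 < \<alpha>"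
    and M: "\<And>k. - k \<in> M \<longleftrightarrow> k \<in> M"
    and P: "fb V a s P p" "\<And>z. z \<in> cdomain V a s \<Longrightarrow> real_phase z \<Longrightarrow> P z \<in> \<real>"
    and Z1: "fb V (a + ga) (s + gs) Z1 z1" "\<And>z. z \<in> cdomain V a s \<Longrightarrow> real_phase z \<Longrightarrow> Z1 z \<in> \<real>"
    and Z2: "fb V a s Z2 z2" "\<And>z. z \<in> cdomain V a s \<Longrightarrow> real_phase z \<Longrightarrow> Z2 z \<in> \<real>"
    and d: "0 < da" "0 < ds" "ds \<le> s" "0 < ga" "0 < gs" and small: "32 * (p / \<alpha>) \<le> da * ds" and \<mu>: "0 \<le> \<mu>"
  obtains C C' c P1 P' where
    "change_pair V (a - da) (s - ds) (2 * (p / \<alpha>) / ds) (2 * (p / \<alpha>) / da) C C'"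
    "\<And>k. holo_fun_on (cdomain V a s) (c k)" "\<And>k. slow (cdomain V a s) (c k)"
    "\<And>z. z \<in> cdomain V a s \<Longrightarrow> P1 z = (\<Sum>k\<in>{k\<in>M. freq_norm k < int N}. c k z * fmode k z)"
    "fb V a s P1 p" "\<And>z. z \<in> cdomain V a s \<Longrightarrow> real_phase z \<Longrightarrow> P1 z \<in> \<real>"
    "fb V (a - da) (s - ds) P' (exp (- real N * ds) * p + 5/4 * (2 * exp 1 * (p / \<alpha>) / (da * ds)) * (z2 + p)
        + 3/2 * (4 * \<mu> * (p / \<alpha>) / ds + 3/2 * z1 * (p / \<alpha>) * (1 / (da * gs) + 1 / (ga * ds))))"
    "\<And>z. z \<in> cdomain V (a - da) (s - ds) \<Longrightarrow> real_phase z \<Longrightarrow> P' z \<in> \<real>"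
    "\<And>z. z \<in> cdomain V (a - da) (s - ds) \<Longrightarrow>
       hh (C z) + of_real \<mu> * fst (snd (C z)) + (Z1 (C z) + Z2 (C z)) + P (C z)
       = hh z + of_real \<mu> * fst (snd z) + (Z1 z + Z2 z + P1 z) + P' z"
proof -
  let ?T = "cdomain V a s"
  obtain c b where f: "fser V a s P c b p" using P(1) by (auto simp: fb_def)
  define S where "S = {k. k \<notin> M \<and> freq_norm k < int N}"
  define X where "X = p / \<alpha>"
  have S: "finite S" unfolding S_def by (rule finite_subset[OF _ finite_freq_norm_le[of "int N"]]) auto
  have p0: "0 \<le> p" by (rule fser_nonneg[OF f])
  define x where "x = (\<lambda>k z. if k \<in> S then c k z / (\<i> * dd hh z (kvec k)) else 0)"
  define y where "y = (\<lambda>k. if k \<in> S then b k / \<alpha> else 0)"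
  define \<psi> where "\<psi> = (\<lambda>z. \<Sum>k\<in>S. x k z * fmode k z)"
  have hom: "trig V a s \<psi> x y S X" "\<And>z. z \<in> ?T \<Longrightarrow> lie \<psi> hh z = - (\<Sum>k\<in>S. c k z * fmode k z)"
    unfolding \<psi>_def x_def y_def X_def
    by (rule homological_equation[OF hh(1-3) _ \<alpha> f S]; use nr in \<open>simp add: S_def\<close>)+
  interpret ham_flow V a s da ds \<psi> x y S X
    by (rule ham_flow.intro) (use hom d small in \<open>auto simp: X_def\<close>)
  \<comment> \<open>\<open>w1\<close> selects the resonant modes, \<open>w2\<close> those removed by the homological equation, \<open>w3\<close> the tail\<close>
  define part where "part = (\<lambda>w z. infsum (\<lambda>k. of_real (w k) * c k z * fmode k z) UNIV)"
  define w1 w2 w3 :: "int^'n \<Rightarrow> real" where "w1 = (\<lambda>k. if k \<in> M \<and> freq_norm k < int N then 1 else 0)"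
    and "w2 = (\<lambda>k. if k \<in> S then 1 else 0)" and "w3 = (\<lambda>k. if int N \<le> freq_norm k then 1 else 0)"
  have w: "\<bar>w1 k\<bar> \<le> 1" "\<bar>w2 k\<bar> \<le> 1" "\<bar>w3 k\<bar> \<le> 1" "w1 k + w2 k + w3 k = 1" for k
    by (auto simp: w1_def w2_def w3_def S_def)
  have partf: "fser V a s (part w) (\<lambda>k z. of_real (w k) * c k z) (\<lambda>k. \<bar>w k\<bar> * b k) p" if "\<And>k. \<bar>w k\<bar> \<le> 1" for w
    unfolding part_def by (rule fser_multiplier[OF f that])
  have partb: "fb V a s (part w) p" if "\<And>k. \<bar>w k\<bar> \<le> 1" for w by (rule fser_fb[OF partf[OF that]])
  have parts: "((\<lambda>k. of_real (w k) * c k z * fmode k z) has_sum part w z) UNIV" if "\<And>k. \<bar>w k\<bar> \<le> 1" "z \<in> ?T" for w z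
    by (rule fserD(7)[OF partf[OF that(1)] that(2)])
  have decomp: "P z = part w1 z + part w2 z + part w3 z" if z: "z \<in> ?T" for z
  proof (rule has_sum_unique[OF fserD(7)[OF f z]])
    have "((\<lambda>k. of_real (w1 k) * c k z * fmode k z + of_real (w2 k) * c k z * fmode k z + of_real (w3 k) * c k z * fmode k z)
        has_sum (part w1 z + part w2 z + part w3 z)) UNIV"
      by (intro has_sum_add parts w z)
    moreover have "of_real (w1 k) * c k z * fmode k z + of_real (w2 k) * c k z * fmode k z + of_real (w3 k) * c k z * fmode k z
        = c k z * fmode k z" for k
    proof -
      have "of_real (w1 k) * c k z * fmode k z + of_real (w2 k) * c k z * fmode k z + of_real (w3 k) * c k z * fmode k z
        = of_real (w1 k + w2 k + w3 k) * (c k z * fmode k z)" by (simp add: algebra_simps)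
      then show ?thesis by (simp add: w)
    qed
    ultimately show "((\<lambda>k. c k z * fmode k z) has_sum (part w1 z + part w2 z + part w3 z)) UNIV" by simp
  qed
  have nrsum: "part w2 z = (\<Sum>k\<in>S. c k z * fmode k z)" if z: "z \<in> ?T" for z
    by (rule has_sum_unique[OF parts[OF w(2) z]], rule has_sum_finite_neutralI[OF S]) (auto simp: w2_def intro!: sum.cong)
  have fin1: "finite {k \<in> M. freq_norm k < int N}" by (rule finite_subset[OF _ finite_freq_norm_le[of "int N"]]) auto
  have ressum: "part w1 z = (\<Sum>k\<in>{k \<in> M. freq_norm k < int N}. c k z * fmode k z)" if z: "z \<in> ?T" for z
    by (rule has_sum_unique[OF parts[OF w(1) z]], rule has_sum_finite_neutralI[OF fin1]) (auto simp: w1_def intro!: sum.cong)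
  have real1: "part w1 z \<in> \<real>" if "z \<in> ?T" "real_phase z" for z
    unfolding part_def by (rule multiplier_real[OF f P(2) _ that]) (simp_all add: w1_def M)
  have psi_real: "\<psi> z \<in> \<real>" if z: "z \<in> ?T" "real_phase z" for z
  proof -
    have "cnj (\<psi> z) = (\<Sum>k\<in>S. x (- k) z * fmode (- k) z)"
      unfolding \<psi>_def cnj_sum
    proof (rule sum.cong[OF refl])
      fix k assume k: "k \<in> S"
      then have k': "- k \<in> S" by (simp add: S_def M)
      have kv: "kvec (- k) = - kvec k" by (rule phase_eqI) (auto simp: kvec_def)
      have "dd hh z (kvec k) \<in> \<real>"
        by (rule real_deriv[OF hh(1) open_cdomain _ z]) (auto simp: hh(4) real_phase_alt kvec_def)
      then show "cnj (x k z * fmode k z) = x (- k) z * fmode (- k) z"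
        using k k' by (simp add: x_def fmode_cnj[OF z(2)] fser_real_coeff[OF f P(2) z] kv holo_linear(2)[OF hh(1) z(1)] Reals_cnj_iff)
    qed
    also have "\<dots> = \<psi> z" unfolding \<psi>_def
      by (rule sum.reindex_bij_witness[of _ uminus uminus]) (auto simp: S_def M)
    finally show ?thesis by (simp add: Reals_cnj_iff)
  qed
  note cp = flow_change_pair[OF psi_real]
  have p4: "a - da / 4 < a" "s - ds / 4 < s" "0 \<le> s - ds / 4" "a - da / 4 < a + ga" "s - ds / 4 < s + gs" using d by auto
  \<comment> \<open>\<open>hh\<close> has derivative \<open>- ?R\<close> along the flow, so its Lie series is combined with that of \<open>?Q\<close>\<close>
  let ?R = "part w2" and ?Q = "\<lambda>z. Z2 z + P z"
  have Qb: "fb V a s ?Q (z2 + p)" by (rule fb_add[OF Z2(1) P(1)])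
  have QR: "fb V a s (\<lambda>z. ?Q z - of_real t * ?R z) (z2 + p)" if t: "0 \<le> t" "t \<le> 1" for t
  proof -
    define wt' where "wt' = (\<lambda>k. 1 - t * w2 k)"
    have wb: "\<bar>wt' k\<bar> \<le> 1" for k using t by (auto simp: wt'_def w2_def)
    have eq: "Z2 z + part wt' z = ?Q z - of_real t * ?R z" if z: "z \<in> ?T" for z
    proof -
      have "((\<lambda>k. of_real (wt' k) * c k z * fmode k z) has_sum (P z - of_real t * ?R z)) UNIV"
        using has_sum_add[OF fserD(7)[OF f z] has_sum_cmult_right[OF parts[OF w(2) z], of "- of_real t"]]
        by (simp add: wt'_def left_diff_distrib mult.assoc)
      then show ?thesis using has_sum_unique[OF parts[OF wb z]] by simp
    qed
    show ?thesis by (rule fb_cong[OF fb_add[OF Z2(1) partb[OF wb]] eq])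
  qed
  have lieQ: "fb V (a - da / 4) (s - ds / 4) (lie \<psi> ?Q) (X * (z2 + p) * (1 / (exp 1 * (a - (a - da / 4)) * (s - (s - ds / 4)))
      + 1 / (exp 1 * (a - (a - da / 4)) * (s - (s - ds / 4)))))"
    by (rule fb_lie[OF trig Qb p4(1,1,2,2,3)])
  have mR: "fb V (a - da / 4) (s - ds / 4) (\<lambda>z. - ?R z) p" by (rule fb_mono[OF fb_uminus[OF partb[OF w(2)]]]) (use d in auto)
  have Z1s: "fb V a s Z1 z1" by (rule fb_mono[OF Z1(1)]) (use d in auto)
  have z10: "0 \<le> z1" by (rule fb_nonneg[OF Z1s])
  have lieZ1: "fb V (a - da / 4) (s - ds / 4) (lie \<psi> Z1) (3/2 * z1 * X * (1 / (da * gs) + 1 / (ga * ds)))"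
  proof (rule fb_mono[OF fb_lie[OF trig Z1(1) p4(4,1,5,2,3)] order_refl order_refl])
    have e: "4 / exp (1::real) \<le> 3/2"
    proof -
      have "(8/3::real) \<le> exp 1" using abs_le_D2[OF e_approx_32] by simp
      then show ?thesis by (simp add: field_simps)
    qed
    have a1: "1 / (exp 1 * (a - (a - da / 4)) * (s + gs - (s - ds / 4))) \<le> 4 / exp 1 * (1 / (da * gs))"
    proof -
      have "1 / (exp 1 * (da / 4) * (gs + ds / 4)) \<le> 1 / (exp 1 * (da / 4) * gs)"
        by (intro divide_left_mono mult_left_mono mult_pos_pos) (use d in auto)
      then show ?thesis by (simp add: algebra_simps)
    qed
    have a2: "1 / (exp 1 * (a + ga - (a - da / 4)) * (s - (s - ds / 4))) \<le> 4 / exp 1 * (1 / (ga * ds))"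
    proof -
      have "1 / (exp 1 * (ga + da / 4) * (ds / 4)) \<le> 1 / (exp 1 * ga * (ds / 4))"
        by (intro divide_left_mono mult_right_mono mult_left_mono mult_pos_pos) (use d in auto)
      then show ?thesis by (simp add: algebra_simps)
    qed
    have "1 / (exp 1 * (a - (a - da / 4)) * (s + gs - (s - ds / 4))) + 1 / (exp 1 * (a + ga - (a - da / 4)) * (s - (s - ds / 4)))
      \<le> 4 / exp 1 * (1 / (da * gs) + 1 / (ga * ds))" using a1 a2 by (simp only: distrib_left)
    also have "\<dots> \<le> 3/2 * (1 / (da * gs) + 1 / (ga * ds))" by (rule mult_right_mono[OF e]) (use d in auto)
    finally have "X * z1 * (1 / (exp 1 * (a - (a - da / 4)) * (s + gs - (s - ds / 4))) + 1 / (exp 1 * (a + ga - (a - da / 4)) * (s - (s - ds / 4))))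
      \<le> X * z1 * (3/2 * (1 / (da * gs) + 1 / (ga * ds)))" by (rule mult_left_mono) (use X0 z10 in simp)
    then show "X * z1 * (1 / (exp 1 * (a - (a - da / 4)) * (s + gs - (s - ds / 4))) + 1 / (exp 1 * (a + ga - (a - da / 4)) * (s - (s - ds / 4))))
      \<le> 3/2 * z1 * X * (1 / (da * gs) + 1 / (ga * ds))" by (simp add: mult_ac)
  qed
  let ?E = "\<lambda>z. fst (snd (ham \<psi> z))"
  have Eb: "fb V (a - da / 4) (s - ds / 4) ?E (4 * X / ds)"
    unfolding ham_coord
    by (rule fb_mono[OF fb_uminus[OF fb_deriv_slow_dir[OF psi_fb disp_dirs(2), where \<rho> = "ds / 4" and ?a0.0 = "a - da / 4" and ?s0.0 = "s - ds / 4"]]])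
       (use d in auto)
  let ?A = "\<lambda>z. lie_series \<psi> (lie \<psi> ?Q) 1 z + (lie_series \<psi> (\<lambda>z. - ?R z) 1 z + ?R z)"
  define P' where "P' = (\<lambda>z. part w3 z + ?A z + (of_real \<mu> * lie_series \<psi> ?E 1 z + lie_series \<psi> (lie \<psi> Z1) 1 z))"
  have P'b: "fb V (a - da) (s - ds) P' (exp (- real N * ds) * p + 5/4 * (2 * exp 1 * X / (da * ds)) * (z2 + p)
        + (cmod (of_real \<mu>) * (3/2 * (4 * X / ds)) + 3/2 * (3/2 * z1 * X * (1 / (da * gs) + 1 / (ga * ds)))))"
    unfolding P'_def
  proof (intro fb_add fb_cmult lie_series_fb lieZ1 Eb)
    have "fser V a (s - ds) (part w3) (\<lambda>k z. of_real (w3 k) * c k z) (\<lambda>k. \<bar>w3 k\<bar> * b k) (exp (- real N * ds) * p)"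
      by (rule fser_tail_gain[OF partf[OF w(3)]]) (use d in \<open>auto simp: w3_def\<close>)
    then show "fb V (a - da) (s - ds) (part w3) (exp (- real N * ds) * p)"
      by (rule fb_mono[OF fser_fb]) (use d in auto)
    show "fb V (a - da) (s - ds) ?A (5/4 * (2 * exp 1 * X / (da * ds)) * (z2 + p))"
      by (rule lie_series_combine[OF Qb partb[OF w(2)] QR])
  qed
  have hhb: "fb V a s hh Bh" if "z \<in> ?T" for z
  proof -
    have "0 \<le> Bh" by (rule order_trans[OF norm_ge_zero hh(3)[OF that]])
    then show ?thesis by (intro fser_fb[OF fser_slow[OF hh(1-3)]]) auto
  qed
  have ident: "hh (flow \<psi> z) + of_real \<mu> * fst (snd (flow \<psi> z)) + (Z1 (flow \<psi> z) + Z2 (flow \<psi> z)) + P (flow \<psi> z)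
       = hh z + of_real \<mu> * fst (snd z) + (Z1 z + Z2 z + part w1 z) + P' z" if z: "z \<in> cdomain V (a - da) (s - ds)" for z
  proof -
    have z1: "z \<in> dom 1" using z by (simp add: dom_def)
    then have zT: "z \<in> ?T" and z15: "z \<in> dom (15/16)" using dom_sub[of 1] dom_mono[of "15/16" 1] by auto
    have 1: "hh (flow \<psi> z) = hh z + lie_series \<psi> (\<lambda>z. - ?R z) 1 z"
    proof (rule flow_lie_series_fb[OF hhb[OF zT] mR _ z1])
      fix z assume "z \<in> dom (13/16)"
      then have "z \<in> ?T" using dom_sub[of "13/16"] by auto
      then show "lie \<psi> hh z = - ?R z" using hom(2) nrsum by simp
    qed
    have 2: "fst (snd (flow \<psi> z)) = fst (snd z) + lie_series \<psi> ?E 1 z"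
      by (rule flow_limit(2)[OF z15 coord_simps(2)])
    have 3: "Z1 (flow \<psi> z) = Z1 z + lie_series \<psi> (lie \<psi> Z1) 1 z"
      by (rule flow_lie_series_fb[OF Z1s lieZ1 refl z1])
    have 4: "Z2 (flow \<psi> z) + P (flow \<psi> z) = Z2 z + P z + lie_series \<psi> (lie \<psi> ?Q) 1 z"
      by (rule flow_lie_series_fb[OF Qb lieQ refl z1])
    show ?thesis
      unfolding P'_def add.assoc[of "Z1 (flow \<psi> z)" ] 
      using 1 2 3 4 decomp[OF zT] by (simp add: algebra_simps)
  qed
  show thesis
  proof (rule that[of "flow \<psi>" "flow (\<lambda>z. - \<psi> z)" c "part w1" P'])
    show "change_pair V (a - da) (s - ds) (2 * (p / \<alpha>) / ds) (2 * (p / \<alpha>) / da) (flow \<psi>) (flow (\<lambda>z. - \<psi> z))"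
      using cp by (simp add: X_def)
    show "holo_fun_on ?T (c k)" "slow ?T (c k)" for k by (rule fserD[OF f])+
    show "part w1 z = (\<Sum>k\<in>{k\<in>M. freq_norm k < int N}. c k z * fmode k z)" if "z \<in> ?T" for z by (rule ressum[OF that])
    show "fb V a s (part w1) p" by (rule partb[OF w(1)])
    show "part w1 z \<in> \<real>" if "z \<in> ?T" "real_phase z" for z by (rule real1[OF that])
    show "fb V (a - da) (s - ds) P' (exp (- real N * ds) * p + 5/4 * (2 * exp 1 * (p / \<alpha>) / (da * ds)) * (z2 + p)
        + 3/2 * (4 * \<mu> * (p / \<alpha>) / ds + 3/2 * z1 * (p / \<alpha>) * (1 / (da * gs) + 1 / (ga * ds))))"
      by (rule fb_mono[OF P'b]) (use \<mu> in \<open>simp_all add: X_def algebra_simps\<close>)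
    show "P' z \<in> \<real>" if z: "z \<in> cdomain V (a - da) (s - ds)" "real_phase z" for z
    proof -
      have zT: "z \<in> ?T" by (rule cdomain_monoD[OF z(1)]) (use d in auto)
      have fz: "flow \<psi> z \<in> ?T" "real_phase (flow \<psi> z)"
      proof -
        have z1: "z \<in> dom 1" using z by (simp add: dom_def)
        have z15: "z \<in> dom (15/16)" using z1 dom_mono[of "15/16" 1] by auto
        show "flow \<psi> z \<in> ?T" by (rule subsetD[OF dom_sub flow_dom[OF z15]]) auto
        show "real_phase (flow \<psi> z)" by (rule flow_real[OF psi_real z15 z(2)])
      qed
      have "P' z = hh (flow \<psi> z) + of_real \<mu> * fst (snd (flow \<psi> z)) + (Z1 (flow \<psi> z) + Z2 (flow \<psi> z)) + P (flow \<psi> z)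
         - (hh z + of_real \<mu> * fst (snd z) + (Z1 z + Z2 z + part w1 z))" using ident[OF z(1)] by simp
      also have "\<dots> \<in> \<real>"
        using hh(4)[OF fz] hh(4)[OF zT z(2)] Z1(2)[OF fz] Z1(2)[OF zT z(2)] Z2(2)[OF fz] Z2(2)[OF zT z(2)]
          P(2)[OF fz] real1[OF zT z(2)] fz(2) z(2)
        by (intro Reals_diff Reals_add Reals_mult) (auto simp: real_phase_alt)
      finally show ?thesis .
    qed
  qed (rule ident)
qed

section \<open>Fourier expansion of periodic functions on a strip\<close>

text \<open>Means over a period are limits of averages over equidistant points instead of integrals: a finite average of
  functions that depend holomorphically on further variables is clearly holomorphic in these, and the rate of
  convergence is uniform.\<close>

definition favg :: "nat \<Rightarrow> (complex \<Rightarrow> complex) \<Rightarrow> complex" where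
  "favg M h = (\<Sum>l<Suc M. h (of_real (2 * pi * real l / real (Suc M)))) / of_nat (Suc M)"

definition fmean :: "(complex \<Rightarrow> complex) \<Rightarrow> complex" where
  "fmean h = lim (\<lambda>M. favg M h)"

definition fcoeff :: "int \<Rightarrow> (complex \<Rightarrow> complex) \<Rightarrow> complex" where
  "fcoeff m g = fmean (\<lambda>w. g w * exp (- \<i> * of_int m * w))"

definition periodic_on_strip :: "real \<Rightarrow> (complex \<Rightarrow> complex) \<Rightarrow> bool" where
  "periodic_on_strip s h \<longleftrightarrow> h holomorphic_on strip s \<and> (\<forall>w\<in>strip s. h (w + of_real (2 * pi)) = h w)"

lemma tendsto_const_over_Suc: "(\<lambda>M. C * (1 / real (Suc M))) \<longlonglongrightarrow> 0"
  using tendsto_mult_right_zero[OF LIMSEQ_inverse_real_of_nat, of C] by (simp only: inverse_eq_divide)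

lemma convex_strip: "convex (strip s)"
proof -
  have "strip s = {w. Im w < s} \<inter> {w. Im w > - s}" by (auto simp: strip_def abs_less_iff)
  moreover have "convex \<dots>" by (intro convex_Int convex_halfspace_Im_lt convex_halfspace_Im_gt)
  ultimately show ?thesis by simp
qed

lemma strip_shift: "w \<in> strip s \<Longrightarrow> w + of_real x \<in> strip s" by (simp add: strip_def)

lemma convex_line: "convex {w. Im w = y}"
  using convex_hyperplane[of \<i> y] by (simp add: inner_complex_def)

text \<open>A primitive on the strip, which is convex, turns the mean into a difference of two values; this
  yields independence of the height at which the mean is taken, and the rate of convergence of the
  discrete averages.\<close>

lemma fmean_primitive:
  assumes h: "periodic_on_strip s h" and bd: "\<And>w. w \<in> strip s \<Longrightarrow> cmod (h w) \<le> C" and s: "0 < s"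
  shows "\<exists>\<Phi>. (\<forall>w\<in>strip s. (\<Phi> has_field_derivative h w) (at w)) \<and>
      (\<forall>w\<in>strip s. \<Phi> (w + of_real (2 * pi)) - \<Phi> w = of_real (2 * pi) * fmean h)"
    and "cmod (favg M h - fmean h) \<le> 2 * pi * C / s * (1 / real (Suc M))"
proof -
  have hol: "h holomorphic_on strip s" and per: "\<And>w. w \<in> strip s \<Longrightarrow> h (w + of_real (2 * pi)) = h w"
    using h by (auto simp: periodic_on_strip_def)
  obtain \<Phi> where d': "\<And>w. w \<in> strip s \<Longrightarrow> (\<Phi> has_field_derivative h w) (at w within strip s)"
    using holomorphic_convex_primitive'[OF convex_strip open_strip hol] by blast
  have d: "(\<Phi> has_field_derivative h w) (at w)" if "w \<in> strip s" for w
    using d'[OF that] at_within_open[OF that open_strip] by simp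
  define L where "L = \<Phi> (of_real (2 * pi)) - \<Phi> 0"
  have const: "\<Phi> (w + of_real (2 * pi)) - \<Phi> w = L" if w: "w \<in> strip s" for w
  proof -
    have "\<exists>c. \<forall>w\<in>strip s. \<Phi> (w + of_real (2 * pi)) - \<Phi> w = c"
    proof (rule has_field_derivative_zero_constant[OF convex_strip])
      fix w assume w: "w \<in> strip s"
      have "((\<lambda>w. \<Phi> (w + of_real (2 * pi))) has_field_derivative h (w + of_real (2 * pi))) (at w)"
        by (rule DERIV_shift[THEN iffD1, OF d[OF strip_shift[OF w]]])
      from has_field_derivative_at_within[OF DERIV_diff[OF this d[OF w]]]
      show "((\<lambda>w. \<Phi> (w + of_real (2 * pi)) - \<Phi> w) has_field_derivative 0) (at w within strip s)"
        using per[OF w] by simp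
    qed
    then obtain c where c: "\<And>w. w \<in> strip s \<Longrightarrow> \<Phi> (w + of_real (2 * pi)) - \<Phi> w = c" by blast
    have "0 \<in> strip s" using s by (simp add: strip_def)
    from c[OF this] c[OF w] show ?thesis by (simp add: L_def)
  qed
  have rate: "cmod (favg M h - L / of_real (2 * pi)) \<le> 2 * pi * C / s * (1 / real (Suc M))" for M
  proof -
    define \<delta> where "\<delta> = 2 * pi / real (Suc M)"
    define t where "t = (\<lambda>l. complex_of_real (2 * pi * real l / real (Suc M)))"
    have \<delta>: "\<delta> > 0" by (simp add: \<delta>_def)
    have ts: "t (Suc l) = t l + of_real \<delta>" for l by (simp add: t_def \<delta>_def add_divide_distrib algebra_simps flip: of_real_add)
    let ?R = "{w. Im w = 0}"
    have Rs: "?R \<subseteq> strip s" using s by (auto simp: strip_def)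
    have hd: "cmod (deriv h w) \<le> C / s" if "w \<in> ?R" for w
    proof -
      have sub: "ball w s \<subseteq> strip s"
      proof
        fix v assume "v \<in> ball w s"
        then have "\<bar>Im (v - w)\<bar> < s" using abs_Im_le_cmod[of "v - w"] by (simp add: dist_norm norm_minus_commute)
        then show "v \<in> strip s" using that by (simp add: strip_def)
      qed
      have "cmod ((deriv ^^ 1) h w) \<le> fact 1 * C / s ^ 1"
        by (rule cauchy_deriv_bound) (use sub s bd holomorphic_on_subset[OF hol sub] in auto)
      then show ?thesis by simp
    qed
    have step: "cmod (\<Phi> (t (Suc l)) - \<Phi> (t l) - of_real \<delta> * h (t l)) \<le> C / s * \<delta>\<^sup>2" for l
    proof -
      define f where "f = (\<lambda>i::nat. if i = 0 then \<Phi> else if i = 1 then h else deriv h)"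
      have "cmod (f 0 (t (Suc l)) - (\<Sum>i\<le>1. f i (t l) * (t (Suc l) - t l) ^ i / fact i)) \<le> C / s * cmod (t (Suc l) - t l) ^ Suc 1 / fact 1"
      proof (rule complex_Taylor[of ?R 1 f])
        show "convex ?R" by (rule convex_line)
        show "(f i has_field_derivative f (Suc i) x) (at x within ?R)" if "x \<in> ?R" "i \<le> 1" for i x
        proof -
          have x: "x \<in> strip s" using that Rs by auto
          have "i = 0 \<or> i = 1" using that by auto
          then show ?thesis using d[OF x] holomorphic_derivI[OF hol open_strip x]
            by (auto simp: f_def intro: has_field_derivative_at_within)
        qed
      qed (auto simp: f_def hd t_def)
      then show ?thesis by (simp add: f_def ts algebra_simps power2_eq_square norm_mult \<delta> less_imp_le)
    qed
    have "(\<Sum>l<Suc M. \<Phi> (t (Suc l)) - \<Phi> (t l)) = \<Phi> (t (Suc M)) - \<Phi> (t 0)"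
      by (rule sum_lessThan_telescope[of "\<lambda>l. \<Phi> (t l)"])
    moreover have "t (Suc M) = of_real (2 * pi)" "t 0 = 0"
      unfolding t_def by (simp_all del: of_nat_Suc of_real_mult of_real_divide)
    ultimately have "L = (\<Sum>l<Suc M. \<Phi> (t (Suc l)) - \<Phi> (t l))" by (simp only: L_def)
    then have "L - of_real \<delta> * (\<Sum>l<Suc M. h (t l)) = (\<Sum>l<Suc M. \<Phi> (t (Suc l)) - \<Phi> (t l) - of_real \<delta> * h (t l))"
      by (simp only: sum_subtractf sum_distrib_left)
    also have "cmod \<dots> \<le> (\<Sum>l<Suc M. C / s * \<delta>\<^sup>2)" by (rule order_trans[OF norm_sum sum_mono[OF step]])
    finally have *: "cmod (L - of_real \<delta> * (\<Sum>l<Suc M. h (t l))) \<le> real (Suc M) * (C / s * \<delta>\<^sup>2)" by simp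
    have alg: "S / n - L / p = - (L - p / n * S) / p" if "p \<noteq> 0" for S n p :: complex
      using that by (simp add: diff_divide_distrib)
    have "favg M h = (\<Sum>l<Suc M. h (t l)) / of_nat (Suc M)" by (simp only: favg_def t_def)
    moreover have "complex_of_real \<delta> = of_real (2 * pi) / of_nat (Suc M)"
      by (simp only: \<delta>_def of_real_divide of_real_of_nat_eq)
    ultimately have "favg M h - L / of_real (2 * pi) = - (L - of_real \<delta> * (\<Sum>l<Suc M. h (t l))) / of_real (2 * pi)"
      by (simp only:) (rule alg, simp)
    then have "cmod (favg M h - L / of_real (2 * pi)) = cmod (L - of_real \<delta> * (\<Sum>l<Suc M. h (t l))) / (2 * pi)"
      by (simp only: norm_divide norm_minus_cancel norm_of_real) simp
    also have "\<dots> \<le> real (Suc M) * (C / s * \<delta>\<^sup>2) / (2 * pi)" by (rule divide_right_mono[OF *]) simp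
    also have "\<dots> = 2 * pi * C / s * (1 / real (Suc M))" by (simp add: \<delta>_def power2_eq_square del: of_nat_Suc)
    finally show ?thesis .
  qed
  have "(\<lambda>M. favg M h - L / of_real (2 * pi)) \<longlonglongrightarrow> 0"
  proof (rule Lim_null_comparison[OF always_eventually[OF allI[OF rate]]])
    show "(\<lambda>M. 2 * pi * C / s * (1 / real (Suc M))) \<longlonglongrightarrow> 0"
      by (rule tendsto_const_over_Suc)
  qed
  then have "fmean h = L / of_real (2 * pi)" unfolding fmean_def by (intro limI) (simp only: LIM_zero_iff)
  then have Lm: "L = of_real (2 * pi) * fmean h" by simp
  show "\<exists>\<Phi>. (\<forall>w\<in>strip s. (\<Phi> has_field_derivative h w) (at w)) \<and>
      (\<forall>w\<in>strip s. \<Phi> (w + of_real (2 * pi)) - \<Phi> w = of_real (2 * pi) * fmean h)"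
    using d const Lm by blast
  show "cmod (favg M h - fmean h) \<le> 2 * pi * C / s * (1 / real (Suc M))"
    using rate[of M] by (simp add: Lm)
qed

lemma favg_tendsto:
  assumes "periodic_on_strip s h" "\<And>w. w \<in> strip s \<Longrightarrow> cmod (h w) \<le> C" "0 < s"
  shows "(\<lambda>M. favg M h) \<longlonglongrightarrow> fmean h"
proof -
  have "(\<lambda>M. favg M h - fmean h) \<longlonglongrightarrow> 0"
  proof (rule Lim_null_comparison[OF always_eventually[OF allI[OF fmean_primitive(2)[OF assms]]]])
    show "(\<lambda>M. 2 * pi * C / s * (1 / real (Suc M))) \<longlonglongrightarrow> 0"
      by (rule tendsto_const_over_Suc)
  qed
  then show ?thesis by (simp only: LIM_zero_iff)
qed

lemma fmean_bound:
  assumes h: "periodic_on_strip s h" "\<And>w. w \<in> strip s \<Longrightarrow> cmod (h w) \<le> C" "0 < s"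
    and y: "\<bar>y\<bar> < s" and D: "\<And>w. Im w = y \<Longrightarrow> cmod (h w) \<le> D"
  shows "cmod (fmean h) \<le> D"
proof -
  obtain \<Phi> where d: "\<And>w. w \<in> strip s \<Longrightarrow> (\<Phi> has_field_derivative h w) (at w)"
    and e: "\<And>w. w \<in> strip s \<Longrightarrow> \<Phi> (w + of_real (2 * pi)) - \<Phi> w = of_real (2 * pi) * fmean h"
    using fmean_primitive(1)[OF h] by blast
  let ?w = "\<i> * of_real y"
  have w: "?w \<in> strip s" using y by (simp add: strip_def)
  have "cmod (\<Phi> (?w + of_real (2 * pi)) - \<Phi> ?w) \<le> D * cmod (?w + of_real (2 * pi) - ?w)"
    by (rule field_differentiable_bound[OF convex_line[of y], of \<Phi> h])
       (use d D y in \<open>auto simp: strip_def intro: has_field_derivative_at_within\<close>)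
  then show ?thesis unfolding e[OF w] by (simp add: norm_mult)
qed

lemma favg_linear: "favg M (\<lambda>w. f w + c * g w) = favg M f + c * favg M g"
  by (simp add: favg_def sum.distrib sum_distrib_left add_divide_distrib del: sum.lessThan_Suc of_nat_Suc)

lemma mode_periodic: "exp (- \<i> * of_int m * (w + of_real (2 * pi))) = exp (- \<i> * of_int m * w)"
proof -
  have "exp (- \<i> * of_int m * (w + of_real (2 * pi))) = exp (- \<i> * of_int m * w) * exp ((2 * of_int (- m) * pi) * \<i>)"
    by (simp add: algebra_simps flip: exp_add)
  also have "exp ((2 * of_int (- m) * pi) * \<i>) = (1::complex)" by (rule exp_integer_2pi) simp
  finally show ?thesis by simp
qed

lemma periodic_mode:
  assumes "periodic_on_strip s g" shows "periodic_on_strip s (\<lambda>w. g w * exp (- \<i> * of_int m * w))"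
  using assms unfolding periodic_on_strip_def mode_periodic by (auto intro!: holomorphic_intros)

lemma mode_norm: "cmod (exp (- \<i> * of_int m * w)) = exp (of_int m * Im w)" by simp

lemma mode_bound: "w \<in> strip s \<Longrightarrow> cmod (exp (- \<i> * of_int m * w)) \<le> exp (real_of_int \<bar>m\<bar> * s)"
proof -
  assume "w \<in> strip s"
  then have "\<bar>of_int m * Im w\<bar> \<le> real_of_int \<bar>m\<bar> * s" by (auto simp: abs_mult strip_def intro!: mult_left_mono)
  then show ?thesis unfolding mode_norm by (simp add: abs_le_iff)
qed

lemma fcoeff_facts:
  assumes g: "periodic_on_strip s g" "\<And>w. w \<in> strip s \<Longrightarrow> cmod (g w) \<le> C" "0 < s"
  shows "(\<lambda>M. favg M (\<lambda>w. g w * exp (- \<i> * of_int m * w))) \<longlonglongrightarrow> fcoeff m g"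
    "cmod (favg M (\<lambda>w. g w * exp (- \<i> * of_int m * w)) - fcoeff m g) \<le> 2 * pi * (C * exp (real_of_int \<bar>m\<bar> * s)) / s * (1 / real (Suc M))"
    "cmod (fcoeff m g) \<le> C * exp (- s * real_of_int \<bar>m\<bar>)"
proof -
  have b: "cmod (g w * exp (- \<i> * of_int m * w)) \<le> C * exp (real_of_int \<bar>m\<bar> * s)" if "w \<in> strip s" for w
    unfolding norm_mult by (rule mult_mono[OF g(2)[OF that] mode_bound[OF that]]) (use order_trans[OF norm_ge_zero g(2)[OF that]] in auto)
  note p = periodic_mode[OF g(1), of m] b g(3)
  show "(\<lambda>M. favg M (\<lambda>w. g w * exp (- \<i> * of_int m * w))) \<longlonglongrightarrow> fcoeff m g"
    unfolding fcoeff_def by (rule favg_tendsto[OF p])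
  show "cmod (favg M (\<lambda>w. g w * exp (- \<i> * of_int m * w)) - fcoeff m g) \<le> 2 * pi * (C * exp (real_of_int \<bar>m\<bar> * s)) / s * (1 / real (Suc M))"
    unfolding fcoeff_def by (rule fmean_primitive(2)[OF p])
  have *: "cmod (fcoeff m g) \<le> C * exp (- t * real_of_int \<bar>m\<bar>)" if t: "0 < t" "t < s" for t
    unfolding fcoeff_def
  proof (rule fmean_bound[OF p])
    let ?y = "if m \<ge> 0 then - t else t"
    show "\<bar>?y\<bar> < s" using t by auto
    fix w assume w: "Im w = ?y"
    then have ws: "w \<in> strip s" using t by (auto simp: strip_def split: if_splits)
    have "of_int m * Im w = - t * real_of_int \<bar>m\<bar>" using w by (auto split: if_splits)
    then show "cmod (g w * exp (- \<i> * of_int m * w)) \<le> C * exp (- t * real_of_int \<bar>m\<bar>)"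
      unfolding norm_mult mode_norm using g(2)[OF ws] by (simp add: mult_right_mono)
  qed
  have "((\<lambda>t. C * exp (- t * real_of_int \<bar>m\<bar>)) \<longlongrightarrow> C * exp (- s * real_of_int \<bar>m\<bar>)) (at_left s)"
    by (intro tendsto_intros)
  moreover have "\<forall>\<^sub>F t in at_left s. cmod (fcoeff m g) \<le> C * exp (- t * real_of_int \<bar>m\<bar>)"
    using eventually_at_left_real[OF g(3)] by eventually_elim (use * in auto)
  ultimately show "cmod (fcoeff m g) \<le> C * exp (- s * real_of_int \<bar>m\<bar>)" by (rule tendsto_lowerbound) simp
qed

lemma fcoeff_const: "fcoeff m (\<lambda>w. 1) = (if m = 0 then 1 else 0)"
proof (cases "m = 0")
  case True
  then show ?thesis by (simp add: fcoeff_def fmean_def favg_def limI del: of_nat_Suc)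
next
  case False
  have "cmod (fcoeff m (\<lambda>w. 1)) \<le> 1 * exp (- s * real_of_int \<bar>m\<bar>)" if "0 < s" for s
    by (rule fcoeff_facts(3)) (use that in \<open>auto simp: periodic_on_strip_def\<close>)
  moreover have "1 * exp (- s * real_of_int \<bar>m\<bar>) \<le> 1 / s" if "0 < s" for s
  proof -
    have "s * 1 \<le> s * real_of_int \<bar>m\<bar>" using that False by (intro mult_left_mono) auto
    also have "\<dots> \<le> exp (s * real_of_int \<bar>m\<bar>)" using exp_ge_add_one_self[of "s * real_of_int \<bar>m\<bar>"] by linarith
    finally show ?thesis using that by (simp add: exp_minus field_simps)
  qed
  ultimately have *: "cmod (fcoeff m (\<lambda>w. 1)) \<le> 1 / s" if "0 < s" for s using that by (meson order_trans)
  have "cmod (fcoeff m (\<lambda>w. 1)) \<le> 0"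
  proof (rule ccontr)
    assume "\<not> ?thesis"
    then show False using *[of "2 / cmod (fcoeff m (\<lambda>w. 1))"] by (simp add: field_simps)
  qed
  then show ?thesis using False by simp
qed

lemma exp_ii_eqD: "exp (\<i> * w) = exp (\<i> * v) \<Longrightarrow> \<exists>n::int. w = v + of_real (2 * pi * of_int n)"
proof -
  assume "exp (\<i> * w) = exp (\<i> * v)"
  then obtain n :: int where "\<i> * w = \<i> * v + (of_int (2 * n) * pi) * \<i>" unfolding exp_eq by blast
  then have "\<i> * w = \<i> * (v + of_real (2 * pi * of_int n))" by (simp add: algebra_simps)
  then show ?thesis by (intro exI[of _ n]) simp
qed

lemma periodic_int:
  assumes "\<And>w. w \<in> strip s \<Longrightarrow> g (w + of_real (2 * pi)) = g w" "w \<in> strip s"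
  shows "g (w + of_real (2 * pi * of_int n)) = g w"
proof -
  have nat: "g (w + of_real (2 * pi * real n)) = g w" if "w \<in> strip s" for n w
  proof (induction n)
    case (Suc n)
    have "w + of_real (2 * pi * real (Suc n)) = (w + of_real (2 * pi * real n)) + of_real (2 * pi)"
      by (simp add: algebra_simps)
    then show ?case by (simp only: assms(1)[OF strip_shift[OF that, of "2 * pi * real n"]] Suc)
  qed simp
  show ?thesis
  proof (cases "n \<ge> 0")
    case True then show ?thesis using nat[OF assms(2), of "nat n"] by simp
  next
    case False
    have "g ((w + of_real (2 * pi * of_int n)) + of_real (2 * pi * real (nat (- n)))) = g (w + of_real (2 * pi * of_int n))"
      by (rule nat[OF strip_shift[OF assms(2)]])
    then show ?thesis using False by simp
  qed
qed

lemma periodic_deriv: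
  assumes "periodic_on_strip s g" "w \<in> strip s" shows "deriv g (w + of_real (2 * pi)) = deriv g w"
proof -
  have hol: "g holomorphic_on strip s" and per: "\<And>w. w \<in> strip s \<Longrightarrow> g (w + of_real (2 * pi)) = g w"
    using assms(1) by (auto simp: periodic_on_strip_def)
  have "(g has_field_derivative deriv g (w + of_real (2 * pi))) (at (w + of_real (2 * pi)))"
    by (rule holomorphic_derivI[OF hol open_strip strip_shift[OF assms(2)]])
  then have "((\<lambda>w. g (w + of_real (2 * pi))) has_field_derivative deriv g (w + of_real (2 * pi))) (at w)"
    by (rule DERIV_shift[THEN iffD1])
  then have "(g has_field_derivative deriv g (w + of_real (2 * pi))) (at w)"
    by (rule has_field_derivative_transform_within_open[OF _ open_strip assms(2)]) (rule per)
  then show ?thesis by (simp add: DERIV_imp_deriv)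
qed

text \<open>By periodicity of \<open>g\<close>, the difference \<open>g w - g w0\<close> vanishes at all zeros of
  \<open>exp (\<i> * w) - exp (\<i> * w0)\<close>, and these are simple; so the singularities of the quotient are removable.\<close>

lemma periodic_quotient:
  assumes g: "periodic_on_strip s g" and w0: "w0 \<in> strip s"
  shows "\<exists>h. periodic_on_strip s h \<and> (\<forall>w\<in>strip s. g w - g w0 = h w * (exp (\<i> * w) - exp (\<i> * w0)))"
proof -
  have hol: "g holomorphic_on strip s" and per: "\<And>w. w \<in> strip s \<Longrightarrow> g (w + of_real (2 * pi)) = g w"
    using g by (auto simp: periodic_on_strip_def)
  let ?e = "\<lambda>w. exp (\<i> * w)"
  define h where "h = (\<lambda>w. if ?e w = ?e w0 then deriv g w0 / (\<i> * ?e w0) else (g w - g w0) / (?e w - ?e w0))"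
  have pole: "g w = g w0" "deriv g w = deriv g w0" if w: "?e w = ?e w0" for w
  proof -
    obtain n :: int where n: "w = w0 + of_real (2 * pi * of_int n)" using exp_ii_eqD[OF w] by blast
    show "g w = g w0" unfolding n by (rule periodic_int[of s g, OF per w0])
    show "deriv g w = deriv g w0" unfolding n by (rule periodic_int[of s "deriv g", OF periodic_deriv[OF g] w0])
  qed
  have "h field_differentiable (at w1)" if w1: "w1 \<in> strip s" for w1
  proof (cases "?e w1 = ?e w0")
    case False
    define A where "A = strip s \<inter> {w. ?e w - ?e w0 \<noteq> 0}"
    have "open A" unfolding A_def by (intro open_Int open_strip open_Collect_neq continuous_intros)
    have "(\<lambda>w. (g w - g w0) / (?e w - ?e w0)) holomorphic_on A"
      by (intro holomorphic_intros holomorphic_on_subset[OF hol]) (auto simp: A_def)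
    then have "h holomorphic_on A" by (rule holomorphic_transform) (auto simp: h_def A_def)
    then show ?thesis using \<open>open A\<close> w1 False by (intro holomorphic_on_imp_differentiable_at[of h A]) (auto simp: A_def)
  next
    case True
    obtain r where r: "r > 0" "ball w1 r \<subseteq> strip s" using open_strip w1 open_contains_ball by blast
    define U where "U = ball w1 (min r 1)"
    have iso: "?e w \<noteq> ?e w0" if "w \<in> U" "w \<noteq> w1" for w
    proof
      assume "?e w = ?e w0"
      then obtain n :: int where n: "w = w1 + of_real (2 * pi * of_int n)" using exp_ii_eqD[of w w1] True by auto
      then have "n \<noteq> 0" using that(2) by auto
      then have "1 \<le> \<bar>real_of_int n\<bar>" by linarith
      then have "2 * pi * 1 \<le> 2 * pi * \<bar>real_of_int n\<bar>" by (rule mult_left_mono) simp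
      moreover have "dist w1 w = 2 * pi * \<bar>real_of_int n\<bar>" unfolding n by (simp add: dist_norm norm_mult)
      ultimately show False using that(1) pi_gt3 unfolding U_def mem_ball by linarith
    qed
    have hU: "h holomorphic_on (U - {w1})"
    proof -
      have "(\<lambda>w. (g w - g w0) / (?e w - ?e w0)) holomorphic_on (U - {w1})"
        by (intro holomorphic_intros holomorphic_on_subset[OF hol]) (use iso r in \<open>auto simp: U_def\<close>)
      then show ?thesis by (rule holomorphic_transform) (use iso in \<open>auto simp: h_def\<close>)
    qed
    have lim: "(h \<longlongrightarrow> h w1) (at w1)"
    proof -
      have 1: "((\<lambda>w. (g w - g w1) / (w - w1)) \<longlongrightarrow> deriv g w1) (at w1)"
        using holomorphic_derivI[OF hol open_strip w1] by (simp add: has_field_derivative_iff)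
      have "(?e has_field_derivative \<i> * ?e w1) (at w1)" by (auto intro!: derivative_eq_intros)
      then have 2: "((\<lambda>w. (?e w - ?e w1) / (w - w1)) \<longlongrightarrow> \<i> * ?e w1) (at w1)" by (simp add: has_field_derivative_iff)
      have 3: "((\<lambda>w. ((g w - g w1) / (w - w1)) / ((?e w - ?e w1) / (w - w1))) \<longlongrightarrow> deriv g w1 / (\<i> * ?e w1)) (at w1)"
        by (intro tendsto_divide 1 2) simp
      have "\<forall>\<^sub>F w in at w1. ((g w - g w1) / (w - w1)) / ((?e w - ?e w1) / (w - w1)) = h w"
        unfolding eventually_at
      proof (intro exI[of _ "min r 1"] conjI ballI impI)
        fix w assume "w \<noteq> w1 \<and> dist w w1 < min r 1"
        then have "?e w \<noteq> ?e w0" "w \<noteq> w1" using iso[of w] by (auto simp: U_def dist_commute)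
        then show "((g w - g w1) / (w - w1)) / ((?e w - ?e w1) / (w - w1)) = h w"
          using pole(1)[OF True] True by (simp add: h_def)
      qed (use r in auto)
      from Lim_transform_eventually[OF 3 this] show ?thesis using True pole(2)[OF True] by (simp add: h_def)
    qed
    have "continuous_on U h"
      unfolding continuous_on_eq_continuous_at[OF open_ball[of w1 "min r 1", folded U_def]]
    proof
      fix w assume w: "w \<in> U"
      show "isCont h w"
      proof (cases "w = w1")
        case True then show ?thesis using lim by (simp add: isCont_def)
      next
        case False
        have "open (U - {w1})" unfolding U_def by (intro open_delete open_ball)
        from holomorphic_on_imp_differentiable_at[OF hU this] show ?thesis
          using w False by (intro field_differentiable_imp_continuous_at) auto
      qed
    qed
    then have "h holomorphic_on U"
      by (rule no_isolated_singularity[of U h "{w1}"]) (use hU in \<open>auto simp: U_def\<close>)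
    then show ?thesis using r by (intro holomorphic_on_imp_differentiable_at[of h U]) (auto simp: U_def)
  qed
  then have "h holomorphic_on strip s" by (simp add: holomorphic_on_def field_differentiable_at_within)
  moreover have "h (w + of_real (2 * pi)) = h w" if "w \<in> strip s" for w
  proof -
    have "?e (w + of_real (2 * pi)) = ?e w"
      using exp_integer_2pi[of 1] by (simp add: distrib_left exp_add mult_ac)
    then show ?thesis using per[OF that] by (simp add: h_def)
  qed
  moreover have "g w - g w0 = h w * (?e w - ?e w0)" for w
    using pole(1)[of w] by (simp add: h_def)
  ultimately show ?thesis unfolding periodic_on_strip_def by blast
qed

lemma periodic_bounded:
  assumes h: "periodic_on_strip s h" and t: "0 \<le> t" "t < s"
  shows "\<exists>C. \<forall>w\<in>strip t. cmod (h w) \<le> C"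
proof -
  have hol: "h holomorphic_on strip s" and per: "\<And>w. w \<in> strip s \<Longrightarrow> h (w + of_real (2 * pi)) = h w"
    using h by (auto simp: periodic_on_strip_def)
  let ?K = "cbox (Complex 0 (- t)) (Complex (2 * pi) t)"
  have K: "?K \<subseteq> strip s" using t by (auto simp: strip_def in_cbox_complex_iff)
  have "compact (h ` ?K)"
    by (rule compact_continuous_image[OF continuous_on_subset[OF holomorphic_on_imp_continuous_on[OF hol] K] compact_cbox])
  then obtain C where C: "\<And>w. w \<in> ?K \<Longrightarrow> cmod (h w) \<le> C" using compact_imp_bounded bounded_iff by (metis imageI)
  have "cmod (h w) \<le> C" if w: "w \<in> strip t" for w
  proof -
    define n where "n = - \<lfloor>Re w / (2 * pi)\<rfloor>"
    have "0 \<le> Re w + 2 * pi * real_of_int n" "Re w + 2 * pi * real_of_int n \<le> 2 * pi"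
      using floor_divide_lower[of "2 * pi" "Re w"] floor_divide_upper[of "2 * pi" "Re w"]
      by (simp_all add: n_def algebra_simps)
    then have "w + of_real (2 * pi * of_int n) \<in> ?K" using w by (auto simp: in_cbox_complex_iff strip_def abs_less_iff)
    moreover have "h (w + of_real (2 * pi * of_int n)) = h w"
      by (rule periodic_int[of s h, OF per]) (use w t in \<open>auto simp: strip_def\<close>)
    ultimately show ?thesis using C by metis
  qed
  then show ?thesis by blast
qed

lemma sum_int_Suc:
  fixes f :: "int \<Rightarrow> 'a::comm_monoid_add"
  shows "sum f {- int (Suc M)..int (Suc M)} = f (int (Suc M)) + (f (- int (Suc M)) + sum f {- int M..int M})"
proof -
  have "{- int (Suc M)..int (Suc M)} = insert (int (Suc M)) (insert (- int (Suc M)) {- int M..int M})" by auto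
  then show ?thesis by (simp only:) simp
qed

lemma int_exp_sum:
  assumes "0 < d"
  shows "(\<Sum>m\<in>{- int M..int M}. exp (- d * real_of_int \<bar>m\<bar>)) \<le> (1 + exp (- d)) / (1 - exp (- d))"
proof -
  define q where "q = exp (- d)"
  have q: "0 < q" "q < 1" using assms by (simp_all add: q_def)
  have e: "exp (- d * real_of_int \<bar>m\<bar>) = q ^ nat \<bar>m\<bar>" for m
    by (simp add: q_def mult.commute flip: exp_of_nat_mult)
  have "(1 - q) * (\<Sum>m\<in>{- int M..int M}. q ^ nat \<bar>m\<bar>) = 1 + q - 2 * q ^ Suc M"
  proof (induction M)
    case (Suc M)
    have "nat \<bar>int (Suc M)\<bar> = Suc M" "nat \<bar>- int (Suc M)\<bar> = Suc M" by auto
    then show ?case unfolding sum_int_Suc distrib_left Suc by (simp only:) (simp add: algebra_simps)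
  qed simp
  also have "\<dots> \<le> 1 + q" using q by simp
  finally show ?thesis unfolding e using q by (simp add: q_def[symmetric] pos_le_divide_eq mult.commute)
qed

lemma finite_int_interval: "finite X \<Longrightarrow> \<exists>M. X \<subseteq> {- int M..int M}"
proof (induction X rule: finite_induct)
  case (insert x X)
  then obtain M where "X \<subseteq> {- int M..int M}" by blast
  moreover have "x \<in> {- int (M + nat \<bar>x\<bar>)..int (M + nat \<bar>x\<bar>)}" by auto
  ultimately have "insert x X \<subseteq> {- int (M + nat \<bar>x\<bar>)..int (M + nat \<bar>x\<bar>)}" by fastforce
  then show ?case by blast
qed simp

lemma int_exp_summable:
  assumes "0 < d" shows "(\<lambda>m::int. exp (- d * real_of_int \<bar>m\<bar>)) summable_on UNIV"
proof (rule nonneg_bdd_above_summable_on)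
  show "bdd_above (sum (\<lambda>m::int. exp (- d * real_of_int \<bar>m\<bar>)) ` {F. F \<subseteq> UNIV \<and> finite F})"
  proof (rule bdd_aboveI2)
    fix X :: "int set" assume "X \<in> {F. F \<subseteq> UNIV \<and> finite F}"
    then obtain M where "X \<subseteq> {- int M..int M}" using finite_int_interval by blast
    then have "sum (\<lambda>m::int. exp (- d * real_of_int \<bar>m\<bar>)) X \<le> (\<Sum>m\<in>{- int M..int M}. exp (- d * real_of_int \<bar>m\<bar>))"
      by (intro sum_mono2) auto
    also note int_exp_sum[OF assms]
    finally show "sum (\<lambda>m::int. exp (- d * real_of_int \<bar>m\<bar>)) X \<le> (1 + exp (- d)) / (1 - exp (- d))" .
  qed
qed simp

text \<open>The weight is a product over the coordinates, so a finite sum is dominated by a power of the sum over an interval.\<close>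

lemma wt_sum:
  assumes "0 < d" "finite X"
  shows "(\<Sum>k\<in>X. wt (- d) (k::int^'n)) \<le> ((1 + exp (- d)) / (1 - exp (- d))) ^ CARD('n)"
proof -
  define g where "g = (\<lambda>m::int. exp (- d * real_of_int \<bar>m\<bar>))"
  have w: "wt (- d) k = (\<Prod>j\<in>UNIV. g (k $ j))" for k :: "int^'n"
    by (simp add: wt_def freq_norm_def g_def sum_distrib_left sum_negf flip: exp_sum)
  have "finite (\<Union>j. (\<lambda>k. k $ j) ` X)" using assms(2) by auto
  then obtain M where M: "(\<Union>j. (\<lambda>k. k $ j) ` X) \<subseteq> {- int M..int M}" using finite_int_interval by blast
  have inj: "inj_on (\<lambda>k j. k $ j) X" by (auto simp: inj_on_def vec_eq_iff fun_eq_iff)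
  have "(\<Sum>k\<in>X. wt (- d) k) = (\<Sum>p\<in>(\<lambda>k j. k $ j) ` X. \<Prod>j\<in>UNIV. g (p j))"
    by (simp add: w sum.reindex[OF inj])
  also have "\<dots> \<le> (\<Sum>p\<in>(\<Pi>\<^sub>E j\<in>(UNIV::'n set). {- int M..int M}). \<Prod>j\<in>UNIV. g (p j))"
    by (rule sum_mono2) (use M in \<open>auto intro!: finite_PiE prod_nonneg simp: g_def\<close>)
  also have "\<dots> = (\<Prod>j\<in>(UNIV::'n set). \<Sum>m\<in>{- int M..int M}. g m)"
    by (rule prod_sum_PiE[symmetric]) auto
  also have "\<dots> \<le> (\<Prod>j\<in>(UNIV::'n set). (1 + exp (- d)) / (1 - exp (- d)))"
    by (intro prod_mono conjI sum_nonneg) (use int_exp_sum[OF assms(1), of M] in \<open>auto simp: g_def\<close>)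
  also have "\<dots> = ((1 + exp (- d)) / (1 - exp (- d))) ^ CARD('n)" by simp
  finally show ?thesis .
qed

lemma wt_summable:
  assumes "0 < d"
  shows "(\<lambda>k::int^'n. wt (- d) k) summable_on UNIV"
    "infsum (\<lambda>k::int^'n. wt (- d) k) UNIV \<le> ((1 + exp (- d)) / (1 - exp (- d))) ^ CARD('n)"
proof -
  show s: "(\<lambda>k::int^'n. wt (- d) k) summable_on UNIV"
    by (rule nonneg_bdd_above_summable_on) (auto intro!: bdd_aboveI2[OF wt_sum[OF assms]])
  show "infsum (\<lambda>k::int^'n. wt (- d) k) UNIV \<le> ((1 + exp (- d)) / (1 - exp (- d))) ^ CARD('n)"
    by (rule infsum_le_finite_sums[OF s]) (use wt_sum[OF assms] in blast)
qed

lemma favg_cong: "(\<And>x. f (of_real x) = g (of_real x)) \<Longrightarrow> favg M f = favg M g"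
  by (simp add: favg_def del: of_nat_Suc of_real_mult of_real_divide sum.lessThan_Suc)

lemma fcoeff_cong: "(\<And>x. f (of_real x) = g (of_real x)) \<Longrightarrow> fcoeff m f = fcoeff m g"
  unfolding fcoeff_def fmean_def by (intro arg_cong[where f = lim] ext favg_cong) simp

text \<open>Writing \<open>g - g w0\<close> as a multiple of \<open>exp (\<i> * w) - exp (\<i> * w0)\<close> makes the Fourier series at
  \<open>w0\<close> telescope.\<close>

lemma fourier_has_sum_1d:
  assumes g: "periodic_on_strip s g" and C: "\<And>w. w \<in> strip s \<Longrightarrow> cmod (g w) \<le> C" and w0: "w0 \<in> strip s"
  shows "((\<lambda>m::int. fcoeff m g * exp (\<i> * of_int m * w0)) has_sum g w0) UNIV"
proof -
  have s: "0 < s" using w0 by (simp add: strip_def)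
  define y where "y = \<bar>Im w0\<bar>"
  define t where "t = (y + s) / 2"
  have t: "y < t" "t < s" "0 < t" "0 \<le> y" using w0 by (auto simp: t_def y_def strip_def)
  obtain h where h: "periodic_on_strip s h" and gh: "\<And>w. w \<in> strip s \<Longrightarrow> g w - g w0 = h w * (exp (\<i> * w) - exp (\<i> * w0))"
    using periodic_quotient[OF g w0] by blast
  obtain B where B: "\<And>w. w \<in> strip t \<Longrightarrow> cmod (h w) \<le> B" using periodic_bounded[OF h, of t] t by auto
  have st: "strip t \<subseteq> strip s" using t by (auto simp: strip_def)
  have ht: "periodic_on_strip t h" using h st by (auto simp: periodic_on_strip_def intro: holomorphic_on_subset)
  have one: "periodic_on_strip s (\<lambda>w. 1)" by (simp add: periodic_on_strip_def)
  have B0: "0 \<le> B" using order_trans[OF norm_ge_zero B[of 0]] t by (simp add: strip_def)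
  have rec: "fcoeff m g = g w0 * (if m = 0 then 1 else 0) + fcoeff (m - 1) h - exp (\<i> * w0) * fcoeff m h" for m
  proof (rule LIMSEQ_unique[OF fcoeff_facts(1)[OF g C s]])
    let ?a = "\<lambda>m h M. favg M (\<lambda>w. h w * exp (- \<i> * of_int m * w))"
    have eq: "?a m g M = ?a (m - 1) h M + g w0 * ?a m (\<lambda>w. 1) M + (- exp (\<i> * w0)) * ?a m h M" for M
      unfolding favg_linear[symmetric]
    proof (rule favg_cong)
      fix x :: real
      let ?w = "complex_of_real x"
      have "?w \<in> strip s" using s by (simp add: strip_def)
      then have "g ?w = h ?w * (exp (\<i> * ?w) - exp (\<i> * w0)) + g w0" using gh by (simp add: diff_eq_eq)
      moreover have "exp (- \<i> * of_int (m - 1) * ?w) = exp (\<i> * ?w) * exp (- \<i> * of_int m * ?w)"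
        by (simp add: algebra_simps flip: exp_add)
      ultimately show "g ?w * exp (- \<i> * of_int m * ?w) = h ?w * exp (- \<i> * of_int (m - 1) * ?w)
          + g w0 * (1 * exp (- \<i> * of_int m * ?w)) + (- exp (\<i> * w0)) * (h ?w * exp (- \<i> * of_int m * ?w))"
        by (simp only:) (simp add: ring_distribs)
    qed
    show "?a m g \<longlonglongrightarrow> g w0 * (if m = 0 then 1 else 0) + fcoeff (m - 1) h - exp (\<i> * w0) * fcoeff m h"
    proof -
      have "?a m g \<longlonglongrightarrow> fcoeff (m - 1) h + g w0 * fcoeff m (\<lambda>w. 1) + (- exp (\<i> * w0)) * fcoeff m h"
        unfolding eq
        by (intro tendsto_add tendsto_mult tendsto_const fcoeff_facts(1)[OF ht B t(3)] fcoeff_facts(1)[OF one _ s, of 1]) simp_all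
      then show ?thesis by (simp add: fcoeff_const algebra_simps)
    qed
  qed
  define a where "a = (\<lambda>m. fcoeff m g * exp (\<i> * of_int m * w0))"
  define c where "c = (\<lambda>m. exp (\<i> * of_int m * w0) * fcoeff (m - 1) h)"
  have ac: "a m = (if m = 0 then g w0 else 0) + (c m - c (m + 1))" for m
    unfolding a_def c_def rec[of m] by (simp add: algebra_simps exp_add)
  have tel: "sum a {- int M..int M} = g w0 + (c (- int M) - c (int M + 1))" for M
  proof (induction M)
    case 0 then show ?case by (simp add: ac)
  next
    case (Suc M)
    then show ?case unfolding sum_int_Suc Suc by (simp add: ac algebra_simps)
  qed
  have em: "cmod (exp (\<i> * of_int m * w0)) \<le> exp (y * real_of_int \<bar>m\<bar>)" for m
  proof -
    have "- (real_of_int m * Im w0) \<le> \<bar>real_of_int m\<bar> * y" unfolding y_def by (simp flip: abs_mult)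
    then show ?thesis by (simp add: mult.commute)
  qed
  have cb: "cmod (c m) \<le> B * exp t * exp (- (t - y) * real_of_int \<bar>m\<bar>)" for m
  proof -
    have "cmod (fcoeff (m - 1) h) \<le> B * exp (- t * real_of_int \<bar>m - 1\<bar>)" by (rule fcoeff_facts(3)[OF ht B t(3)])
    also have "\<dots> \<le> B * exp (t - t * real_of_int \<bar>m\<bar>)"
    proof -
      have "t * (real_of_int \<bar>m\<bar> - 1) \<le> t * real_of_int \<bar>m - 1\<bar>" using t by (intro mult_left_mono) auto
      then show ?thesis using B0 by (intro mult_left_mono) (auto simp: algebra_simps)
    qed
    finally have "cmod (c m) \<le> exp (y * real_of_int \<bar>m\<bar>) * (B * exp (t - t * real_of_int \<bar>m\<bar>))"
      unfolding c_def norm_mult by (intro mult_mono em) auto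
    then show ?thesis by (simp add: mult_ac algebra_simps flip: exp_add)
  qed
  have z: "(\<lambda>M. B * exp t * exp (- (t - y) * real M)) \<longlonglongrightarrow> 0"
  proof -
    have "exp (- (t - y) * real M) = exp (- (t - y)) ^ M" for M by (simp add: mult.commute flip: exp_of_nat_mult)
    moreover have "(\<lambda>M. exp (- (t - y)) ^ M) \<longlonglongrightarrow> 0" using t by (intro LIMSEQ_power_zero) simp
    ultimately show ?thesis using tendsto_mult_right_zero by auto
  qed
  have dec: "B * exp t * exp (- (t - y) * u) \<le> B * exp t * exp (- (t - y) * v)" if "v \<le> u" for u v
    using that t B0 by (intro mult_left_mono) auto
  have c1: "(\<lambda>M. c (- int M)) \<longlonglongrightarrow> 0" by (rule Lim_null_comparison[OF always_eventually z]) (use cb[of "- int _"] in auto)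
  have c2: "(\<lambda>M. c (int M + 1)) \<longlonglongrightarrow> 0"
  proof (rule Lim_null_comparison[OF always_eventually z], rule allI)
    fix M show "cmod (c (int M + 1)) \<le> B * exp t * exp (- (t - y) * real M)"
      by (rule order_trans[OF cb dec]) simp
  qed
  have lim: "(\<lambda>M. sum a {- int M..int M}) \<longlonglongrightarrow> g w0"
    unfolding tel using tendsto_add[OF tendsto_const tendsto_diff[OF c1 c2], of "g w0"] by simp
  have C0: "0 \<le> C" using order_trans[OF norm_ge_zero C[OF w0]] .
  have ab: "cmod (a m) \<le> C * exp (- (s - y) * real_of_int \<bar>m\<bar>)" for m
  proof -
    have "cmod (a m) \<le> (C * exp (- s * real_of_int \<bar>m\<bar>)) * exp (y * real_of_int \<bar>m\<bar>)"
      unfolding a_def norm_mult by (intro mult_mono em fcoeff_facts(3)[OF g C s]) (use C0 in auto)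
    then show ?thesis by (simp add: mult.assoc algebra_simps flip: exp_add)
  qed
  have "(\<lambda>m. C * exp (- (s - y) * real_of_int \<bar>m\<bar>)) summable_on UNIV"
    by (intro summable_on_cmult_right int_exp_summable) (use t in simp)
  then have "a summable_on UNIV" by (rule abs_summable_summable[OF summable_on_comparison_test]) (use ab in auto)
  then have hs: "(a has_sum infsum a UNIV) UNIV" by simp
  have "filterlim (\<lambda>M. {- int M..int M}) (finite_subsets_at_top UNIV) sequentially"
    unfolding filterlim_finite_subsets_at_top
  proof (intro allI impI)
    fix X :: "int set" assume "finite X \<and> X \<subseteq> UNIV"
    then obtain M0 where M0: "X \<subseteq> {- int M0..int M0}" using finite_int_interval by blast
    show "\<forall>\<^sub>F M in sequentially. finite {- int M..int M} \<and> X \<subseteq> {- int M..int M} \<and> {- int M..int M} \<subseteq> UNIV"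
      using eventually_ge_at_top[of M0] by eventually_elim (use M0 in fastforce)
  qed
  from filterlim_compose[OF hs[unfolded has_sum_def] this]
  have "(\<lambda>M. sum a {- int M..int M}) \<longlonglongrightarrow> infsum a UNIV" .
  from LIMSEQ_unique[OF this lim] hs show ?thesis by (simp add: a_def)
qed

section \<open>Fourier expansion in several angles\<close>

definition upd :: "'n::finite \<Rightarrow> complex \<Rightarrow> 'n phase \<Rightarrow> 'n phase" where
  "upd j w z = (fst z, fst (snd z), (\<chi> i. if i = j then w else fst (snd (snd z)) $ i), snd (snd (snd z)))"

definition angle_fun :: "(real^'n::finite) set \<Rightarrow> real \<Rightarrow> real \<Rightarrow> real \<Rightarrow> ('n phase \<Rightarrow> complex) \<Rightarrow> bool" where
  "angle_fun V a s C F \<longleftrightarrow> holo_fun_on (cdomain V a s) F \<and> (\<forall>z\<in>cdomain V a s. cmod (F z) \<le> C) \<and>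
     (\<forall>z\<in>cdomain V a s. \<forall>j. F (shift_angle j z) = F z) \<and>
     (\<forall>z\<in>cdomain V a s. \<forall>\<eta>\<in>strip a. F (fst z, \<eta>, snd (snd z)) = F z)"

definition angle_free :: "(real^'n::finite) set \<Rightarrow> real \<Rightarrow> real \<Rightarrow> 'n \<Rightarrow> ('n phase \<Rightarrow> complex) \<Rightarrow> bool" where
  "angle_free V a s j F \<longleftrightarrow> (\<forall>z\<in>cdomain V a s. \<forall>w\<in>strip s. F (upd j w z) = F z)"

definition angle_coeff :: "'n::finite \<Rightarrow> int \<Rightarrow> ('n phase \<Rightarrow> complex) \<Rightarrow> 'n phase \<Rightarrow> complex" where
  "angle_coeff j m F z = fcoeff m (\<lambda>w. F (upd j w z))"

lemma upd_simps:
  "fst (upd j w z) = fst z" "fst (snd (upd j w z)) = fst (snd z)"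
  "fst (snd (snd (upd j w z))) $ i = (if i = j then w else fst (snd (snd z)) $ i)"
  "snd (snd (snd (upd j w z))) = snd (snd (snd z))"
  by (simp_all add: upd_def)

lemma upd_upd: "upd j w (upd j v z) = upd j w z"
  by (rule phase_eqI) (simp_all add: upd_simps)
lemma upd_commute: "i \<noteq> j \<Longrightarrow> upd j w (upd i v z) = upd i v (upd j w z)"
  by (rule phase_eqI) (auto simp: upd_simps)
lemma upd_same: "upd j (fst (snd (snd z)) $ j) z = z"
  by (rule phase_eqI) (auto simp: upd_simps)
lemma upd_cdomain: "z \<in> cdomain V a s \<Longrightarrow> w \<in> strip s \<Longrightarrow> upd j w z \<in> cdomain V a s"
  by (simp add: mem_cdomain upd_simps strip_def)
lemma upd_eta: "upd j w (fst z, \<eta>, snd (snd z)) = (fst (upd j w z), \<eta>, snd (snd (upd j w z)))"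
  by (rule phase_eqI) (simp_all add: upd_simps)
lemma upd_shift: "upd j w (shift_angle i z) = (if i = j then upd j w z else shift_angle i (upd j w z))"
  by (rule phase_eqI) (auto simp: upd_simps shift_angle_alt axis_def)
lemma upd_add: "upd j (w + of_real (2 * pi)) z = shift_angle j (upd j w z)"
  by (rule phase_eqI) (auto simp: upd_simps shift_angle_alt axis_def)

lemma upd_holo: "holo_map_on S (upd j w)"
proof (rule holo_map_components(1))
  show "holo_fun_on S (\<lambda>z. fst (snd (snd (upd j w z))) $ i)" for i
    by (cases "i = j") (simp_all add: upd_simps holo_const holo_coords)
qed (simp_all add: upd_simps holo_coords)

lemma upd_holomorphic:
  assumes "holo_fun_on (cdomain V a s) F" "z \<in> cdomain V a s"
  shows "(\<lambda>w. F (upd j w z)) holomorphic_on strip s"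
proof -
  have line: "upd j w z = upd j 0 z + cscale w (dirPhi j)" for w
    by (rule phase_eqI) (auto simp: upd_simps axis_def)
  have "\<exists>D. ((\<lambda>w. F (upd j w z)) has_field_derivative D) (at w)" if w: "w \<in> strip s" for w
  proof -
    have mem: "upd j 0 z + cscale w (dirPhi j) \<in> cdomain V a s" using upd_cdomain[OF assms(2) w, of j] line[of w] by metis
    have "(\<lambda>w. F (upd j w z)) = (\<lambda>w. F (upd j 0 z + cscale w (dirPhi j)))" using line by metis
    then show ?thesis using holo_line[OF assms(1) mem] by metis
  qed
  then show ?thesis by (simp add: holomorphic_on_open open_strip)
qed

lemma angle_section:
  assumes F: "angle_fun V a s C F" and z: "z \<in> cdomain V a s"
  shows "periodic_on_strip s (\<lambda>w. F (upd j w z))" "w \<in> strip s \<Longrightarrow> cmod (F (upd j w z)) \<le> C"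
proof -
  have D: "upd j w z \<in> cdomain V a s" if "w \<in> strip s" for w by (rule upd_cdomain[OF z that])
  show "periodic_on_strip s (\<lambda>w. F (upd j w z))"
    unfolding periodic_on_strip_def upd_add
    using upd_holomorphic[OF _ z, of F j] F D by (auto simp: angle_fun_def)
  show "w \<in> strip s \<Longrightarrow> cmod (F (upd j w z)) \<le> C" using F D by (auto simp: angle_fun_def)
qed

lemma angle_coeff_has_sum:
  assumes F: "angle_fun V a s C F" and z: "z \<in> cdomain V a s"
  shows "((\<lambda>m. angle_coeff j m F z * exp (\<i> * of_int m * fst (snd (snd z)) $ j)) has_sum F z) UNIV"
  using fourier_has_sum_1d[OF angle_section[OF F z], of "fst (snd (snd z)) $ j" j] z
  unfolding angle_coeff_def[symmetric] upd_same by (simp add: mem_cdomain strip_def)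

text \<open>The averages in the angle \<open>j\<close> converge uniformly on the whole domain, so the coefficient is holomorphic in all variables.\<close>

lemma angle_coeff_fun:
  assumes F: "angle_fun V a s C F" and s: "0 < s"
  shows "angle_fun V a s (C * exp (- s * real_of_int \<bar>m\<bar>)) (angle_coeff j m F)"
proof -
  let ?D = "cdomain V a s"
  have real: "of_real x \<in> strip s" for x using s by (simp add: strip_def)
  define G where "G = (\<lambda>M z. favg M (\<lambda>w. F (upd j w z) * exp (- \<i> * of_int m * w)))"
  have hG: "holo_fun_on ?D (G M)" for M
  proof -
    define x where "x = (\<lambda>l. complex_of_real (2 * pi * real l / real (Suc M)))"
    have "holo_fun_on ?D (\<lambda>z. F (upd j (x l) z))" for l
    proof (rule holo_compose(1)[OF _ upd_holo])
      show "holo_fun_on ?D F" using F by (simp add: angle_fun_def)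
      show "upd j (x l) ` ?D \<subseteq> ?D" unfolding x_def by (intro image_subsetI upd_cdomain[OF _ real])
    qed
    then have "holo_fun_on ?D (\<lambda>z. exp (- \<i> * of_int m * x l) * F (upd j (x l) z))" for l by (rule holo_cmult(1))
    then have "holo_fun_on ?D (\<lambda>z. \<Sum>l<Suc M. exp (- \<i> * of_int m * x l) * F (upd j (x l) z))"
      using holo_sum[of "{..<Suc M}" ?D "\<lambda>l z. exp (- \<i> * of_int m * x l) * F (upd j (x l) z)"] by blast
    then have 1: "holo_fun_on ?D (\<lambda>z. inverse (of_nat (Suc M)) * (\<Sum>l<Suc M. exp (- \<i> * of_int m * x l) * F (upd j (x l) z)))"
      by (rule holo_cmult(1))
    have "G M z = inverse (of_nat (Suc M)) * (\<Sum>l<Suc M. exp (- \<i> * of_int m * x l) * F (upd j (x l) z))" for z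
    proof -
      have "G M z = (\<Sum>l<Suc M. F (upd j (x l) z) * exp (- \<i> * of_int m * x l)) / of_nat (Suc M)"
        by (simp only: G_def favg_def x_def)
      then show ?thesis by (simp only: divide_inverse mult.commute)
    qed
    then have "G M = (\<lambda>z. inverse (of_nat (Suc M)) * (\<Sum>l<Suc M. exp (- \<i> * of_int m * x l) * F (upd j (x l) z)))" by (rule ext)
    with 1 show ?thesis by (simp only:)
  qed
  note sec = angle_section[OF F]
  define L where "L = 2 * pi * (C * exp (real_of_int \<bar>m\<bar> * s)) / s"
  have rate: "cmod (G M z - angle_coeff j m F z) \<le> L * (1 / real (Suc M))" if "z \<in> ?D" for M z
    unfolding G_def angle_coeff_def L_def by (rule fcoeff_facts(2)[OF sec[OF that] s])
  have ul: "uniform_limit ?D G (angle_coeff j m F) sequentially"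
  proof (rule uniform_limitI)
    fix e :: real assume "0 < e"
    from order_tendstoD(2)[OF tendsto_const_over_Suc this, of L]
    show "\<forall>\<^sub>F M in sequentially. \<forall>z\<in>?D. dist (G M z) (angle_coeff j m F z) < e"
    proof eventually_elim
      case (elim M)
      show ?case unfolding dist_norm by (intro ballI le_less_trans[OF rate elim])
    qed
  qed
  have "holo_fun_on ?D (angle_coeff j m F)"
  proof (rule holo_limit(1)[where F = G, OF open_cdomain hG])
    show "\<exists>\<rho>>0. uniform_limit (ball z \<rho> \<inter> ?D) G (angle_coeff j m F) sequentially" for z
      by (intro exI[of _ "1::real"] conjI uniform_limit_on_subset[OF ul]) simp_all
  qed
  moreover have "cmod (angle_coeff j m F z) \<le> C * exp (- s * real_of_int \<bar>m\<bar>)" if "z \<in> ?D" for z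
    unfolding angle_coeff_def by (rule fcoeff_facts(3)[OF sec[OF that] s])
  moreover have "angle_coeff j m F (shift_angle i z) = angle_coeff j m F z" if "z \<in> ?D" for i z
    unfolding angle_coeff_def upd_shift
    by (rule fcoeff_cong) (use F upd_cdomain[OF that real] in \<open>auto simp: angle_fun_def\<close>)
  moreover have "angle_coeff j m F (fst z, \<eta>, snd (snd z)) = angle_coeff j m F z" if "z \<in> ?D" "\<eta> \<in> strip a" for \<eta> z
    unfolding angle_coeff_def upd_eta
    by (rule fcoeff_cong) (use F upd_cdomain[OF that(1) real] that(2) in \<open>auto simp: angle_fun_def\<close>)
  ultimately show ?thesis unfolding angle_fun_def by blast
qed

lemma angle_coeff_free:
  assumes s: "0 < s"
  shows "angle_free V a s j (angle_coeff j m F)"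
    "angle_free V a s i F \<Longrightarrow> angle_free V a s i (angle_coeff j m F)"
proof -
  have real: "of_real x \<in> strip s" for x using s by (simp add: strip_def)
  show j: "angle_free V a s j (angle_coeff j m F)" by (simp add: angle_free_def angle_coeff_def upd_upd)
  assume i: "angle_free V a s i F"
  show "angle_free V a s i (angle_coeff j m F)"
  proof (cases "i = j")
    case False
    show ?thesis
      unfolding angle_free_def angle_coeff_def
    proof (intro ballI fcoeff_cong)
      fix z w x assume z: "z \<in> cdomain V a s" and w: "w \<in> strip s"
      show "F (upd j (of_real x) (upd i w z)) = F (upd j (of_real x) z)"
        unfolding upd_commute[OF False]
        by (rule i[unfolded angle_free_def, rule_format, OF upd_cdomain[OF z real] w])
    qed
  qed (use j in simp)
qed

definition supp_in :: "'n::finite set \<Rightarrow> (int^'n) set" where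
  "supp_in A = {k. \<forall>j. j \<notin> A \<longrightarrow> k $ j = 0}"

definition zero_at :: "'n::finite \<Rightarrow> int^'n \<Rightarrow> int^'n" where
  "zero_at j k = (\<chi> i. if i = j then 0 else k $ i)"

lemma zero_at_split:
  shows "freq_norm k = freq_norm (zero_at j k) + \<bar>k $ j\<bar>"
    "fmode k z = fmode (zero_at j k) z * exp (\<i> * of_int (k $ j) * fst (snd (snd z)) $ j)"
proof -
  have r: "sum f UNIV = f j + sum f (UNIV - {j})" for f :: "'a \<Rightarrow> 'b::comm_monoid_add" by (rule sum.remove) auto
  show "freq_norm k = freq_norm (zero_at j k) + \<bar>k $ j\<bar>"
    unfolding freq_norm_def r[of "\<lambda>j. \<bar>_ $ j\<bar>"] by (simp add: zero_at_def)
  show "fmode k z = fmode (zero_at j k) z * exp (\<i> * of_int (k $ j) * fst (snd (snd z)) $ j)"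
    unfolding fmode_alt r[of "\<lambda>j. fst (snd (snd z)) $ j * _ j"] exp_add[symmetric]
    by (simp add: zero_at_def algebra_simps)
qed

text \<open>The coefficients of an expansion in the angles in \<open>A\<close> no longer depend on these angles but inherit all other
  properties of \<open>F\<close>, so the next angle can be expanded in each of them, and the exponential bounds multiply.
  The expansion holds on a narrower strip, where the bounds make the iterated sum an absolutely convergent one.\<close>

lemma fourier_partial:
  fixes A :: "'n::finite set"
  assumes F: "angle_fun V a s C F" and t: "0 < t" "t < s" and C: "0 \<le> C"
  shows "\<exists>c. (\<forall>k\<in>supp_in A. angle_fun V a s (C * wt (- s) k) (c k) \<and> (\<forall>j\<in>A. angle_free V a s j (c k))) \<and>
     (\<forall>z\<in>cdomain V a t. ((\<lambda>k. c k z * fmode k z) has_sum F z) (supp_in A))"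
  using finite[of A]
proof (induction A rule: finite_induct)
  case empty
  have e: "supp_in {} = {0::int^'n}" by (auto simp: supp_in_def vec_eq_iff)
  show ?case
    by (rule exI[of _ "\<lambda>_. F"])
       (use F in \<open>auto simp: e wt_def fmode_alt has_sum_finite_iff\<close>)
next
  case (insert j A)
  from insert(3) obtain c where c1: "\<And>k. k \<in> supp_in A \<Longrightarrow> angle_fun V a s (C * wt (- s) k) (c k)"
    and c2: "\<And>k j. k \<in> supp_in A \<Longrightarrow> j \<in> A \<Longrightarrow> angle_free V a s j (c k)"
    and c3: "\<And>z. z \<in> cdomain V a t \<Longrightarrow> ((\<lambda>k. c k z * fmode k z) has_sum F z) (supp_in A)" by blast
  have s: "0 < s" using t by simp
  define c' where "c' = (\<lambda>k. angle_coeff j (k $ j) (c (zero_at j k)))"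
  have za: "zero_at j k \<in> supp_in A" if "k \<in> supp_in (insert j A)" for k
    using that by (auto simp: supp_in_def zero_at_def)
  have d1: "angle_fun V a s (C * wt (- s) k) (c' k)" if "k \<in> supp_in (insert j A)" for k
  proof -
    have "wt (- s) k = wt (- s) (zero_at j k) * exp (- s * real_of_int \<bar>k $ j\<bar>)"
      unfolding wt_def zero_at_split(1)[of k j] by (simp add: distrib_left exp_diff exp_minus field_simps)
    then show ?thesis using angle_coeff_fun[OF c1[OF za[OF that]] s, of "k $ j" j] by (simp add: c'_def mult.assoc)
  qed
  have d2: "angle_free V a s i (c' k)" if "k \<in> supp_in (insert j A)" "i \<in> insert j A" for k i
    using angle_coeff_free[OF s] c2[OF za[OF that(1)]] that(2) unfolding c'_def by blast
  have d3: "((\<lambda>k. c' k z * fmode k z) has_sum F z) (supp_in (insert j A))" if z: "z \<in> cdomain V a t" for z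
  proof -
    have zs: "z \<in> cdomain V a s" using cdomain_monoD[OF z] t by auto
    define g where "g = (\<lambda>k. c' k z * fmode k z)"
    have bd: "cmod (g k) \<le> C * wt (- (s - t)) k" if "k \<in> supp_in (insert j A)" for k
    proof -
      have "cmod (g k) \<le> (C * wt (- s) k) * wt t k"
        unfolding g_def norm_mult using d1[OF that] zs fmode_bound[OF z] C by (intro mult_mono) (auto simp: angle_fun_def)
      then show ?thesis by (simp add: wt_def mult.assoc left_diff_distrib flip: exp_add)
    qed
    have "(\<lambda>k. C * wt (- (s - t)) k) summable_on supp_in (insert j A)"
      by (intro summable_on_cmult_right summable_on_subset_banach[OF wt_summable(1)]) (use t in auto)
    then have gs: "g summable_on supp_in (insert j A)"
      by (rule abs_summable_summable[OF summable_on_comparison_test]) (use bd in auto)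
    define p where "p = (\<lambda>(k0::int^'n, m). (\<chi> i. if i = j then m else k0 $ i))"
    have bij: "bij_betw p (supp_in A \<times> UNIV) (supp_in (insert j A))"
      by (rule bij_betwI[of _ _ _ "\<lambda>k. (zero_at j k, k $ j)"])
         (use insert(2) in \<open>auto simp: p_def supp_in_def zero_at_def vec_eq_iff split: if_splits\<close>)
    have p1: "p (k0, m) $ j = m" and p2: "k0 \<in> supp_in A \<Longrightarrow> zero_at j (p (k0, m)) = k0" for k0 m
      using insert(2) by (auto simp: p_def zero_at_def vec_eq_iff supp_in_def)
    have "((\<lambda>x. g (p x)) has_sum F z) (supp_in A \<times> UNIV)"
    proof (rule has_sum_SigmaI[OF _ c3[OF z]])
      fix k0 assume k0: "k0 \<in> supp_in A"
      have "g (p (k0, m)) = fmode k0 z * (angle_coeff j m (c k0) z * exp (\<i> * of_int m * fst (snd (snd z)) $ j))" for m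
        unfolding g_def c'_def zero_at_split(2)[of "p (k0, m)" z j] p1 p2[OF k0] by (simp only: mult_ac)
      then show "((\<lambda>m. g (p (k0, m))) has_sum c k0 z * fmode k0 z) UNIV"
        using has_sum_cmult_right[OF angle_coeff_has_sum[OF c1[OF k0] zs, of j], of "fmode k0 z"]
        by (simp add: mult.commute[of "c k0 z"])
    next
      show "(\<lambda>x. g (p x)) summable_on supp_in A \<times> UNIV"
        using gs summable_on_reindex_bij_betw[OF bij, of g] by simp
    qed
    then show ?thesis using has_sum_reindex_bij_betw[OF bij, of g "F z"] by (simp add: g_def)
  qed
  show ?case using d1 d2 d3 by blast
qed

text \<open>A bounded function on the wider strip has a Fourier series on the narrower one, with the
  explicit norm bound coming from summing the geometric series in each angle.\<close>

lemma fb_of_bounded: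
  fixes F :: "'n::finite phase \<Rightarrow> complex"
  assumes F: "angle_fun V a s C F" and t: "0 < t" "t < s" and C: "0 \<le> C"
  shows "fb V a t F (C * ((1 + exp (- (s - t))) / (1 - exp (- (s - t)))) ^ CARD('n))"
proof -
  have U: "supp_in (UNIV::'n set) = UNIV" by (simp add: supp_in_def)
  obtain c where c1: "\<And>k. angle_fun V a s (C * wt (- s) k) (c k)" and c2: "\<And>k j. angle_free V a s j (c k)"
    and c3: "\<And>z. z \<in> cdomain V a t \<Longrightarrow> ((\<lambda>k. c k z * fmode k z) has_sum F z) UNIV"
    using fourier_partial[OF F t C, of UNIV] unfolding U by blast
  have sub: "cdomain V a t \<subseteq> cdomain V a s" using t by (intro cdomain_mono) auto
  have slow: "c k z = c k (slow_part z)" if z: "z \<in> cdomain V a s" for k z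
  proof -
    define Z where "Z = (\<lambda>A z. (fst z, fst (snd z), (\<chi> i. if i \<in> A then 0 else fst (snd (snd z)) $ i), snd (snd (snd z))) :: 'n phase)"
    have ZD: "Z A z \<in> cdomain V a s" for A using z t by (auto simp: Z_def mem_cdomain)
    have "c k (Z A z) = c k z" for A
      using finite[of A]
    proof (induction A rule: finite_induct)
      case empty then show ?case by (simp add: Z_def)
    next
      case (insert j A)
      have "Z (insert j A) z = upd j 0 (Z A z)" by (rule phase_eqI) (auto simp: Z_def upd_simps)
      then show ?case using c2[of j k] ZD[of A] insert(3) t by (auto simp: angle_free_def strip_def)
    qed
    moreover have "slow_part z = (fst (Z UNIV z), 0, snd (snd (Z UNIV z)))"
      by (rule phase_eqI) (auto simp: Z_def)
    moreover have "0 \<in> strip a" using cdomain_pos[OF z] by (simp add: strip_def)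
    ultimately show ?thesis using c1[of k] ZD[of UNIV] by (simp add: angle_fun_def)
  qed
  have w: "C * wt (- s) k * wt t k = C * wt (- (s - t)) k" for k :: "int^'n"
    by (simp add: wt_def mult.assoc left_diff_distrib flip: exp_add)
  have d: "0 < s - t" using t by simp
  have "fser V a t F c (\<lambda>k. C * wt (- s) k) (C * ((1 + exp (- (s - t))) / (1 - exp (- (s - t)))) ^ CARD('n))"
  proof (rule fserI)
    show "holo_fun_on (cdomain V a t) (c k)" for k using c1[of k] holo_fun_subset[OF _ sub] by (auto simp: angle_fun_def)
    show "slow (cdomain V a t) (c k)" for k unfolding slow_def using slow sub by blast
    show "0 \<le> C * wt (- s) k" for k :: "int^'n" using C by simp
    show "z \<in> cdomain V a t \<Longrightarrow> cmod (c k z) \<le> C * wt (- s) k" for k z using c1[of k] sub by (auto simp: angle_fun_def)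
    show "(\<lambda>k::int^'n. C * wt (- s) k * wt t k) summable_on UNIV"
      unfolding w by (intro summable_on_cmult_right wt_summable(1)[OF d])
    have "infsum (\<lambda>k::int^'n. C * wt (- (s - t)) k) UNIV = C * infsum (\<lambda>k::int^'n. wt (- (s - t)) k) UNIV"
      by (rule infsum_cmult_right) (rule wt_summable(1)[OF d])
    then show "infsum (\<lambda>k::int^'n. C * wt (- s) k * wt t k) UNIV \<le> C * ((1 + exp (- (s - t))) / (1 - exp (- (s - t)))) ^ CARD('n)"
      unfolding w using wt_summable(2)[OF d, where 'n='n] C by (simp add: mult_left_mono)
  qed (rule c3)
  then show ?thesis by (rule fser_fb)
qed

section \<open>Iterating the normal form step\<close>

lemma exp_1_bounds: "27/10 \<le> exp (1::real)" "(exp (1::real))\<^sup>2 \<le> 8"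
proof -
  have e: "27/10 \<le> exp (1::real)" "exp (1::real) < 272/100"
  proof -
    have "- (exp (1::real) - 5837465777 / 2147483648) \<le> inverse (2 ^ 32)" by (rule abs_le_D2[OF e_approx_32])
    moreover have "inverse (2 ^ 32) \<le> (1/100 :: real)" by simp
    ultimately show "27/10 \<le> exp (1::real)" by linarith
  qed (rule e_less_272)
  show "27/10 \<le> exp (1::real)" by (rule e(1))
  have "(exp (1::real))\<^sup>2 \<le> (272/100)\<^sup>2" by (rule power_mono) (use e in auto)
  then show "(exp (1::real))\<^sup>2 \<le> 8" by (simp add: power2_eq_square)
qed

text \<open>\<open>E\<close> is the initial size of the perturbation \<open>P0\<close>; the smallness assumption says that the \<open>\<Delta>\<close> of the
  normal form theorem is at most one half.\<close>

locale resonant_setting =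
  fixes V :: "(real^'n::finite) set" and hh P0 :: "'n phase \<Rightarrow> complex" and M :: "(int^'n) set"
    and \<delta> \<sigma> \<alpha> \<mu> E Bh :: real and r K :: nat
  assumes hh: "holo_fun_on (cdomain V \<delta> (3/2 * \<sigma>)) hh" "slow (cdomain V \<delta> (3/2 * \<sigma>)) hh"
      "\<And>z. z \<in> cdomain V \<delta> (3/2 * \<sigma>) \<Longrightarrow> cmod (hh z) \<le> Bh"
      "\<And>z. z \<in> cdomain V \<delta> (3/2 * \<sigma>) \<Longrightarrow> real_phase z \<Longrightarrow> hh z \<in> \<real>"
    and nr: "\<And>k z. k \<notin> M \<Longrightarrow> freq_norm k < int (r * K) \<Longrightarrow> z \<in> cdomain V \<delta> (3/2 * \<sigma>) \<Longrightarrow> \<alpha> < cmod (dd hh z (kvec k))"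
    and M: "\<And>k. - k \<in> M \<longleftrightarrow> k \<in> M"
    and P0: "fb V \<delta> (3/2 * \<sigma>) P0 E" "\<And>z. z \<in> cdomain V \<delta> (3/2 * \<sigma>) \<Longrightarrow> real_phase z \<Longrightarrow> P0 z \<in> \<real>"
    and pos: "0 < \<delta>" "\<delta> \<le> 1" "0 < \<sigma>" "0 < \<alpha>" "0 \<le> \<mu>" "1 \<le> r"
    and small: "2 ^ 8 * real r / (\<alpha> * \<delta> * \<sigma>) * (\<mu> + exp 1 * E) + 4 * exp (- real K * \<sigma> / 2) \<le> 1/2"
begin

lemma E: "0 \<le> E" by (rule fb_nonneg[OF P0(1)])

definition q :: real where "q = exp (- real K * \<sigma> / 2)"
text \<open>The two small parameters in units of \<open>\<alpha> * \<delta> * \<sigma>\<close>, in which every bound below is expressed.\<close>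

definition T :: real where "T = E / (\<alpha> * \<delta> * \<sigma>)"
definition m :: real where "m = \<mu> / (\<alpha> * \<delta> * \<sigma>)"
definition \<Delta> :: real where "\<Delta> = 2 ^ 8 * real r / (\<alpha> * \<delta> * \<sigma>) * (\<mu> + exp 1 * E) + 4 * exp (- real K * \<sigma> / 2)"

lemma nonneg: "0 \<le> T" "0 \<le> m" "0 < q"
  using E pos by (simp_all add: T_def m_def q_def)

lemma \<Delta>: "\<Delta> = 256 * (real r * (m + exp 1 * T)) + 4 * q"
  by (simp add: \<Delta>_def T_def m_def q_def add_divide_distrib algebra_simps)

lemma \<Delta>_bounds: "0 \<le> \<Delta>" "\<Delta> \<le> 1/2" "q \<le> 1/8" "real r * (m + exp 1 * T) \<le> 1/512"
proof -
  have x: "0 \<le> real r * (m + exp 1 * T)" using nonneg by simp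
  show "\<Delta> \<le> 1/2" using small by (simp add: \<Delta>_def)
  then show "0 \<le> \<Delta>" "q \<le> 1/8" "real r * (m + exp 1 * T) \<le> 1/512" using x nonneg(3) unfolding \<Delta> by linarith+
qed

lemma T_small: "real r * T \<le> 1/1382" "T \<le> 1/1382"
proof -
  have "(27/10) * (real r * T) \<le> exp 1 * (real r * T)" using exp_1_bounds(1) nonneg by (intro mult_right_mono) auto
  also have "\<dots> \<le> real r * (m + exp 1 * T)" using nonneg by (simp add: algebra_simps)
  finally show *: "real r * T \<le> 1/1382" using \<Delta>_bounds(4) by linarith
  have "1 * T \<le> real r * T" using pos nonneg by (intro mult_right_mono) auto
  with * show "T \<le> 1/1382" by linarith
qed

text \<open>The tail is reduced by \<open>q powr (3 * r / 8)\<close>, which is at most \<open>1 / 2 ^ r\<close> as \<open>q \<le> 1/8\<close>.\<close>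

lemma first_bound:
  "exp (- real (r * K) * (3 * \<sigma> / 16)) * E + 5/4 * (2 * exp 1 * (E / \<alpha>) / (\<delta> / 8 * (3 * \<sigma> / 16))) * (0 + E)
     + 3/2 * (4 * \<mu> * (E / \<alpha>) / (3 * \<sigma> / 16) + 3/2 * 0 * (E / \<alpha>) * (1 / (\<delta> / 8 * 1) + 1 / (1 * (3 * \<sigma> / 16)))) \<le> E / real r"
proof -
  have tail: "exp (- real (r * K) * (3 * \<sigma> / 16)) \<le> 1 / (2 * real r)"
  proof -
    have "ln q \<le> ln (1/8)" using \<Delta>_bounds(3) nonneg(3) by (subst ln_le_cancel_iff) auto
    then have "- real K * \<sigma> / 2 \<le> - (3 * ln 2)" using ln_realpow[of 2 3] by (simp add: q_def ln_div)
    moreover have "0 < ln (2::real)" by simp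
    ultimately have "3/8 * (- real K * \<sigma> / 2) \<le> - ln 2" by linarith
    then have "real r * (3/8 * (- real K * \<sigma> / 2)) \<le> real r * (- ln 2)" by (rule mult_left_mono) simp
    moreover have "- real (r * K) * (3 * \<sigma> / 16) = real r * (3/8 * (- real K * \<sigma> / 2))" by simp
    ultimately have "exp (- real (r * K) * (3 * \<sigma> / 16)) \<le> exp (real r * (- ln 2))" by simp
    also have "exp (real r * (- ln 2)) = 1 / 2 ^ r" by (simp add: exp_minus inverse_eq_divide exp_of_nat_mult)
    also have "2 * real r \<le> 2 ^ r" using pos(6)
    proof (induction r rule: dec_induct)
      case (step n) then show ?case by simp
    qed simp
    then have "1 / 2 ^ r \<le> 1 / (2 * real r)" using pos(6) by (intro divide_left_mono) auto
    finally show ?thesis .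
  qed
  have 2: "5/4 * (2 * exp 1 * (E / \<alpha>) / (\<delta> / 8 * (3 * \<sigma> / 16))) * (0 + E) = E * (320/3 * (exp 1 * T))"
    using pos by (simp add: T_def)
  have 3: "3/2 * (4 * \<mu> * (E / \<alpha>) / (3 * \<sigma> / 16) + 3/2 * 0 * (E / \<alpha>) * (1 / (\<delta> / 8 * 1) + 1 / (1 * (3 * \<sigma> / 16)))) = E * (32 * (\<delta> * m))"
    using pos by (simp add: m_def)
  have "\<delta> * m \<le> m" using mult_right_mono[OF pos(2) nonneg(2)] by simp
  moreover have "m + exp 1 * T \<le> 1 / (512 * real r)" using \<Delta>_bounds(4) pos(6) by (simp add: pos_le_divide_eq mult_ac)
  moreover have "1 / (512 * real r) = 1/256 * (1 / (2 * real r))" "0 \<le> 1 / (2 * real r)" by simp_all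
  moreover have "0 \<le> exp 1 * T" using nonneg by simp
  ultimately have "320/3 * (exp 1 * T) + 32 * (\<delta> * m) \<le> 1 / (2 * real r)" using nonneg by linarith
  with tail have "exp (- real (r * K) * (3 * \<sigma> / 16)) + (320/3 * (exp 1 * T) + 32 * (\<delta> * m)) \<le> 1 / (2 * real r) + 1 / (2 * real r)"
    by linarith
  from mult_left_mono[OF this E]
  have "E * (exp (- real (r * K) * (3 * \<sigma> / 16)) + (320/3 * (exp 1 * T) + 32 * (\<delta> * m))) \<le> E / real r" by simp
  then show ?thesis unfolding 2 3 by (simp add: algebra_simps)
qed

text \<open>Multiplying the order \<open>r * K\<close> by the angular loss \<open>\<sigma> / (2 * r)\<close> gives the reduction of the tail by \<open>q\<close>;
  all other terms carry a factor \<open>r * T\<close> or \<open>r * m\<close>.  The bracket with the first resonant part fits because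
  \<open>228 \<le> 96 * exp 1\<close>.\<close>

lemma next_bound:
  assumes p: "0 \<le> p" "z2 + p \<le> 2 * (E / real r)"
  shows "exp (- real (r * K) * (\<sigma> / (2 * real r))) * p
     + 5/4 * (2 * exp 1 * (p / \<alpha>) / (\<delta> / (16 * real r) * (\<sigma> / (2 * real r)))) * (z2 + p)
     + 3/2 * (4 * \<mu> * (p / \<alpha>) / (\<sigma> / (2 * real r)) + 3/2 * E * (p / \<alpha>) *
         (1 / (\<delta> / (16 * real r) * (3 * \<sigma> / 16)) + 1 / (\<delta> / 8 * (\<sigma> / (2 * real r))))) \<le> \<Delta> * p"
proof -
  have r: "0 < real r" using pos(6) by simp
  have 1: "exp (- real (r * K) * (\<sigma> / (2 * real r))) = q" using r by (simp add: q_def)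
  have "5/4 * (2 * exp 1 * (p / \<alpha>) / (\<delta> / (16 * real r) * (\<sigma> / (2 * real r)))) * (z2 + p)
      \<le> 5/4 * (2 * exp 1 * (p / \<alpha>) / (\<delta> / (16 * real r) * (\<sigma> / (2 * real r)))) * (2 * (E / real r))"
    using p pos by (intro mult_left_mono) auto
  also have "\<dots> = p * (real r * (160 * (exp 1 * T)))" using pos r by (simp add: T_def field_simps)
  finally have 2: "5/4 * (2 * exp 1 * (p / \<alpha>) / (\<delta> / (16 * real r) * (\<sigma> / (2 * real r)))) * (z2 + p) \<le> p * (real r * (160 * (exp 1 * T)))" .
  have 3: "3/2 * (4 * \<mu> * (p / \<alpha>) / (\<sigma> / (2 * real r)) + 3/2 * E * (p / \<alpha>) *
         (1 / (\<delta> / (16 * real r) * (3 * \<sigma> / 16)) + 1 / (\<delta> / 8 * (\<sigma> / (2 * real r)))))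
      = p * (real r * (12 * (\<delta> * m) + 228 * T))" using pos r by (simp add: T_def m_def field_simps)
  have "\<delta> * m \<le> m" using mult_right_mono[OF pos(2) nonneg(2)] by simp
  moreover have "228 * T \<le> 96 * (exp 1 * T)" using mult_right_mono[OF exp_1_bounds(1) nonneg(1)] nonneg(1) by simp
  ultimately have "160 * (exp 1 * T) + (12 * (\<delta> * m) + 228 * T) \<le> 256 * (m + exp 1 * T)" using nonneg(2) by simp
  then have "real r * (160 * (exp 1 * T) + (12 * (\<delta> * m) + 228 * T)) \<le> real r * (256 * (m + exp 1 * T))" by (rule mult_left_mono) simp
  then have "q + real r * (160 * (exp 1 * T)) + real r * (12 * (\<delta> * m) + 228 * T) \<le> \<Delta>"
    using nonneg(3) unfolding \<Delta> distrib_left by linarith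
  from mult_left_mono[OF this p(1)]
  have "q * p + p * (real r * (160 * (exp 1 * T))) + p * (real r * (12 * (\<delta> * m) + 228 * T)) \<le> \<Delta> * p" by (simp add: algebra_simps)
  then show ?thesis using 2 unfolding 1 3 by linarith
qed

definition act_width :: "nat \<Rightarrow> real" where "act_width j = 7/8 * \<delta> - real j * (\<delta> / (16 * real r))"
definition ang_width :: "nat \<Rightarrow> real" where "ang_width j = 21/16 * \<sigma> - real j * (\<sigma> / (2 * real r))"
text \<open>The accumulated displacement in units of \<open>\<delta>\<close> and \<open>\<sigma>\<close>: at most \<open>16 * T\<close> from the first step and
  \<open>32 * T * \<Delta> ^ i\<close> from the later ones, summed using \<open>\<Delta> \<le> 1/2\<close>.\<close>

definition shift_by :: "nat \<Rightarrow> real" where "shift_by j = T * (16 + 64 * (1 - \<Delta> ^ j))"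

abbreviation dom_at :: "nat \<Rightarrow> 'n phase set" where "dom_at j \<equiv> cdomain V (act_width j) (ang_width j)"

lemma widths:
  assumes "j \<le> r"
  shows "13/16 * \<delta> \<le> act_width j" "act_width j \<le> 7/8 * \<delta>" "13/16 * \<sigma> \<le> ang_width j" "ang_width j \<le> 21/16 * \<sigma>"
proof -
  have "real j / real r \<le> 1" using assms pos(6) by simp
  from mult_right_mono[OF this, of "\<delta> / 16"] mult_right_mono[OF this, of "\<sigma> / 2"] pos
  have "real j / real r * (\<delta> / 16) \<le> \<delta> / 16" "real j / real r * (\<sigma> / 2) \<le> \<sigma> / 2" by simp_all
  moreover have "real j * (\<delta> / (16 * real r)) = real j / real r * (\<delta> / 16)" "real j * (\<sigma> / (2 * real r)) = real j / real r * (\<sigma> / 2)"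
    by simp_all
  ultimately show "13/16 * \<delta> \<le> act_width j" "13/16 * \<sigma> \<le> ang_width j" unfolding act_width_def ang_width_def by linarith+
  show "act_width j \<le> 7/8 * \<delta>" "ang_width j \<le> 21/16 * \<sigma>" using pos by (simp_all add: act_width_def ang_width_def)
qed

lemma \<Delta>_power: "0 \<le> \<Delta> ^ j" "\<Delta> ^ j \<le> 1" "2 * \<Delta> ^ Suc j \<le> \<Delta> ^ j"
proof -
  show 0: "0 \<le> \<Delta> ^ j" and "\<Delta> ^ j \<le> 1" using \<Delta>_bounds by (auto intro: power_le_one)
  show "2 * \<Delta> ^ Suc j \<le> \<Delta> ^ j" using mult_right_mono[OF \<Delta>_bounds(2) 0] by simp
qed

lemma shift_bounds: "0 \<le> shift_by j" "shift_by j \<le> 1/16" "shift_by j \<le> 80 * T" "shift_by j + 32 * T * \<Delta> ^ j \<le> shift_by (Suc j)"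
proof -
  show "0 \<le> shift_by j" using nonneg \<Delta>_power[of j] by (simp add: shift_by_def)
  have "T * (16 + 64 * (1 - \<Delta> ^ j)) \<le> T * 80" using nonneg \<Delta>_power[of j] by (intro mult_left_mono) auto
  then show "shift_by j \<le> 80 * T" "shift_by j \<le> 1/16" using T_small(2) by (simp_all add: shift_by_def)
  have "T * (16 + 64 * (1 - \<Delta> ^ j) + 32 * \<Delta> ^ j) \<le> T * (16 + 64 * (1 - \<Delta> ^ Suc j))"
    using nonneg \<Delta>_power(3)[of j] by (intro mult_left_mono) auto
  then show "shift_by j + 32 * T * \<Delta> ^ j \<le> shift_by (Suc j)" by (simp add: shift_by_def algebra_simps)
qed

text \<open>The situation after the first step and \<open>j\<close> further ones.  The resonant part is \<open>Z1 + Z2\<close>, where \<open>Z1\<close> comes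
  from the first step; since the perturbations decrease at least by half, the bound of \<open>Z2\<close> stays below
  \<open>2 * E / r\<close>.  The transformation is controlled on a domain that shrinks with the displacement only.\<close>

definition reached :: "('n phase \<Rightarrow> complex) \<Rightarrow> nat \<Rightarrow> ('n phase \<Rightarrow> 'n phase) \<Rightarrow> ('n phase \<Rightarrow> 'n phase)
    \<Rightarrow> (int^'n \<Rightarrow> 'n phase \<Rightarrow> complex) \<Rightarrow> ('n phase \<Rightarrow> complex) \<Rightarrow> ('n phase \<Rightarrow> complex) \<Rightarrow> bool" where
  "reached Z1 j C C' c Z2 P \<longleftrightarrow>
     change_pair V ((13/16 - shift_by j) * \<delta>) ((13/16 - shift_by j) * \<sigma>) (shift_by j * \<delta>) (shift_by j * \<sigma>) C C' \<and>
     (\<forall>k. holo_fun_on (dom_at j) (c k)) \<and> (\<forall>k. slow (dom_at j) (c k)) \<and>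
     (\<forall>z\<in>dom_at j. Z1 z + Z2 z = (\<Sum>k\<in>{k\<in>M. freq_norm k < int (r * K)}. c k z * fmode k z)) \<and>
     fb V (act_width j) (ang_width j) Z2 (2 * (E / real r) * (1 - \<Delta> ^ j)) \<and>
     (\<forall>z\<in>dom_at j. real_phase z \<longrightarrow> Z2 z \<in> \<real>) \<and>
     fb V (act_width j) (ang_width j) P (E / real r * \<Delta> ^ j) \<and>
     (\<forall>z\<in>dom_at j. real_phase z \<longrightarrow> P z \<in> \<real>) \<and>
     (\<forall>z\<in>cdomain V ((13/16 - shift_by j) * \<delta>) ((13/16 - shift_by j) * \<sigma>).
        hh (C z) + of_real \<mu> * fst (snd (C z)) + P0 (C z) = hh z + of_real \<mu> * fst (snd z) + (Z1 z + Z2 z) + P z)"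

lemma reachedD:
  assumes "reached Z1 j C C' c Z2 P"
  shows "change_pair V ((13/16 - shift_by j) * \<delta>) ((13/16 - shift_by j) * \<sigma>) (shift_by j * \<delta>) (shift_by j * \<sigma>) C C'"
    "holo_fun_on (dom_at j) (c k)" "slow (dom_at j) (c k)"
    "z \<in> dom_at j \<Longrightarrow> Z1 z + Z2 z = (\<Sum>k\<in>{k\<in>M. freq_norm k < int (r * K)}. c k z * fmode k z)"
    "fb V (act_width j) (ang_width j) Z2 (2 * (E / real r) * (1 - \<Delta> ^ j))"
    "z \<in> dom_at j \<Longrightarrow> real_phase z \<Longrightarrow> Z2 z \<in> \<real>"
    "fb V (act_width j) (ang_width j) P (E / real r * \<Delta> ^ j)"
    "z \<in> dom_at j \<Longrightarrow> real_phase z \<Longrightarrow> P z \<in> \<real>"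
    "z \<in> cdomain V ((13/16 - shift_by j) * \<delta>) ((13/16 - shift_by j) * \<sigma>) \<Longrightarrow>
       hh (C z) + of_real \<mu> * fst (snd (C z)) + P0 (C z) = hh z + of_real \<mu> * fst (snd z) + (Z1 z + Z2 z) + P z"
  using assms unfolding reached_def by blast+

lemma slow_subset: "slow A c \<Longrightarrow> B \<subseteq> A \<Longrightarrow> slow B c" unfolding slow_def by blast

lemma core_widths:
  assumes j: "j \<le> r"
  shows "(13/16 - shift_by i) * \<delta> \<le> act_width j" "(13/16 - shift_by i) * \<sigma> \<le> ang_width j"
proof -
  have "(13/16 - shift_by i) * d \<le> 13/16 * d" if "0 < d" for d
    using that shift_bounds(1)[of i] by (intro mult_right_mono) auto
  from this[OF pos(1)] this[OF pos(3)] widths[OF j]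
  show "(13/16 - shift_by i) * \<delta> \<le> act_width j" "(13/16 - shift_by i) * \<sigma> \<le> ang_width j" by linarith+
qed

lemma core_subset: "j \<le> r \<Longrightarrow> z \<in> cdomain V ((13/16 - shift_by i) * \<delta>) ((13/16 - shift_by i) * \<sigma>) \<Longrightarrow> z \<in> dom_at j"
  by (erule cdomain_monoD) (rule core_widths; assumption)+

lemma first_step:
  "\<exists>Z1 C C' c P. fb V \<delta> (3/2 * \<sigma>) Z1 E \<and> (\<forall>z\<in>cdomain V \<delta> (3/2 * \<sigma>). real_phase z \<longrightarrow> Z1 z \<in> \<real>) \<and>
     reached Z1 0 C C' c (\<lambda>z. 0) P"
proof -
  have sm: "32 * (E / \<alpha>) \<le> \<delta> / 8 * (3 * \<sigma> / 16)"
  proof -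
    have "\<delta> * \<sigma> * (32 * T) \<le> \<delta> * \<sigma> * (3/128)" using T_small(2) pos by (intro mult_left_mono) auto
    moreover have "E / \<alpha> = \<delta> * \<sigma> * T" using pos by (simp add: T_def)
    ultimately show ?thesis by (simp add: algebra_simps)
  qed
  have zero: "fb V (\<delta> + 1) (3/2 * \<sigma> + 1) (\<lambda>z. 0) 0" "fb V \<delta> (3/2 * \<sigma>) (\<lambda>z. 0) 0"
    "\<And>z. z \<in> cdomain V \<delta> (3/2 * \<sigma>) \<Longrightarrow> real_phase z \<Longrightarrow> (0::complex) \<in> \<real>"
    "0 < \<delta> / 8" "0 < 3 * \<sigma> / 16" "3 * \<sigma> / 16 \<le> 3/2 * \<sigma>" "0 < (1::real)"
    using pos by (simp_all add: fb_zero)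
  obtain C C' c P1 P' where 1: "change_pair V (\<delta> - \<delta> / 8) (3/2 * \<sigma> - 3 * \<sigma> / 16) (2 * (E / \<alpha>) / (3 * \<sigma> / 16)) (2 * (E / \<alpha>) / (\<delta> / 8)) C C'"
    and 2: "\<And>k. holo_fun_on (cdomain V \<delta> (3/2 * \<sigma>)) (c k)" "\<And>k. slow (cdomain V \<delta> (3/2 * \<sigma>)) (c k)"
    and 3: "\<And>z. z \<in> cdomain V \<delta> (3/2 * \<sigma>) \<Longrightarrow> P1 z = (\<Sum>k\<in>{k\<in>M. freq_norm k < int (r * K)}. c k z * fmode k z)"
    and 4: "fb V \<delta> (3/2 * \<sigma>) P1 E" "\<And>z. z \<in> cdomain V \<delta> (3/2 * \<sigma>) \<Longrightarrow> real_phase z \<Longrightarrow> P1 z \<in> \<real>"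
    and 5: "fb V (\<delta> - \<delta> / 8) (3/2 * \<sigma> - 3 * \<sigma> / 16) P' (exp (- real (r * K) * (3 * \<sigma> / 16)) * E + 5/4 * (2 * exp 1 * (E / \<alpha>) / (\<delta> / 8 * (3 * \<sigma> / 16))) * (0 + E)
     + 3/2 * (4 * \<mu> * (E / \<alpha>) / (3 * \<sigma> / 16) + 3/2 * 0 * (E / \<alpha>) * (1 / (\<delta> / 8 * 1) + 1 / (1 * (3 * \<sigma> / 16)))))"
    and 6: "\<And>z. z \<in> cdomain V (\<delta> - \<delta> / 8) (3/2 * \<sigma> - 3 * \<sigma> / 16) \<Longrightarrow> real_phase z \<Longrightarrow> P' z \<in> \<real>"
    and 7: "\<And>z. z \<in> cdomain V (\<delta> - \<delta> / 8) (3/2 * \<sigma> - 3 * \<sigma> / 16) \<Longrightarrow>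
       hh (C z) + of_real \<mu> * fst (snd (C z)) + (0 + 0) + P0 (C z) = hh z + of_real \<mu> * fst (snd z) + (0 + 0 + P1 z) + P' z"
  proof -
    show thesis by (rule normal_form_step[where ?Z1.0 = "\<lambda>z. 0" and ?Z2.0 = "\<lambda>z. 0" and ?z1.0 = 0 and ?z2.0 = 0 and ga = 1 and gs = 1
          and da = "\<delta> / 8" and ds = "3 * \<sigma> / 16" and a = \<delta> and s = "3/2 * \<sigma>" and hh = hh and P = P0 and p = E and M = M
          and N = "r * K" and \<alpha> = \<alpha> and \<mu> = \<mu> and V = V and Bh = Bh])
       (fact that hh nr pos M P0 zero sm)+
  qed
  have w: "\<delta> - \<delta> / 8 = act_width 0" "3/2 * \<sigma> - 3 * \<sigma> / 16 = ang_width 0" by (simp_all add: act_width_def ang_width_def)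
  have sub: "dom_at 0 \<subseteq> cdomain V \<delta> (3/2 * \<sigma>)" by (rule cdomain_mono) (use widths[of 0] pos in auto)
  have "reached P1 0 C C' c (\<lambda>z. 0) P'"
    unfolding reached_def
  proof (intro conjI allI ballI impI)
    have T': "2 * (E / \<alpha>) / (3 * \<sigma> / 16) = 32/3 * T * \<delta>" "2 * (E / \<alpha>) / (\<delta> / 8) = 16 * T * \<sigma>"
      using pos by (simp_all add: T_def)
    have t0: "shift_by 0 = 16 * T" by (simp add: shift_by_def)
    have "32/3 * T * \<delta> \<le> 16 * T * \<delta>" using nonneg pos by (intro mult_right_mono) auto
    then show "change_pair V ((13/16 - shift_by 0) * \<delta>) ((13/16 - shift_by 0) * \<sigma>) (shift_by 0 * \<delta>) (shift_by 0 * \<sigma>) C C'"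
      by (intro change_pair_mono[OF 1[unfolded w T']] core_widths) (simp_all add: t0)
    show "holo_fun_on (dom_at 0) (c k)" "slow (dom_at 0) (c k)" for k
      using holo_fun_subset[OF 2(1) sub] slow_subset[OF 2(2) sub] by blast+
    show "P1 z + 0 = (\<Sum>k\<in>{k\<in>M. freq_norm k < int (r * K)}. c k z * fmode k z)" if "z \<in> dom_at 0" for z
      unfolding 3[OF subsetD[OF sub that]] by simp
    show "fb V (act_width 0) (ang_width 0) (\<lambda>z. 0) (2 * (E / real r) * (1 - \<Delta> ^ 0))" by (rule fb_zero) simp
    show "fb V (act_width 0) (ang_width 0) P' (E / real r * \<Delta> ^ 0)"
      by (rule fb_mono[OF 5[unfolded w]]) (use first_bound in auto)
    show "P' z \<in> \<real>" if "z \<in> dom_at 0" "real_phase z" for z using 6 that unfolding w by blast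
    show "hh (C z) + of_real \<mu> * fst (snd (C z)) + P0 (C z) = hh z + of_real \<mu> * fst (snd z) + (P1 z + 0) + P' z"
      if "z \<in> cdomain V ((13/16 - shift_by 0) * \<delta>) ((13/16 - shift_by 0) * \<sigma>)" for z
      using 7[unfolded w, OF core_subset[OF _ that]] by simp
  qed simp
  then show ?thesis using 4 by blast
qed

lemma next_step:
  assumes Z1: "fb V \<delta> (3/2 * \<sigma>) Z1 E" "\<And>z. z \<in> cdomain V \<delta> (3/2 * \<sigma>) \<Longrightarrow> real_phase z \<Longrightarrow> Z1 z \<in> \<real>"
    and R: "reached Z1 j C C' c Z2 P" and j: "Suc j < r"
  shows "\<exists>C C' c Z2 P. reached Z1 (Suc j) C C' c Z2 P"
proof -
  note D = reachedD[OF R]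
  define p where "p = E / real r * \<Delta> ^ j"
  define z2 where "z2 = 2 * (E / real r) * (1 - \<Delta> ^ j)"
  let ?da = "\<delta> / (16 * real r)" and ?ds = "\<sigma> / (2 * real r)"
  have r: "0 < real r" "1 \<le> real r" using pos(6) by auto
  have jr: "j \<le> r" "Suc j \<le> r" using j by auto
  have sub: "dom_at j \<subseteq> cdomain V \<delta> (3/2 * \<sigma>)" by (rule cdomain_mono) (use widths[OF jr(1)] pos in auto)
  have Er: "0 \<le> E / real r" using E by simp
  have p0: "0 \<le> p" unfolding p_def by (rule mult_nonneg_nonneg[OF Er \<Delta>_power(1)])
  have z2p: "z2 + p \<le> 2 * (E / real r)" using p0 by (simp add: z2_def p_def algebra_simps)
  have pT: "p / \<alpha> = \<delta> * \<sigma> * (T * \<Delta> ^ j / real r)" using pos by (simp add: p_def T_def)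
  have sm: "32 * (p / \<alpha>) \<le> ?da * ?ds"
  proof -
    have "T * \<Delta> ^ j \<le> T * 1" using nonneg \<Delta>_power[of j] by (intro mult_left_mono) auto
    then have "real r * (T * \<Delta> ^ j) \<le> real r * T" using r by simp
    then have "32 * (real r * (T * \<Delta> ^ j)) \<le> 1/32" using T_small(1) by linarith
    then have "32 * (T * \<Delta> ^ j / real r) \<le> 1 / (32 * (real r * real r))" using r by (simp add: field_simps)
    then have "\<delta> * \<sigma> * (32 * (T * \<Delta> ^ j / real r)) \<le> \<delta> * \<sigma> * (1 / (32 * (real r * real r)))" using pos by (intro mult_left_mono) auto
    then show ?thesis unfolding pT by simp
  qed
  have ds: "?ds \<le> ang_width j"
  proof -
    have "?ds \<le> \<sigma> / 2" using r pos by (simp add: field_simps)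
    then show ?thesis using widths(3)[OF jr(1)] pos by simp
  qed
  have Z1': "fb V (act_width j + \<delta> / 8) (ang_width j + 3 * \<sigma> / 16) Z1 E"
    by (rule fb_mono[OF Z1(1)]) (use widths[OF jr(1)] in auto)
  have local: "holo_fun_on (dom_at j) hh" "slow (dom_at j) hh" "\<And>z. z \<in> dom_at j \<Longrightarrow> cmod (hh z) \<le> Bh"
    "\<And>z. z \<in> dom_at j \<Longrightarrow> real_phase z \<Longrightarrow> hh z \<in> \<real>" "\<And>z. z \<in> dom_at j \<Longrightarrow> real_phase z \<Longrightarrow> Z1 z \<in> \<real>"
    "\<And>k z. k \<notin> M \<Longrightarrow> freq_norm k < int (r * K) \<Longrightarrow> z \<in> dom_at j \<Longrightarrow> \<alpha> < cmod (dd hh z (kvec k))"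
    "0 < ?da" "0 < ?ds" "0 < \<delta> / 8" "0 < 3 * \<sigma> / 16"
    using holo_fun_subset[OF hh(1) sub] slow_subset[OF hh(2) sub] hh(3,4) Z1(2) nr subsetD[OF sub] pos r by (blast | simp)+
  obtain C2 C2' c2 P1 P' where
      1: "change_pair V (act_width j - ?da) (ang_width j - ?ds) (2 * (p / \<alpha>) / ?ds) (2 * (p / \<alpha>) / ?da) C2 C2'"
    and 2: "\<And>k. holo_fun_on (dom_at j) (c2 k)" "\<And>k. slow (dom_at j) (c2 k)"
    and 3: "\<And>z. z \<in> dom_at j \<Longrightarrow> P1 z = (\<Sum>k\<in>{k\<in>M. freq_norm k < int (r * K)}. c2 k z * fmode k z)"
    and 4: "fb V (act_width j) (ang_width j) P1 p" "\<And>z. z \<in> dom_at j \<Longrightarrow> real_phase z \<Longrightarrow> P1 z \<in> \<real>"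
    and 5: "fb V (act_width j - ?da) (ang_width j - ?ds) P' (exp (- real (r * K) * ?ds) * p + 5/4 * (2 * exp 1 * (p / \<alpha>) / (?da * ?ds)) * (z2 + p)
     + 3/2 * (4 * \<mu> * (p / \<alpha>) / ?ds + 3/2 * E * (p / \<alpha>) * (1 / (?da * (3 * \<sigma> / 16)) + 1 / (\<delta> / 8 * ?ds))))"
    and 6: "\<And>z. z \<in> cdomain V (act_width j - ?da) (ang_width j - ?ds) \<Longrightarrow> real_phase z \<Longrightarrow> P' z \<in> \<real>"
    and 7: "\<And>z. z \<in> cdomain V (act_width j - ?da) (ang_width j - ?ds) \<Longrightarrow>
       hh (C2 z) + of_real \<mu> * fst (snd (C2 z)) + (Z1 (C2 z) + Z2 (C2 z)) + P (C2 z) = hh z + of_real \<mu> * fst (snd z) + (Z1 z + Z2 z + P1 z) + P' z"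
  proof -
    show thesis by (rule normal_form_step[where ?Z1.0 = Z1 and ?Z2.0 = Z2 and ?z1.0 = E and ?z2.0 = z2 and ga = "\<delta> / 8" and gs = "3 * \<sigma> / 16"
          and da = ?da and ds = ?ds and a = "act_width j" and s = "ang_width j" and hh = hh and P = P and p = p and M = M
          and N = "r * K" and \<alpha> = \<alpha> and \<mu> = \<mu> and V = V and Bh = Bh])
       (fact that local pos M Z1' D(5-8)[folded p_def z2_def] sm ds)+
  qed
  have w: "act_width j - ?da = act_width (Suc j)" "ang_width j - ?ds = ang_width (Suc j)"
    by (simp_all add: act_width_def ang_width_def algebra_simps add_divide_distrib)
  have sub': "dom_at (Suc j) \<subseteq> dom_at j" unfolding w[symmetric] by (rule cdomain_mono) (use pos in auto)
  define \<tau> where "\<tau> = 32 * T * \<Delta> ^ j"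
  have \<tau>0: "0 \<le> \<tau>" using nonneg \<Delta>_power[of j] by (simp add: \<tau>_def)
  have two: "change_pair V (act_width (Suc j)) (ang_width (Suc j)) (\<tau> * \<delta>) (\<tau> * \<sigma>) C2 C2'"
  proof (rule change_pair_mono[OF 1[unfolded w] order_refl order_refl])
    have "2 * (p / \<alpha>) / ?ds = 4 * T * \<Delta> ^ j * \<delta>" "2 * (p / \<alpha>) / ?da = \<tau> * \<sigma>" unfolding pT \<tau>_def using pos r by simp_all
    moreover have "4 * T * \<Delta> ^ j * \<delta> \<le> \<tau> * \<delta>"
      using nonneg \<Delta>_power[of j] pos by (auto simp: \<tau>_def intro!: mult_right_mono)
    ultimately show "2 * (p / \<alpha>) / ?ds \<le> \<tau> * \<delta>" "2 * (p / \<alpha>) / ?da \<le> \<tau> * \<sigma>" by simp_all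
  qed
  let ?t = "shift_by j" and ?t' = "shift_by (Suc j)"
  have tt: "?t + \<tau> \<le> ?t'" using shift_bounds(4)[of j] by (simp add: \<tau>_def)
  have le: "(13/16 - ?t') * d + \<tau> * d \<le> (13/16 - ?t) * d" "?t * d + \<tau> * d \<le> ?t' * d" "(13/16 - ?t') * d + ?t * d \<le> 13/16 * d" if "0 < d" for d
  proof -
    have "(?t + \<tau>) * d \<le> ?t' * d" "?t * d \<le> ?t' * d" using tt \<tau>0 that by (intro mult_right_mono; simp)+
    then show "(13/16 - ?t') * d + \<tau> * d \<le> (13/16 - ?t) * d" "?t * d + \<tau> * d \<le> ?t' * d" "(13/16 - ?t') * d + ?t * d \<le> 13/16 * d"
      by (simp_all add: algebra_simps)
  qed
  note ws = widths[OF jr(2)]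
  have comp: "change_pair V ((13/16 - ?t') * \<delta>) ((13/16 - ?t') * \<sigma>) (?t * \<delta> + \<tau> * \<delta>) (?t * \<sigma> + \<tau> * \<sigma>) (\<lambda>z. C (C2 z)) (\<lambda>z. C2' (C' z))"
    by (rule change_pair_compose[OF D(1) two])
       (use le[OF pos(1)] le[OF pos(3)] ws shift_bounds(1)[of j] \<tau>0 pos in \<open>auto intro: order_trans\<close>)
  have "reached Z1 (Suc j) (\<lambda>z. C (C2 z)) (\<lambda>z. C2' (C' z)) (\<lambda>k z. c k z + c2 k z) (\<lambda>z. Z2 z + P1 z) P'"
    unfolding reached_def
  proof (intro conjI allI ballI impI)
    show "change_pair V ((13/16 - ?t') * \<delta>) ((13/16 - ?t') * \<sigma>) (?t' * \<delta>) (?t' * \<sigma>) (\<lambda>z. C (C2 z)) (\<lambda>z. C2' (C' z))"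
      by (rule change_pair_mono[OF comp]) (use le[OF pos(1)] le[OF pos(3)] in auto)
    show "holo_fun_on (dom_at (Suc j)) (\<lambda>z. c k z + c2 k z)" for k
      by (rule holo_add(1)[OF holo_fun_subset[OF D(2) sub'] holo_fun_subset[OF 2(1) sub']])
    show "slow (dom_at (Suc j)) (\<lambda>z. c k z + c2 k z)" for k
      using slow_subset[OF D(3) sub', of k] slow_subset[OF 2(2) sub', of k] by (simp add: slow_def)
    show "Z1 z + (Z2 z + P1 z) = (\<Sum>k\<in>{k\<in>M. freq_norm k < int (r * K)}. (c k z + c2 k z) * fmode k z)" if "z \<in> dom_at (Suc j)" for z
    proof -
      have z: "z \<in> dom_at j" using that sub' by blast
      have "Z1 z + (Z2 z + P1 z) = (Z1 z + Z2 z) + P1 z" by simp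
      then show ?thesis unfolding D(4)[OF z] 3[OF z] by (simp add: distrib_right sum.distrib)
    qed
    show "fb V (act_width (Suc j)) (ang_width (Suc j)) (\<lambda>z. Z2 z + P1 z) (2 * (E / real r) * (1 - \<Delta> ^ Suc j))"
    proof (rule fb_mono[OF fb_add[OF D(5) 4(1)]])
      have "E / real r * (2 * \<Delta> ^ Suc j) \<le> E / real r * \<Delta> ^ j" by (rule mult_left_mono[OF \<Delta>_power(3) Er])
      then show "2 * (E / real r) * (1 - \<Delta> ^ j) + p \<le> 2 * (E / real r) * (1 - \<Delta> ^ Suc j)" by (simp add: p_def algebra_simps)
    qed (use pos in \<open>simp_all flip: w\<close>)
    show "Z2 z + P1 z \<in> \<real>" if "z \<in> dom_at (Suc j)" "real_phase z" for z
      using D(6) 4(2) sub' that by (intro Reals_add) blast+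
    show "fb V (act_width (Suc j)) (ang_width (Suc j)) P' (E / real r * \<Delta> ^ Suc j)"
    proof (rule fb_mono[OF 5[unfolded w] order_refl order_refl order_trans[OF next_bound[OF p0 z2p]]])
      show "\<Delta> * p \<le> E / real r * \<Delta> ^ Suc j" by (simp add: p_def mult_ac)
    qed
    show "P' z \<in> \<real>" if "z \<in> dom_at (Suc j)" "real_phase z" for z using 6 that unfolding w by blast
    fix z assume z: "z \<in> cdomain V ((13/16 - ?t') * \<delta>) ((13/16 - ?t') * \<sigma>)"
    have zS: "z \<in> dom_at (Suc j)" by (rule core_subset[OF jr(2) z])
    have "C2 z \<in> cdomain V ((13/16 - ?t') * \<delta> + \<tau> * \<delta>) ((13/16 - ?t') * \<sigma> + \<tau> * \<sigma>)"
      by (rule change_pair_image(1)[OF two z]) (rule core_widths[OF jr(2)])+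
    then have C2: "C2 z \<in> cdomain V ((13/16 - ?t) * \<delta>) ((13/16 - ?t) * \<sigma>)"
      by (rule cdomain_monoD) (use le(1)[OF pos(1)] le(1)[OF pos(3)] in auto)
    show "hh (C (C2 z)) + of_real \<mu> * fst (snd (C (C2 z))) + P0 (C (C2 z)) = hh z + of_real \<mu> * fst (snd z) + (Z1 z + (Z2 z + P1 z)) + P' z"
      using D(9)[OF C2] 7[unfolded w, OF zS] by (simp add: add.assoc)
  qed
  then show ?thesis by blast
qed

theorem normal_form:
  "\<exists>C C' c P. change_pair V (3/4 * \<delta>) (3/4 * \<sigma>) (80 * T * \<delta>) (80 * T * \<sigma>) C C' \<and> 0 \<le> 80 * T \<and> 80 * T \<le> 1/16 \<and>
     (\<forall>k. holo_fun_on (cdomain V (3/4 * \<delta>) (3/4 * \<sigma>)) (c k)) \<and> (\<forall>k. slow (cdomain V (3/4 * \<delta>) (3/4 * \<sigma>)) (c k)) \<and>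
     fb V (3/4 * \<delta>) (3/4 * \<sigma>) P (E / real r * \<Delta> ^ (r - 1)) \<and>
     (\<forall>z\<in>cdomain V (3/4 * \<delta>) (3/4 * \<sigma>). hh (C z) + of_real \<mu> * fst (snd (C z)) + P0 (C z)
        = hh z + of_real \<mu> * fst (snd z) + (\<Sum>k\<in>{k\<in>M. freq_norm k < int (r * K)}. c k z * fmode k z) + P z)"
proof -
  obtain Z1 C C' c P where Z1: "fb V \<delta> (3/2 * \<sigma>) Z1 E" "\<And>z. z \<in> cdomain V \<delta> (3/2 * \<sigma>) \<Longrightarrow> real_phase z \<Longrightarrow> Z1 z \<in> \<real>"
    and 0: "reached Z1 0 C C' c (\<lambda>z. 0) P" using first_step by blast
  have "\<exists>C C' c Z2 P. reached Z1 j C C' c Z2 P" if "j < r" for j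
    using that
  proof (induction j)
    case 0 then show ?case using \<open>reached Z1 0 C C' c (\<lambda>z. 0) P\<close> by blast
  next
    case (Suc j)
    then obtain C C' c Z2 P where "reached Z1 j C C' c Z2 P" by auto
    from next_step[OF Z1 this Suc.prems] show ?case .
  qed
  then obtain C C' c Z2 P where R: "reached Z1 (r - 1) C C' c Z2 P" using pos(6) by (metis One_nat_def diff_less less_le_trans zero_less_one)
  note D = reachedD[OF R]
  let ?t = "shift_by (r - 1)"
  have le: "3/4 * d \<le> (13/16 - ?t) * d" "?t * d \<le> 80 * T * d" "3/4 * d \<le> 13/16 * d" if "0 < d" for d
    using that shift_bounds(2,3)[of "r - 1"] by (intro mult_right_mono; simp)+
  have core: "cdomain V (3/4 * \<delta>) (3/4 * \<sigma>) \<subseteq> cdomain V ((13/16 - ?t) * \<delta>) ((13/16 - ?t) * \<sigma>)"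
    by (intro cdomain_mono le pos)
  have sub: "cdomain V (3/4 * \<delta>) (3/4 * \<sigma>) \<subseteq> dom_at (r - 1)"
    using core core_subset[of "r - 1"] by fastforce
  have w: "3/4 * \<delta> \<le> act_width (r - 1)" "3/4 * \<sigma> \<le> ang_width (r - 1)"
    using widths[of "r - 1"] le(3)[OF pos(1)] le(3)[OF pos(3)] by auto
  show ?thesis
  proof (intro exI conjI allI ballI)
    show "change_pair V (3/4 * \<delta>) (3/4 * \<sigma>) (80 * T * \<delta>) (80 * T * \<sigma>) C C'"
      by (intro change_pair_mono[OF D(1)] le pos)
    show "0 \<le> 80 * T" "80 * T \<le> 1/16" using nonneg T_small(2) by simp_all
    show "holo_fun_on (cdomain V (3/4 * \<delta>) (3/4 * \<sigma>)) (c k)" for k by (rule holo_fun_subset[OF D(2) sub])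
    show "slow (cdomain V (3/4 * \<delta>) (3/4 * \<sigma>)) (c k)" for k by (rule slow_subset[OF D(3) sub])
    show "fb V (3/4 * \<delta>) (3/4 * \<sigma>) P (E / real r * \<Delta> ^ (r - 1))" by (rule fb_mono[OF D(7) w order_refl])
    show "hh (C z) + of_real \<mu> * fst (snd (C z)) + P0 (C z)
        = hh z + of_real \<mu> * fst (snd z) + (\<Sum>k\<in>{k\<in>M. freq_norm k < int (r * K)}. c k z * fmode k z) + P z"
      if "z \<in> cdomain V (3/4 * \<delta>) (3/4 * \<sigma>)" for z
      using D(9)[OF subsetD[OF core that]] D(4)[OF subsetD[OF sub that]] by simp
  qed
qed

end

section \<open>The resonant normal form theorem\<close>

lemma freq_pair_frequency:
  assumes h: "holo_fun_on S (\<lambda>z. h (fst z))" and z: "z \<in> S"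
  shows "freq_pair (frequency h (fst z)) k = dd (\<lambda>z. h (fst z)) z (kvec k)"
proof -
  have "frequency h (fst z) $ j = dd (\<lambda>z. h (fst z)) z (dirI j)" for j
  proof -
    have 0: "z + cscale 0 (dirI j) = z" by (rule phase_eqI) simp_all
    have 1: "fst (z + cscale t (dirI j)) = fst z + axis j t" for t
      by (simp add: vec_eq_iff axis_def)
    have "((\<lambda>t. h (fst (z + cscale t (dirI j)))) has_field_derivative dd (\<lambda>z. h (fst z)) (z + cscale 0 (dirI j)) (dirI j)) (at 0)"
      by (rule holo_line[OF h]) (simp only: 0 z)
    then have "((\<lambda>t. h (fst z + axis j t)) has_field_derivative dd (\<lambda>z. h (fst z)) z (dirI j)) (at 0)"
      unfolding 0 1 .
    then show ?thesis by (simp add: frequency_def DERIV_imp_deriv)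
  qed
  then have "freq_pair (frequency h (fst z)) k = (\<Sum>j\<in>UNIV. of_int (k $ j) * dd (\<lambda>z. h (fst z)) z (dirI j))"
    by (simp add: freq_pair_def mult.commute)
  also have "\<dots> = (\<Sum>j\<in>UNIV. dd (\<lambda>z. h (fst z)) z (cscale (of_int (k $ j)) (dirI j)))"
    by (rule sum.cong[OF refl]) (rule holo_derivD(2)[OF h z, symmetric])
  also have "\<dots> = dd (\<lambda>z. h (fst z)) z (kvec k)" unfolding kvec_sum holo_linear(6)[OF h z] by simp
  finally show ?thesis .
qed

text \<open>The real span is closed under negation.\<close>

lemma resonance_module_uminus:
  assumes "resonance_module M" shows "- k \<in> M \<longleftrightarrow> k \<in> M"
proof -
  have "- k \<in> M" if "k \<in> M" for k
  proof -
    have "- int_rvec k \<in> span (int_rvec ` M)" using that by (intro span_neg span_base) simp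
    moreover have "- int_rvec k = int_rvec (- k)" by (simp add: int_rvec_def vec_eq_iff)
    ultimately have "int_rvec (- k) \<in> int_rvec ` M" using assms unfolding resonance_module_def by auto
    moreover have "inj (int_rvec :: int^'a \<Rightarrow> _)" by (simp add: inj_def int_rvec_def vec_eq_iff)
    ultimately show ?thesis by (simp add: inj_image_mem_iff)
  qed
  from this[of k] this[of "- k"] show ?thesis by auto
qed

text \<open>The coefficients and the modes do not involve \<open>\<eta>\<close>.\<close>

lemma fb_eta_free:
  assumes "fb V a s F B" "z \<in> cdomain V a s"
  shows "F (fst z, 0, snd (snd z)) = F z"
proof -
  obtain c b where f: "fser V a s F c b B" using assms by (auto simp: fb_def)
  let ?z = "(fst z, 0, snd (snd z))"
  have z': "?z \<in> cdomain V a s" using assms(2) cdomain_pos[OF assms(2)] by (simp add: mem_cdomain)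
  have "c k ?z = c k z" for k
  proof -
    have "slow_part ?z = slow_part z" by (simp add: slow_part_def)
    then show ?thesis
      using bspec[OF fserD(2)[OF f, unfolded slow_def] z', of k] bspec[OF fserD(2)[OF f, unfolded slow_def] assms(2), of k] by simp
  qed
  then have "((\<lambda>k. c k z * fmode k z) has_sum F ?z) UNIV"
    using fserD(7)[OF f z'] by (simp add: fmode_def)
  then show ?thesis by (rule has_sum_unique[OF _ fserD(7)[OF f assms(2)]])
qed

text \<open>Points move by at most a sixteenth of the widths, and the gaps between the three domains are an eighth.\<close>

lemma change_pair_inclusions:
  assumes C: "change_pair V (3/4 * \<delta>) (3/4 * \<sigma>) (t * \<delta>) (t * \<sigma>) C C'" and t: "0 \<le> t" "t \<le> 1/16" and pos: "0 < \<delta>" "0 < \<sigma>"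
  shows "inverse_changes_on (cdomain V (3/4 * \<delta>) (3/4 * \<sigma>)) C C'"
    "cdomain V (5/8 * \<delta>) (5/8 * \<sigma>) \<subseteq> C ` cdomain V (3/4 * \<delta>) (3/4 * \<sigma>)"
    "C ` cdomain V (3/4 * \<delta>) (3/4 * \<sigma>) \<subseteq> cdomain V (7/8 * \<delta>) (7/8 * \<sigma>)"
    "cdomain V (5/8 * \<delta>) (5/8 * \<sigma>) \<subseteq> C' ` cdomain V (3/4 * \<delta>) (3/4 * \<sigma>)"
    "C' ` cdomain V (3/4 * \<delta>) (3/4 * \<sigma>) \<subseteq> cdomain V (7/8 * \<delta>) (7/8 * \<sigma>)"
proof -
  let ?D = "\<lambda>c. cdomain V (c * \<delta>) (c * \<sigma>)"
  have im: "C z \<in> ?D c'" "C' z \<in> ?D c'" if "z \<in> ?D c" "c \<le> 3/4" "c + 1/16 \<le> c'" for z c c'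
  proof -
    have le: "c * d \<le> 3/4 * d" "c * d + t * d \<le> c' * d" if "0 < d" for d
      using \<open>c \<le> 3/4\<close> \<open>c + 1/16 \<le> c'\<close> t \<open>0 < d\<close> by (simp_all add: mult_right_mono flip: distrib_right)
    note m = cdomain_monoD[OF _ le(2)[OF pos(1)] le(2)[OF pos(2)]]
    show "C z \<in> ?D c'" "C' z \<in> ?D c'"
      by (rule m, rule change_pair_image[OF C that(1) le(1)[OF pos(1)] le(1)[OF pos(2)]])+
  qed
  have sub: "z \<in> ?D (3/4)" if "z \<in> ?D (5/8)" for z using cdomain_monoD[OF that] pos by simp
  show "inverse_changes_on (?D (3/4)) C C'"
    unfolding inverse_changes_on_def using C change_pairD(3,4)[OF C] by (simp add: change_pair_def)
  have "z \<in> C ` ?D (3/4) \<and> z \<in> C' ` ?D (3/4)" if z: "z \<in> ?D (5/8)" for z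
  proof -
    have "C z \<in> ?D (3/4)" "C' z \<in> ?D (3/4)" by (rule im[OF z]; simp)+
    then show ?thesis using change_pairD(3,4)[OF C sub[OF z]] by (metis imageI)
  qed
  then show "?D (5/8) \<subseteq> C ` ?D (3/4)" "?D (5/8) \<subseteq> C' ` ?D (3/4)" by blast+
  show "C ` ?D (3/4) \<subseteq> ?D (7/8)" "C' ` ?D (3/4) \<subseteq> ?D (7/8)"
    by (rule image_subsetI, rule im[of _ "3/4"]; simp)+
qed

theorem theorem3p3:
  fixes G V :: "(real^'n) set"
    and h :: "complex^'n \<Rightarrow> complex"
    and f :: "complex^'n \<Rightarrow> complex^'n \<Rightarrow> complex \<Rightarrow> complex"
    and M :: "(int^'n) set"
    and \<delta> \<sigma> \<mu> \<alpha> C\<^sub>f F\<^sub>t :: real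
    and \<Delta> :: "real \<Rightarrow> real"
    and r K N :: nat
    and D :: "real \<Rightarrow> 'n phase set"
  assumes "open G"
    and "0 < \<delta>" "\<delta> \<le> 1" "0 < \<sigma>" "\<sigma> \<le> 1" "0 < \<mu>" "0 < \<alpha>" "1 \<le> r" "1 \<le> K"
    and "holo_fun_on (cdomain G \<delta> (2 * \<sigma>)) (\<lambda>(I, \<eta>, \<phi>, \<xi>). h I)"
    and "holo_fun_on (cdomain G \<delta> (2 * \<sigma>)) (\<lambda>(I, \<eta>, \<phi>, \<xi>). f I \<phi> \<xi>)"
    and "bounded ((\<lambda>(I, \<eta>, \<phi>, \<xi>). h I) ` cdomain G \<delta> (2 * \<sigma>))"
    and "bounded ((\<lambda>(I, \<eta>, \<phi>, \<xi>). f I \<phi> \<xi>) ` cdomain G \<delta> (2 * \<sigma>))"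
    and "angle_periodic_on (cdomain G \<delta> (2 * \<sigma>)) (\<lambda>(I, \<eta>, \<phi>, \<xi>). f I \<phi> \<xi>)"
    and "\<forall>(I, \<eta>, \<phi>, \<xi>) \<in> cdomain G \<delta> (2 * \<sigma>).
           real_phase (I, \<eta>, \<phi>, \<xi>) \<longrightarrow> h I \<in> \<real> \<and> f I \<phi> \<xi> \<in> \<real>"
    and "C\<^sub>f = (SUP (I, \<eta>, \<phi>, \<xi>) \<in> cdomain G \<delta> (2 * \<sigma>). cmod (f I \<phi> \<xi>))"
    and "F\<^sub>t = C\<^sub>f * ((1 + exp (- \<sigma> / 2)) / (1 - exp (- \<sigma> / 2))) ^ CARD('n)"
    and "\<And>\<epsilon>. \<Delta> \<epsilon> = 2 ^ 8 * real r / (\<alpha> * \<delta> * \<sigma>) * (\<mu> + exp 1 * F\<^sub>t * \<epsilon>)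
                     + 4 * exp (- real K * \<sigma> / 2)"
    and "resonance_module M"
    and "N = r * K"
    and "nonresonance_domain h G V M \<alpha> \<delta> N"
    and "exp (- real K * \<sigma> / 2) \<ge> 1 / (8 + 3 * (exp 1)\<^sup>2)"
    and "\<And>c. D c = cdomain V (c * \<delta>) (c * \<sigma>)"
  shows "\<exists>(C :: real \<Rightarrow> 'n phase \<Rightarrow> 'n phase) (C' :: real \<Rightarrow> 'n phase \<Rightarrow> 'n phase).
    (\<forall>\<epsilon>>0. \<Delta> \<epsilon> \<le> 1/2 \<longrightarrow>
       inverse_changes_on (D (3/4)) (C \<epsilon>) (C' \<epsilon>) \<and>
       D (5/8) \<subseteq> C \<epsilon> ` D (3/4) \<and> C \<epsilon> ` D (3/4) \<subseteq> D (7/8) \<and>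
       D (5/8) \<subseteq> C' \<epsilon> ` D (3/4) \<and> C' \<epsilon> ` D (3/4) \<subseteq> D (7/8) \<and>
       (\<exists>(zc :: int^'n \<Rightarrow> complex^'n \<Rightarrow> complex \<Rightarrow> complex)
          (R :: complex^'n \<Rightarrow> complex^'n \<Rightarrow> complex \<Rightarrow> complex).
          (\<forall>k. holo_fun_on (D (3/4)) (\<lambda>(I, \<eta>, \<phi>, \<xi>). zc k I \<xi>)) \<and>
          holo_fun_on (D (3/4)) (\<lambda>(I, \<eta>, \<phi>, \<xi>). R I \<phi> \<xi>) \<and>
          angle_periodic_on (D (3/4)) (\<lambda>(I, \<eta>, \<phi>, \<xi>). R I \<phi> \<xi>) \<and>
          (\<forall>(I, \<eta>, \<phi>, \<xi>) \<in> D (3/4).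
             hamiltonian h f \<mu> \<epsilon> (C \<epsilon> (I, \<eta>, \<phi>, \<xi>)) =
               h I + of_real \<mu> * \<eta>
               + (\<Sum>k\<in>{k \<in> M. freq_norm k \<le> int N}. zc k I \<xi> * fourier_mode k \<phi>)
               + R I \<phi> \<xi>) \<and>
          fourier_norm V (3/4 * \<delta>) (3/4 * \<sigma>) R \<le> ennreal (8 * \<epsilon> * F\<^sub>t * \<Delta> \<epsilon> ^ r))) \<and>
    (\<exists>B. \<forall>\<^sub>F \<epsilon> in at_right 0. \<Delta> \<epsilon> \<le> 1/2 \<longrightarrow> (\<forall>z\<in>D (3/4). norm (C \<epsilon> z - z) \<le> B * \<epsilon>))"
proof -
  define hh :: "'n phase \<Rightarrow> complex" where "hh = (\<lambda>z. h (fst z))"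
  define ff :: "'n phase \<Rightarrow> complex" where "ff = (\<lambda>z. f (fst z) (fst (snd (snd z))) (snd (snd (snd z))))"
  have hh: "(\<lambda>(I, \<eta>, \<phi>, \<xi>). h I) = hh" and ff: "(\<lambda>(I, \<eta>, \<phi>, \<xi>). f I \<phi> \<xi>) = ff"
    by (simp_all add: hh_def ff_def fun_eq_iff split: prod.splits)
  define Q where "Q = (\<lambda>\<epsilon> C C'.
       inverse_changes_on (D (3/4)) C C' \<and>
       D (5/8) \<subseteq> C ` D (3/4) \<and> C ` D (3/4) \<subseteq> D (7/8) \<and>
       D (5/8) \<subseteq> C' ` D (3/4) \<and> C' ` D (3/4) \<subseteq> D (7/8) \<and>
       (\<exists>(zc :: int^'n \<Rightarrow> complex^'n \<Rightarrow> complex \<Rightarrow> complex)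
          (R :: complex^'n \<Rightarrow> complex^'n \<Rightarrow> complex \<Rightarrow> complex).
          (\<forall>k. holo_fun_on (D (3/4)) (\<lambda>(I, \<eta>, \<phi>, \<xi>). zc k I \<xi>)) \<and>
          holo_fun_on (D (3/4)) (\<lambda>(I, \<eta>, \<phi>, \<xi>). R I \<phi> \<xi>) \<and>
          angle_periodic_on (D (3/4)) (\<lambda>(I, \<eta>, \<phi>, \<xi>). R I \<phi> \<xi>) \<and>
          (\<forall>(I, \<eta>, \<phi>, \<xi>) \<in> D (3/4).
             hamiltonian h f \<mu> \<epsilon> (C (I, \<eta>, \<phi>, \<xi>)) =
               h I + of_real \<mu> * \<eta>
               + (\<Sum>k\<in>{k \<in> M. freq_norm k \<le> int N}. zc k I \<xi> * fourier_mode k \<phi>)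
               + R I \<phi> \<xi>) \<and>
          fourier_norm V (3/4 * \<delta>) (3/4 * \<sigma>) R \<le> ennreal (8 * \<epsilon> * F\<^sub>t * \<Delta> \<epsilon> ^ r)))"
  have "\<exists>B. \<forall>\<epsilon>>0. \<Delta> \<epsilon> \<le> 1/2 \<longrightarrow> (\<exists>C C'. Q \<epsilon> C C' \<and> (\<forall>z\<in>D (3/4). norm (C z - z) \<le> B * \<epsilon>))"
  proof (cases "V = {}")
    case True
    then have D: "D c = {}" for c using assms(23)[of c] by (simp add: cdomain_def cnbhd_def)
    have e: "cdomain V a s = {}" for a s using True by (simp add: cdomain_def cnbhd_def)
    have fn: "fourier_norm V a s R = 0" for a s R by (simp add: fourier_norm_def e bot_ennreal)
    have inv: "inverse_changes_on {} (\<lambda>z. z) (\<lambda>z. z :: 'n phase)"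
      by (simp add: inverse_changes_on_def symplectic_change_on_def holo_map_on_def symplectic_on_def)
    have "Q \<epsilon> (\<lambda>z. z) (\<lambda>z. z)" for \<epsilon>
      unfolding Q_def D fn using inv by (simp add: holo_fun_on_def angle_periodic_on_def)
    then show ?thesis unfolding D by blast
  next
    case False
    then obtain I0 where I0: "I0 \<in> V" by blast
    have VG: "V \<subseteq> G" using assms(21) by (simp add: nonresonance_domain_def)
    have subG: "cdomain V \<delta> (2 * \<sigma>) \<subseteq> cdomain G \<delta> (2 * \<sigma>)"
      using VG unfolding cdomain_def cnbhd_def by blast
    have sub: "cdomain V \<delta> (3/2 * \<sigma>) \<subseteq> cdomain V \<delta> (2 * \<sigma>)" by (rule cdomain_mono) (use assms(4) in auto)
    have mem: "z \<in> cdomain G \<delta> (2 * \<sigma>)" if "z \<in> cdomain V \<delta> (3/2 * \<sigma>)" for z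
      using subsetD[OF subG subsetD[OF sub that]] .
    have fbd: "cmod (ff z) \<le> C\<^sub>f" if "z \<in> cdomain G \<delta> (2 * \<sigma>)" for z
    proof -
      have C: "C\<^sub>f = (SUP z\<in>cdomain G \<delta> (2 * \<sigma>). cmod (ff z))"
        unfolding assms(16) by (rule SUP_cong) (auto simp: ff_def)
      obtain b where "\<And>z. z \<in> cdomain G \<delta> (2 * \<sigma>) \<Longrightarrow> cmod (ff z) \<le> b"
        using assms(13) unfolding ff bounded_iff by blast
      then have "bdd_above ((\<lambda>z. cmod (ff z)) ` cdomain G \<delta> (2 * \<sigma>))" by (rule bdd_aboveI2)
      from cSUP_upper[OF that this] show ?thesis unfolding C .
    qed
    \<comment> \<open>the supremum defining \<open>C\<^sub>f\<close> is taken over a nonempty set, hence nonnegative\<close>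
    have "(cvec I0, 0, 0, 0) \<in> cdomain V \<delta> (2 * \<sigma>)" using assms(2,4) by (auto simp: mem_cdomain mem_cnbhd intro!: bexI[OF _ I0])
    from fbd[OF subsetD[OF subG this]] have Cf: "0 \<le> C\<^sub>f" by (meson norm_ge_zero order_trans)
    have AF: "angle_fun V \<delta> (2 * \<sigma>) C\<^sub>f ff"
      unfolding angle_fun_def
    proof (intro conjI ballI allI)
      show "holo_fun_on (cdomain V \<delta> (2 * \<sigma>)) ff" using holo_fun_subset[OF assms(11) subG] unfolding ff .
      fix z assume z: "z \<in> cdomain V \<delta> (2 * \<sigma>)"
      then have z': "z \<in> cdomain G \<delta> (2 * \<sigma>)" using subG by blast
      show "cmod (ff z) \<le> C\<^sub>f" by (rule fbd[OF z'])
      show "ff (shift_angle j z) = ff z" for j using assms(14) z' unfolding ff angle_periodic_on_def by blast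
    qed (simp add: ff_def)
    have "2 * \<sigma> - 3/2 * \<sigma> = \<sigma> / 2" by simp
    with fb_of_bounded[OF AF _ _ Cf, of "3/2 * \<sigma>"] have fbf: "fb V \<delta> (3/2 * \<sigma>) ff F\<^sub>t"
      using assms(4) by (simp add: assms(17))
    obtain Bh where Bh: "\<And>z. z \<in> cdomain G \<delta> (2 * \<sigma>) \<Longrightarrow> cmod (hh z) \<le> Bh"
      using assms(12) unfolding hh bounded_iff by blast
    have realG: "hh z \<in> \<real>" "ff z \<in> \<real>" if "z \<in> cdomain G \<delta> (2 * \<sigma>)" "real_phase z" for z
      using bspec[OF assms(15) that(1)] that(2) by (auto simp: hh_def ff_def split: prod.splits)
    define B where "B = (real CARD('n) + 1) * (80 * F\<^sub>t / (\<alpha> * \<delta> * \<sigma>) * (\<delta> + \<sigma>))"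
    show ?thesis
    proof (intro exI[of _ B] allI impI)
      fix \<epsilon> :: real assume eps: "0 < \<epsilon>" and Deps: "\<Delta> \<epsilon> \<le> 1/2"
      have D\<epsilon>: "2 ^ 8 * real r / (\<alpha> * \<delta> * \<sigma>) * (\<mu> + exp 1 * (\<epsilon> * F\<^sub>t)) + 4 * exp (- real K * \<sigma> / 2) = \<Delta> \<epsilon>"
        unfolding assms(18) by (simp add: mult_ac)
      interpret resonant_setting V hh "\<lambda>z. of_real \<epsilon> * ff z" M \<delta> \<sigma> \<alpha> \<mu> "\<epsilon> * F\<^sub>t" Bh r K
      proof
        show "holo_fun_on (cdomain V \<delta> (3/2 * \<sigma>)) hh"
          using holo_fun_subset[OF assms(10) order_trans[OF sub subG]] unfolding hh .
        show "slow (cdomain V \<delta> (3/2 * \<sigma>)) hh" by (simp add: slow_def hh_def)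
        show "cmod (hh z) \<le> Bh" if "z \<in> cdomain V \<delta> (3/2 * \<sigma>)" for z by (rule Bh[OF mem[OF that]])
        show "hh z \<in> \<real>" "of_real \<epsilon> * ff z \<in> \<real>" if "z \<in> cdomain V \<delta> (3/2 * \<sigma>)" "real_phase z" for z
          using realG[OF mem[OF that(1)] that(2)] by auto
        show "\<alpha> < cmod (dd hh z (kvec k))" if k: "k \<notin> M" "freq_norm k < int (r * K)" and z: "z \<in> cdomain V \<delta> (3/2 * \<sigma>)" for k z
        proof -
          have "holo_fun_on (cdomain G \<delta> (2 * \<sigma>)) (\<lambda>z. h (fst z))" using assms(10) unfolding hh unfolding hh_def .
          then have "freq_pair (frequency h (fst z)) k = dd hh z (kvec k)"
            unfolding hh_def by (rule freq_pair_frequency[OF _ mem[OF z]])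
          moreover have "fst z \<in> cnbhd V \<delta>" using z by (simp add: mem_cdomain)
          then have "\<alpha> < cmod (freq_pair (frequency h (fst z)) k)"
            using assms(21) k unfolding nonresonance_domain_def assms(20) by blast
          ultimately show ?thesis by simp
        qed
        show "fb V \<delta> (3/2 * \<sigma>) (\<lambda>z. of_real \<epsilon> * ff z) (\<epsilon> * F\<^sub>t)"
          using fb_cmult[OF fbf, of "of_real \<epsilon>"] eps by simp
        show "2 ^ 8 * real r / (\<alpha> * \<delta> * \<sigma>) * (\<mu> + exp 1 * (\<epsilon> * F\<^sub>t)) + 4 * exp (- real K * \<sigma> / 2) \<le> 1/2"
          using Deps unfolding D\<epsilon> .
      qed (use assms(2-8) resonance_module_uminus[OF assms(19)] in auto)
      let ?D = "cdomain V (3/4 * \<delta>) (3/4 * \<sigma>)"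
      obtain C C' c P where CC: "change_pair V (3/4 * \<delta>) (3/4 * \<sigma>) (80 * T * \<delta>) (80 * T * \<sigma>) C C'" and T80: "0 \<le> 80 * T" "80 * T \<le> 1/16"
        and c: "\<And>k. holo_fun_on ?D (c k)" "\<And>k. slow ?D (c k)"
        and P: "fb V (3/4 * \<delta>) (3/4 * \<sigma>) P (\<epsilon> * F\<^sub>t / real r * local.\<Delta> ^ (r - 1))"
        and eq: "\<And>z. z \<in> ?D \<Longrightarrow> hh (C z) + of_real \<mu> * fst (snd (C z)) + of_real \<epsilon> * ff (C z)
          = hh z + of_real \<mu> * fst (snd z) + (\<Sum>k\<in>{k\<in>M. freq_norm k < int (r * K)}. c k z * fmode k z) + P z"
      proof -
        from normal_form show thesis by (elim exE conjE) (rule that, assumption, assumption, assumption, erule spec, erule spec, assumption, erule bspec, assumption)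
      qed
      have \<Delta>\<epsilon>: "local.\<Delta> = \<Delta> \<epsilon>" unfolding \<Delta>_def by (rule D\<epsilon>)
      show "\<exists>C C'. Q \<epsilon> C C' \<and> (\<forall>z\<in>D (3/4). norm (C z - z) \<le> B * \<epsilon>)"
      proof (intro exI conjI)
        have D: "D (3/4) = ?D" "D (5/8) = cdomain V (5/8 * \<delta>) (5/8 * \<sigma>)" "D (7/8) = cdomain V (7/8 * \<delta>) (7/8 * \<sigma>)"
          by (rule assms(23))+
        define zc where "zc = (\<lambda>k I \<xi>. if freq_norm k < int N then c k (I, 0, 0, \<xi>) else 0)"
        define R where "R = (\<lambda>I \<phi> \<xi>. P (I, 0, \<phi>, \<xi>))"
        have zc: "zc k (fst z) (snd (snd (snd z))) = (if freq_norm k < int N then c k z else 0)" if "z \<in> ?D" for k z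
          using bspec[OF c(2)[unfolded slow_def] that, of k] by (simp add: zc_def slow_part_def)
        have R: "R (fst z) (fst (snd (snd z))) (snd (snd (snd z))) = P z" if "z \<in> ?D" for z
          using fb_eta_free[OF P that] by (simp add: R_def)
        have zc': "(\<lambda>(I, \<eta>, \<phi>, \<xi>). zc k I \<xi>) = (\<lambda>z::'n phase. zc k (fst z) (snd (snd (snd z))))" for k
          by (simp add: fun_eq_iff split: prod.splits)
        have R': "(\<lambda>(I, \<eta>, \<phi>, \<xi>). R I \<phi> \<xi>) = (\<lambda>z::'n phase. R (fst z) (fst (snd (snd z))) (snd (snd (snd z))))"
          by (simp add: fun_eq_iff split: prod.splits)
        show "Q \<epsilon> C C'"
          unfolding Q_def D
        proof (intro conjI exI change_pair_inclusions[OF CC T80 assms(2,4)] allI ballI)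
          show "holo_fun_on ?D (\<lambda>(I, \<eta>, \<phi>, \<xi>). zc k I \<xi>)" for k
            unfolding zc'
          proof (rule holo_fun_cong[OF open_cdomain zc[symmetric]])
            show "holo_fun_on ?D (\<lambda>z. if freq_norm k < int N then c k z else 0)"
            proof (cases "freq_norm k < int N")
              case True show ?thesis unfolding if_P[OF True] by (rule c(1))
            next
              case False show ?thesis unfolding if_not_P[OF False] by (rule holo_const)
            qed
          qed
          show "holo_fun_on ?D (\<lambda>(I, \<eta>, \<phi>, \<xi>). R I \<phi> \<xi>)"
            unfolding R' by (rule holo_fun_cong[OF open_cdomain R[symmetric] fb_holo[OF P]])
          show "angle_periodic_on ?D (\<lambda>(I, \<eta>, \<phi>, \<xi>). R I \<phi> \<xi>)"
            unfolding R' angle_periodic_on_def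
          proof (intro ballI allI)
            fix z j assume z: "z \<in> ?D"
            then have sz: "shift_angle j z \<in> ?D" by simp
            show "R (fst (shift_angle j z)) (fst (snd (snd (shift_angle j z)))) (snd (snd (snd (shift_angle j z))))
                = R (fst z) (fst (snd (snd z))) (snd (snd (snd z)))"
              unfolding R[OF sz] R[OF z] by (rule fb_shift[OF P z])
          qed
          show "case z of (I, \<eta>, \<phi>, \<xi>) \<Rightarrow> hamiltonian h f \<mu> \<epsilon> (C (I, \<eta>, \<phi>, \<xi>)) =
               h I + of_real \<mu> * \<eta>
               + (\<Sum>k\<in>{k \<in> M. freq_norm k \<le> int N}. zc k I \<xi> * fourier_mode k \<phi>)
               + R I \<phi> \<xi>" if z: "z \<in> ?D" for z
          proof -
            obtain I \<eta> \<phi> \<xi> where zz: "z = (I, \<eta>, \<phi>, \<xi>)" by (cases z)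
            have ham: "hamiltonian h f \<mu> \<epsilon> w = hh w + of_real \<mu> * fst (snd w) + of_real \<epsilon> * ff w" for w
              by (simp add: hamiltonian_def hh_def ff_def split: prod.splits)
            have "(\<Sum>k\<in>{k \<in> M. freq_norm k \<le> int N}. zc k I \<xi> * fourier_mode k \<phi>)
                = (\<Sum>k\<in>{k \<in> M. freq_norm k < int (r * K)}. zc k I \<xi> * fourier_mode k \<phi>)"
              by (rule sum.mono_neutral_right)
                 (auto simp: zc_def assms(20) intro: finite_subset[OF _ finite_freq_norm_le[of "int N"]])
            also have "\<dots> = (\<Sum>k\<in>{k \<in> M. freq_norm k < int (r * K)}. c k z * fmode k z)"
              by (rule sum.cong[OF refl]) (use zc[OF z] in \<open>simp add: zz fmode_def assms(20)\<close>)
            finally show ?thesis using eq[OF z] R[OF z] by (simp add: zz ham hh_def)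
          qed
          show "fourier_norm V (3/4 * \<delta>) (3/4 * \<sigma>) R \<le> ennreal (8 * \<epsilon> * F\<^sub>t * \<Delta> \<epsilon> ^ r)"
          proof -
            have E0: "0 \<le> \<epsilon> * F\<^sub>t" by (rule E)
            \<comment> \<open>the missing power of \<open>\<Delta>\<close> costs at most a factor 8 because \<open>4 * q \<le> \<Delta>\<close> and \<open>q\<close> is bounded below\<close>
            have "1 / 8 \<le> 4 / (8 + 3 * (exp (1::real))\<^sup>2)"
              using exp_1_bounds(2) by (simp add: field_simps add_pos_nonneg)
            also have "\<dots> \<le> 4 * q" using assms(22) by (simp add: q_def)
            also have "\<dots> \<le> local.\<Delta>" unfolding \<Delta> using nonneg by simp
            finally have 8: "1 \<le> 8 * local.\<Delta>" by simp
            have "\<epsilon> * F\<^sub>t / real r \<le> \<epsilon> * F\<^sub>t * 1" using E0 assms(8) by (simp add: divide_le_eq mult_le_cancel_left1)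
            also have "\<dots> \<le> \<epsilon> * F\<^sub>t * (8 * local.\<Delta>)" by (rule mult_left_mono[OF 8 E0])
            finally have "\<epsilon> * F\<^sub>t / real r * local.\<Delta> ^ (r - 1) \<le> \<epsilon> * F\<^sub>t * (8 * local.\<Delta>) * local.\<Delta> ^ (r - 1)"
              by (rule mult_right_mono) (rule \<Delta>_power(1))
            also have "\<dots> = 8 * \<epsilon> * F\<^sub>t * local.\<Delta> ^ Suc (r - 1)" by simp
            also have "Suc (r - 1) = r" using assms(8) by simp
            finally show ?thesis
              unfolding R_def \<Delta>\<epsilon>[symmetric] by (rule order_trans[OF fourier_norm_le[OF P] ennreal_leI])
          qed
        qed
        show "\<forall>z\<in>D (3/4). norm (C z - z) \<le> B * \<epsilon>"
        proof
          fix z assume "z \<in> D (3/4)"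
          then have "norm (C z - z) \<le> (real CARD('n) + 1) * (80 * T * \<delta> + 80 * T * \<sigma>)"
            unfolding D by (rule norm_disp[OF change_pairD(1)[OF CC]])
          also have "80 * T * \<delta> + 80 * T * \<sigma> = 80 * T * (\<delta> + \<sigma>)" by (simp only: distrib_left)
          also have "80 * T = 80 * F\<^sub>t / (\<alpha> * \<delta> * \<sigma>) * \<epsilon>"
            unfolding T_def by (simp only: times_divide_eq_left times_divide_eq_right mult_ac)
          also have "(real CARD('n) + 1) * (80 * F\<^sub>t / (\<alpha> * \<delta> * \<sigma>) * \<epsilon> * (\<delta> + \<sigma>)) = B * \<epsilon>"
            by (simp only: B_def mult_ac)
          finally show "norm (C z - z) \<le> B * \<epsilon>" .
        qed
      qed
    qed
  qed
  then obtain B where B: "\<And>\<epsilon>. 0 < \<epsilon> \<Longrightarrow> \<Delta> \<epsilon> \<le> 1/2 \<Longrightarrow> \<exists>C C'. Q \<epsilon> C C' \<and> (\<forall>z\<in>D (3/4). norm (C z - z) \<le> B * \<epsilon>)" by blast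
  have "\<forall>\<epsilon>. \<exists>p. 0 < \<epsilon> \<and> \<Delta> \<epsilon> \<le> 1/2 \<longrightarrow> Q \<epsilon> (fst p) (snd p) \<and> (\<forall>z\<in>D (3/4). norm (fst p z - z) \<le> B * \<epsilon>)"
  proof
    fix \<epsilon>
    show "\<exists>p. 0 < \<epsilon> \<and> \<Delta> \<epsilon> \<le> 1/2 \<longrightarrow> Q \<epsilon> (fst p) (snd p) \<and> (\<forall>z\<in>D (3/4). norm (fst p z - z) \<le> B * \<epsilon>)"
    proof (cases "0 < \<epsilon> \<and> \<Delta> \<epsilon> \<le> 1/2")
      case True
      then obtain C C' where C: "Q \<epsilon> C C' \<and> (\<forall>z\<in>D (3/4). norm (C z - z) \<le> B * \<epsilon>)" using B by blast
      show ?thesis by (rule exI[of _ "(C, C')"], rule impI, unfold fst_conv snd_conv, rule C)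
    qed (rule exI, rule impI, erule notE)
  qed
  from choice[OF this] obtain p where p: "\<And>\<epsilon>. 0 < \<epsilon> \<Longrightarrow> \<Delta> \<epsilon> \<le> 1/2 \<Longrightarrow> Q \<epsilon> (fst (p \<epsilon>)) (snd (p \<epsilon>))"
    "\<And>\<epsilon>. 0 < \<epsilon> \<Longrightarrow> \<Delta> \<epsilon> \<le> 1/2 \<Longrightarrow> \<forall>z\<in>D (3/4). norm (fst (p \<epsilon>) z - z) \<le> B * \<epsilon>" by blast
  have "\<forall>\<^sub>F \<epsilon> in at_right 0. \<Delta> \<epsilon> \<le> 1/2 \<longrightarrow> (\<forall>z\<in>D (3/4). norm (fst (p \<epsilon>) z - z) \<le> B * \<epsilon>)"
    using eventually_at_right_less[of "0::real"] by eventually_elim (use p(2) in blast)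
  note close = this
  show ?thesis
    by (rule exI[of _ "\<lambda>\<epsilon>. fst (p \<epsilon>)"], rule exI[of _ "\<lambda>\<epsilon>. snd (p \<epsilon>)"], rule conjI)
       (intro allI impI p(1)[unfolded Q_def], assumption, assumption, rule exI[of _ B], rule close)
qed

end
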